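(* Assume that for every $a>0$: $\mathbb E[e^{a\ell(Z^{(1)})}]<+\infty$, $\mathbb E[e^{aZ^{(1)}}]<+\infty$, $\mathbb E[e^{aZ^{(2)}}]<+\infty$. Consider proportional reinsurance $\Phi(z,u)=zu$, $u\in U=[0,1]$, with reinsurance premium $q^u_t=(1+\theta_R)\,\mathbb E[Z^{(1)}]\,\pi_{t^-}(\lambda)(1-u_t)$, $\theta_R>0$. Then there exist two stochastic thresholds $\theta^F_t<\theta^N_t$ such that the optimal reinsurance strategy is $$u^*_t(\omega)=\begin{cases}0&\text{if }\theta_R<\theta^F_t(\omega),\\ 1&\text{if }\theta_R>\theta^N_t(\omega),\\ \bar u\big(t,W^N_{t^-}(\omega),\Theta^{W^N}_t(\cdot)(\omega)\big)&\text{otherwise,}\end{cases}$$ where $$\theta^F_t=\frac1{\mathbb E[Z^{(1)}]}\int_0^{+\infty}\frac{W^N_{t^-}+\Theta^{W^N}_t(z)}{W^N_{t^-}}\,z\,e^{-\eta e^{r(T-t)}z}F^{(1)}(dz)-1,$$ $$\theta^N_t=\frac1{\mathbb E[Z^{(1)}]}\int_0^{+\infty}\frac{W^N_{t^-}+\Theta^{W^N}_t(z)}{W^N_{t^-}}\,z\,F^{(1)}(dz)-1,$$ and $\bar u(t,w,\theta(\cdot))\in(0,1)$ solves the following equation in $u$: $$(1+\theta_R)\,\mathbb E[Z^{(1)}]=\int_0^{+\infty}\frac{w+\theta(z)}{w}\,z\,e^{-\eta e^{r(T-t)}z(1-u)}F^{(1)}(dz).$$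
   Context: Model. Fix $T>0$, constants $\alpha,\beta,\lambda_0,\rho>0$, a measurable function $\ell:[0,+\infty)\to[0,+\infty)$ and distribution functions $F^{(1)},F^{(2)}$ on $(0,+\infty)$. Let $(\Omega,\mathcal F,\mathbf P;\mathbb F)$ be a filtered probability space satisfying the usual hypotheses. For $i=1,2$, $N^{(i)}$ is a counting process with jump times $\{T^{(i)}_n\}_{n\ge1}$, and $\{Z^{(i)}_n\}_{n\ge1}$ are i.i.d. positive marks with distribution $F^{(i)}$ ($Z^{(i)}$ is a generic one). $N^{(2)}$ is Poisson with intensity $\rho$, and $N^{(2)},\{Z^{(1)}_n\},\{Z^{(2)}_n\}$ are independent of each other. Put $$\lambda_t=\beta+(\lambda_0-\beta)e^{-\alpha t}+\sum_{j=1}^{N^{(1)}_t}e^{-\alpha(t-T^{(1)}_j)}\ell(Z^{(1)}_j)+\sum_{j=1}^{N^{(2)}_t}e^{-\alpha(t-T^{(2)}_j)}Z^{(2)}_j ,$$ $m^{(i)}(dt,dz)=\sum_{n\ge1}\delta_{(T^{(i)}_n,Z^{(i)}_n)}(dt,dz)\mathbf 1_{\{T^{(i)}_n<+\infty\}}$; the $(\mathbf P,\mathbb F)$-compensators of $m^{(1)},m^{(2)}$ are $\lambda_{t^-}F^{(1)}(dz)dt$ and $\rho F^{(2)}(dz)dt$. $C_t=\sum_{j=1}^{N^{(1)}_t}Z^{(1)}_j$, $\mathbb H=\{\mathcal H_t\}$ is the natural filtration of $C$, $\pi_t(\lambda)=\mathbb E[\lambda_t\mid\mathcal H_t]$ (càdlàg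 version), and $\widetilde m^{(1)}(dt,dz)=m^{(1)}(dt,dz)-\pi_{t^-}(\lambda)F^{(1)}(dz)dt$. Control problem. The insurance premium rate $c$ is $\mathbb H$-predictable with $\mathbb E[\int_0^Tc_tdt]<+\infty$. The constant $\theta_R$ is the reinsurer's safety loading. Given $r>0$, $\eta>0$, $R_0\in\mathbb R^+$, wealth is $$X^u_t=R_0e^{rt}+\int_0^te^{r(t-s)}(c_s-q^u_s)ds-\int_0^t\int_0^{+\infty}e^{r(t-s)}\Phi(z,u_s)m^{(1)}(ds,dz).$$ $\mathcal U$ is the set of $U$-valued $\mathbb H$-predictable processes $u$ on $[0,T]$ with $\mathbb E[e^{-\eta X^u_T}]<+\infty$; a strategy is optimal if it attains $\inf_{u\in\mathcal U}\mathbb E[e^{-\eta X^u_T}]$. Null reinsurance is $u_N=1$, $X^N$ is the wealth for $u\equiv u_N$, and $$W^N_t=\operatorname*{ess\,inf}\big\{\mathbb E[e^{-\eta X^{\bar u}_T}\mid\mathcal H_t]:\bar u\in\mathcal U,\ \bar u_s=u_N\text{ a.s. for all }s\le t\big\}.$$ $(W^N,\Theta^{W^N})$ is the unique solution in $\mathcal L^2\times\widehat{\mathcal L}^2$ of the BSDE $$W^N_t=e^{-\eta X^N_T}-\int_t^T\int_0^{+\infty}\Theta^{W^N}_s(z)\widetilde m^{(1)}(ds,dz)-\int_t^T\operatorname*{ess\,sup}_{u\in\mathcal U}\widetilde f(s,W^N_s,\Theta^{W^N}_s(\cdot),u_s)ds ,$$ $$\widetilde f(t,W^N_t,\Theta^{W^N}_t(\cdot),u_t)=-W^N_{t^-}\eta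 e^{r(T-t)}q^u_t-\int_0^{+\infty}[W^N_{t^-}+\Theta^{W^N}_t(z)]\big[e^{-\eta e^{r(T-t)}(z-\Phi(z,u_t))}-1\big]\pi_{t^-}(\lambda)F^{(1)}(dz).$$ Here $\mathcal L^2$ is the space of càdlàg $\mathbb H$-adapted $Y$ with $\mathbb E[\int_0^T|Y_t|^2dt]<+\infty$, and $\widehat{\mathcal L}^2$ the space of $\mathbb H$-predictable random fields $\Theta_t(z)$ with $\mathbb E[\int_0^T\int_0^{+\infty}\Theta_t^2(z)\pi_{t^-}(\lambda)F^{(1)}(dz)dt]<+\infty$.
   Formalization: In the "otherwise" case, ū is claimed to lie in (0,1) only when θ^F < θ_R < θ^N; if θ_R equals θ^F or θ^N, the equation's only solution is 0 or 1, so there ū is only claimed to solve it in [0,1]. *)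

theory Defs
  imports "HOL-Probability.Probability"
begin

section \<open>Processes in continuous time\<close>

text \<open>Processes are curried functions of time and scenario; times are reals, and only nonnegative
  times matter.\<close>

definition cadlag_on :: "real \<Rightarrow> (real \<Rightarrow> real) \<Rightarrow> bool" where
  "cadlag_on T f \<longleftrightarrow>
     (\<forall>t\<in>{0..<T}. continuous (at_right t) f) \<and> (\<forall>t\<in>{0<..T}. \<exists>l. (f \<longlongrightarrow> l) (at_left t))"

definition left_lim :: "(real \<Rightarrow> real) \<Rightarrow> real \<Rightarrow> real" where
  "left_lim f t = (if t \<le> 0 then f 0 else Lim (at_left t) f)"

definition usual_filtration :: "'a measure \<Rightarrow> (real \<Rightarrow> 'a measure) \<Rightarrow> bool" where
  "usual_filtration M G \<longleftrightarrow>
     complete_measure M \<and>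
     (\<forall>t\<ge>0. subalgebra M (G t)) \<and>
     (\<forall>s t. 0 \<le> s \<longrightarrow> s \<le> t \<longrightarrow> sets (G s) \<subseteq> sets (G t)) \<and>
     (\<forall>t\<ge>0. sets (G t) = (\<Inter>s\<in>{t<..}. sets (G s))) \<and>
     null_sets M \<subseteq> sets (G 0)"

definition generated_sigma ::
    "'a set \<Rightarrow> 'i set \<Rightarrow> ('i \<Rightarrow> 'a \<Rightarrow> 'b::topological_space) \<Rightarrow> 'a measure" where
  "generated_sigma \<Omega> I X = sigma \<Omega> {X i -` A \<inter> \<Omega> |i A. i \<in> I \<and> A \<in> sets borel}"

definition natural_filtration :: "'a measure \<Rightarrow> (real \<Rightarrow> 'a \<Rightarrow> real) \<Rightarrow> real \<Rightarrow> 'a measure" where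
  "natural_filtration M X t = generated_sigma (space M) {0..t} X"

text \<open>The predictable sigma-algebra on \<open>I \<times> \<Omega>\<close>, where \<open>I\<close> is a time interval starting at 0.\<close>

definition predictable_sigma :: "real set \<Rightarrow> (real \<Rightarrow> 'a measure) \<Rightarrow> (real \<times> 'a) measure" where
  "predictable_sigma I G = sigma (I \<times> space (G 0))
     ({{0} \<times> A |A. A \<in> sets (G 0)} \<union>
      {{s<..t} \<times> A |s t A. 0 \<le> s \<and> {s<..t} \<subseteq> I \<and> A \<in> sets (G s)})"

definition predictable_process ::
    "real set \<Rightarrow> (real \<Rightarrow> 'a measure) \<Rightarrow> (real \<Rightarrow> 'a \<Rightarrow> real) \<Rightarrow> bool" where
  "predictable_process I G X \<longleftrightarrow> (\<lambda>(t, \<omega>). X t \<omega>) \<in> borel_measurable (predictable_sigma I G)"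

definition field_sigma :: "real set \<Rightarrow> (real \<Rightarrow> 'a measure) \<Rightarrow> ((real \<times> 'a) \<times> real) measure" where
  "field_sigma I G = predictable_sigma I G \<Otimes>\<^sub>M restrict_space borel {0<..}"

definition predictable_field ::
    "real set \<Rightarrow> (real \<Rightarrow> 'a measure) \<Rightarrow> (real \<Rightarrow> 'a \<Rightarrow> real \<Rightarrow> real) \<Rightarrow> bool" where
  "predictable_field I G K \<longleftrightarrow> (\<lambda>((t, \<omega>), z). K t \<omega> z) \<in> borel_measurable (field_sigma I G)"

definition time_scenario :: "real \<Rightarrow> 'a measure \<Rightarrow> (real \<times> 'a) measure" where
  "time_scenario T M = restrict_space lborel {0..T} \<Otimes>\<^sub>M M"

section \<open>Essential infimum and supremum of a family of random variables\<close>

definition is_ess_sup :: "'b measure \<Rightarrow> ('b \<Rightarrow> real) set \<Rightarrow> ('b \<Rightarrow> real) \<Rightarrow> bool" where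
  "is_ess_sup N S Y \<longleftrightarrow>
     Y \<in> borel_measurable N \<and> (\<forall>X\<in>S. AE x in N. X x \<le> Y x) \<and>
     (\<forall>Y'\<in>borel_measurable N. (\<forall>X\<in>S. AE x in N. X x \<le> Y' x) \<longrightarrow> (AE x in N. Y x \<le> Y' x))"

definition is_ess_inf :: "'b measure \<Rightarrow> ('b \<Rightarrow> real) set \<Rightarrow> ('b \<Rightarrow> real) \<Rightarrow> bool" where
  "is_ess_inf N S Y \<longleftrightarrow>
     Y \<in> borel_measurable N \<and> (\<forall>X\<in>S. AE x in N. Y x \<le> X x) \<and>
     (\<forall>Y'\<in>borel_measurable N. (\<forall>X\<in>S. AE x in N. Y' x \<le> X x) \<longrightarrow> (AE x in N. Y' x \<le> Y x))"

section \<open>Marked point processes\<close>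

text \<open>The jump times and marks of a marked point process are enumerated from 0, so \<open>\<tau> n\<close> and
  \<open>Z n\<close> belong to the jump number \<open>n + 1\<close>; \<open>\<tau> n \<omega> = \<infinity>\<close> means that this jump does not occur.\<close>

definition jump_times :: "'a measure \<Rightarrow> (nat \<Rightarrow> 'a \<Rightarrow> ereal) \<Rightarrow> bool" where
  "jump_times M \<tau> \<longleftrightarrow>
     (\<forall>\<omega>\<in>space M.
        (\<forall>n. 0 < \<tau> n \<omega> \<and> \<tau> n \<omega> \<le> \<tau> (Suc n) \<omega> \<and> (\<tau> n \<omega> < \<infinity> \<longrightarrow> \<tau> n \<omega> < \<tau> (Suc n) \<omega>)) \<and>
        (\<forall>t. finite {n. \<tau> n \<omega> \<le> ereal t}))"

definition counting :: "(nat \<Rightarrow> 'a \<Rightarrow> ereal) \<Rightarrow> real \<Rightarrow> 'a \<Rightarrow> nat" where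
  "counting \<tau> t \<omega> = card {n. \<tau> n \<omega> \<le> ereal t}"

definition poisson_process :: "'a measure \<Rightarrow> real \<Rightarrow> (real \<Rightarrow> 'a \<Rightarrow> nat) \<Rightarrow> bool" where
  "poisson_process M \<rho> N \<longleftrightarrow>
     (\<forall>\<omega>\<in>space M. N 0 \<omega> = 0) \<and>
     (\<forall>s t. 0 \<le> s \<longrightarrow> s < t \<longrightarrow>
        distr M (count_space UNIV) (\<lambda>\<omega>. N t \<omega> - N s \<omega>) = measure_pmf (poisson_pmf (\<rho> * (t - s)))) \<and>
     (\<forall>ts m. 0 \<le> ts 0 \<longrightarrow> mono ts \<longrightarrow>
        prob_space.indep_vars M (\<lambda>_. count_space UNIV)
          (\<lambda>k \<omega>. N (ts (Suc k)) \<omega> - N (ts k) \<omega>) {..<m::nat})"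

definition iid_marks :: "'a measure \<Rightarrow> real measure \<Rightarrow> (nat \<Rightarrow> 'a \<Rightarrow> real) \<Rightarrow> bool" where
  "iid_marks M F Z \<longleftrightarrow>
     (\<forall>n. \<forall>\<omega>\<in>space M. 0 < Z n \<omega>) \<and>
     prob_space.indep_vars M (\<lambda>_. borel) Z UNIV \<and> (\<forall>n. distr M borel (Z n) = F)"

text \<open>The sum of the Dirac measures at the points \<open>(\<tau> n \<omega>, Z n \<omega>)\<close> with \<open>\<tau> n \<omega> < \<infinity>\<close>.\<close>

definition jump_measure ::
    "(nat \<Rightarrow> 'a \<Rightarrow> ereal) \<Rightarrow> (nat \<Rightarrow> 'a \<Rightarrow> real) \<Rightarrow> 'a \<Rightarrow> (real \<times> real) measure" where
  "jump_measure \<tau> Z \<omega> =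
     distr (count_space {n. \<tau> n \<omega> < \<infinity>}) borel (\<lambda>n. (real_of_ereal (\<tau> n \<omega>), Z n \<omega>))"

text \<open>The jump measure is adapted to \<open>G\<close> and its compensator with respect to \<open>G\<close> is
  \<open>\<phi>\<^sub>t F(dz) dt\<close>.\<close>

definition has_compensator ::
    "'a measure \<Rightarrow> (real \<Rightarrow> 'a measure) \<Rightarrow> (nat \<Rightarrow> 'a \<Rightarrow> ereal) \<Rightarrow> (nat \<Rightarrow> 'a \<Rightarrow> real) \<Rightarrow>
     (real \<Rightarrow> 'a \<Rightarrow> real) \<Rightarrow> real measure \<Rightarrow> bool" where
  "has_compensator M G \<tau> Z \<phi> F \<longleftrightarrow>
     (\<forall>n. \<forall>t\<ge>0. \<forall>B\<in>sets borel. {\<omega>\<in>space M. \<tau> n \<omega> \<le> ereal t \<and> Z n \<omega> \<in> B} \<in> sets (G t)) \<and>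
     predictable_process {0..} G \<phi> \<and>
     (\<forall>K :: (real \<times> 'a) \<times> real \<Rightarrow> ennreal. K \<in> borel_measurable (field_sigma {0..} G) \<longrightarrow>
        (\<integral>\<^sup>+\<omega>. (\<integral>\<^sup>+x\<in>{0<..} \<times> {0<..}. K ((fst x, \<omega>), snd x) \<partial>jump_measure \<tau> Z \<omega>) \<partial>M) =
        (\<integral>\<^sup>+\<omega>. (\<integral>\<^sup>+t\<in>{0<..}. (\<integral>\<^sup>+z\<in>{0<..}. K ((t, \<omega>), z) * ennreal (\<phi> t \<omega>) \<partial>F) \<partial>lborel) \<partial>M))"

text \<open>Integral of \<open>K\<close> over \<open>{a<..b} \<times> {0<..}\<close> with respect to the jump measure minus
  \<open>p\<^sub>t\<^sub>- F(dz) dt\<close>.\<close>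

definition compensated_integral ::
    "(nat \<Rightarrow> 'a \<Rightarrow> ereal) \<Rightarrow> (nat \<Rightarrow> 'a \<Rightarrow> real) \<Rightarrow> (real \<Rightarrow> 'a \<Rightarrow> real) \<Rightarrow> real measure \<Rightarrow>
     (real \<Rightarrow> 'a \<Rightarrow> real \<Rightarrow> real) \<Rightarrow> real \<Rightarrow> real \<Rightarrow> 'a \<Rightarrow> real" where
  "compensated_integral \<tau> Z p F K a b \<omega> =
     (LINT x:{a<..b} \<times> {0<..}|jump_measure \<tau> Z \<omega>. K (fst x) \<omega> (snd x)) -
     (LINT s:{a<..b}|lborel. (LINT z:{0<..}|F. K s \<omega> z * left_lim (\<lambda>t. p t \<omega>) s))"

section \<open>The risk model\<close>

definition intensity ::
    "real \<Rightarrow> real \<Rightarrow> real \<Rightarrow> (real \<Rightarrow> real) \<Rightarrow> (nat \<Rightarrow> 'a \<Rightarrow> ereal) \<Rightarrow> (nat \<Rightarrow> 'a \<Rightarrow> real) \<Rightarrow>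
     (nat \<Rightarrow> 'a \<Rightarrow> ereal) \<Rightarrow> (nat \<Rightarrow> 'a \<Rightarrow> real) \<Rightarrow> real \<Rightarrow> 'a \<Rightarrow> real" where
  "intensity \<alpha> \<beta> lam0 l \<tau>1 Z1 \<tau>2 Z2 t \<omega> =
     \<beta> + (lam0 - \<beta>) * exp (- \<alpha> * t)
     + (\<Sum>j | \<tau>1 j \<omega> \<le> ereal t. exp (- \<alpha> * (t - real_of_ereal (\<tau>1 j \<omega>))) * l (Z1 j \<omega>))
     + (\<Sum>j | \<tau>2 j \<omega> \<le> ereal t. exp (- \<alpha> * (t - real_of_ereal (\<tau>2 j \<omega>))) * Z2 j \<omega>)"

definition claims ::
    "(nat \<Rightarrow> 'a \<Rightarrow> ereal) \<Rightarrow> (nat \<Rightarrow> 'a \<Rightarrow> real) \<Rightarrow> real \<Rightarrow> 'a \<Rightarrow> real" where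
  "claims \<tau> Z t \<omega> = (\<Sum>j | \<tau> j \<omega> \<le> ereal t. Z j \<omega>)"

text \<open>The distribution functions \<open>F\<^sup>(\<^sup>i\<^sup>)\<close> enter as the probability measures \<open>F\<^sup>(\<^sup>i\<^sup>)(dz)\<close>.\<close>

locale risk_model = prob_space M for M :: "'a measure" +
  fixes G :: "real \<Rightarrow> 'a measure"
    and \<alpha> \<beta> lam0 \<rho> :: real and l :: "real \<Rightarrow> real" and F1 F2 :: "real measure"
    and \<tau>1 :: "nat \<Rightarrow> 'a \<Rightarrow> ereal" and Z1 :: "nat \<Rightarrow> 'a \<Rightarrow> real"
    and \<tau>2 :: "nat \<Rightarrow> 'a \<Rightarrow> ereal" and Z2 :: "nat \<Rightarrow> 'a \<Rightarrow> real"
  assumes usual: "usual_filtration M G"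
    and pos: "0 < \<alpha>" "0 < \<beta>" "0 < lam0" "0 < \<rho>"
    and l_meas: "l \<in> borel_measurable (restrict_space borel {0..})"
    and l_nonneg: "\<And>z. 0 \<le> z \<Longrightarrow> 0 \<le> l z"
    and F1: "real_distribution F1" "measure F1 {0<..} = 1"
    and F2: "real_distribution F2" "measure F2 {0<..} = 1"
    and jumps1: "jump_times M \<tau>1"
    and jumps2: "jump_times M \<tau>2"
    and marks1: "iid_marks M F1 Z1"
    and marks2: "iid_marks M F2 Z2"
    and poisson2: "poisson_process M \<rho> (counting \<tau>2)"
    and independent: "indep_sets
          (\<lambda>i::nat. if i = 0 then sets (generated_sigma (space M) {0..} (counting \<tau>2))
                    else if i = 1 then sets (generated_sigma (space M) UNIV Z1)
                    else sets (generated_sigma (space M) UNIV Z2)) {0, 1, 2}"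
    and compensator1: "has_compensator M G \<tau>1 Z1
          (\<lambda>t \<omega>. left_lim (\<lambda>s. intensity \<alpha> \<beta> lam0 l \<tau>1 Z1 \<tau>2 Z2 s \<omega>) t) F1"
    and compensator2: "has_compensator M G \<tau>2 Z2 (\<lambda>t \<omega>. \<rho>) F2"

text \<open>The cadlag version \<open>p\<close> of the conditional expectations of \<open>X\<close>.\<close>

definition is_filter_of ::
    "'a measure \<Rightarrow> (real \<Rightarrow> 'a measure) \<Rightarrow> real \<Rightarrow> (real \<Rightarrow> 'a \<Rightarrow> real) \<Rightarrow> (real \<Rightarrow> 'a \<Rightarrow> real) \<Rightarrow> bool"
  where
  "is_filter_of M H T X p \<longleftrightarrow>
     (\<forall>\<omega>\<in>space M. cadlag_on T (\<lambda>t. p t \<omega>)) \<and>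
     (\<forall>t\<in>{0..T}. p t \<in> borel_measurable (H t) \<and>
        (AE \<omega> in M. p t \<omega> = real_cond_exp M (H t) (X t) \<omega>))"

section \<open>The control problem\<close>

text \<open>\<open>\<Phi> z v\<close> is the retained part of a claim \<open>z\<close> and \<open>q t \<omega> v\<close> the reinsurance premium rate
  when the current control is \<open>v\<close>.\<close>

definition wealth ::
    "real \<Rightarrow> real \<Rightarrow> (real \<Rightarrow> 'a \<Rightarrow> real) \<Rightarrow> (nat \<Rightarrow> 'a \<Rightarrow> ereal) \<Rightarrow> (nat \<Rightarrow> 'a \<Rightarrow> real) \<Rightarrow>
     (real \<Rightarrow> real \<Rightarrow> real) \<Rightarrow> (real \<Rightarrow> 'a \<Rightarrow> real \<Rightarrow> real) \<Rightarrow>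
     (real \<Rightarrow> 'a \<Rightarrow> real) \<Rightarrow> real \<Rightarrow> 'a \<Rightarrow> real" where
  "wealth r R0 c \<tau> Z \<Phi> q u t \<omega> =
     R0 * exp (r * t)
     + (LINT s:{0..t}|lborel. exp (r * (t - s)) * (c s \<omega> - q s \<omega> (u s \<omega>)))
     - (LINT x:{0<..t} \<times> {0<..}|jump_measure \<tau> Z \<omega>. exp (r * (t - fst x)) * \<Phi> (snd x) (u (fst x) \<omega>))"

text \<open>\<open>X u\<close> is the wealth process under the control \<open>u\<close>.\<close>

definition admissible ::
    "'a measure \<Rightarrow> (real \<Rightarrow> 'a measure) \<Rightarrow> real \<Rightarrow> real set \<Rightarrow> real \<Rightarrow>
     ((real \<Rightarrow> 'a \<Rightarrow> real) \<Rightarrow> real \<Rightarrow> 'a \<Rightarrow> real) \<Rightarrow> (real \<Rightarrow> 'a \<Rightarrow> real) set" where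
  "admissible M H T U \<eta> X =
     {u. predictable_process {0..T} H u \<and> (\<forall>t\<in>{0..T}. \<forall>\<omega>\<in>space M. u t \<omega> \<in> U) \<and>
         integrable M (\<lambda>\<omega>. exp (- \<eta> * X u T \<omega>))}"

definition optimal ::
    "'a measure \<Rightarrow> (real \<Rightarrow> 'a measure) \<Rightarrow> real \<Rightarrow> real set \<Rightarrow> real \<Rightarrow>
     ((real \<Rightarrow> 'a \<Rightarrow> real) \<Rightarrow> real \<Rightarrow> 'a \<Rightarrow> real) \<Rightarrow> (real \<Rightarrow> 'a \<Rightarrow> real) \<Rightarrow> bool" where
  "optimal M H T U \<eta> X u \<longleftrightarrow>
     u \<in> admissible M H T U \<eta> X \<and>
     (\<integral>\<omega>. exp (- \<eta> * X u T \<omega>) \<partial>M) =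
       (INF v\<in>admissible M H T U \<eta> X. (\<integral>\<omega>. exp (- \<eta> * X v T \<omega>) \<partial>M))"

text \<open>\<open>W\<close> is the value process of the controls that equal \<open>uN\<close> up to the current time.\<close>

definition is_value_process ::
    "'a measure \<Rightarrow> (real \<Rightarrow> 'a measure) \<Rightarrow> real \<Rightarrow> real set \<Rightarrow> real \<Rightarrow>
     ((real \<Rightarrow> 'a \<Rightarrow> real) \<Rightarrow> real \<Rightarrow> 'a \<Rightarrow> real) \<Rightarrow> real \<Rightarrow> (real \<Rightarrow> 'a \<Rightarrow> real) \<Rightarrow> bool" where
  "is_value_process M H T U \<eta> X uN W \<longleftrightarrow>
     (\<forall>t\<in>{0..T}. is_ess_inf M
        {real_cond_exp M (H t) (\<lambda>\<omega>. exp (- \<eta> * X u T \<omega>)) |u.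
           u \<in> admissible M H T U \<eta> X \<and> (\<forall>s\<in>{0..t}. AE \<omega> in M. u s \<omega> = uN)}
        (W t))"

section \<open>The backward equation\<close>

definition in_L2 ::
    "'a measure \<Rightarrow> (real \<Rightarrow> 'a measure) \<Rightarrow> real \<Rightarrow> (real \<Rightarrow> 'a \<Rightarrow> real) \<Rightarrow> bool" where
  "in_L2 M H T Y \<longleftrightarrow>
     (\<forall>\<omega>\<in>space M. cadlag_on T (\<lambda>t. Y t \<omega>)) \<and> (\<forall>t\<in>{0..T}. Y t \<in> borel_measurable (H t)) \<and>
     (\<integral>\<^sup>+\<omega>. (\<integral>\<^sup>+t\<in>{0..T}. ennreal (\<bar>Y t \<omega>\<bar>\<^sup>2) \<partial>lborel) \<partial>M) < \<infinity>"

definition sq_norm_L2hat ::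
    "'a measure \<Rightarrow> real \<Rightarrow> (real \<Rightarrow> 'a \<Rightarrow> real) \<Rightarrow> real measure \<Rightarrow>
     (real \<Rightarrow> 'a \<Rightarrow> real \<Rightarrow> real) \<Rightarrow> ennreal" where
  "sq_norm_L2hat M T p F \<Theta> =
     (\<integral>\<^sup>+\<omega>. (\<integral>\<^sup>+t\<in>{0..T}. (\<integral>\<^sup>+z\<in>{0<..}.
        ennreal ((\<Theta> t \<omega> z)\<^sup>2 * left_lim (\<lambda>s. p s \<omega>) t) \<partial>F) \<partial>lborel) \<partial>M)"

definition in_L2hat ::
    "'a measure \<Rightarrow> (real \<Rightarrow> 'a measure) \<Rightarrow> real \<Rightarrow> (real \<Rightarrow> 'a \<Rightarrow> real) \<Rightarrow> real measure \<Rightarrow>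
     (real \<Rightarrow> 'a \<Rightarrow> real \<Rightarrow> real) \<Rightarrow> bool" where
  "in_L2hat M H T p F \<Theta> \<longleftrightarrow> predictable_field {0..T} H \<Theta> \<and> sq_norm_L2hat M T p F \<Theta> < \<infinity>"

text \<open>The driver as a function of the values \<open>w\<close> of \<open>W\<^sub>t\<^sub>-\<close>, \<open>\<theta>\<close> of \<open>\<Theta>\<^sub>t\<close> and \<open>v\<close> of the control.\<close>

definition driver ::
    "real \<Rightarrow> real \<Rightarrow> real \<Rightarrow> (real \<Rightarrow> real \<Rightarrow> real) \<Rightarrow> (real \<Rightarrow> 'a \<Rightarrow> real \<Rightarrow> real) \<Rightarrow>
     (real \<Rightarrow> 'a \<Rightarrow> real) \<Rightarrow> real measure \<Rightarrow>
     real \<Rightarrow> 'a \<Rightarrow> real \<Rightarrow> (real \<Rightarrow> real) \<Rightarrow> real \<Rightarrow> real" where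
  "driver T r \<eta> \<Phi> q p F t \<omega> w \<theta> v =
     - w * \<eta> * exp (r * (T - t)) * q t \<omega> v
     - (LINT z:{0<..}|F. (w + \<theta> z) * (exp (- \<eta> * exp (r * (T - t)) * (z - \<Phi> z v)) - 1)
          * left_lim (\<lambda>s. p s \<omega>) t)"

text \<open>\<open>\<xi>\<close> is the terminal value, \<open>f\<close> the driver and \<open>A\<close> the set of controls. The process \<open>g\<close> is the
  essential supremum of the driver over \<open>A\<close>, taken with respect to \<open>dt \<otimes> dP\<close>.\<close>

definition bsde_solution ::
    "'a measure \<Rightarrow> (real \<Rightarrow> 'a measure) \<Rightarrow> real \<Rightarrow> (nat \<Rightarrow> 'a \<Rightarrow> ereal) \<Rightarrow> (nat \<Rightarrow> 'a \<Rightarrow> real) \<Rightarrow>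
     (real \<Rightarrow> 'a \<Rightarrow> real) \<Rightarrow> real measure \<Rightarrow> ('a \<Rightarrow> real) \<Rightarrow>
     (real \<Rightarrow> 'a \<Rightarrow> real \<Rightarrow> (real \<Rightarrow> real) \<Rightarrow> real \<Rightarrow> real) \<Rightarrow> (real \<Rightarrow> 'a \<Rightarrow> real) set \<Rightarrow>
     (real \<Rightarrow> 'a \<Rightarrow> real) \<Rightarrow> (real \<Rightarrow> 'a \<Rightarrow> real \<Rightarrow> real) \<Rightarrow> bool" where
  "bsde_solution M H T \<tau> Z p F \<xi> f A W \<Theta> \<longleftrightarrow>
     in_L2 M H T W \<and> in_L2hat M H T p F \<Theta> \<and>
     (\<exists>g. is_ess_sup (time_scenario T M)
            {\<lambda>(t, \<omega>). f t \<omega> (left_lim (\<lambda>s. W s \<omega>) t) (\<Theta> t \<omega>) (u t \<omega>) |u. u \<in> A}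
            (\<lambda>(t, \<omega>). g t \<omega>) \<and>
          (AE \<omega> in M. set_integrable lborel {0..T} (\<lambda>t. g t \<omega>)) \<and>
          (AE \<omega> in M. \<forall>t\<in>{0..T}.
             W t \<omega> = \<xi> \<omega> - compensated_integral \<tau> Z p F \<Theta> t T \<omega> - (LINT s:{t..T}|lborel. g s \<omega>)))"

text \<open>Uniqueness is up to indistinguishability of \<open>W\<close> and up to null elements for \<open>\<Theta>\<close>.\<close>

definition unique_bsde_solution ::
    "'a measure \<Rightarrow> (real \<Rightarrow> 'a measure) \<Rightarrow> real \<Rightarrow> (nat \<Rightarrow> 'a \<Rightarrow> ereal) \<Rightarrow> (nat \<Rightarrow> 'a \<Rightarrow> real) \<Rightarrow>
     (real \<Rightarrow> 'a \<Rightarrow> real) \<Rightarrow> real measure \<Rightarrow> ('a \<Rightarrow> real) \<Rightarrow>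
     (real \<Rightarrow> 'a \<Rightarrow> real \<Rightarrow> (real \<Rightarrow> real) \<Rightarrow> real \<Rightarrow> real) \<Rightarrow> (real \<Rightarrow> 'a \<Rightarrow> real) set \<Rightarrow>
     (real \<Rightarrow> 'a \<Rightarrow> real) \<Rightarrow> (real \<Rightarrow> 'a \<Rightarrow> real \<Rightarrow> real) \<Rightarrow> bool" where
  "unique_bsde_solution M H T \<tau> Z p F \<xi> f A W \<Theta> \<longleftrightarrow>
     bsde_solution M H T \<tau> Z p F \<xi> f A W \<Theta> \<and>
     (\<forall>W' \<Theta>'. bsde_solution M H T \<tau> Z p F \<xi> f A W' \<Theta>' \<longrightarrow>
        (AE \<omega> in M. \<forall>t\<in>{0..T}. W' t \<omega> = W t \<omega>) \<and>
        sq_norm_L2hat M T p F (\<lambda>t \<omega> z. \<Theta>' t \<omega> z - \<Theta> t \<omega> z) = 0)"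

section \<open>Proportional reinsurance\<close>

definition mean :: "real measure \<Rightarrow> real" where
  "mean F = (LINT z:{0<..}|F. z)"

definition proportional :: "real \<Rightarrow> real \<Rightarrow> real" where
  "proportional z v = z * v"

definition expected_value_premium ::
    "real \<Rightarrow> real measure \<Rightarrow> (real \<Rightarrow> 'a \<Rightarrow> real) \<Rightarrow> real \<Rightarrow> 'a \<Rightarrow> real \<Rightarrow> real" where
  "expected_value_premium \<theta>R F p t \<omega> v = (1 + \<theta>R) * mean F * left_lim (\<lambda>s. p s \<omega>) t * (1 - v)"

text \<open>The equation that determines the retention level \<open>v\<close> between the two thresholds.\<close>

definition retention_equation ::
    "real \<Rightarrow> real \<Rightarrow> real \<Rightarrow> real \<Rightarrow> real measure \<Rightarrow> real \<Rightarrow> real \<Rightarrow> (real \<Rightarrow> real) \<Rightarrow> real \<Rightarrow> bool" where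
  "retention_equation T r \<eta> \<theta>R F t w \<theta> v \<longleftrightarrow>
     (1 + \<theta>R) * mean F =
       (LINT z:{0<..}|F. (w + \<theta> z) / w * z * exp (- \<eta> * exp (r * (T - t)) * z * (1 - v)))"

end

theory Submission
  imports Defs
begin

text \<open>The candidate \<open>u*\<close> maximises the driver \<open>f\<close> pointwise. The driver is concave in the control,
  because \<open>W\<^sub>t\<^sub>- + \<Theta>\<^sub>t(z)\<close> is the value of the positive process \<open>W\<close> after a jump with mark \<open>z\<close>, and
  its derivative at \<open>v\<close> has the sign of \<open>(1 + \<theta>\<^sub>R) \<mu> - h\<^sub>t(v)\<close>, where \<open>\<mu>\<close> is the mean claim and
  \<open>h\<^sub>t(v)\<close> is the integral of \<open>(W\<^sub>t\<^sub>- + \<Theta>\<^sub>t(z)) / W\<^sub>t\<^sub>- z exp (- \<eta> exp (r (T - t)) z (1 - v))\<close>. As \<open>h\<^sub>t\<close>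
  is strictly increasing, its values at \<open>0\<close> and \<open>1\<close> give the thresholds, and between them its
  crossing point is the interior maximiser.

  Let \<open>D\<close> be the gain of \<open>u*\<close> over null reinsurance. The drift of \<open>exp (- \<eta> D) W\<close> is
  \<open>exp (- \<eta> D) (ess sup f - f(u*)) \<le> 0\<close>, so after localisation the expected terminal disutility of
  \<open>u*\<close> is at most \<open>E W\<^sub>0\<close>. On the other hand \<open>W\<^sub>0\<close> is an essential infimum over all admissible
  strategies, so \<open>E W\<^sub>0\<close> is at most the expected terminal disutility of any of them.\<close>

section \<open>Right-continuous paths with left limits\<close>

text \<open>The filtration \<open>H\<close> is the raw one generated by the claims. The proof
  therefore uses neither stochastic integrals nor stopping times: every probabilistic step goes
  through the compensator identity for nonnegative predictable fields, localisation uses predictable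
  sets described by rational times, and all else is done path by path, where only finitely many
  jumps occur up to \<open>T\<close>. Three facts have to be extracted from the hypotheses. The
  filter must inherit the compensator, which requires the self-exciting intensity to have finite
  mean; a Gronwall bound on the expected number of claims gives this. The process \<open>W\<close>
  must have a positive lower bound along each whole path, while the value process only supplies
  inequalities at one fixed time each; a maximal inequality under a density common to all controls
  gives this. Finally, the candidate \<open>ustar\<close> must be admissible. Its disutility is seen
  to be integrable only at the end, from the comparison itself, so until then it is treated as a
  predictable process with values in the unit interval.\<close>

lemma left_lim_tendsto:
  assumes "cadlag_on T f" "0 < t" "t \<le> T"
  shows "(f \<longlongrightarrow> left_lim f t) (at_left t)"
proof -
  obtain l where l: "(f \<longlongrightarrow> l) (at_left t)"
    using assms unfolding cadlag_on_def by (metis greaterThanAtMost_iff)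
  then have "Lim (at_left t) f = l"
    by (intro tendsto_Lim) auto
  with l assms show ?thesis by (simp add: left_lim_def)
qed

lemma left_lim_eqI: "(f \<longlongrightarrow> l) (at_left t) \<Longrightarrow> 0 < t \<Longrightarrow> left_lim f t = l"
  unfolding left_lim_def by (auto intro!: tendsto_Lim)

lemma cadlag_on_right: "cadlag_on T f \<Longrightarrow> 0 \<le> t \<Longrightarrow> t < T \<Longrightarrow> (f \<longlongrightarrow> f t) (at_right t)"
  unfolding cadlag_on_def continuous_within by auto

text \<open>One-sided limits bound the path on a neighbourhood of every time, and finitely many of
  these neighbourhoods cover the compact interval.\<close>

lemma cadlag_on_bounded:
  assumes f: "cadlag_on T f"
  obtains B where "\<And>t. t \<in> {0..T} \<Longrightarrow> \<bar>f t\<bar> \<le> B"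
proof -
  have "\<exists>U B. open U \<and> t \<in> U \<and> (\<forall>s\<in>U \<inter> {0..T}. \<bar>f s\<bar> \<le> B)" if t: "t \<in> {0..T}" for t
  proof -
    obtain b B1 where 1: "t < b" "\<And>s. t < s \<Longrightarrow> s < b \<Longrightarrow> s \<le> T \<Longrightarrow> \<bar>f s\<bar> \<le> B1"
    proof (cases "t < T")
      case True
      then have "(f \<longlongrightarrow> f t) (at_right t)" using cadlag_on_right[OF f] t by auto
      then have "eventually (\<lambda>s. \<bar>f s - f t\<bar> < 1) (at_right t)"
        unfolding tendsto_iff dist_real_def by (auto dest: spec[of _ 1])
      then obtain b where "t < b" "\<And>s. t < s \<Longrightarrow> s < b \<Longrightarrow> \<bar>f s - f t\<bar> < 1"
        by (auto simp: eventually_at_right_field)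
      then show thesis by (intro that[of b "\<bar>f t\<bar> + 1"]) (auto, smt (verit))
    next
      case False
      then show thesis by (intro that[of "t + 1" 0]) auto
    qed
    obtain a B2 where 2: "a < t" "\<And>s. a < s \<Longrightarrow> s < t \<Longrightarrow> 0 \<le> s \<Longrightarrow> \<bar>f s\<bar> \<le> B2"
    proof (cases "0 < t")
      case True
      then obtain l where "(f \<longlongrightarrow> l) (at_left t)" using f t unfolding cadlag_on_def
        by (metis atLeastAtMost_iff greaterThanAtMost_iff)
      then have "eventually (\<lambda>s. \<bar>f s - l\<bar> < 1) (at_left t)"
        unfolding tendsto_iff dist_real_def by (auto dest: spec[of _ 1])
      then obtain b where "b < t" "\<And>s. b < s \<Longrightarrow> s < t \<Longrightarrow> \<bar>f s - l\<bar> < 1"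
        by (auto simp: eventually_at_left_field)
      then show thesis by (intro that[of b "\<bar>l\<bar> + 1"]) (auto, smt (verit))
    next
      case False
      then show thesis by (intro that[of "t - 1" 0]) auto
    qed
    have "\<bar>f s\<bar> \<le> max \<bar>f t\<bar> (max B1 B2)" if "s \<in> {a<..<b} \<inter> {0..T}" for s
      using 1(2)[of s] 2(2)[of s] that by (cases s t rule: linorder_cases) auto
    then show ?thesis using 1(1) 2(1)
      by (intro exI[of _ "{a<..<b}"] exI[of _ "max \<bar>f t\<bar> (max B1 B2)"]) auto
  qed
  then obtain U B where UB: "\<And>t. t \<in> {0..T} \<Longrightarrow> open (U t) \<and> t \<in> U t \<and> (\<forall>s\<in>U t \<inter> {0..T}. \<bar>f s\<bar> \<le> B t)"
    by metis
  have "compact {0..T}" by simp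
  then obtain D where D: "D \<subseteq> {0..T}" "finite D" "{0..T} \<subseteq> (\<Union>t\<in>D. U t)"
    using UB by (elim compactE_image[of "{0..T}" "{0..T}" U]) auto
  have "\<bar>f t\<bar> \<le> (\<Sum>s\<in>D. \<bar>B s\<bar>)" if t: "t \<in> {0..T}" for t
  proof -
    obtain s where s: "s \<in> D" "t \<in> U s" using D(3) t by blast
    then have "\<bar>f t\<bar> \<le> B s" using UB[of s] D(1) t by auto
    also have "\<dots> \<le> (\<Sum>s\<in>D. \<bar>B s\<bar>)"
      using member_le_sum[of s D "\<lambda>s. \<bar>B s\<bar>"] s D(2) by auto
    finally show ?thesis .
  qed
  then show thesis by (rule that)
qed

lemma left_lim_between:
  assumes f: "cadlag_on T f" and t: "0 < t" "t \<le> T"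
    and b: "\<And>s. s \<in> {0<..<t} \<Longrightarrow> a \<le> f s"
  shows "a \<le> left_lim f t"
proof -
  have "eventually (\<lambda>s. a \<le> f s) (at_left t)"
    unfolding eventually_at_left_field using t b by (auto intro!: exI[of _ 0])
  then show ?thesis
    using left_lim_tendsto[OF f t] by (intro tendsto_lowerbound[of f _ "at_left t"]) auto
qed

lemma left_lim_uminus:
  assumes f: "cadlag_on T f" and t: "0 < t" "t \<le> T"
  shows "left_lim (\<lambda>s. - f s) t = - left_lim f t"
  using tendsto_minus[OF left_lim_tendsto[OF f t]] t by (intro left_lim_eqI)

lemma cadlag_on_uminus: "cadlag_on T f \<Longrightarrow> cadlag_on T (\<lambda>t. - f t)"
  unfolding cadlag_on_def by (blast intro: continuous_minus tendsto_minus)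

lemma left_lim_between':
  assumes f: "cadlag_on T f" and t: "0 < t" "t \<le> T"
    and b: "\<And>s. s \<in> {0<..<t} \<Longrightarrow> f s \<le> a"
  shows "left_lim f t \<le> a"
  using left_lim_between[OF cadlag_on_uminus[OF f] t, of "-a"] b left_lim_uminus[OF f t] by auto

text \<open>Pick a rational in each gap \<open>{d t<..<t}\<close>. For \<open>s < t\<close> in
  \<open>S\<close> the point \<open>s\<close> cannot lie in the gap of \<open>t\<close>, so the
  rational of \<open>s\<close> is below \<open>s\<close> and that of \<open>t\<close> is above it;
  the choice is injective.\<close>

lemma countable_left_isolated:
  fixes S :: "real set"
  assumes "\<And>t. t \<in> S \<Longrightarrow> \<exists>d<t. {d<..<t} \<inter> S = {}"
  shows "countable S"
proof -
  obtain d where d: "\<And>t. t \<in> S \<Longrightarrow> d t < t \<and> {d t<..<t} \<inter> S = {}"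
    using assms by metis
  define q where "q t = (SOME q. d t < real_of_rat q \<and> real_of_rat q < t)" for t
  have q: "d t < real_of_rat (q t) \<and> real_of_rat (q t) < t" if "t \<in> S" for t
    unfolding q_def using d[OF that] of_rat_dense[of "d t" t] by (metis (mono_tags, lifting) someI_ex)
  have less: "q s \<noteq> q t" if "s \<in> S" "t \<in> S" "s < t" for s t
    using q[of s] q[of t] d[of t] that by (auto simp: disjoint_iff)
  have "inj_on q S"
    by (rule inj_onI) (metis less linorder_neqE_linordered_idom)
  then show ?thesis by (metis countableI' countableI_type countable_image_inj_on)
qed

text \<open>At an upward jump some rational \<open>a\<close> separates the left limit from the
  value. For fixed \<open>a\<close> such times are isolated from the left, because the path stays
  below \<open>a\<close> just before each of them. Downward jumps are upward jumps of the negated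
  path.\<close>

lemma countable_left_jumps:
  assumes f: "cadlag_on T f"
  shows "countable {t\<in>{0<..T}. left_lim f t \<noteq> f t}"
proof -
  have up: "countable {t\<in>{0<..T}. left_lim g t < real_of_rat a \<and> real_of_rat a < g t}" (is "countable ?S")
    if g: "cadlag_on T g" for g a
  proof (rule countable_left_isolated)
    fix t assume t: "t \<in> ?S"
    then have "eventually (\<lambda>s. g s < real_of_rat a) (at_left t)"
      using left_lim_tendsto[OF g, of t] by (auto simp: order_tendstoD)
    then obtain b where "b < t" "\<And>s. b < s \<Longrightarrow> s < t \<Longrightarrow> g s < real_of_rat a"
      by (auto simp: eventually_at_left_field)
    then show "\<exists>d<t. {d<..<t} \<inter> ?S = {}" by (intro exI[of _ b]) force
  qed
  have "{t\<in>{0<..T}. left_lim f t \<noteq> f t} \<subseteq>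
     (\<Union>a. {t\<in>{0<..T}. left_lim f t < real_of_rat a \<and> real_of_rat a < f t}) \<union>
     (\<Union>a. {t\<in>{0<..T}. left_lim (\<lambda>t. - f t) t < real_of_rat a \<and> real_of_rat a < - f t})"
  proof
    fix t assume t: "t \<in> {t\<in>{0<..T}. left_lim f t \<noteq> f t}"
    then consider "left_lim f t < f t" | "- left_lim f t < - f t" by fastforce
    then show "t \<in> (\<Union>a. {t\<in>{0<..T}. left_lim f t < real_of_rat a \<and> real_of_rat a < f t}) \<union>
     (\<Union>a. {t\<in>{0<..T}. left_lim (\<lambda>t. - f t) t < real_of_rat a \<and> real_of_rat a < - f t})"
      using of_rat_dense[of "left_lim f t" "f t"] of_rat_dense[of "- left_lim f t" "- f t"] t
        left_lim_uminus[OF f, of t]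
      by cases auto
  qed
  then show ?thesis
    by (rule countable_subset) (intro countable_Un countable_UN countableI_type up f cadlag_on_uminus)
qed

text \<open>The grid point of mesh \<open>2^-n\<close> strictly before \<open>t\<close>: ceiling
  minus one rather than floor, so that the value is below \<open>t\<close> even when
  \<open>t\<close> is a grid point. Sampling an adapted process there is predictable, and the
  samples converge to the left limit.\<close>

definition dyadic_below :: "nat \<Rightarrow> real \<Rightarrow> real" where
  "dyadic_below n t = max 0 ((of_int \<lceil>t * 2 ^ n\<rceil> - 1) / 2 ^ n)"

lemma dyadic_below_less: "0 < t \<Longrightarrow> 0 \<le> dyadic_below n t \<and> dyadic_below n t < t"
  unfolding dyadic_below_def by (simp add: field_simps) linarith

lemma dyadic_below_tendsto: 
  assumes "0 < t" shows "filterlim (\<lambda>n. dyadic_below n t) (at_left t) sequentially"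
proof -
  have *: "t - (1/2)^n \<le> dyadic_below n t" for n
    unfolding dyadic_below_def by (simp add: field_simps max_def power_divide)
  have "(\<lambda>n. t - (1/2)^n) \<longlonglongrightarrow> t - 0"
    by (intro tendsto_intros LIMSEQ_power_zero) simp
  then have lim: "(\<lambda>n. t - (1/2)^n) \<longlonglongrightarrow> t" by simp
  have "(\<lambda>n. dyadic_below n t) \<longlonglongrightarrow> t"
    by (rule tendsto_sandwich[OF always_eventually always_eventually lim tendsto_const])
       (use * dyadic_below_less[OF assms] in \<open>auto intro: less_imp_le\<close>)
  then show ?thesis using dyadic_below_less[OF assms]
    by (auto simp: filterlim_at eventually_sequentially less_imp_neq)
qed

lemma left_lim_dyadic:
  assumes "cadlag_on T f" "0 < t" "t \<le> T"
  shows "(\<lambda>n. f (dyadic_below n t)) \<longlonglongrightarrow> left_lim f t"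
  using filterlim_compose[OF left_lim_tendsto[OF assms] dyadic_below_tendsto[OF assms(2)]] .


section \<open>Product rule for an exponential and a path with finitely many jumps\<close>

text \<open>Telescoping over a fine equal partition bounds the total increment of \<open>R\<close>
  by \<open>\<epsilon>\<close> times that of \<open>\<Lambda>\<close>, for every positive
  \<open>\<epsilon>\<close>. This replaces differentiation of \<open>R\<close>: in the application
  its ingredients are integrals of merely integrable functions, differentiable only almost
  everywhere.\<close>

lemma eq_if_small_increments:
  fixes R \<Lambda> :: "real \<Rightarrow> real"
  assumes "a \<le> b"
    and small: "\<And>\<epsilon>. 0 < \<epsilon> \<Longrightarrow> \<exists>\<delta>>0. \<forall>x\<in>{a..b}. \<forall>y\<in>{a..b}. x \<le> y \<longrightarrow> y - x < \<delta> \<longrightarrow>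
      \<bar>R y - R x\<bar> \<le> \<epsilon> * (\<Lambda> y - \<Lambda> x)"
  shows "R b = R a"
proof -
  have *: "\<bar>R b - R a\<bar> \<le> \<epsilon> * (\<Lambda> b - \<Lambda> a)" if "0 < \<epsilon>" for \<epsilon>
  proof -
    obtain \<delta> where \<delta>: "0 < \<delta>" "\<And>x y. x \<in> {a..b} \<Longrightarrow> y \<in> {a..b} \<Longrightarrow> x \<le> y \<Longrightarrow> y - x < \<delta> \<Longrightarrow>
      \<bar>R y - R x\<bar> \<le> \<epsilon> * (\<Lambda> y - \<Lambda> x)"
      using small[OF \<open>0 < \<epsilon>\<close>] by meson
    obtain n :: nat where n: "(b - a) / \<delta> < real n" using reals_Archimedean2 by blast
    with \<delta> assms(1) have n0: "0 < n"
      by (metis divide_nonneg_pos diff_ge_0_iff_ge not_gr_zero of_nat_0 not_less)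
    define x where "x k = a + real k * ((b - a) / real n)" for k
    have x: "x k \<in> {a..b}" if "k \<le> n" for k
    proof -
      have "real k * ((b - a) / real n) \<le> real n * ((b - a) / real n)"
        using that assms(1) by (intro mult_right_mono) auto
      then show ?thesis using n0 assms(1) unfolding x_def by auto
    qed
    have step: "x (Suc k) - x k = (b - a) / real n" for k
      unfolding x_def by (simp add: algebra_simps add_divide_distrib diff_divide_distrib)
    have d: "(b - a) / real n < \<delta>" "0 \<le> (b - a) / real n"
      using n n0 \<delta>(1) assms(1) by (auto simp: field_simps)
    have inc: "x k \<le> x (Suc k)" for k using step[of k] d(2) by linarith
    have "R b - R a = (\<Sum>k<n. R (x (Suc k)) - R (x k))"
      using n0 by (simp add: sum_lessThan_telescope[of "\<lambda>k. R (x k)"]) (simp add: x_def)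
    also have "\<bar>\<dots>\<bar> \<le> (\<Sum>k<n. \<epsilon> * (\<Lambda> (x (Suc k)) - \<Lambda> (x k)))"
      by (intro order_trans[OF sum_abs] sum_mono \<delta>(2) x) (use step[of _] d inc in auto)
    also have "\<dots> = \<epsilon> * (\<Lambda> b - \<Lambda> a)"
      using n0 by (simp add: sum_distrib_left[symmetric] sum_lessThan_telescope[of "\<lambda>k. \<Lambda> (x k)"])
        (simp add: x_def)
    finally show ?thesis .
  qed
  have L: "0 \<le> \<Lambda> b - \<Lambda> a" using *[of 1] by simp
  have "\<bar>R b - R a\<bar> \<le> 0 + e" if "0 < e" for e
  proof -
    \<comment> \<open>One is added to the denominator because the increment of
      \<open>\<Lambda>\<close> may vanish.\<close>
    have "\<bar>R b - R a\<bar> \<le> e / (\<Lambda> b - \<Lambda> a + 1) * (\<Lambda> b - \<Lambda> a)"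
      using that L by (intro *) auto
    also have "\<dots> \<le> e / (\<Lambda> b - \<Lambda> a + 1) * (\<Lambda> b - \<Lambda> a + 1)"
      using that L by (intro mult_left_mono divide_nonneg_nonneg) auto
    finally show ?thesis using L by simp
  qed
  then have "\<bar>R b - R a\<bar> \<le> 0" by (rule field_le_epsilon)
  then show ?thesis by simp
qed

lemma set_integrable_mult_bounded:
  fixes f g :: "'b \<Rightarrow> real"
  assumes f: "set_integrable M A f" and g: "set_borel_measurable M A g"
    and B: "\<And>x. x \<in> A \<Longrightarrow> \<bar>g x\<bar> \<le> B"
  shows "set_integrable M A (\<lambda>x. g x * f x)"
proof -
  have 1: "integrable M (\<lambda>x. B * (indicator A x *\<^sub>R f x))"
    using f unfolding set_integrable_def by simp
  have "(\<lambda>x. (indicator A x *\<^sub>R g x) * (indicator A x *\<^sub>R f x)) \<in> borel_measurable M"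
    using f g unfolding set_integrable_def set_borel_measurable_def
    by (intro borel_measurable_times) auto
  moreover have "(\<lambda>x. (indicator A x *\<^sub>R g x) * (indicator A x *\<^sub>R f x)) = (\<lambda>x. indicator A x *\<^sub>R (g x * f x))"
    by (auto simp: indicator_def)
  ultimately have 2: "(\<lambda>x. indicator A x *\<^sub>R (g x * f x)) \<in> borel_measurable M" by simp
  have "norm (indicator A x *\<^sub>R (g x * f x)) \<le> norm (B * (indicator A x *\<^sub>R f x))" for x
    using B[of x] by (auto simp: indicator_def abs_mult intro!: mult_right_mono)
  then show ?thesis
    unfolding set_integrable_def by (intro Bochner_Integration.integrable_bound[OF 1 2]) auto
qed

text \<open>With \<open>V = exp A (w + B)\<close>, the difference \<open>R\<close> between
  \<open>V\<close> and the integral of its formal derivative \<open>V a + exp A b\<close> has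
  increments that are small against those of \<open>\<Lambda>\<close>, the integral of
  \<open>|a| + |b|\<close>. Hence \<open>R\<close> is constant.\<close>

lemma exp_product_formula:
  fixes a b :: "real \<Rightarrow> real"
  assumes "s \<le> t" and a: "set_integrable lborel {s..t} a" and b: "set_integrable lborel {s..t} b"
  defines "A \<equiv> \<lambda>x. integral {s..x} a" and "B \<equiv> \<lambda>x. integral {s..x} b"
  shows "exp (A t) * (w + B t) = w + integral {s..t} (\<lambda>x. exp (A x) * ((w + B x) * a x + b x))"
proof -
  have ai: "a integrable_on {s..t}" "b integrable_on {s..t}"
    "(\<lambda>x. \<bar>a x\<bar>) integrable_on {s..t}" "(\<lambda>x. \<bar>b x\<bar>) integrable_on {s..t}"
    using a b set_integrable_abs[OF a] set_integrable_abs[OF b]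
    by (auto intro: set_borel_integral_eq_integral)
  have cA: "continuous_on {s..t} A" and cB: "continuous_on {s..t} B"
    unfolding A_def B_def by (intro indefinite_integral_continuous_1 ai)+
  define E where "E x = exp (A x)" for x
  define V where "V x = exp (A x) * (w + B x)" for x
  have cE: "continuous_on {s..t} E" and cV: "continuous_on {s..t} V" and cW: "continuous_on {s..t} (\<lambda>x. w + B x)"
    unfolding E_def V_def by (intro continuous_intros cA cB)+
  have bnd: "\<exists>C. \<forall>x\<in>{s..t}. \<bar>f x\<bar> \<le> C" if "continuous_on {s..t} f" for f :: "real \<Rightarrow> real"
    using compact_imp_bounded[OF compact_continuous_image[OF that]] by (auto simp: bounded_iff)
  have meas: "set_borel_measurable lborel {s..t} f" if "continuous_on {s..t} f" for f :: "real \<Rightarrow> real"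
    using borel_measurable_continuous_on_indicator[OF _ that] unfolding set_borel_measurable_def by simp
  have int: "(\<lambda>x. f x * h x) integrable_on {s..t}" 
    if "continuous_on {s..t} f" "set_integrable lborel {s..t} h" for f h :: "real \<Rightarrow> real"
    using set_integrable_mult_bounded[OF that(2) meas[OF that(1)]] bnd[OF that(1)]
    by (meson set_borel_integral_eq_integral(1))
  define \<phi> where "\<phi> x = V x * a x + E x * b x" for x
  have \<phi>: "\<phi> integrable_on {s..t}"
    unfolding \<phi>_def by (intro integrable_add int cE cV a b)
  define R where "R x = V x - integral {s..x} \<phi>" for x
  define \<Lambda> where "\<Lambda> x = integral {s..x} (\<lambda>v. \<bar>a v\<bar> + \<bar>b v\<bar>)" for x
  obtain C where C: "\<forall>x\<in>{s..t}. \<bar>w + B x\<bar> \<le> C" using bnd[OF cW] by auto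
  then have C0: "0 \<le> C" using \<open>s \<le> t\<close> by (force intro: order_trans[OF abs_ge_zero])
  have "R t = R s"
  proof (rule eq_if_small_increments[OF \<open>s \<le> t\<close>, of R \<Lambda>])
    fix \<epsilon> :: real assume "0 < \<epsilon>"
    \<comment> \<open>The three errors below add up to \<open>e\<close> times the integral of
      \<open>|b| + (1 + C) |a|\<close>, where \<open>C\<close> bounds \<open>w + B\<close>; dividing
      by \<open>2 + C\<close> absorbs both factors.\<close>
    define e where "e = \<epsilon> / (2 + C)"
    have e: "0 < e" using \<open>0 < \<epsilon>\<close> C0 by (simp add: e_def)
    obtain d1 where d1: "0 < d1" "\<And>x y. x \<in> {s..t} \<Longrightarrow> y \<in> {s..t} \<Longrightarrow> dist y x < d1 \<Longrightarrow> dist (E y) (E x) < e"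
      using compact_uniformly_continuous[OF cE] e unfolding uniformly_continuous_on_def by (metis compact_Icc)
    obtain d2 where d2: "0 < d2" "\<And>x y. x \<in> {s..t} \<Longrightarrow> y \<in> {s..t} \<Longrightarrow> dist y x < d2 \<Longrightarrow> dist (V y) (V x) < e"
      using compact_uniformly_continuous[OF cV] e unfolding uniformly_continuous_on_def by (metis compact_Icc)
    have "\<bar>R y - R x\<bar> \<le> \<epsilon> * (\<Lambda> y - \<Lambda> x)"
      if xy: "x \<in> {s..t}" "y \<in> {s..t}" "x \<le> y" "y - x < min d1 d2" for x y
    proof -
      have sub: "f integrable_on {x..y}" if "f integrable_on {s..t}" for f :: "real \<Rightarrow> real"
        using that xy by (auto intro: integrable_subinterval_real)
      have comb: "integral {s..y} f - integral {s..x} f = integral {x..y} f"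
        if "f integrable_on {s..t}" for f :: "real \<Rightarrow> real"
        using Henstock_Kurzweil_Integration.integral_combine[of s x y f] xy
          integrable_subinterval_real[OF that, of s y] by auto
      have DA: "A y - A x = integral {x..y} a" and DB: "B y - B x = integral {x..y} b"
        unfolding A_def B_def by (intro comb ai)+
      have near: "\<bar>E y - E v\<bar> \<le> e" "\<bar>V x - V v\<bar> \<le> e" "\<bar>E v - E x\<bar> \<le> e" if "v \<in> {x..y}" for v
        using d1(2)[of v y] d2(2)[of v x] d1(2)[of x v] that xy by (auto simp: dist_real_def less_imp_le)
      have i: "(\<lambda>v. e * \<bar>a v\<bar>) integrable_on {x..y}" "(\<lambda>v. e * \<bar>b v\<bar>) integrable_on {x..y}"
        using integrable_cmul[OF sub[OF ai(3)], of e] integrable_cmul[OF sub[OF ai(4)], of e] by auto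
      have 1: "\<bar>integral {x..y} (\<lambda>v. (E y - E v) * b v)\<bar> \<le> integral {x..y} (\<lambda>v. e * \<bar>b v\<bar>)"
        by (rule integral_norm_bound_integral[where 'a=real, unfolded real_norm_def])
          (use near(1) in \<open>auto simp: abs_mult intro!: i mult_right_mono sub[OF int] continuous_intros cE b\<close>)
      have 2: "\<bar>integral {x..y} (\<lambda>v. (V x - V v) * a v)\<bar> \<le> integral {x..y} (\<lambda>v. e * \<bar>a v\<bar>)"
        by (rule integral_norm_bound_integral[where 'a=real, unfolded real_norm_def])
          (use near(2) in \<open>auto simp: abs_mult intro!: i mult_right_mono sub[OF int] continuous_intros cV a\<close>)
      \<comment> \<open>The increment of \<open>exp\<close> is its value at an intermediate point
        times the increment of \<open>A\<close>; by monotonicity that value differs from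
        \<open>E x\<close> by at most \<open>|E y - E x|\<close>.\<close>
      have mvt: "\<bar>E y - E x - (A y - A x) * E x\<bar> \<le> e * \<bar>A y - A x\<bar>"
      proof -
        have aux: "\<exists>z. (z \<in> {p..q} \<or> z \<in> {q..p}) \<and> exp q - exp p = exp z * (q - p)" for p q :: real
        proof (cases p q rule: linorder_cases)
          case less
          then obtain z where "p < z" "z < q" "exp q - exp p = (q - p) * exp z"
            using MVT2[OF less, of exp exp] by (auto intro: derivative_eq_intros)
          then show ?thesis by (intro exI[of _ z]) auto
        next
          case greater
          then obtain z where "q < z" "z < p" "exp p - exp q = (p - q) * exp z"
            using MVT2[OF greater, of exp exp] by (auto intro: derivative_eq_intros)
          then show ?thesis by (intro exI[of _ z]) (auto simp: algebra_simps)
        qed auto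
        obtain z where z: "z \<in> {A x..A y} \<or> z \<in> {A y..A x}" "E y - E x = exp z * (A y - A x)"
          using aux[of "A x" "A y"] unfolding E_def by auto
        have "\<bar>exp z - E x\<bar> \<le> \<bar>E y - E x\<bar>" using z(1) unfolding E_def by (auto simp: abs_if)
        also have "\<dots> \<le> e" using near(3)[of y] xy by auto
        finally have "\<bar>exp z - E x\<bar> * \<bar>A y - A x\<bar> \<le> e * \<bar>A y - A x\<bar>"
          by (rule mult_right_mono) simp
        then show ?thesis unfolding z(2) abs_mult[symmetric] by (simp add: algebra_simps)
      qed
      have 3: "\<bar>(w + B x) * (E y - E x - (A y - A x) * E x)\<bar> \<le> C * (e * integral {x..y} (\<lambda>v. \<bar>a v\<bar>))"
      proof -
        have "\<bar>A y - A x\<bar> \<le> integral {x..y} (\<lambda>v. \<bar>a v\<bar>)"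
          unfolding DA using integral_norm_bound_integral[of a "{x..y}" "\<lambda>v. \<bar>a v\<bar>"] ai sub by auto
        then show ?thesis unfolding abs_mult using C xy(1) C0 e mvt
          by (intro mult_mono) (auto intro: order_trans mult_left_mono)
      qed
      \<comment> \<open>Freezing \<open>E\<close> at \<open>y\<close> in the integral of
        \<open>b\<close>, freezing \<open>V\<close> at \<open>x\<close> in the integral of
        \<open>a\<close> and linearising \<open>exp\<close> at \<open>A x\<close> leaves exactly the
        three terms bounded above.\<close>
      have "R y - R x = E y * (B y - B x) + (w + B x) * (E y - E x) - integral {x..y} \<phi>"
        unfolding R_def comb[OF \<phi>, symmetric] V_def E_def by (simp add: algebra_simps)
      also have "E y * (B y - B x) = integral {x..y} (\<lambda>v. E y * b v)"
        unfolding DB by simp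
      also have "(w + B x) * (E y - E x) = integral {x..y} (\<lambda>v. V x * a v) + (w + B x) * (E y - E x - (A y - A x) * E x)"
        unfolding integral_mult_right DA[symmetric] by (simp add: V_def E_def algebra_simps)
      also have "integral {x..y} \<phi> = integral {x..y} (\<lambda>v. V v * a v) + integral {x..y} (\<lambda>v. E v * b v)"
        unfolding \<phi>_def by (intro integral_add sub int cE cV a b)
      also have "integral {x..y} (\<lambda>v. E y * b v) +
          (integral {x..y} (\<lambda>v. V x * a v) + (w + B x) * (E y - E x - (A y - A x) * E x)) -
          (integral {x..y} (\<lambda>v. V v * a v) + integral {x..y} (\<lambda>v. E v * b v)) =
          integral {x..y} (\<lambda>v. (E y - E v) * b v) + integral {x..y} (\<lambda>v. (V x - V v) * a v)
          + (w + B x) * (E y - E x - (A y - A x) * E x)"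
        unfolding left_diff_distrib
        by (subst (1 2) integral_diff) (auto intro!: sub int cE cV a b continuous_intros)
      finally have "\<bar>R y - R x\<bar> \<le> integral {x..y} (\<lambda>v. e * \<bar>b v\<bar>) + integral {x..y} (\<lambda>v. e * \<bar>a v\<bar>)
          + C * (e * integral {x..y} (\<lambda>v. \<bar>a v\<bar>))"
        using 1 2 3 by linarith
      also have "\<dots> = e * (integral {x..y} (\<lambda>v. \<bar>b v\<bar>) + (1 + C) * integral {x..y} (\<lambda>v. \<bar>a v\<bar>))"
        by (simp add: algebra_simps)
      also have "\<dots> \<le> e * ((2 + C) * (integral {x..y} (\<lambda>v. \<bar>a v\<bar>) + integral {x..y} (\<lambda>v. \<bar>b v\<bar>)))"
      proof (intro mult_left_mono)
        have "0 \<le> integral {x..y} (\<lambda>v. \<bar>b v\<bar>)" "0 \<le> integral {x..y} (\<lambda>v. \<bar>a v\<bar>)"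
          by (auto intro!: integral_nonneg sub ai)
        then show "integral {x..y} (\<lambda>v. \<bar>b v\<bar>) + (1 + C) * integral {x..y} (\<lambda>v. \<bar>a v\<bar>) \<le>
           (2 + C) * (integral {x..y} (\<lambda>v. \<bar>a v\<bar>) + integral {x..y} (\<lambda>v. \<bar>b v\<bar>))"
          using C0 mult_nonneg_nonneg[of C "integral {x..y} (\<lambda>v. \<bar>b v\<bar>)"] by (simp add: algebra_simps)
      qed (use e in simp)
      also have "\<dots> = \<epsilon> * (integral {x..y} (\<lambda>v. \<bar>a v\<bar>) + integral {x..y} (\<lambda>v. \<bar>b v\<bar>))"
        unfolding e_def using C0 by simp
      also have "integral {x..y} (\<lambda>v. \<bar>a v\<bar>) + integral {x..y} (\<lambda>v. \<bar>b v\<bar>) = \<Lambda> y - \<Lambda> x"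
        unfolding \<Lambda>_def by (subst comb) (auto intro!: integrable_add ai sub integral_add[symmetric])
      finally show ?thesis .
    qed
    then show "\<exists>\<delta>>0. \<forall>x\<in>{s..t}. \<forall>y\<in>{s..t}. x \<le> y \<longrightarrow> y - x < \<delta> \<longrightarrow> \<bar>R y - R x\<bar> \<le> \<epsilon> * (\<Lambda> y - \<Lambda> x)"
      using d1(1) d2(1) by (intro exI[of _ "min d1 d2"]) auto
  qed
  then have "V t = w + integral {s..t} \<phi>"
    unfolding R_def V_def A_def B_def by simp
  then show ?thesis
    unfolding V_def \<phi>_def E_def by (simp add: algebra_simps)
qed


text \<open>The jumps are added in increasing order of time, so the newest one is the last: before
  it nothing changes, and after it the continuous formula is restarted at \<open>\<tau> m\<close>.
  In the jump sum \<open>exp (- \<alpha> j)\<close> and \<open>- \<beta> j\<close> undo the jump, so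
  each summand is the value of the product at the jump time minus its value just before it, written
  without left limits.\<close>

lemma exp_product_formula_jumps:
  fixes w :: real and a b :: "real \<Rightarrow> real" and \<tau> :: "'i \<Rightarrow> real" and \<alpha> \<beta> :: "'i \<Rightarrow> real"
  assumes ab: "set_integrable lborel {s..t} a" "set_integrable lborel {s..t} b"
    and "finite J" "inj_on \<tau> J" "\<And>j. j \<in> J \<Longrightarrow> s < \<tau> j"
  defines "E \<equiv> \<lambda>J x. exp (integral {s..x} a + (\<Sum>j\<in>{j\<in>J. \<tau> j \<le> x}. \<alpha> j))"
    and "V \<equiv> \<lambda>J x. w + integral {s..x} b + (\<Sum>j\<in>{j\<in>J. \<tau> j \<le> x}. \<beta> j)"
  assumes x: "x \<in> {s..t}"
  shows "E J x * V J x = w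
      + (\<Sum>j\<in>{j\<in>J. \<tau> j \<le> x}. E J (\<tau> j) * (V J (\<tau> j) - exp (- \<alpha> j) * (V J (\<tau> j) - \<beta> j)))
      + integral {s..x} (\<lambda>v. E J v * (V J v * a v + b v))"
  using assms(3-5) x
proof (induction J arbitrary: x rule: finite_ranking_induct[where f = \<tau>])
  case empty
  have "set_integrable lborel {s..x} a" "set_integrable lborel {s..x} b"
    using empty by (auto intro!: set_integrable_subset[OF ab(1)] set_integrable_subset[OF ab(2)])
  then show ?case
    using exp_product_formula[of s x a b w] empty unfolding E_def V_def by auto
next
  case (insert m S)
  show ?case
  proof (cases "m \<in> S")
    case True
    then show ?thesis using insert by (simp add: insert_absorb)
  next
    case mS: False
    have inj: "inj_on \<tau> S" and m: "\<tau> m \<notin> \<tau> ` S" and sm: "s < \<tau> m"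
      using insert.prems(1,2) mS by auto
    have less: "\<tau> j < \<tau> m" if "j \<in> S" for j
      using insert.hyps(2)[OF that] m that by (metis image_eqI less_le)
    have before: "{j\<in>insert m S. \<tau> j \<le> y} = {j\<in>S. \<tau> j \<le> y}" if "y < \<tau> m" for y using that by auto
    have after: "{j\<in>insert m S. \<tau> j \<le> y} = insert m S" if "\<tau> m \<le> y" for y
      using that less by force
    have Eb: "E (insert m S) y = E S y" "V (insert m S) y = V S y" if "y < \<tau> m" for y
      unfolding E_def V_def before[OF that] by auto
    have jumps: "(\<Sum>j\<in>S'. E (insert m S) (\<tau> j) * (V (insert m S) (\<tau> j) - exp (- \<alpha> j) * (V (insert m S) (\<tau> j) - \<beta> j)))
        = (\<Sum>j\<in>S'. E S (\<tau> j) * (V S (\<tau> j) - exp (- \<alpha> j) * (V S (\<tau> j) - \<beta> j)))" if "S' \<subseteq> S" for S'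
      using that less by (intro sum.cong) (auto simp: Eb subset_iff)
    \<comment> \<open>Up to \<open>\<tau> m\<close> the two integrands differ at the single point
      \<open>\<tau> m\<close>.\<close>
    have spike: "integral {s..y} (\<lambda>v. E (insert m S) v * (V (insert m S) v * a v + b v)) =
       integral {s..y} (\<lambda>v. E S v * (V S v * a v + b v))" if "y \<le> \<tau> m" for y
      using that by (intro integral_spike[of "{\<tau> m}"]) (auto simp: Eb)
    show ?thesis
    proof (cases "x < \<tau> m")
      case True
      then show ?thesis
        using insert.IH[of x] insert.prems insert.hyps inj before[OF True] spike[of x] jumps[of "{j\<in>S. \<tau> j \<le> x}"] Eb[OF True] by simp
    next
      case False
      then have mx: "\<tau> m \<le> x" by simp
      let ?E = "E (insert m S)" and ?V = "V (insert m S)"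
      have si: "set_integrable lborel {\<tau> m..x} a" "set_integrable lborel {\<tau> m..x} b"
        using set_integrable_subset[OF ab(1), of "{\<tau> m..x}"] set_integrable_subset[OF ab(2), of "{\<tau> m..x}"]
          insert.prems sm by auto
      have ab': "a integrable_on {s..x}" "b integrable_on {s..x}"
        using set_borel_integral_eq_integral(1)[OF set_integrable_subset[OF ab(1), of "{s..x}"]]
          set_borel_integral_eq_integral(1)[OF set_integrable_subset[OF ab(2), of "{s..x}"]] insert.prems by auto
      have comb: "integral {s..y} f = integral {s..\<tau> m} f + integral {\<tau> m..y} f"
        if "f integrable_on {s..x}" "\<tau> m \<le> y" "y \<le> x" for f :: "real \<Rightarrow> real" and y
        using Henstock_Kurzweil_Integration.integral_combine[of s "\<tau> m" y f] that sm mx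
          integrable_subinterval_real[OF that(1), of s y] by auto
      have EV: "?E y = ?E (\<tau> m) * exp (integral {\<tau> m..y} a)" "?V y = ?V (\<tau> m) + integral {\<tau> m..y} b"
        if "\<tau> m \<le> y" "y \<le> x" for y
        using comb[OF ab'(1) that] comb[OF ab'(2) that] that
        unfolding E_def V_def after[OF that(1)] after[OF order_refl] by (auto simp: exp_add[symmetric])
      have meas: "set_borel_measurable lborel {s..t} (E J')" "set_borel_measurable lborel {s..t} (V J')"
         and bnd: "\<exists>C. \<forall>x\<in>{s..t}. \<bar>E J' x\<bar> \<le> C \<and> \<bar>V J' x\<bar> \<le> C" if "finite J'" for J'
      proof -
        have ai: "a integrable_on {s..t}" "b integrable_on {s..t}"
          using ab by (auto intro!: set_borel_integral_eq_integral)
        have "continuous_on {s..t} (\<lambda>x. integral {s..x} a)" "continuous_on {s..t} (\<lambda>x. integral {s..x} b)"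
          by (intro indefinite_integral_continuous_1 ai)+
        note c = this
        \<comment> \<open>As a finite sum of indicators of half-lines the jump sum is measurable in
          \<open>x\<close>.\<close>
        have s: "(\<Sum>j\<in>{j\<in>J'. \<tau> j \<le> x}. h j) = (\<Sum>j\<in>J'. h j * indicator {\<tau> j..} x)" for h :: "'i \<Rightarrow> real" and x
          by (subst sum.inter_filter[OF that]) (auto intro!: sum.cong simp: indicator_def)
        have m: "(\<lambda>x. indicator {s..t} x *\<^sub>R integral {s..x} a) \<in> borel_measurable lborel"
          "(\<lambda>x. indicator {s..t} x *\<^sub>R integral {s..x} b) \<in> borel_measurable lborel"
          using borel_measurable_continuous_on_indicator[OF _ c(1)] borel_measurable_continuous_on_indicator[OF _ c(2)]
          by auto
        have "(\<lambda>x. indicator {s..t} x *\<^sub>R exp (indicator {s..t} x *\<^sub>R integral {s..x} a + (\<Sum>j\<in>J'. \<alpha> j * indicator {\<tau> j..} x)))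
            \<in> borel_measurable lborel" using m by measurable
        also have "(\<lambda>x. indicator {s..t} x *\<^sub>R exp (indicator {s..t} x *\<^sub>R integral {s..x} a + (\<Sum>j\<in>J'. \<alpha> j * indicator {\<tau> j..} x)))
           = (\<lambda>x. indicator {s..t} x *\<^sub>R E J' x)" unfolding E_def s by (auto simp: indicator_def)
        finally show "set_borel_measurable lborel {s..t} (E J')" unfolding set_borel_measurable_def .
        have "(\<lambda>x. indicator {s..t} x *\<^sub>R (w + indicator {s..t} x *\<^sub>R integral {s..x} b + (\<Sum>j\<in>J'. \<beta> j * indicator {\<tau> j..} x)))
            \<in> borel_measurable lborel" using m by measurable
        also have "(\<lambda>x. indicator {s..t} x *\<^sub>R (w + indicator {s..t} x *\<^sub>R integral {s..x} b + (\<Sum>j\<in>J'. \<beta> j * indicator {\<tau> j..} x)))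
           = (\<lambda>x. indicator {s..t} x *\<^sub>R V J' x)" unfolding V_def s by (auto simp: indicator_def)
        finally show "set_borel_measurable lborel {s..t} (V J')" unfolding set_borel_measurable_def .
        obtain Ca Cb where C: "\<And>x. x \<in> {s..t} \<Longrightarrow> \<bar>integral {s..x} a\<bar> \<le> Ca" "\<And>x. x \<in> {s..t} \<Longrightarrow> \<bar>integral {s..x} b\<bar> \<le> Cb"
          using compact_imp_bounded[OF compact_continuous_image[OF c(1)]]
            compact_imp_bounded[OF compact_continuous_image[OF c(2)]]
          by (auto simp: bounded_iff) (metis atLeastAtMost_iff)
        have sb: "\<bar>\<Sum>j\<in>{j\<in>J'. \<tau> j \<le> x}. h j\<bar> \<le> (\<Sum>j\<in>J'. \<bar>h j\<bar>)" for h :: "'i \<Rightarrow> real" and x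
          using that by (intro order_trans[OF sum_abs] sum_mono2) auto
        have "\<bar>E J' x\<bar> \<le> max (exp (Ca + (\<Sum>j\<in>J'. \<bar>\<alpha> j\<bar>))) (\<bar>w\<bar> + Cb + (\<Sum>j\<in>J'. \<bar>\<beta> j\<bar>)) \<and>
             \<bar>V J' x\<bar> \<le> max (exp (Ca + (\<Sum>j\<in>J'. \<bar>\<alpha> j\<bar>))) (\<bar>w\<bar> + Cb + (\<Sum>j\<in>J'. \<bar>\<beta> j\<bar>))" if "x \<in> {s..t}" for x
          using C[OF that] sb[of \<alpha> x] sb[of \<beta> x] unfolding E_def V_def by (auto simp: le_max_iff_disj)
        then show "\<exists>C. \<forall>x\<in>{s..t}. \<bar>E J' x\<bar> \<le> C \<and> \<bar>V J' x\<bar> \<le> C" by blast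
      qed
      have fin: "finite (insert m S)" using insert by auto
      have EVi: "(\<lambda>v. ?E v * (?V v * a v + b v)) integrable_on {s..x}"
      proof -
        obtain C where C: "\<And>x. x \<in> {s..t} \<Longrightarrow> \<bar>?E x\<bar> \<le> C" "\<And>x. x \<in> {s..t} \<Longrightarrow> \<bar>?V x\<bar> \<le> C"
          using bnd[OF fin] by metis
        have "set_integrable lborel {s..t} (\<lambda>v. ?E v * (?V v * a v + b v))"
          by (rule set_integrable_mult_bounded[OF
                set_integral_add(1)[OF set_integrable_mult_bounded[OF ab(1) meas(2)[OF fin] C(2)] ab(2)]
                meas(1)[OF fin] C(1)])
        then have "(\<lambda>v. ?E v * (?V v * a v + b v)) integrable_on {s..t}"
          by (rule set_borel_integral_eq_integral)
        then show ?thesis using insert.prems by (auto intro: integrable_subinterval_real)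
      qed
      have Vm: "?E (\<tau> m) = E S (\<tau> m) * exp (\<alpha> m)" "?V (\<tau> m) = V S (\<tau> m) + \<beta> m"
      proof -
        have "{j\<in>S. \<tau> j \<le> \<tau> m} = S" "m \<notin> S" using less by force+
        then show "?E (\<tau> m) = E S (\<tau> m) * exp (\<alpha> m)" "?V (\<tau> m) = V S (\<tau> m) + \<beta> m"
          using after[of "\<tau> m"] \<open>finite S\<close> unfolding E_def V_def by (auto simp: exp_add)
      qed
      have "?E x * ?V x = ?E (\<tau> m) * (exp (integral {\<tau> m..x} a) * (?V (\<tau> m) + integral {\<tau> m..x} b))"
        using EV[OF mx order_refl] by simp
      also have "\<dots> = ?E (\<tau> m) * ?V (\<tau> m)
         + ?E (\<tau> m) * integral {\<tau> m..x} (\<lambda>v. exp (integral {\<tau> m..v} a) * ((?V (\<tau> m) + integral {\<tau> m..v} b) * a v + b v))"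
        by (subst exp_product_formula[OF mx si]) (simp add: algebra_simps)
      also have "?E (\<tau> m) * integral {\<tau> m..x} (\<lambda>v. exp (integral {\<tau> m..v} a) * ((?V (\<tau> m) + integral {\<tau> m..v} b) * a v + b v))
         = integral {\<tau> m..x} (\<lambda>v. ?E v * (?V v * a v + b v))"
      proof (subst integral_mult_right[symmetric], rule integral_cong)
        fix v assume "v \<in> {\<tau> m..x}"
        then have v: "\<tau> m \<le> v" "v \<le> x" by auto
        show "?E (\<tau> m) * (exp (integral {\<tau> m..v} a) * ((?V (\<tau> m) + integral {\<tau> m..v} b) * a v + b v))
          = ?E v * (?V v * a v + b v)"
          unfolding EV(1)[OF v] EV(2)[OF v] by (simp only: mult.assoc)
      qed
      finally have 1: "?E x * ?V x = ?E (\<tau> m) * ?V (\<tau> m) + integral {\<tau> m..x} (\<lambda>v. ?E v * (?V v * a v + b v))" .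
      have "?E (\<tau> m) * ?V (\<tau> m) = ?E (\<tau> m) * (?V (\<tau> m) - exp (- \<alpha> m) * (?V (\<tau> m) - \<beta> m)) + E S (\<tau> m) * V S (\<tau> m)"
        unfolding Vm by (simp add: algebra_simps exp_minus)
      also have "E S (\<tau> m) * V S (\<tau> m) = w
        + (\<Sum>j\<in>S. ?E (\<tau> j) * (?V (\<tau> j) - exp (- \<alpha> j) * (?V (\<tau> j) - \<beta> j)))
        + integral {s..\<tau> m} (\<lambda>v. ?E v * (?V v * a v + b v))"
      proof -
        have "{j\<in>S. \<tau> j \<le> \<tau> m} = S" using less by force
        then show ?thesis using insert.IH[of "\<tau> m"] insert.prems insert.hyps inj sm mx spike[of "\<tau> m"] jumps[of S] by auto
      qed
      finally have 2: "?E (\<tau> m) * ?V (\<tau> m) = w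
        + (\<Sum>j\<in>insert m S. ?E (\<tau> j) * (?V (\<tau> j) - exp (- \<alpha> j) * (?V (\<tau> j) - \<beta> j)))
        + integral {s..\<tau> m} (\<lambda>v. ?E v * (?V v * a v + b v))"
        using m \<open>finite S\<close> by (subst sum.insert) auto
      show ?thesis unfolding 1 2 after[OF mx] comb[OF EVi mx order_refl] by simp
    qed
  qed
qed

section \<open>Predictable processes\<close>

text \<open>An increasing family of sub-sigma-algebras without the usual hypotheses, so as to cover
  both \<open>G\<close> and the raw filtration generated by the claims.\<close>

locale subalgebra_family =
  fixes M :: "'a measure" and F :: "real \<Rightarrow> 'a measure"
  assumes subalg: "\<And>t. 0 \<le> t \<Longrightarrow> subalgebra M (F t)"
    and sets_mono: "\<And>s t. 0 \<le> s \<Longrightarrow> s \<le> t \<Longrightarrow> sets (F s) \<subseteq> sets (F t)"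
begin

lemma space_F: "0 \<le> t \<Longrightarrow> space (F t) = space M"
  using subalg[of t] by (simp add: subalgebra_def)

lemma sets_F: "0 \<le> t \<Longrightarrow> A \<in> sets (F t) \<Longrightarrow> A \<in> sets M"
  using subalg[of t] by (auto simp: subalgebra_def)

lemma measurable_F: "0 \<le> s \<Longrightarrow> s \<le> t \<Longrightarrow> f \<in> measurable (F s) N \<Longrightarrow> f \<in> measurable (F t) N"
  using sets_mono[of s t] space_F[of s] space_F[of t] by (auto simp: measurable_def)

lemma measurable_F': "0 \<le> s \<Longrightarrow> f \<in> measurable (F s) N \<Longrightarrow> f \<in> measurable M N"
  using subalg[of s] by (auto simp: measurable_def subalgebra_def)

lemma space_predictable: "space (predictable_sigma I F) = I \<times> space M"
  unfolding predictable_sigma_def by (simp add: space_F space_measure_of_conv)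

lemma predictable_generator:
  "{{0} \<times> A |A. A \<in> sets (F 0)} \<union> {{s<..t} \<times> A |s t A. 0 \<le> s \<and> {s<..t} \<subseteq> I \<and> A \<in> sets (F s)}
    \<subseteq> Pow (I \<times> space (F 0))" if "0 \<in> I"
  using that sets.sets_into_space by (fastforce simp: space_F)

lemma predictable_rect0: "0 \<in> I \<Longrightarrow> A \<in> sets (F 0) \<Longrightarrow> {0} \<times> A \<in> sets (predictable_sigma I F)"
  unfolding predictable_sigma_def by (subst sets_measure_of[OF predictable_generator]) auto

lemma predictable_rect:
  "0 \<in> I \<Longrightarrow> 0 \<le> s \<Longrightarrow> {s<..t} \<subseteq> I \<Longrightarrow> A \<in> sets (F s) \<Longrightarrow> {s<..t} \<times> A \<in> sets (predictable_sigma I F)"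
  unfolding predictable_sigma_def by (subst sets_measure_of[OF predictable_generator]) auto

lemma measurable_predictableI:
  assumes I: "0 \<in> I" and f: "f \<in> space N \<rightarrow> I \<times> space M"
    and "\<And>A. A \<in> sets (F 0) \<Longrightarrow> f -` ({0} \<times> A) \<inter> space N \<in> sets N"
    and "\<And>s t A. 0 \<le> s \<Longrightarrow> {s<..t} \<subseteq> I \<Longrightarrow> A \<in> sets (F s) \<Longrightarrow> f -` ({s<..t} \<times> A) \<inter> space N \<in> sets N"
  shows "f \<in> measurable N (predictable_sigma I F)"
  unfolding predictable_sigma_def
  by (rule measurable_measure_of[OF predictable_generator[OF I]]) (use assms in \<open>auto simp: space_F\<close>)

text \<open>Predictable processes are progressively measurable: a generating rectangle cut off at
  \<open>t\<close> is empty unless its left end is at most \<open>t\<close>, and then its scenario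
  part is known by \<open>t\<close>. The measure \<open>N\<close> is left free so that both
  \<open>F t\<close> and \<open>M\<close> can be used.\<close>

lemma measurable_progressive:
  assumes t: "0 \<le> t" "t \<le> T" and N: "space N = space M" "\<And>s. 0 \<le> s \<Longrightarrow> s \<le> t \<Longrightarrow> sets (F s) \<subseteq> sets N"
  shows "(\<lambda>x. x) \<in> measurable (restrict_space borel {0..t} \<Otimes>\<^sub>M N) (predictable_sigma {0..T} F)"
proof (rule measurable_predictableI)
  have rect: "(A \<inter> {0..t}) \<times> B \<in> sets (restrict_space borel {0..t} \<Otimes>\<^sub>M N)"
    if "A \<in> sets borel" "B \<in> sets N" for A :: "real set" and B
    using that by (intro pair_measureI) (auto simp: sets_restrict_space)
  { fix A assume A: "A \<in> sets (F 0)"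
    then have "A \<subseteq> space M" using sets.sets_into_space space_F[of 0] by fastforce
    then have "(\<lambda>x. x) -` ({0} \<times> A) \<inter> space (restrict_space borel {0..t} \<Otimes>\<^sub>M N) = ({0} \<inter> {0..t}) \<times> A"
      using t N by (auto simp: space_pair_measure space_restrict_space)
    then show "(\<lambda>x. x) -` ({0} \<times> A) \<inter> space (restrict_space borel {0..t} \<Otimes>\<^sub>M N) \<in> sets (restrict_space borel {0..t} \<Otimes>\<^sub>M N)"
      using rect[of "{0}" A] A N(2)[of 0] t by auto }
  { fix a b A assume A: "0 \<le> a" "{a<..b} \<subseteq> {0..T}" "A \<in> sets (F a)"
    then have "A \<subseteq> space M" using sets.sets_into_space space_F[of a] by fastforce
    then have *: "(\<lambda>x. x) -` ({a<..b} \<times> A) \<inter> space (restrict_space borel {0..t} \<Otimes>\<^sub>M N) = ({a<..b} \<inter> {0..t}) \<times> A"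
      using t N by (auto simp: space_pair_measure space_restrict_space)
    show "(\<lambda>x. x) -` ({a<..b} \<times> A) \<inter> space (restrict_space borel {0..t} \<Otimes>\<^sub>M N) \<in> sets (restrict_space borel {0..t} \<Otimes>\<^sub>M N)"
    proof (cases "a \<le> t")
      case True
      then show ?thesis unfolding * using A N(2)[of a] by (intro rect) auto
    next
      case False
      then have "{a<..b} \<inter> {0..t} = {}" by auto
      then show ?thesis unfolding * by simp
    qed }
qed (use t N in \<open>auto simp: space_pair_measure space_restrict_space\<close>)

lemma measurable_time_scenario:
  assumes "f \<in> measurable (predictable_sigma {0..T} F) N" "0 \<le> T"
  shows "f \<in> measurable (time_scenario T M) N"
proof -
  have "f \<in> measurable (restrict_space borel {0..T} \<Otimes>\<^sub>M M) N"
    using measurable_compose[OF measurable_progressive[of T T M] assms(1)] assms(2) subalg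
    by (auto simp: subalgebra_def)
  moreover have "sets (restrict_space borel {0..T} \<Otimes>\<^sub>M M) = sets (time_scenario T M)"
    unfolding time_scenario_def by (intro sets_pair_measure_cong sets_restrict_space_cong) auto
  ultimately show ?thesis by (simp cong: measurable_cong_sets)
qed

lemma predictable_section:
  assumes "f \<in> measurable (predictable_sigma {0..T} F) N" "0 \<le> t" "t \<le> T"
  shows "(\<lambda>\<omega>. f (t, \<omega>)) \<in> measurable (F t) N"
proof -
  have "f \<in> measurable (restrict_space borel {0..t} \<Otimes>\<^sub>M F t) N"
    using measurable_compose[OF measurable_progressive[of t T "F t"] assms(1)] assms(2,3) sets_mono space_F by auto
  from measurable_compose[OF _ this, of "\<lambda>\<omega>. (t, \<omega>)" "F t"] show ?thesis
    using assms(2) by (simp add: measurable_Pair1' space_restrict_space)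
qed

lemma predictable_path:
  assumes "f \<in> measurable (predictable_sigma {0..T} F) N" "0 \<le> T" "\<omega> \<in> space M"
  shows "(\<lambda>t. f (t, \<omega>)) \<in> measurable (restrict_space borel {0..T}) N"
proof -
  have "f \<in> measurable (restrict_space borel {0..T} \<Otimes>\<^sub>M M) N"
    using measurable_compose[OF measurable_progressive[of T T M] assms(1)] assms(2) subalg
    by (auto simp: subalgebra_def)
  from measurable_compose[OF _ this, of "\<lambda>t. (t, \<omega>)" "restrict_space borel {0..T}"] show ?thesis
    using assms(3) by simp
qed

lemma predictable_field_path:
  assumes "f \<in> measurable (field_sigma {0..T} F) N" "0 \<le> T" "\<omega> \<in> space M"
  shows "(\<lambda>(t, z). f ((t, \<omega>), z)) \<in> measurable (restrict_space borel {0..T} \<Otimes>\<^sub>M restrict_space borel {0<..}) N"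
proof -
  have "(\<lambda>t. (t, \<omega>)) \<in> measurable (restrict_space borel {0..T}) (predictable_sigma {0..T} F)"
    using measurable_compose[OF _ measurable_progressive[of T T M], of "\<lambda>t. (t, \<omega>)" "restrict_space borel {0..T}"] assms(2,3) subalg
    by (auto simp: subalgebra_def)
  then have "(\<lambda>(t, z). ((t, \<omega>), z)) \<in> measurable (restrict_space borel {0..T} \<Otimes>\<^sub>M restrict_space borel {0<..}) (field_sigma {0..T} F)"
    unfolding field_sigma_def split_beta by measurable
  from measurable_compose[OF this assms(1)] show ?thesis by (simp add: split_beta)
qed

text \<open>Progressive measurability makes the integrand jointly measurable with respect to
  \<open>F t\<close>, and Fubini integrates time out.\<close>

lemma predictable_integral:
  assumes f: "f \<in> borel_measurable (predictable_sigma {0..T} F)" and t: "0 \<le> t" "t \<le> T"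
  shows "(\<lambda>\<omega>. LINT s:{0..t}|lborel. f (s, \<omega>) :: real) \<in> borel_measurable (F t)"
proof -
  interpret L: finite_measure "restrict_space lborel {0..t}"
    by (rule finite_measureI) (simp add: emeasure_restrict_space space_restrict_space t)
  have "f \<in> borel_measurable (restrict_space borel {0..t} \<Otimes>\<^sub>M F t)"
    using measurable_compose[OF measurable_progressive[of t T "F t"] f] t sets_mono space_F by auto
  moreover have "sets (restrict_space borel {0..t} \<Otimes>\<^sub>M F t) = sets (restrict_space lborel {0..t} \<Otimes>\<^sub>M F t)"
    by (intro sets_pair_measure_cong sets_restrict_space_cong) auto
  ultimately have "f \<in> borel_measurable (restrict_space lborel {0..t} \<Otimes>\<^sub>M F t)"
    by (simp cong: measurable_cong_sets)
  then have "(\<lambda>(\<omega>, s). f (s, \<omega>)) \<in> borel_measurable (F t \<Otimes>\<^sub>M restrict_space lborel {0..t})"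
    by (subst measurable_split_conv) (auto intro: measurable_compose[OF measurable_pair_swap'])
  then have "(\<lambda>\<omega>. \<integral>s. f (s, \<omega>) \<partial>restrict_space lborel {0..t}) \<in> borel_measurable (F t)"
    by (rule L.borel_measurable_lebesgue_integral)
  then show ?thesis
    by (simp add: integral_restrict_space set_lebesgue_integral_def)
qed

section \<open>Predictable sets and processes built from adapted data\<close>

lemma predictable_time: "(\<lambda>x. fst x) \<in> borel_measurable (predictable_sigma {0..T} F)" if "0 \<le> T" for T :: real
proof (rule borel_measurable_iff_greater[THEN iffD2], rule allI)
  fix a :: real
  have "{w \<in> space (predictable_sigma {0..T} F). a < fst w} =
      {max a 0<..T} \<times> space M \<union> (if a < 0 then {0} \<times> space M else {})"
    using that unfolding space_predictable by (auto simp: max_def split: if_splits)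
  moreover have "{max a 0<..T} \<times> space M \<in> sets (predictable_sigma {0..T} F)"
    using that sets.top[of "F (max a 0)"] space_F by (intro predictable_rect) auto
  moreover have "{0} \<times> space M \<in> sets (predictable_sigma {0..T} F)"
    using that sets.top[of "F 0"] space_F by (intro predictable_rect0) auto
  ultimately show "{w \<in> space (predictable_sigma {0..T} F). a < fst w} \<in> sets (predictable_sigma {0..T} F)"
    by auto
qed

text \<open>The complement is a countable union of rectangles \<open>{q<..T}\<close> times the event
  that \<open>P q\<close> fails, an event known at \<open>q\<close>. Such sets serve as stochastic
  intervals without stopping times.\<close>

lemma predictable_until:
  assumes "0 \<le> T" and P: "\<And>q. 0 \<le> q \<Longrightarrow> q \<le> T \<Longrightarrow> {\<omega>\<in>space M. P q \<omega>} \<in> sets (F q)"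
  shows "{x\<in>space (predictable_sigma {0..T} F). \<forall>q\<in>\<rat> \<inter> {0..T}. q < fst x \<longrightarrow> P q (snd x)}
    \<in> sets (predictable_sigma {0..T} F)"
proof -
  let ?S = "predictable_sigma {0..T} F"
  have "countable (\<rat> \<inter> {0..T})" using countable_rat by (rule countable_subset[rotated]) auto
  moreover have "{q<..T} \<times> (space M - {\<omega>\<in>space M. P q \<omega>}) \<in> sets ?S" if "q \<in> \<rat> \<inter> {0..T}" for q
    using that assms(1) P[of q] sets.compl_sets[of _ "F q"] space_F[of q]
    by (intro predictable_rect) auto
  ultimately have "(\<Union>q\<in>\<rat> \<inter> {0..T}. {q<..T} \<times> (space M - {\<omega>\<in>space M. P q \<omega>})) \<in> sets ?S"
    by (intro sets.countable_UN') auto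
  then have "space ?S - (\<Union>q\<in>\<rat> \<inter> {0..T}. {q<..T} \<times> (space M - {\<omega>\<in>space M. P q \<omega>})) \<in> sets ?S"
    by auto
  also have "space ?S - (\<Union>q\<in>\<rat> \<inter> {0..T}. {q<..T} \<times> (space M - {\<omega>\<in>space M. P q \<omega>})) =
    {x\<in>space ?S. \<forall>q\<in>\<rat> \<inter> {0..T}. q < fst x \<longrightarrow> P q (snd x)}"
    unfolding space_predictable by force
  finally show ?thesis .
qed

lemma measurable_restrict_predictable:
  assumes "0 \<le> T" "0 \<le> c" "c \<le> T" "d \<le> T" "Z \<in> measurable (F c) N"
  shows "(\<lambda>x. Z (snd x)) \<in> measurable (restrict_space (predictable_sigma {0..T} F) ({c<..d} \<times> space M)) N"
proof (rule measurableI)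
  fix A assume A: "A \<in> sets N"
  let ?R = "restrict_space (predictable_sigma {0..T} F) ({c<..d} \<times> space M)"
  have "(\<lambda>x. Z (snd x)) -` A \<inter> space ?R = {c<..d} \<times> (Z -` A \<inter> space (F c)) \<inter> ({c<..d} \<times> space M)"
    using assms space_F[of c] by (auto simp: space_restrict_space space_predictable)
  also have "\<dots> \<in> sets ?R"
    using assms measurable_sets[OF assms(5) A] sets.top[of "F c"] space_F[of c]
    by (subst sets_restrict_space_iff) (auto intro!: predictable_rect sets.Int)
  finally show "(\<lambda>x. Z (snd x)) -` A \<inter> space ?R \<in> sets ?R" .
qed (use assms space_F[of c] in \<open>auto simp: space_restrict_space space_predictable dest: measurable_space\<close>)

lemma measurable_restrict_predictable0:
  assumes "0 \<le> T" "Z \<in> measurable (F 0) N"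
  shows "(\<lambda>x. Z (snd x)) \<in> measurable (restrict_space (predictable_sigma {0..T} F) ({0} \<times> space M)) N"
proof (rule measurableI)
  fix A assume A: "A \<in> sets N"
  let ?R = "restrict_space (predictable_sigma {0..T} F) ({0} \<times> space M)"
  have "(\<lambda>x. Z (snd x)) -` A \<inter> space ?R = {0} \<times> (Z -` A \<inter> space (F 0)) \<inter> ({0} \<times> space M)"
    using assms space_F[of 0] by (auto simp: space_restrict_space space_predictable)
  also have "\<dots> \<in> sets ?R"
    using assms measurable_sets[OF assms(2) A] sets.top[of "F 0"] space_F[of 0]
    by (subst sets_restrict_space_iff) (auto intro!: predictable_rect0 sets.Int)
  finally show "(\<lambda>x. Z (snd x)) -` A \<inter> space ?R \<in> sets ?R" .
qed (use assms space_F[of 0] in \<open>auto simp: space_restrict_space space_predictable dest: measurable_space\<close>)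

text \<open>On each strip between consecutive grid points the sampling time is the left end of the
  strip, so the process equals there a variable known at that left end. Time \<open>0\<close> forms
  a strip of its own.\<close>

lemma predictable_dyadic:
  fixes Y :: "real \<Rightarrow> 'a \<Rightarrow> real"
  assumes T: "0 \<le> T" and Y: "\<And>t. t \<in> {0..T} \<Longrightarrow> Y t \<in> borel_measurable (F t)"
  shows "(\<lambda>(t, \<omega>). if t \<le> 0 then Y 0 \<omega> else Y (dyadic_below n t) \<omega>) \<in> borel_measurable (predictable_sigma {0..T} F)"
proof (rule measurable_piecewise_restrict)
  define c d where "c k = (max 0 ((of_int k - 1) / 2 ^ n) :: real)" and "d k = min T (of_int k / 2 ^ n)" for k :: int
  let ?C = "insert ({0} \<times> space M) ((\<lambda>k. {c k<..d k} \<times> space M) ` {k. c k \<le> T})"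
  let ?S = "predictable_sigma {0..T} F"
  show "countable ?C" by auto
  have c0: "0 \<le> c k" for k by (simp add: c_def)
  have dT: "d k \<le> T" for k by (simp add: d_def)
  have dyc: "dyadic_below n t = c k" if "t \<in> {c k<..d k}" for t k
  proof -
    have "(of_int k - 1) / 2 ^ n < t" "t \<le> of_int k / 2 ^ n" using that by (auto simp: c_def d_def)
    then have "\<lceil>t * 2 ^ n\<rceil> = k" by (intro ceiling_unique) (auto simp: field_simps)
    then show ?thesis by (simp add: dyadic_below_def c_def)
  qed
  show "A \<inter> space ?S \<in> sets ?S" if "A \<in> ?C" for A
  proof -
    have "{0} \<times> space M \<in> sets ?S" using T sets.top[of "F 0"] space_F by (intro predictable_rect0) auto
    moreover have "{c k<..d k} \<times> space M \<in> sets ?S" for k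
      using T sets.top[of "F (c k)"] space_F[OF c0] c0[of k] dT[of k] by (intro predictable_rect) auto
    ultimately show ?thesis using that by auto
  qed
  show "space ?S \<subseteq> \<Union>?C"
  proof
    fix x assume x: "x \<in> space ?S"
    then obtain t \<omega> where x': "x = (t, \<omega>)" "0 \<le> t" "t \<le> T" "\<omega> \<in> space M" unfolding space_predictable by auto
    show "x \<in> \<Union>?C"
    proof (cases "t = 0")
      case False
      define k where "k = \<lceil>t * 2 ^ n\<rceil>"
      have "of_int k - 1 < t * 2 ^ n" "t * 2 ^ n \<le> of_int k" unfolding k_def by linarith+
      then have "t \<in> {c k<..d k}" using False x'(2,3) by (auto simp: c_def d_def field_simps)
      then show ?thesis using x' dT[of k] by (auto intro!: bexI[of _ k])
    qed (use x' in auto)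
  qed
  fix A assume "A \<in> ?C"
  then consider "A = {0} \<times> space M" | k where "A = {c k<..d k} \<times> space M" "c k \<le> T" by auto
  then show "(\<lambda>(t, \<omega>). if t \<le> 0 then Y 0 \<omega> else Y (dyadic_below n t) \<omega>) \<in> borel_measurable (restrict_space ?S A)"
  proof cases
    case 1
    have "(\<lambda>x. Y 0 (snd x)) \<in> borel_measurable (restrict_space ?S A)"
      unfolding 1 using T Y by (intro measurable_restrict_predictable0) auto
    then show ?thesis
      by (subst measurable_cong[where g="\<lambda>x. Y 0 (snd x)"]) (auto simp: 1 space_restrict_space)
  next
    case 2
    have "(\<lambda>x. Y (c k) (snd x)) \<in> borel_measurable (restrict_space ?S A)"
      unfolding 2 using T Y[of "c k"] c0[of k] dT[of k] 2(2) by (intro measurable_restrict_predictable) auto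
    then show ?thesis
      using c0[of k] dyc[of _ k] by (subst measurable_cong[where g="\<lambda>x. Y (c k) (snd x)"]) (auto simp: 2 space_restrict_space)
  qed
qed

text \<open>Left limits are pointwise limits of the dyadic samples, which are predictable for any
  adapted process.\<close>

lemma predictable_left_lim:
  assumes T: "0 \<le> T" and Y: "\<And>t. t \<in> {0..T} \<Longrightarrow> Y t \<in> borel_measurable (F t)"
    and cadlag: "\<And>\<omega>. \<omega> \<in> space M \<Longrightarrow> cadlag_on T (\<lambda>t. Y t \<omega>)"
  shows "(\<lambda>(t, \<omega>). left_lim (\<lambda>s. Y s \<omega>) t) \<in> borel_measurable (predictable_sigma {0..T} F)"
proof (rule borel_measurable_LIMSEQ_real[OF _ predictable_dyadic[OF T Y]])
  fix x assume "x \<in> space (predictable_sigma {0..T} F)"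
  then obtain t \<omega> where x: "x = (t, \<omega>)" "0 \<le> t" "t \<le> T" "\<omega> \<in> space M" unfolding space_predictable by auto
  show "(\<lambda>n. case x of (t, \<omega>) \<Rightarrow> if t \<le> 0 then Y 0 \<omega> else Y (dyadic_below n t) \<omega>)
      \<longlonglongrightarrow> (case x of (t, \<omega>) \<Rightarrow> left_lim (\<lambda>s. Y s \<omega>) t)"
    using left_lim_dyadic[OF cadlag[OF x(4)], of t] x by (cases "t = 0") (auto simp: left_lim_def)
qed auto

end

section \<open>Transfer from a smaller filtration on a bounded interval to a larger one on the
  half-line\<close>

lemma measurable_predictable_extend:
  assumes H: "subalgebra_family M H" and G: "subalgebra_family M G"
    and HG: "\<And>t. 0 \<le> t \<Longrightarrow> sets (H t) \<subseteq> sets (G t)" and T: "0 \<le> T"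
  shows "(\<lambda>x. x) \<in> measurable (restrict_space (predictable_sigma {0..} G) ({0..T} \<times> space M)) (predictable_sigma {0..T} H)"
proof -
  interpret H: subalgebra_family M H by fact
  interpret G: subalgebra_family M G by fact
  let ?R = "restrict_space (predictable_sigma {0..} G) ({0..T} \<times> space M)"
  have R: "A \<in> sets (predictable_sigma {0..} G) \<Longrightarrow> (\<lambda>x. x) -` A \<inter> space ?R \<in> sets ?R" for A
  proof -
    assume A: "A \<in> sets (predictable_sigma {0..} G)"
    then have "(\<lambda>x. x) -` A \<inter> space ?R = ({0..T} \<times> space M) \<inter> A"
      using sets.sets_into_space[OF A] by (auto simp: space_restrict_space)
    then show ?thesis using A unfolding sets_restrict_space by blast
  qed
  show ?thesis
  proof (rule H.measurable_predictableI)
    fix A assume "A \<in> sets (H 0)"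
    then show "(\<lambda>x. x) -` ({0} \<times> A) \<inter> space ?R \<in> sets ?R"
      using HG[of 0] by (intro R G.predictable_rect0) auto
  next
    fix s t A assume "0 \<le> s" "{s<..t} \<subseteq> {0..T}" "A \<in> sets (H s)"
    then show "(\<lambda>x. x) -` ({s<..t} \<times> A) \<inter> space ?R \<in> sets ?R"
      using HG[of s] by (intro R G.predictable_rect) auto
  qed (use T in \<open>auto simp: space_restrict_space\<close>)
qed

text \<open>The compensator identity is formulated for fields of the large filtration on the whole
  half-line; extension by zero after \<open>T\<close> brings fields of the small filtration under
  it.\<close>

lemma measurable_field_extend:
  fixes K :: "(real \<times> 'a) \<times> real \<Rightarrow> ennreal"
  assumes H: "subalgebra_family M H" and G: "subalgebra_family M G"
    and HG: "\<And>t. 0 \<le> t \<Longrightarrow> sets (H t) \<subseteq> sets (G t)" and T: "0 \<le> T"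
    and K: "K \<in> borel_measurable (field_sigma {0..T} H)"
  shows "(\<lambda>x. if fst (fst x) \<le> T then K x else 0) \<in> borel_measurable (field_sigma {0..} G)"
proof -
  interpret H: subalgebra_family M H by fact
  interpret G: subalgebra_family M G by fact
  let ?P = "predictable_sigma {0..} G"
  have "{0..T} \<times> space M = {0} \<times> space M \<union> {0<..T} \<times> space M" using T by auto
  also have "\<dots> \<in> sets ?P"
    using sets.top[of "G 0"] G.space_F[of 0] by (intro sets.Un G.predictable_rect0 G.predictable_rect) auto
  finally have S: "{0..T} \<times> space M \<in> sets ?P" .
  have sp: "{x \<in> space (field_sigma {0..} G). fst (fst x) \<le> T} = ({0..T} \<times> space M) \<times> {0<..}"
    by (auto simp: field_sigma_def space_pair_measure G.space_predictable space_restrict_space)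
  have S': "{x \<in> space (field_sigma {0..} G). fst (fst x) \<le> T} \<in> sets (field_sigma {0..} G)"
    unfolding sp unfolding field_sigma_def using S by (intro pair_measureI) (auto simp: sets_restrict_space)
  let ?R = "restrict_space (field_sigma {0..} G) {x. fst (fst x) \<le> T}"
  have "fst \<in> measurable ?R (restrict_space ?P ({0..T} \<times> space M))"
  proof (rule measurable_restrict_space2)
    show "fst \<in> space ?R \<rightarrow> {0..T} \<times> space M"
      by (auto simp: space_restrict_space field_sigma_def space_pair_measure G.space_predictable)
    show "fst \<in> measurable ?R ?P"
      by (rule measurable_restrict_space1) (simp add: field_sigma_def)
  qed
  from measurable_compose[OF this measurable_predictable_extend[OF H G HG T]]
  have "fst \<in> measurable ?R (predictable_sigma {0..T} H)" by simp
  moreover have "snd \<in> measurable ?R (restrict_space borel {0<..})"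
    by (rule measurable_restrict_space1) (simp add: field_sigma_def)
  ultimately have "(\<lambda>x. (fst x, snd x)) \<in> measurable ?R (field_sigma {0..T} H)"
    unfolding field_sigma_def by (rule measurable_Pair)
  from measurable_compose[OF this K] have "K \<in> borel_measurable ?R" by simp
  then show ?thesis using S' by (subst measurable_If_restrict_space_iff) auto
qed

section \<open>Marked point processes\<close>

lemma measurable_pair_restrict:
  fixes f :: "real \<Rightarrow> real \<Rightarrow> 'b"
  assumes f: "(\<lambda>(t, z). f t z) \<in> measurable (restrict_space borel A \<Otimes>\<^sub>M restrict_space borel B) N"
    and A': "A' \<subseteq> A"
  shows "(\<lambda>x. f (fst x) (snd x)) \<in> measurable (restrict_space borel (A' \<times> B)) N"
proof -
  let ?R = "restrict_space (borel :: (real \<times> real) measure) (A' \<times> B)"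
  have "fst \<in> borel_measurable (borel :: (real \<times> real) measure)" "snd \<in> borel_measurable (borel :: (real \<times> real) measure)"
    using measurable_fst[of "borel :: real measure" "borel :: real measure"]
      measurable_snd[of "borel :: real measure" "borel :: real measure"] unfolding borel_prod by auto
  then have "fst \<in> measurable ?R (restrict_space borel A)" "snd \<in> measurable ?R (restrict_space borel B)"
    using A' by (intro measurable_restrict_space2 measurable_restrict_space1; force simp: space_restrict_space)+
  then have "(\<lambda>x. (fst x, snd x)) \<in> measurable ?R (restrict_space borel A \<Otimes>\<^sub>M restrict_space borel B)"
    by (rule measurable_Pair)
  from measurable_compose[OF this f] show ?thesis by (simp add: split_beta)
qed

lemma borel_Times: "A \<in> sets borel \<Longrightarrow> B \<in> sets borel \<Longrightarrow> (A \<times> B :: (real \<times> real) set) \<in> sets borel"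
  using pair_measureI[of A borel B borel] unfolding borel_prod .

lemma measurable_pair_restrict_indicator:
  fixes f :: "real \<Rightarrow> real \<Rightarrow> real"
  assumes "(\<lambda>(t, z). f t z) \<in> borel_measurable (restrict_space borel A \<Otimes>\<^sub>M restrict_space borel B)"
    and "B \<in> sets borel" and "A' \<subseteq> A" "A' \<in> sets borel"
  shows "(\<lambda>x. indicator (A' \<times> B) x *\<^sub>R f (fst x) (snd x)) \<in> borel_measurable borel"
  using measurable_pair_restrict[OF assms(1,3)] borel_Times[OF assms(4,2)]
  by (subst (asm) borel_measurable_restrict_space_iff) auto

lemma measurable_pair_restrict_indicator_ennreal:
  fixes f :: "real \<Rightarrow> real \<Rightarrow> ennreal"
  assumes "(\<lambda>(t, z). f t z) \<in> borel_measurable (restrict_space borel A \<Otimes>\<^sub>M restrict_space borel B)"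
    and "B \<in> sets borel" and "A' \<subseteq> A" "A' \<in> sets borel"
  shows "(\<lambda>x. indicator (A' \<times> B) x * f (fst x) (snd x)) \<in> borel_measurable borel"
  using measurable_pair_restrict[OF assms(1,3)] borel_Times[OF assms(4,2)]
  by (subst (asm) borel_measurable_restrict_space_iff_ennreal) (auto simp: mult.commute)

lemma jump_timesD:
  assumes "jump_times M \<tau>" "\<omega> \<in> space M"
  shows "0 < \<tau> n \<omega>" "incseq (\<lambda>n. \<tau> n \<omega>)" "\<tau> n \<omega> < \<infinity> \<Longrightarrow> n < m \<Longrightarrow> \<tau> n \<omega> < \<tau> m \<omega>"
    "finite {n. \<tau> n \<omega> \<le> ereal t}"
proof -
  show "0 < \<tau> n \<omega>" "finite {n. \<tau> n \<omega> \<le> ereal t}" using assms unfolding jump_times_def by auto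
  show inc: "incseq (\<lambda>n. \<tau> n \<omega>)" using assms unfolding jump_times_def by (intro incseq_SucI) auto
  show "\<tau> n \<omega> < \<tau> m \<omega>" if "\<tau> n \<omega> < \<infinity>" "n < m"
  proof -
    have "\<tau> n \<omega> < \<tau> (Suc n) \<omega>" using assms that unfolding jump_times_def by auto
    also have "\<dots> \<le> \<tau> m \<omega>" using incseqD[OF inc, of "Suc n" m] that by auto
    finally show ?thesis .
  qed
qed

lemma jump_time_real:
  assumes "jump_times M \<tau>" "\<omega> \<in> space M" "\<tau> n \<omega> \<le> ereal t"
  shows "ereal (real_of_ereal (\<tau> n \<omega>)) = \<tau> n \<omega>" "0 < real_of_ereal (\<tau> n \<omega>)" "real_of_ereal (\<tau> n \<omega>) \<le> t"
  using jump_timesD(1)[OF assms(1,2), of n] assms(3) by (cases "\<tau> n \<omega>"; auto)+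

lemma jump_times_inj:
  assumes "jump_times M \<tau>" "\<omega> \<in> space M"
  shows "inj_on (\<lambda>n. real_of_ereal (\<tau> n \<omega>)) {n. \<tau> n \<omega> \<le> ereal t}"
proof (rule inj_onI)
  fix i j assume *: "i \<in> {n. \<tau> n \<omega> \<le> ereal t}" "j \<in> {n. \<tau> n \<omega> \<le> ereal t}" "real_of_ereal (\<tau> i \<omega>) = real_of_ereal (\<tau> j \<omega>)"
  then have "ereal (real_of_ereal (\<tau> i \<omega>)) = \<tau> i \<omega>" "ereal (real_of_ereal (\<tau> j \<omega>)) = \<tau> j \<omega>"
    using *(1,2) by (intro jump_time_real(1)[OF assms, of _ t]; simp)+
  then have "\<tau> i \<omega> = \<tau> j \<omega>" "\<tau> i \<omega> < \<infinity>"
    using *(3) by (metis, metis less_ereal.simps(4))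
  then show "i = j"
    using jump_timesD(3)[OF assms, of i j] jump_timesD(3)[OF assms, of j i] by (metis less_irrefl linorder_neqE_nat)
qed

text \<open>Only finitely many jumps occur up to \<open>T\<close> and \<open>f\<close> vanishes
  afterwards, so the integral over all jumps is a finite sum.\<close>

lemma nn_integral_jump_measure:
  fixes f :: "real \<Rightarrow> real \<Rightarrow> ennreal"
  assumes \<tau>: "jump_times M \<tau>" "\<omega> \<in> space M" and Z: "\<And>n. 0 < Z n \<omega>"
    and f: "(\<lambda>x. indicator ({0..T} \<times> {0<..}) x * f (fst x) (snd x)) \<in> borel_measurable borel"
    and f0: "\<And>t z. T < t \<Longrightarrow> f t z = 0"
  shows "(\<integral>\<^sup>+x\<in>{0<..} \<times> {0<..}. f (fst x) (snd x) \<partial>jump_measure \<tau> Z \<omega>) =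
    (\<Sum>j | \<tau> j \<omega> \<le> ereal T. f (real_of_ereal (\<tau> j \<omega>)) (Z j \<omega>))"
proof -
  have S: "({0<..} \<times> {0<..} :: (real \<times> real) set) \<in> sets borel"
    by (rule borel_Times) auto
  have *: "(\<lambda>x. f (fst x) (snd x) * indicator ({0<..} \<times> {0<..}) x) \<in> borel_measurable borel"
  proof -
    have "(\<lambda>x. indicator ({0<..} \<times> {0<..}) x * (indicator ({0..T} \<times> {0<..}) x * f (fst x) (snd x))) \<in> borel_measurable borel"
      by (rule borel_measurable_times_ennreal[OF borel_measurable_indicator[OF S] f])
    also have "(\<lambda>x. indicator ({0<..} \<times> {0<..}) x * (indicator ({0..T} \<times> {0<..}) x * f (fst x) (snd x))) =
      (\<lambda>x. f (fst x) (snd x) * indicator ({0<..} \<times> {0<..}) x)"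
      using f0 by (auto simp: indicator_def fun_eq_iff not_le)
    finally show ?thesis .
  qed
  have "(\<integral>\<^sup>+x\<in>{0<..} \<times> {0<..}. f (fst x) (snd x) \<partial>jump_measure \<tau> Z \<omega>) =
    (\<integral>\<^sup>+n. f (real_of_ereal (\<tau> n \<omega>)) (Z n \<omega>) * indicator ({0<..} \<times> {0<..}) (real_of_ereal (\<tau> n \<omega>), Z n \<omega>) \<partial>count_space {n. \<tau> n \<omega> < \<infinity>})"
    unfolding jump_measure_def using * by (subst nn_integral_distr) auto
  also have "\<dots> = (\<Sum>j | \<tau> j \<omega> \<le> ereal T. f (real_of_ereal (\<tau> j \<omega>)) (Z j \<omega>) * indicator ({0<..} \<times> {0<..}) (real_of_ereal (\<tau> j \<omega>), Z j \<omega>))"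
  proof (rule nn_integral_count_space')
    show "finite {j. \<tau> j \<omega> \<le> ereal T}" by (rule jump_timesD[OF \<tau>])
    fix n assume "n \<in> {n. \<tau> n \<omega> < \<infinity>}" "n \<notin> {j. \<tau> j \<omega> \<le> ereal T}"
    then have "T < real_of_ereal (\<tau> n \<omega>)"
      using jump_timesD(1)[OF \<tau>, of n] by (cases "\<tau> n \<omega>") auto
    then show "f (real_of_ereal (\<tau> n \<omega>)) (Z n \<omega>) * indicator ({0<..} \<times> {0<..}) (real_of_ereal (\<tau> n \<omega>), Z n \<omega>) = 0"
      by (simp add: f0)
  qed auto
  also have "\<dots> = (\<Sum>j | \<tau> j \<omega> \<le> ereal T. f (real_of_ereal (\<tau> j \<omega>)) (Z j \<omega>))"
    using jump_time_real(2)[OF \<tau>] Z by (intro sum.cong) auto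
  finally show ?thesis .
qed

lemma integral_jump_measure:
  fixes f :: "real \<Rightarrow> real \<Rightarrow> real"
  assumes \<tau>: "jump_times M \<tau>" "\<omega> \<in> space M" and Z: "\<And>n. 0 < Z n \<omega>"
    and f: "(\<lambda>x. indicator ({a<..b} \<times> {0<..}) x *\<^sub>R f (fst x) (snd x)) \<in> borel_measurable borel"
  shows "(LINT x:{a<..b} \<times> {0<..}|jump_measure \<tau> Z \<omega>. f (fst x) (snd x)) =
    (\<Sum>j | ereal a < \<tau> j \<omega> \<and> \<tau> j \<omega> \<le> ereal b. f (real_of_ereal (\<tau> j \<omega>)) (Z j \<omega>))"
proof -
  let ?g = "\<lambda>n. indicator ({a<..b} \<times> {0<..}) (real_of_ereal (\<tau> n \<omega>), Z n \<omega>) *\<^sub>R f (real_of_ereal (\<tau> n \<omega>)) (Z n \<omega>)"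
  have fin: "finite {j. ereal a < \<tau> j \<omega> \<and> \<tau> j \<omega> \<le> ereal b}"
    by (rule finite_subset[OF _ jump_timesD(4)[OF \<tau>, of b]]) auto
  have iff: "real_of_ereal (\<tau> n \<omega>) \<in> {a<..b} \<longleftrightarrow> ereal a < \<tau> n \<omega> \<and> \<tau> n \<omega> \<le> ereal b" if "\<tau> n \<omega> < \<infinity>" for n
    using jump_timesD(1)[OF \<tau>, of n] that by (cases "\<tau> n \<omega>") auto
  have sub: "{n \<in> {n. \<tau> n \<omega> < \<infinity>}. ?g n \<noteq> 0} \<subseteq> {j. ereal a < \<tau> j \<omega> \<and> \<tau> j \<omega> \<le> ereal b}"
    using iff by (auto simp: indicator_def split: if_splits)
  have "(LINT x:{a<..b} \<times> {0<..}|jump_measure \<tau> Z \<omega>. f (fst x) (snd x)) =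
    (\<integral>n. ?g n \<partial>count_space {n. \<tau> n \<omega> < \<infinity>})"
    unfolding jump_measure_def set_lebesgue_integral_def using f by (subst integral_distr) auto
  also have "\<dots> = (\<Sum>n | n \<in> {n. \<tau> n \<omega> < \<infinity>} \<and> ?g n \<noteq> 0. ?g n)"
    by (rule lebesgue_integral_count_space_finite_support) (rule finite_subset[OF sub fin])
  also have "\<dots> = (\<Sum>j | ereal a < \<tau> j \<omega> \<and> \<tau> j \<omega> \<le> ereal b. ?g j)"
    by (rule sum.mono_neutral_left[OF fin]) (use sub in \<open>force simp: less_top[symmetric]\<close>)+
  also have "\<dots> = (\<Sum>j | ereal a < \<tau> j \<omega> \<and> \<tau> j \<omega> \<le> ereal b. f (real_of_ereal (\<tau> j \<omega>)) (Z j \<omega>))"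
    using iff Z by (intro sum.cong) (auto simp: indicator_def, (metis ereal_infty_less(1) leD less_ereal.simps(4) linorder_not_less)+)
  finally show ?thesis .
qed

section \<open>Evaluation and summation of predictable fields at jump times\<close>

locale adapted_marks = subalgebra_family M F for M :: "'a measure" and F +
  fixes \<tau> :: "nat \<Rightarrow> 'a \<Rightarrow> ereal" and Z :: "nat \<Rightarrow> 'a \<Rightarrow> real"
  assumes jumps: "jump_times M \<tau>"
    and Z_pos: "\<And>n \<omega>. \<omega> \<in> space M \<Longrightarrow> 0 < Z n \<omega>"
    and adapted: "\<And>n t B. 0 \<le> t \<Longrightarrow> B \<in> sets borel \<Longrightarrow> {\<omega>\<in>space M. \<tau> n \<omega> \<le> ereal t \<and> Z n \<omega> \<in> B} \<in> sets (F t)"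
begin

lemma tau_adapted: "0 \<le> t \<Longrightarrow> {\<omega>\<in>space M. \<tau> n \<omega> \<le> ereal t} \<in> sets (F t)"
  using adapted[of t UNIV n] by simp

text \<open>It suffices to pull back generating rectangles: \<open>{a<..b} \<times> A\<close> gives
  the part of \<open>A\<close> where \<open>\<tau> n\<close> lies in \<open>{a<..min b t}\<close>,
  an event of \<open>F t\<close>, and the rectangles at time \<open>0\<close> give the empty set
  because jump times are positive. No sigma-algebra at a stopping time is involved.\<close>

lemma measurable_at_jump:
  assumes t: "0 \<le> t" "t \<le> T" and f: "f \<in> measurable (field_sigma {0..T} F) N"
  shows "(\<lambda>\<omega>. f ((real_of_ereal (\<tau> n \<omega>), \<omega>), Z n \<omega>)) \<in> measurable (restrict_space (F t) {\<omega>. \<tau> n \<omega> \<le> ereal t}) N"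
proof -
  let ?S = "{\<omega>\<in>space M. \<tau> n \<omega> \<le> ereal t}"
  let ?R = "restrict_space (F t) {\<omega>. \<tau> n \<omega> \<le> ereal t}"
  have S: "?S \<in> sets (F t)" by (rule tau_adapted[OF t(1)])
  have sp: "space ?R = ?S" using t by (auto simp: space_restrict_space space_F)
  have sets_R: "A \<in> sets ?R" if "A \<in> sets (F t)" "A \<subseteq> ?S" for A
  proof -
    have "A = {\<omega>. \<tau> n \<omega> \<le> ereal t} \<inter> A" using that by auto
    then show ?thesis using that unfolding sets_restrict_space by blast
  qed
  have R: "0 < real_of_ereal (\<tau> n \<omega>)" "real_of_ereal (\<tau> n \<omega>) \<le> t" "ereal (real_of_ereal (\<tau> n \<omega>)) = \<tau> n \<omega>" if "\<omega> \<in> ?S" for \<omega>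
    using jump_time_real[OF jumps, of \<omega> n t] that by auto
  have 1: "(\<lambda>\<omega>. (real_of_ereal (\<tau> n \<omega>), \<omega>)) \<in> measurable ?R (predictable_sigma {0..T} F)"
  proof (rule measurable_predictableI)
    fix A assume "A \<in> sets (F 0)"
    have "(\<lambda>\<omega>. (real_of_ereal (\<tau> n \<omega>), \<omega>)) -` ({0} \<times> A) \<inter> space ?R = {}"
      unfolding sp using R(1) by fastforce
    then show "(\<lambda>\<omega>. (real_of_ereal (\<tau> n \<omega>), \<omega>)) -` ({0} \<times> A) \<inter> space ?R \<in> sets ?R" by simp
  next
    fix a b A assume A: "0 \<le> a" "{a<..b} \<subseteq> {0..T}" "A \<in> sets (F a)"
    show "(\<lambda>\<omega>. (real_of_ereal (\<tau> n \<omega>), \<omega>)) -` ({a<..b} \<times> A) \<inter> space ?R \<in> sets ?R"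
    proof (cases "a < min b t")
      case True
      have "(\<lambda>\<omega>. (real_of_ereal (\<tau> n \<omega>), \<omega>)) -` ({a<..b} \<times> A) \<inter> space ?R =
        A \<inter> ({\<omega>\<in>space M. \<tau> n \<omega> \<le> ereal (min b t)} - {\<omega>\<in>space M. \<tau> n \<omega> \<le> ereal a})" (is "?L = ?X")
      proof -
        have "\<omega> \<in> ?L \<longleftrightarrow> \<omega> \<in> ?X" if "\<omega> \<in> space M" for \<omega>
          unfolding sp using that jump_timesD(1)[OF jumps that, of n] by (cases "\<tau> n \<omega>") auto
        moreover have "?L \<subseteq> space M" "?X \<subseteq> space M" unfolding sp by auto
        ultimately show ?thesis by blast
      qed
      moreover have "?X \<in> sets (F t)"
        using A True tau_adapted[of "min b t" n] tau_adapted[of a n] sets_mono[of a t] sets_mono[of "min b t" t]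
        by (intro sets.Int sets.Diff) auto
      moreover have "?L \<subseteq> ?S" unfolding sp by auto
      ultimately show ?thesis by (intro sets_R) auto
    next
      case False
      then have "(\<lambda>\<omega>. (real_of_ereal (\<tau> n \<omega>), \<omega>)) -` ({a<..b} \<times> A) \<inter> space ?R = {}"
        unfolding sp using R(2) by fastforce
      then show ?thesis by simp
    qed
  qed (use t R in \<open>auto simp: sp less_imp_le intro: order_trans[OF R(2)]\<close>)
  have 2: "Z n \<in> measurable ?R (restrict_space borel {0<..})"
  proof (rule measurable_restrict_space2)
    show "Z n \<in> space ?R \<rightarrow> {0<..}" unfolding sp using Z_pos by auto
    show "Z n \<in> borel_measurable ?R"
    proof (rule measurableI)
      fix B :: "real set" assume "B \<in> sets borel"
      then have "{\<omega>\<in>space M. \<tau> n \<omega> \<le> ereal t \<and> Z n \<omega> \<in> B} \<in> sets (F t)" by (rule adapted[OF t(1)])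
      then have "{\<omega>\<in>space M. \<tau> n \<omega> \<le> ereal t \<and> Z n \<omega> \<in> B} \<in> sets ?R" by (rule sets_R) auto
      also have "{\<omega>\<in>space M. \<tau> n \<omega> \<le> ereal t \<and> Z n \<omega> \<in> B} = Z n -` B \<inter> space ?R" unfolding sp by auto
      finally show "Z n -` B \<inter> space ?R \<in> sets ?R" .
    qed auto
  qed
  have "(\<lambda>\<omega>. ((real_of_ereal (\<tau> n \<omega>), \<omega>), Z n \<omega>)) \<in> measurable ?R (field_sigma {0..T} F)"
    unfolding field_sigma_def using 1 2 by (rule measurable_Pair)
  from measurable_compose[OF this f] show ?thesis by simp
qed

lemma measurable_at_jump_if:
  assumes t: "0 \<le> t" "t \<le> T" and f: "f \<in> measurable (field_sigma {0..T} F) N" and c: "c \<in> space N"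
  shows "(\<lambda>\<omega>. if \<tau> n \<omega> \<le> ereal t then f ((real_of_ereal (\<tau> n \<omega>), \<omega>), Z n \<omega>) else c) \<in> measurable (F t) N"
  using measurable_at_jump[OF t f, of n] tau_adapted[OF t(1), of n] space_F[OF t(1)] c
  by (subst measurable_If_restrict_space_iff) auto

text \<open>The index set of the jump sum depends on the scenario; a series over all indices moves
  this dependence into the terms, which are measurable one by one.\<close>

lemma sum_jumps_suminf:
  fixes f :: "nat \<Rightarrow> 'b::{comm_monoid_add, t2_space}"
  assumes "\<omega> \<in> space M"
  shows "(\<Sum>j | \<tau> j \<omega> \<le> ereal t. f j) = (\<Sum>j. if \<tau> j \<omega> \<le> ereal t then f j else 0)"
  by (subst suminf_finite[OF jump_timesD(4)[OF jumps assms, of t]]) auto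

lemma sum_jumps_adapted:
  assumes t: "0 \<le> t" "t \<le> T" and f: "f \<in> borel_measurable (field_sigma {0..T} F)"
  shows "(\<lambda>\<omega>. \<Sum>j | \<tau> j \<omega> \<le> ereal t. f ((real_of_ereal (\<tau> j \<omega>), \<omega>), Z j \<omega>) :: real) \<in> borel_measurable (F t)"
proof -
  have "(\<lambda>\<omega>. \<Sum>j. if \<tau> j \<omega> \<le> ereal t then f ((real_of_ereal (\<tau> j \<omega>), \<omega>), Z j \<omega>) else 0) \<in> borel_measurable (F t)"
    by (intro borel_measurable_suminf measurable_at_jump_if[OF t f]) auto
  then show ?thesis
    by (subst measurable_cong[OF sum_jumps_suminf]) (auto simp: space_F[OF t(1)])
qed

lemma sum_jumps_adapted_ennreal:
  assumes t: "0 \<le> t" "t \<le> T" and f: "f \<in> borel_measurable (field_sigma {0..T} F)"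
  shows "(\<lambda>\<omega>. \<Sum>j | \<tau> j \<omega> \<le> ereal t. f ((real_of_ereal (\<tau> j \<omega>), \<omega>), Z j \<omega>) :: ennreal) \<in> borel_measurable (F t)"
proof -
  have "(\<lambda>\<omega>. \<Sum>j. if \<tau> j \<omega> \<le> ereal t then f ((real_of_ereal (\<tau> j \<omega>), \<omega>), Z j \<omega>) else 0) \<in> borel_measurable (F t)"
    by (intro borel_measurable_suminf_order measurable_at_jump_if[OF t f]) auto
  then show ?thesis
    by (subst measurable_cong[OF sum_jumps_suminf]) (auto simp: space_F[OF t(1)])
qed

lemma measurable_mark: "snd \<in> borel_measurable (field_sigma I F)"
  unfolding field_sigma_def
  using measurable_compose[OF measurable_snd, of "\<lambda>z. z" "restrict_space borel {0<..}" borel]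
    measurable_restrict_space1[of "\<lambda>z. z" borel borel]
  by auto

lemma claims_adapted: "0 \<le> t \<Longrightarrow> claims \<tau> Z t \<in> borel_measurable (F t)"
  unfolding claims_def using sum_jumps_adapted[of t t snd, OF _ order_refl measurable_mark] by simp

end

section \<open>The raw filtration generated by the claims\<close>

lemma subalgebra_family_natural:
  assumes "\<And>t. 0 \<le> t \<Longrightarrow> X t \<in> borel_measurable M"
  shows "subalgebra_family M (natural_filtration M X)"
proof
  have sets: "sets (natural_filtration M X t) = sigma_sets (space M) {X i -` A \<inter> space M |i A. i \<in> {0..t} \<and> A \<in> sets borel}" for t
    unfolding natural_filtration_def generated_sigma_def by (rule sets_measure_of) auto
  show "subalgebra M (natural_filtration M X t)" if "0 \<le> t" for t
    unfolding subalgebra_def sets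
  proof
    show "space (natural_filtration M X t) = space M"
      unfolding natural_filtration_def generated_sigma_def by (simp add: space_measure_of_conv)
    show "sigma_sets (space M) {X i -` A \<inter> space M |i A. i \<in> {0..t} \<and> A \<in> sets borel} \<subseteq> sets M"
      using assms by (intro sets.sigma_sets_subset) (auto intro: measurable_sets)
  qed
  show "sets (natural_filtration M X s) \<subseteq> sets (natural_filtration M X t)" if "0 \<le> s" "s \<le> t" for s t
    unfolding sets using that by (intro sigma_sets_mono') fastforce
qed

lemma natural_filtration_adapted:
  "0 \<le> s \<Longrightarrow> s \<le> t \<Longrightarrow> X s \<in> borel_measurable (natural_filtration M X t)"
  unfolding natural_filtration_def generated_sigma_def
  by (intro measurableI) (auto simp: space_measure_of_conv intro!: in_measure_of)

lemma sets_natural_filtration_subset: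
  assumes "space N = space M" "\<And>s. 0 \<le> s \<Longrightarrow> s \<le> t \<Longrightarrow> X s \<in> borel_measurable N"
  shows "sets (natural_filtration M X t) \<subseteq> sets N"
proof -
  have "sets (natural_filtration M X t) = sigma_sets (space N) {X i -` A \<inter> space N |i A. i \<in> {0..t} \<and> A \<in> sets borel}"
    unfolding natural_filtration_def generated_sigma_def assms(1) by (rule sets_measure_of) auto
  also have "\<dots> \<subseteq> sets N"
    using assms(2) by (intro sets.sigma_sets_subset) (auto intro: measurable_sets)
  finally show ?thesis .
qed

text \<open>The marks are positive, so the path of the claims determines the jumps: the next jump has
  occurred by time \<open>s\<close> iff the claims have increased since some rational time after the last one.\<close>

lemma adapted_marks_natural_filtration:
  fixes F :: "real \<Rightarrow> 'a measure"
  assumes "adapted_marks M F \<tau> Z"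
  shows "adapted_marks M (natural_filtration M (claims \<tau> Z)) \<tau> Z"
proof -
  interpret adapted_marks M F \<tau> Z by fact
  let ?H = "natural_filtration M (claims \<tau> Z)"
  interpret H: subalgebra_family M ?H
    by (rule subalgebra_family_natural) (use claims_adapted measurable_F' in blast)
  have C: "claims \<tau> Z q \<in> borel_measurable (?H t)" if "0 \<le> q" "q \<le> t" for q t
    by (rule natural_filtration_adapted[OF that])
  have less: "claims \<tau> Z q \<omega> < claims \<tau> Z s \<omega> \<longleftrightarrow> (\<exists>j. ereal q < \<tau> j \<omega> \<and> \<tau> j \<omega> \<le> ereal s)"
    if \<omega>: "\<omega> \<in> space M" and "q \<le> s" for q s \<omega>
  proof -
    have sub: "{j. \<tau> j \<omega> \<le> ereal q} \<subseteq> {j. \<tau> j \<omega> \<le> ereal s}"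
      using that by (auto intro: order_trans)
    have "claims \<tau> Z s \<omega> = claims \<tau> Z q \<omega> + (\<Sum>j\<in>{j. \<tau> j \<omega> \<le> ereal s} - {j. \<tau> j \<omega> \<le> ereal q}. Z j \<omega>)"
      unfolding claims_def using sum.subset_diff[OF sub jump_timesD(4)[OF jumps \<omega>], of "\<lambda>j. Z j \<omega>"] by simp
    moreover have "(\<Sum>j\<in>{j. \<tau> j \<omega> \<le> ereal s} - {j. \<tau> j \<omega> \<le> ereal q}. Z j \<omega>) > 0
      \<longleftrightarrow> {j. \<tau> j \<omega> \<le> ereal s} - {j. \<tau> j \<omega> \<le> ereal q} \<noteq> {}"
    proof (cases "{j. \<tau> j \<omega> \<le> ereal s} - {j. \<tau> j \<omega> \<le> ereal q} = {}")
      case False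
      then show ?thesis using Z_pos[OF \<omega>] jump_timesD(4)[OF jumps \<omega>, of s] by (simp add: sum_pos)
    qed (simp only: sum.empty, simp)
    ultimately show ?thesis by (auto simp: not_le)
  qed
  have rat: "countable (\<rat> \<inter> {0..<s} :: real set)" for s
    using countable_rat by (rule countable_subset[rotated]) auto
  have tau: "{\<omega>\<in>space M. \<tau> n \<omega> \<le> ereal s} \<in> sets (?H s)" if "0 \<le> s" for n s
    using that
  proof (induction n arbitrary: s)
    case (0 s)
    have "{\<omega>\<in>space M. \<tau> 0 \<omega> \<le> ereal s} = {\<omega>\<in>space (?H s). claims \<tau> Z 0 \<omega> < claims \<tau> Z s \<omega>}"
    proof -
      have "\<tau> 0 \<omega> \<le> ereal s" if "\<omega> \<in> space M" "\<tau> j \<omega> \<le> ereal s" for \<omega> j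
        using incseqD[OF jump_timesD(2)[OF jumps that(1)], of 0 j] that(2) by auto
      then show ?thesis
        using less[of _ 0 s] 0 jump_timesD(1)[OF jumps] H.space_F[OF 0]
        by (auto simp: zero_ereal_def)
    qed
    also have "\<dots> \<in> sets (?H s)"
      using C[of 0 s] C[of s s] 0 by measurable
    finally show ?case .
  next
    case (Suc n s)
    have "{\<omega>\<in>space M. \<tau> (Suc n) \<omega> \<le> ereal s} =
      (\<Union>q\<in>\<rat> \<inter> {0..<s}. {\<omega>\<in>space M. \<tau> n \<omega> \<le> ereal q} \<inter> {\<omega>\<in>space (?H s). claims \<tau> Z q \<omega> < claims \<tau> Z s \<omega>})"
      (is "?L = ?R")
    proof (intro equalityI subsetI)
      fix \<omega> assume "\<omega> \<in> ?L"
      then have \<omega>: "\<omega> \<in> space M" "\<tau> (Suc n) \<omega> \<le> ereal s" by auto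
      have "\<tau> n \<omega> \<le> ereal s" using incseqD[OF jump_timesD(2)[OF jumps \<omega>(1)], of n "Suc n"] \<omega>(2) by auto
      note n = jump_time_real[OF jumps \<omega>(1) this]
      note Sn = jump_time_real[OF jumps \<omega>]
      have "\<tau> n \<omega> < \<tau> (Suc n) \<omega>"
        using jump_timesD(3)[OF jumps \<omega>(1), of n "Suc n"] n(1) by (metis ereal_infty_less(1) less_ereal.simps(4) lessI PInfty_neq_ereal(1))
      then have "real_of_ereal (\<tau> n \<omega>) < real_of_ereal (\<tau> (Suc n) \<omega>)"
        using n(1) Sn(1) by (metis less_ereal.simps(1))
      then obtain q where q: "q \<in> \<rat>" "real_of_ereal (\<tau> n \<omega>) < q" "q < real_of_ereal (\<tau> (Suc n) \<omega>)"
        using Rats_dense_in_real by blast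
      have "ereal q < \<tau> (Suc n) \<omega>" "\<tau> n \<omega> \<le> ereal q" 
        using q n(1) Sn(1) by (metis less_ereal.simps(1), metis less_eq_ereal_def less_ereal.simps(1))
      then show "\<omega> \<in> ?R"
        using q n Sn \<omega> less[OF \<omega>(1), of q s] H.space_F[OF Suc.prems] by (auto intro!: bexI[of _ q])
    next
      fix \<omega> assume "\<omega> \<in> ?R"
      then obtain q where \<omega>: "\<omega> \<in> space M" "\<tau> n \<omega> \<le> ereal q" "q < s" "claims \<tau> Z q \<omega> < claims \<tau> Z s \<omega>"
        by auto
      then obtain j where j: "ereal q < \<tau> j \<omega>" "\<tau> j \<omega> \<le> ereal s" using less[of \<omega> q s] by auto
      have "n < j"
        using incseqD[OF jump_timesD(2)[OF jumps \<omega>(1)], of j n] j(1) \<omega>(2) by (metis leD linorder_le_less_linear order.trans)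
      then show "\<omega> \<in> ?L"
        using incseqD[OF jump_timesD(2)[OF jumps \<omega>(1)], of "Suc n" j] j(2) \<omega>(1) by auto
    qed
    also have "\<dots> \<in> sets (?H s)"
    proof (intro sets.countable_UN'' rat sets.Int)
      fix q assume q: "q \<in> \<rat> \<inter> {0..<s}"
      then show "{\<omega>\<in>space M. \<tau> n \<omega> \<le> ereal q} \<in> sets (?H s)"
        using Suc.IH[of q] H.sets_mono[of q s] by auto
      have [measurable]: "claims \<tau> Z q \<in> borel_measurable (?H s)" "claims \<tau> Z s \<in> borel_measurable (?H s)"
        using C[of q s] C[of s s] q by auto
      show "{\<omega>\<in>space (?H s). claims \<tau> Z q \<omega> < claims \<tau> Z s \<omega>} \<in> sets (?H s)"
        by measurable
    qed
    finally show ?case .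
  qed
  \<comment> \<open>Partial sums of the marks: \<open>S n\<close> is the value of the claims from
    jump \<open>n\<close> until the next one, and each mark is a difference of two of them.\<close>
  define S where "S n \<omega> = (\<Sum>i\<le>n. Z i \<omega>)" for n \<omega>
  have S: "(\<lambda>\<omega>. if \<tau> n \<omega> \<le> ereal s then S n \<omega> else 0) \<in> borel_measurable (?H s)" if s: "0 \<le> s" for n s
  proof (rule borel_measurable_iff_less[THEN iffD2], rule allI)
    fix y :: real
    \<comment> \<open>From jump \<open>n\<close> on, the claims are at least \<open>S n\<close>,
      with equality until the next jump, so \<open>S n < y\<close> is visible at a rational time in
      between. The time \<open>s\<close> itself is added because the jump may occur exactly at
      \<open>s\<close>.\<close>
    let ?Q = "insert s (\<rat> \<inter> {0..<s})"
    have *: "\<tau> n \<omega> \<le> ereal s \<and> S n \<omega> < y \<longleftrightarrow> (\<exists>q\<in>?Q. \<tau> n \<omega> \<le> ereal q \<and> claims \<tau> Z q \<omega> < y)" if \<omega>: "\<omega> \<in> space M" for \<omega>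
    proof
      assume n: "\<tau> n \<omega> \<le> ereal s \<and> S n \<omega> < y"
      note r = jump_time_real[OF jumps \<omega> conjunct1[OF n]]
      have lt: "\<tau> n \<omega> < \<tau> (Suc n) \<omega>"
        using jump_timesD(3)[OF jumps \<omega>, of n "Suc n"] r(1) by (metis ereal_infty_less(1) less_ereal.simps(4) lessI PInfty_neq_ereal(1))
      obtain q where q: "q \<in> ?Q" "\<tau> n \<omega> \<le> ereal q" "ereal q < \<tau> (Suc n) \<omega>"
      proof (cases "real_of_ereal (\<tau> n \<omega>) = s")
        case True
        then show thesis using r lt by (intro that[of s]) auto
      next
        case False
        then have "real_of_ereal (\<tau> n \<omega>) < s" using r by auto
        then have "\<tau> n \<omega> < min (ereal s) (\<tau> (Suc n) \<omega>)" using r(1) lt by (metis less_ereal.simps(1) min_less_iff_conj)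
        then obtain u where u: "\<tau> n \<omega> < ereal u" "ereal u < min (ereal s) (\<tau> (Suc n) \<omega>)"
          using ereal_dense2 by blast
        then have "real_of_ereal (\<tau> n \<omega>) < u" using r(1) by (metis less_ereal.simps(1))
        then obtain q where "q \<in> \<rat>" "real_of_ereal (\<tau> n \<omega>) < q" "q < u" using Rats_dense_in_real by blast
        moreover from this have "ereal q < ereal u" "ereal (real_of_ereal (\<tau> n \<omega>)) < ereal q" by auto
        moreover from this have "ereal q < \<tau> (Suc n) \<omega>" using u(2) by (meson less_trans min_less_iff_conj)
        ultimately show thesis using u r by (intro that[of q]) auto
      qed
      have "{i. \<tau> i \<omega> \<le> ereal q} = {..n}"
      proof (intro equalityI subsetI)
        fix i assume "i \<in> {i. \<tau> i \<omega> \<le> ereal q}"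
        then have "\<tau> i \<omega> < \<tau> (Suc n) \<omega>" using q(3) by auto
        then show "i \<in> {..n}"
          using incseqD[OF jump_timesD(2)[OF jumps \<omega>], of "Suc n" i] by (metis atMost_iff leD not_less_eq_eq)
      next
        fix i assume "i \<in> {..n}"
        then show "i \<in> {i. \<tau> i \<omega> \<le> ereal q}"
          using incseqD[OF jump_timesD(2)[OF jumps \<omega>], of i n] q(2) by auto
      qed
      then have "claims \<tau> Z q \<omega> = S n \<omega>" unfolding claims_def S_def by simp
      then show "\<exists>q\<in>?Q. \<tau> n \<omega> \<le> ereal q \<and> claims \<tau> Z q \<omega> < y" using q n by auto
    next
      assume "\<exists>q\<in>?Q. \<tau> n \<omega> \<le> ereal q \<and> claims \<tau> Z q \<omega> < y"
      then obtain q where q: "q \<in> ?Q" "\<tau> n \<omega> \<le> ereal q" "claims \<tau> Z q \<omega> < y" by blast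
      have "{..n} \<subseteq> {i. \<tau> i \<omega> \<le> ereal q}"
        using incseqD[OF jump_timesD(2)[OF jumps \<omega>], of _ n] q(2) by (auto intro: order_trans)
      then have "S n \<omega> \<le> claims \<tau> Z q \<omega>"
        unfolding claims_def S_def using Z_pos[OF \<omega>]
        by (intro sum_mono2 jump_timesD(4)[OF jumps \<omega>]) (auto simp: less_imp_le)
      moreover have "ereal q \<le> ereal s" using q(1) by auto
      ultimately show "\<tau> n \<omega> \<le> ereal s \<and> S n \<omega> < y" using q(2,3) by (auto intro: order_trans)
    qed
    have sp: "space (?H s) = space M" by (rule H.space_F[OF s])
    have "{\<omega>\<in>space (?H s). (if \<tau> n \<omega> \<le> ereal s then S n \<omega> else 0) < y} =
      (\<Union>q\<in>?Q. {\<omega>\<in>space M. \<tau> n \<omega> \<le> ereal q} \<inter> {\<omega>\<in>space (?H s). claims \<tau> Z q \<omega> < y}) \<union>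
      (if 0 < y then space M - {\<omega>\<in>space M. \<tau> n \<omega> \<le> ereal s} else {})" (is "?A = ?B")
    proof -
      have "\<omega> \<in> ?A \<longleftrightarrow> \<omega> \<in> ?B" if \<omega>: "\<omega> \<in> space M" for \<omega>
      proof -
        have "\<omega> \<in> ?B \<longleftrightarrow> (\<exists>q\<in>?Q. \<tau> n \<omega> \<le> ereal q \<and> claims \<tau> Z q \<omega> < y) \<or> (0 < y \<and> \<not> \<tau> n \<omega> \<le> ereal s)"
          using \<omega> sp by auto
        then show ?thesis unfolding *[OF \<omega>, symmetric] using \<omega> sp by auto
      qed
      moreover have "?A \<subseteq> space M" "?B \<subseteq> space M" using sp by auto
      ultimately show ?thesis by blast
    qed
    also have "\<dots> \<in> sets (?H s)"
    proof (intro sets.Un sets.countable_UN'' sets.Int)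
      show "countable ?Q" using rat by auto
      fix q assume q: "q \<in> ?Q"
      then have q': "0 \<le> q" "q \<le> s" using s by auto
      then show "{\<omega>\<in>space M. \<tau> n \<omega> \<le> ereal q} \<in> sets (?H s)"
        using tau[of q n] H.sets_mono[of q s] by auto
      show "{\<omega>\<in>space (?H s). claims \<tau> Z q \<omega> < y} \<in> sets (?H s)"
        using C[OF q'] by measurable
    next
      show "(if 0 < y then space M - {\<omega>\<in>space M. \<tau> n \<omega> \<le> ereal s} else {}) \<in> sets (?H s)"
        using sets.compl_sets[OF tau[OF s, of n]] sp by auto
    qed
    finally show "{\<omega>\<in>space (?H s). (if \<tau> n \<omega> \<le> ereal s then S n \<omega> else 0) < y} \<in> sets (?H s)" .
  qed
  show ?thesis
  proof
    fix n and t :: real and B :: "real set" assume t: "0 \<le> t" and B: "B \<in> sets borel"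
    \<comment> \<open>Once jump \<open>n\<close> has occurred, so has jump \<open>n - 1\<close>, and
      \<open>g\<close> is there the mark \<open>Z n\<close>. Other values of \<open>g\<close> are
      cut off by the intersection below.\<close>
    define g where "g \<omega> = (if \<tau> n \<omega> \<le> ereal t then S n \<omega> else 0)
        - (if n = 0 then 0 else (if \<tau> (n - 1) \<omega> \<le> ereal t then S (n - 1) \<omega> else 0))" for \<omega>
    have g: "g \<in> borel_measurable (?H t)"
    proof (cases "n = 0")
      case True
      then show ?thesis using S[OF t, of n] unfolding g_def by simp
    next
      case False
      then show ?thesis using S[OF t, of n] S[OF t, of "n - 1"] unfolding g_def by simp
    qed
    have "Z n \<omega> = g \<omega>" if "\<omega> \<in> space M" "\<tau> n \<omega> \<le> ereal t" for \<omega>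
    proof (cases n)
      case 0
      then show ?thesis using that by (simp add: g_def S_def)
    next
      case (Suc m)
      have "\<tau> m \<omega> \<le> ereal t" using incseqD[OF jump_timesD(2)[OF jumps that(1)], of m n] that(2) Suc by auto
      then show ?thesis using that Suc by (simp add: g_def S_def)
    qed
    then have "{\<omega>\<in>space M. \<tau> n \<omega> \<le> ereal t \<and> Z n \<omega> \<in> B} = {\<omega>\<in>space M. \<tau> n \<omega> \<le> ereal t} \<inter> (g -` B \<inter> space (?H t))"
      using H.space_F[OF t] by auto
    also have "\<dots> \<in> sets (?H t)"
      using tau[OF t, of n] measurable_sets[OF g B] by auto
    finally show "{\<omega>\<in>space M. \<tau> n \<omega> \<le> ereal t \<and> Z n \<omega> \<in> B} \<in> sets (?H t)" .
  qed (use jumps Z_pos in auto)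
qed

section \<open>Compensators and the intensity\<close>

abbreviation clock :: "real \<Rightarrow> real measure" where
  "clock T \<equiv> restrict_space lborel {0..T}"

abbreviation mark_law :: "real measure \<Rightarrow> real measure" where
  "mark_law F \<equiv> restrict_space F {0<..}"

lemma finite_measure_clock: "finite_measure (clock T)"
  by (rule finite_measureI) (cases "0 \<le> T"; simp add: emeasure_restrict_space space_restrict_space)

lemma nn_integral_clock: "(\<integral>\<^sup>+t. f t \<partial>clock T) = (\<integral>\<^sup>+t\<in>{0..T}. f t \<partial>lborel)"
  by (simp add: nn_integral_restrict_space)

lemma AE_clock: "(AE t in clock T. P t) \<longleftrightarrow> (AE t in lborel. t \<in> {0..T} \<longrightarrow> P t)"
  by (rule AE_restrict_space_iff) simp

lemma AE_clock_countable:
  assumes "countable {t\<in>{0..T}. \<not> P t}" shows "AE t in clock T. P t"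
  unfolding AE_clock
  using AE_not_in[OF countable_imp_null_set_lborel[OF assms]] by eventually_elim auto

lemma sets_mark_law: "sets F = sets borel \<Longrightarrow> sets (mark_law F) = sets (restrict_space borel {0<..})"
  by (rule sets_restrict_space_cong)

lemma (in subalgebra_family) measurable_field_fst:
  "f \<in> measurable (predictable_sigma I F) N \<Longrightarrow> (\<lambda>x. f (fst x)) \<in> measurable (field_sigma I F) N"
  unfolding field_sigma_def by (rule measurable_compose[OF measurable_fst])

lemma (in subalgebra_family) measurable_field_time:
  "0 \<le> T \<Longrightarrow> (\<lambda>x. fst (fst x)) \<in> borel_measurable (field_sigma {0..T} F)"
  by (rule measurable_field_fst[OF predictable_time])

lemma measurable_field_mark:
  "f \<in> measurable (restrict_space borel {0<..}) N \<Longrightarrow> (\<lambda>x. f (snd x)) \<in> measurable (field_sigma I F) N"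
  unfolding field_sigma_def by (rule measurable_compose[OF measurable_snd])

text \<open>Brings the compensator identity into the form used throughout: a finite sum over the
  jumps up to \<open>T\<close> against an integral over \<open>clock T\<close> and
  \<open>mark_law D\<close>, for any filtration contained in \<open>G\<close>.\<close>

lemma compensator_formula:
  assumes G: "adapted_marks M G \<tau> Z" and F: "subalgebra_family M F"
    and FG: "\<And>t. 0 \<le> t \<Longrightarrow> sets (F t) \<subseteq> sets (G t)"
    and comp: "has_compensator M G \<tau> Z \<phi> D" and D: "sets D = sets borel" and T: "0 \<le> T"
    and K: "K \<in> borel_measurable (field_sigma {0..T} F)"
  shows "(\<integral>\<^sup>+\<omega>. (\<Sum>j | \<tau> j \<omega> \<le> ereal T. K ((real_of_ereal (\<tau> j \<omega>), \<omega>), Z j \<omega>)) \<partial>M) =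
    (\<integral>\<^sup>+\<omega>. \<integral>\<^sup>+t. \<integral>\<^sup>+z. K ((t, \<omega>), z) * ennreal (\<phi> t \<omega>) \<partial>mark_law D \<partial>clock T \<partial>M)"
proof -
  interpret G: adapted_marks M G \<tau> Z by fact
  interpret F: subalgebra_family M F by fact
  define K' where "K' x = (if fst (fst x) \<le> T then K x else 0)" for x
  have "K' \<in> borel_measurable (field_sigma {0..} G)"
    unfolding K'_def by (rule measurable_field_extend[OF F G.subalgebra_family_axioms FG T K])
  then have "(\<integral>\<^sup>+\<omega>. (\<integral>\<^sup>+x\<in>{0<..} \<times> {0<..}. K' ((fst x, \<omega>), snd x) \<partial>jump_measure \<tau> Z \<omega>) \<partial>M) =
        (\<integral>\<^sup>+\<omega>. (\<integral>\<^sup>+t\<in>{0<..}. (\<integral>\<^sup>+z\<in>{0<..}. K' ((t, \<omega>), z) * ennreal (\<phi> t \<omega>) \<partial>D) \<partial>lborel) \<partial>M)"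
    using comp unfolding has_compensator_def by blast
  moreover have "(\<integral>\<^sup>+x\<in>{0<..} \<times> {0<..}. K' ((fst x, \<omega>), snd x) \<partial>jump_measure \<tau> Z \<omega>) =
      (\<Sum>j | \<tau> j \<omega> \<le> ereal T. K ((real_of_ereal (\<tau> j \<omega>), \<omega>), Z j \<omega>))" if \<omega>: "\<omega> \<in> space M" for \<omega>
  proof -
    have "(\<lambda>x. indicator ({0..T} \<times> {0<..}) x * K ((fst x, \<omega>), snd x)) \<in> borel_measurable borel"
      using measurable_pair_restrict_indicator_ennreal[OF F.predictable_field_path[OF K T \<omega>], of "{0..T}"] by simp
    also have "(\<lambda>x. indicator ({0..T} \<times> {0<..}) x * K ((fst x, \<omega>), snd x)) =
       (\<lambda>x. indicator ({0..T} \<times> {0<..}) x * K' ((fst x, \<omega>), snd x))"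
      by (auto simp: indicator_def K'_def fun_eq_iff)
    finally have K'm: "(\<lambda>x. indicator ({0..T} \<times> {0<..}) x * K' ((fst x, \<omega>), snd x)) \<in> borel_measurable borel" .
    have "(\<integral>\<^sup>+x\<in>{0<..} \<times> {0<..}. K' ((fst x, \<omega>), snd x) \<partial>jump_measure \<tau> Z \<omega>) =
      (\<Sum>j | \<tau> j \<omega> \<le> ereal T. K' ((real_of_ereal (\<tau> j \<omega>), \<omega>), Z j \<omega>))"
      by (rule nn_integral_jump_measure[where f="\<lambda>t z. K' ((t, \<omega>), z)" and T=T, OF G.jumps \<omega> _ K'm])
         (simp_all add: K'_def G.Z_pos[OF \<omega>])
    also have "\<dots> = (\<Sum>j | \<tau> j \<omega> \<le> ereal T. K ((real_of_ereal (\<tau> j \<omega>), \<omega>), Z j \<omega>))"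
      using jump_time_real(3)[OF G.jumps \<omega>] by (intro sum.cong) (auto simp: K'_def)
    finally show ?thesis .
  qed
  moreover have "(\<integral>\<^sup>+t\<in>{0<..}. (\<integral>\<^sup>+z\<in>{0<..}. K' ((t, \<omega>), z) * ennreal (\<phi> t \<omega>) \<partial>D) \<partial>lborel) =
     (\<integral>\<^sup>+t. \<integral>\<^sup>+z. K ((t, \<omega>), z) * ennreal (\<phi> t \<omega>) \<partial>mark_law D \<partial>clock T)" for \<omega>
  proof -
    have "(\<integral>\<^sup>+t. \<integral>\<^sup>+z. K ((t, \<omega>), z) * ennreal (\<phi> t \<omega>) \<partial>mark_law D \<partial>clock T) =
      (\<integral>\<^sup>+t\<in>{0..T}. (\<integral>\<^sup>+z\<in>{0<..}. K ((t, \<omega>), z) * ennreal (\<phi> t \<omega>) \<partial>D) \<partial>lborel)"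
      unfolding nn_integral_clock using D by (subst nn_integral_restrict_space) auto
    also have "\<dots> = (\<integral>\<^sup>+t\<in>{0<..}. (\<integral>\<^sup>+z\<in>{0<..}. K' ((t, \<omega>), z) * ennreal (\<phi> t \<omega>) \<partial>D) \<partial>lborel)"
    proof (rule nn_integral_cong_AE)
      \<comment> \<open>The clock contains time \<open>0\<close> and the compensator does not; the
        difference is a null set.\<close>
      show "AE t in lborel. (\<integral>\<^sup>+z\<in>{0<..}. K ((t, \<omega>), z) * ennreal (\<phi> t \<omega>) \<partial>D) * indicator {0..T} t =
        (\<integral>\<^sup>+z\<in>{0<..}. K' ((t, \<omega>), z) * ennreal (\<phi> t \<omega>) \<partial>D) * indicator {0<..} t"
        using AE_lborel_singleton[of 0] by eventually_elim (auto simp: K'_def indicator_def)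
    qed
    finally show ?thesis by simp
  qed
  ultimately show ?thesis by (simp cong: nn_integral_cong)
qed

text \<open>In the norm weighted by \<open>exp (- \<kappa> t)\<close> the integral operator
  contracts by one half, so the supremum \<open>S\<close> satisfies
  \<open>S \<le> A T + S / 2\<close>. The a priori bound \<open>C\<close> serves to make
  \<open>S\<close> finite; the resulting bound is free of \<open>C\<close>, which allows an
  application uniform in a truncation parameter.\<close>

lemma gronwall_bounded:
  fixes f :: "real \<Rightarrow> ennreal"
  assumes "0 \<le> T" "0 \<le> A" "0 \<le> L"
    and C: "\<And>t. t \<in> {0..T} \<Longrightarrow> f t \<le> ennreal C"
    and f: "\<And>t. t \<in> {0..T} \<Longrightarrow> f t \<le> (\<integral>\<^sup>+s. ennreal A + ennreal L * f s \<partial>clock t)"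
    and t: "t \<in> {0..T}"
  shows "f t \<le> ennreal (2 * A * T * exp (2 * (L + 1) * T))"
proof -
  \<comment> \<open>Any weight of at least \<open>2 L\<close> gives the factor one half; the added
    one keeps \<open>\<kappa>\<close> positive when \<open>L = 0\<close>.\<close>
  define \<kappa> where "\<kappa> = 2 * (L + 1)"
  have \<kappa>: "0 < \<kappa>" using assms(3) by (simp add: \<kappa>_def)
  define g where "g t = exp (- \<kappa> * t) * enn2real (f t)" for t
  have g_le: "g t \<le> max C 0" if "t \<in> {0..T}" for t
  proof -
    have "enn2real (f t) \<le> max C 0" using C[OF that] by (cases "0 \<le> C") (auto intro: enn2real_leI simp: ennreal_neg)
    moreover have "exp (- \<kappa> * t) \<le> 1" using that \<kappa> by auto
    ultimately show ?thesis unfolding g_def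
      using mult_mono[of "exp (- \<kappa> * t)" 1 "enn2real (f t)" "max C 0"] by auto
  qed
  define S where "S = (SUP t\<in>{0..T}. g t)"
  have bdd: "bdd_above (g ` {0..T})" using g_le by (intro bdd_aboveI2[of _ _ "max C 0"]) auto
  have gS: "g t \<le> S" if "t \<in> {0..T}" for t unfolding S_def by (rule cSUP_upper[OF that bdd])
  have S0: "0 \<le> S" using gS[of 0] assms(1) unfolding g_def by (auto intro: order_trans[rotated])
  have fS: "f t \<le> ennreal (S * exp (\<kappa> * t))" if "t \<in> {0..T}" for t
  proof -
    have "f t < \<top>" using C[OF that] ennreal_less_top by (rule le_less_trans)
    then have "f t = ennreal (enn2real (f t))" by simp
    also have "enn2real (f t) = g t * exp (\<kappa> * t)" by (simp add: g_def exp_minus field_simps)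
    also have "ennreal (g t * exp (\<kappa> * t)) \<le> ennreal (S * exp (\<kappa> * t))"
      using gS[OF that] by (intro ennreal_leI mult_right_mono) auto
    finally show ?thesis .
  qed
  have step: "g t \<le> A * T + S / 2" if t: "t \<in> {0..T}" for t
  proof -
    have "f t \<le> (\<integral>\<^sup>+s. ennreal A + ennreal L * f s \<partial>clock t)" by (rule f[OF t])
    also have "\<dots> \<le> (\<integral>\<^sup>+s. ennreal (A + L * S * exp (\<kappa> * s)) \<partial>clock t)"
    proof (rule nn_integral_mono)
      fix s assume "s \<in> space (clock t)"
      then have "s \<in> {0..T}" using t by (auto simp: space_restrict_space)
      then have "ennreal A + ennreal L * f s \<le> ennreal A + ennreal L * ennreal (S * exp (\<kappa> * s))"
        by (intro add_mono mult_left_mono fS) auto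
      also have "\<dots> = ennreal (A + L * S * exp (\<kappa> * s))"
        using assms S0 by (simp add: ennreal_mult[symmetric] ennreal_plus[symmetric] mult.assoc del: ennreal_plus)
      finally show "ennreal A + ennreal L * f s \<le> ennreal (A + L * S * exp (\<kappa> * s))" .
    qed
    also have "\<dots> = (\<integral>\<^sup>+s. ennreal (A + L * S * exp (\<kappa> * s)) * indicator {0..t} s \<partial>lborel)"
      by (rule nn_integral_clock)
    also have "\<dots> = ennreal ((A * t + L * S * exp (\<kappa> * t) / \<kappa>) - (A * 0 + L * S * exp (\<kappa> * 0) / \<kappa>))"
      using t assms S0 \<kappa>
      by (intro nn_integral_FTC_Icc[where F="\<lambda>s. A * s + L * S * exp (\<kappa> * s) / \<kappa>"])
         (auto intro!: derivative_eq_intros)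
    also have "\<dots> \<le> ennreal (A * T + S / 2 * exp (\<kappa> * t))"
    proof (rule ennreal_leI)
      have "A * t \<le> A * T" using t assms by (auto intro: mult_left_mono)
      moreover have "L * S * exp (\<kappa> * t) / \<kappa> \<le> S / 2 * exp (\<kappa> * t)"
      proof -
        have "L / \<kappa> \<le> 1 / 2" using \<kappa> assms(3) by (simp add: \<kappa>_def field_simps)
        then have "(L / \<kappa>) * (S * exp (\<kappa> * t)) \<le> 1 / 2 * (S * exp (\<kappa> * t))"
          using S0 by (intro mult_right_mono) auto
        then show ?thesis by simp
      qed
      moreover have "0 \<le> L * S * exp (\<kappa> * 0) / \<kappa>" using assms S0 \<kappa> by simp
      ultimately show "A * t + L * S * exp (\<kappa> * t) / \<kappa> - (A * 0 + L * S * exp (\<kappa> * 0) / \<kappa>)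
        \<le> A * T + S / 2 * exp (\<kappa> * t)" by linarith
    qed
    finally have "enn2real (f t) \<le> A * T + S / 2 * exp (\<kappa> * t)"
      using assms S0 by (intro enn2real_leI) auto
    then have "g t \<le> exp (- \<kappa> * t) * (A * T + S / 2 * exp (\<kappa> * t))"
      unfolding g_def by (intro mult_left_mono) auto
    also have "\<dots> = exp (- \<kappa> * t) * (A * T) + S / 2"
      by (simp add: distrib_left mult.left_commute mult_exp_exp)
    also have "exp (- \<kappa> * t) * (A * T) \<le> 1 * (A * T)"
      using t \<kappa> assms by (intro mult_right_mono) auto
    finally show ?thesis by simp
  qed
  have "S \<le> A * T + S / 2" unfolding S_def[symmetric] using step assms(1) 
    unfolding S_def by (intro cSUP_least) auto
  then have "S \<le> 2 * A * T" by simp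
  have "f t \<le> ennreal (S * exp (\<kappa> * t))" by (rule fS[OF t])
  also have "\<dots> \<le> ennreal (2 * A * T * exp (\<kappa> * T))"
    using \<open>S \<le> 2 * A * T\<close> t \<kappa> S0 by (intro ennreal_leI mult_mono) auto
  finally show ?thesis unfolding \<kappa>_def .
qed

text \<open>Each of the finitely many jumps strictly before \<open>t\<close> has occurred by every
  \<open>s\<close> close enough to \<open>t\<close>.\<close>

lemma eventually_jumps_left:
  assumes \<tau>: "jump_times M \<tau>" "\<omega> \<in> space M"
  shows "eventually (\<lambda>s. {j. \<tau> j \<omega> \<le> ereal s} = {j. \<tau> j \<omega> < ereal t}) (at_left t)"
proof -
  have "finite {j. \<tau> j \<omega> < ereal t}"
    by (rule finite_subset[OF _ jump_timesD(4)[OF \<tau>, of t]]) auto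
  moreover have "eventually (\<lambda>s. \<tau> j \<omega> \<le> ereal s) (at_left t)" if "j \<in> {j. \<tau> j \<omega> < ereal t}" for j
  proof -
    have "\<tau> j \<omega> \<le> ereal t" using that by auto
    note r = jump_time_real[OF \<tau> this]
    have "ereal (real_of_ereal (\<tau> j \<omega>)) < ereal t" using that r(1) by auto
    then have lt: "real_of_ereal (\<tau> j \<omega>) < t" by simp
    have "eventually (\<lambda>s. real_of_ereal (\<tau> j \<omega>) < s) (at_left t)"
      using lt unfolding eventually_at_left_field by (intro exI[of _ "real_of_ereal (\<tau> j \<omega>)"]) auto
    then show ?thesis
    proof eventually_elim
      case (elim s)
      then have "ereal (real_of_ereal (\<tau> j \<omega>)) \<le> ereal s" by simp
      then show ?case by (simp only: r(1))
    qed
  qed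
  ultimately have "eventually (\<lambda>s. \<forall>j\<in>{j. \<tau> j \<omega> < ereal t}. \<tau> j \<omega> \<le> ereal s) (at_left t)"
    by (intro eventually_ball_finite) auto
  moreover have "eventually (\<lambda>s. s < t) (at_left t)"
    unfolding eventually_at_left_field by (intro exI[of _ "t - 1"]) auto
  ultimately show ?thesis
  proof eventually_elim
    case (elim s)
    then have "ereal s < ereal t" by simp
    then show ?case using elim(1) by (auto intro: le_less_trans)
  qed
qed

lemma sum_jumps_left_tendsto:
  fixes g :: "real \<Rightarrow> nat \<Rightarrow> real"
  assumes \<tau>: "jump_times M \<tau>" "\<omega> \<in> space M" and g: "\<And>j. ((\<lambda>s. g s j) \<longlongrightarrow> g t j) (at_left t)"
  shows "((\<lambda>s. \<Sum>j | \<tau> j \<omega> \<le> ereal s. g s j) \<longlongrightarrow> (\<Sum>j | \<tau> j \<omega> < ereal t. g t j)) (at_left t)"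
proof -
  have "((\<lambda>s. \<Sum>j | \<tau> j \<omega> < ereal t. g s j) \<longlongrightarrow> (\<Sum>j | \<tau> j \<omega> < ereal t. g t j)) (at_left t)"
    by (intro tendsto_sum g)
  moreover have "eventually (\<lambda>s. (\<Sum>j | \<tau> j \<omega> < ereal t. g s j) = (\<Sum>j | \<tau> j \<omega> \<le> ereal s. g s j)) (at_left t)"
    using eventually_jumps_left[OF \<tau>, of t] by eventually_elim simp
  ultimately show ?thesis by (rule Lim_transform_eventually)
qed

text \<open>The window up to \<open>t + 1\<close> leaves finitely many jumps after \<open>t\<close>,
  and each of them is avoided by coming close enough to \<open>t\<close>.\<close>

lemma eventually_jumps_right:
  assumes \<tau>: "jump_times M \<tau>" "\<omega> \<in> space M"
  shows "eventually (\<lambda>s. {j. \<tau> j \<omega> \<le> ereal s} = {j. \<tau> j \<omega> \<le> ereal t}) (at_right t)"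
proof -
  have "finite {j. \<tau> j \<omega> \<le> ereal (t + 1) \<and> ereal t < \<tau> j \<omega>}"
    by (rule finite_subset[OF _ jump_timesD(4)[OF \<tau>, of "t + 1"]]) auto
  moreover have "eventually (\<lambda>s. ereal s < \<tau> j \<omega>) (at_right t)" if "j \<in> {j. \<tau> j \<omega> \<le> ereal (t + 1) \<and> ereal t < \<tau> j \<omega>}" for j
  proof -
    have "\<tau> j \<omega> \<le> ereal (t + 1)" using that by auto
    note r = jump_time_real[OF \<tau> this]
    have "ereal t < ereal (real_of_ereal (\<tau> j \<omega>))" using that r(1) by auto
    then have lt: "t < real_of_ereal (\<tau> j \<omega>)" by simp
    have "eventually (\<lambda>s. s < real_of_ereal (\<tau> j \<omega>)) (at_right t)"
      using lt unfolding eventually_at_right_field by (intro exI[of _ "real_of_ereal (\<tau> j \<omega>)"]) auto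
    then show ?thesis
    proof eventually_elim
      case (elim s)
      then have "ereal s < ereal (real_of_ereal (\<tau> j \<omega>))" by simp
      then show ?case by (simp only: r(1))
    qed
  qed
  ultimately have "eventually (\<lambda>s. \<forall>j\<in>{j. \<tau> j \<omega> \<le> ereal (t + 1) \<and> ereal t < \<tau> j \<omega>}. ereal s < \<tau> j \<omega>) (at_right t)"
    by (intro eventually_ball_finite) auto
  moreover have "eventually (\<lambda>s. t < s \<and> s < t + 1) (at_right t)"
    unfolding eventually_at_right_field by (intro exI[of _ "t + 1"]) auto
  ultimately show ?thesis
  proof eventually_elim
    case (elim s)
    have "\<tau> j \<omega> \<le> ereal t" if "\<tau> j \<omega> \<le> ereal s" for j
    proof (rule ccontr)
      assume "\<not> ?thesis"
      moreover have "\<tau> j \<omega> \<le> ereal (t + 1)" using that elim(2) by (auto intro: order_trans)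
      ultimately have "ereal s < \<tau> j \<omega>" using elim(1) by auto
      with that show False by simp
    qed
    moreover have "ereal t \<le> ereal s" using elim(2) by simp
    ultimately show ?case by (auto intro: order_trans)
  qed
qed

lemma sum_jumps_right_tendsto:
  fixes g :: "real \<Rightarrow> nat \<Rightarrow> real"
  assumes \<tau>: "jump_times M \<tau>" "\<omega> \<in> space M" and g: "\<And>j. ((\<lambda>s. g s j) \<longlongrightarrow> g t j) (at_right t)"
  shows "((\<lambda>s. \<Sum>j | \<tau> j \<omega> \<le> ereal s. g s j) \<longlongrightarrow> (\<Sum>j | \<tau> j \<omega> \<le> ereal t. g t j)) (at_right t)"
proof -
  have "((\<lambda>s. \<Sum>j | \<tau> j \<omega> \<le> ereal t. g s j) \<longlongrightarrow> (\<Sum>j | \<tau> j \<omega> \<le> ereal t. g t j)) (at_right t)"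
    by (intro tendsto_sum g)
  moreover have "eventually (\<lambda>s. (\<Sum>j | \<tau> j \<omega> \<le> ereal t. g s j) = (\<Sum>j | \<tau> j \<omega> \<le> ereal s. g s j)) (at_right t)"
    using eventually_jumps_right[OF \<tau>, of t] by eventually_elim simp
  ultimately show ?thesis by (rule Lim_transform_eventually)
qed


section \<open>Positivity, paths and finite mean of the intensity\<close>

context risk_model
begin

abbreviation lam :: "real \<Rightarrow> 'a \<Rightarrow> real" where
  "lam \<equiv> intensity \<alpha> \<beta> lam0 l \<tau>1 Z1 \<tau>2 Z2"

abbreviation H :: "real \<Rightarrow> 'a measure" where
  "H \<equiv> natural_filtration M (claims \<tau>1 Z1)"

definition lam_left :: "real \<Rightarrow> 'a \<Rightarrow> real" where
  "lam_left t \<omega> = left_lim (\<lambda>s. lam s \<omega>) t"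

lemma subalgebra_family_G: "subalgebra_family M G"
  using usual unfolding usual_filtration_def subalgebra_family_def by blast

sublocale J1: adapted_marks M G \<tau>1 Z1
  using subalgebra_family_G jumps1 marks1 compensator1
  unfolding adapted_marks_def adapted_marks_axioms_def iid_marks_def has_compensator_def by auto

sublocale J2: adapted_marks M G \<tau>2 Z2
  using subalgebra_family_G jumps2 marks2 compensator2
  unfolding adapted_marks_def adapted_marks_axioms_def iid_marks_def has_compensator_def by auto

sublocale H: adapted_marks M H \<tau>1 Z1
  by (rule adapted_marks_natural_filtration[OF J1.adapted_marks_axioms])

lemma H_subset_G: "0 \<le> t \<Longrightarrow> sets (H t) \<subseteq> sets (G t)"
  by (rule sets_natural_filtration_subset)
     (auto simp: J1.space_F intro!: J1.measurable_F[OF _ _ J1.claims_adapted])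

sublocale F1: real_distribution F1 by (rule F1(1))
sublocale F2: real_distribution F2 by (rule F2(1))

lemma prob_space_mark_law: "prob_space (mark_law F1)" "prob_space (mark_law F2)"
  using F1(2) F2(2)
  by (auto intro!: prob_spaceI simp: emeasure_restrict_space space_restrict_space
      F1.emeasure_eq_measure F2.emeasure_eq_measure)

lemma l_measurable: "l \<in> borel_measurable (restrict_space borel {0<..})"
proof -
  have "(\<lambda>z::real. z) \<in> measurable (restrict_space borel {0<..}) (restrict_space borel {0..})"
    by (intro measurable_restrict_space2 measurable_restrict_space1) (auto simp: space_restrict_space intro: less_imp_le)
  from measurable_compose[OF this l_meas] show ?thesis .
qed

text \<open>The deterministic part is a convex combination of \<open>\<beta>\<close> and
  \<open>lam0\<close>, and the jump sums are nonnegative. The positive floor passes to the filter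
  and later turns null sets of the compensator into null sets of time, scenario and mark.\<close>

lemma intensity_ge:
  assumes "0 \<le> t" "\<omega> \<in> space M" shows "min \<beta> lam0 \<le> lam t \<omega>"
proof -
  have e: "0 \<le> exp (- \<alpha> * t)" "exp (- \<alpha> * t) \<le> 1" using pos assms by auto
  have "min \<beta> lam0 = min \<beta> lam0 * (1 - exp (- \<alpha> * t)) + min \<beta> lam0 * exp (- \<alpha> * t)" by (simp add: algebra_simps)
  also have "\<dots> \<le> \<beta> * (1 - exp (- \<alpha> * t)) + lam0 * exp (- \<alpha> * t)"
    using e by (intro add_mono mult_right_mono) auto
  also have "\<dots> = \<beta> + (lam0 - \<beta>) * exp (- \<alpha> * t)" by (simp add: algebra_simps)
  also have "\<dots> \<le> lam t \<omega>"
    using J1.Z_pos[OF assms(2)] J2.Z_pos[OF assms(2)] l_nonneg unfolding intensity_def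
    by (auto intro!: add_nonneg_nonneg sum_nonneg mult_nonneg_nonneg simp: less_imp_le add.assoc)
  finally show ?thesis .
qed

lemma intensity_floor_pos: "0 < min \<beta> lam0" using pos by simp

lemma intensity_adapted: "0 \<le> t \<Longrightarrow> lam t \<in> borel_measurable (G t)"
proof -
  assume t: "0 \<le> t"
  have "(\<lambda>x. exp (- \<alpha> * (t - fst (fst x))) * l (snd x)) \<in> borel_measurable (field_sigma {0..t} G)"
    "(\<lambda>x. exp (- \<alpha> * (t - fst (fst x))) * snd x) \<in> borel_measurable (field_sigma {0..t} G)"
    using J1.measurable_field_time[OF t] measurable_field_mark[OF l_measurable, of "{0..t}" G]
      J1.measurable_mark[of "{0..t}"] by measurable
  from J1.sum_jumps_adapted[OF t order_refl this(1)] J2.sum_jumps_adapted[OF t order_refl this(2)]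
  show ?thesis unfolding intensity_def by simp
qed

lemma lam_left_tendsto:
  assumes \<omega>: "\<omega> \<in> space M"
  shows "((\<lambda>s. lam s \<omega>) \<longlongrightarrow> \<beta> + (lam0 - \<beta>) * exp (- \<alpha> * t)
     + (\<Sum>j | \<tau>1 j \<omega> < ereal t. exp (- \<alpha> * (t - real_of_ereal (\<tau>1 j \<omega>))) * l (Z1 j \<omega>))
     + (\<Sum>j | \<tau>2 j \<omega> < ereal t. exp (- \<alpha> * (t - real_of_ereal (\<tau>2 j \<omega>))) * Z2 j \<omega>)) (at_left t)"
  unfolding intensity_def
  by (intro tendsto_add sum_jumps_left_tendsto[OF jumps1 \<omega>] sum_jumps_left_tendsto[OF jumps2 \<omega>] tendsto_intros)

lemma lam_left_eq:
  assumes "\<omega> \<in> space M" "0 < t"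
  shows "lam_left t \<omega> = \<beta> + (lam0 - \<beta>) * exp (- \<alpha> * t)
     + (\<Sum>j | \<tau>1 j \<omega> < ereal t. exp (- \<alpha> * (t - real_of_ereal (\<tau>1 j \<omega>))) * l (Z1 j \<omega>))
     + (\<Sum>j | \<tau>2 j \<omega> < ereal t. exp (- \<alpha> * (t - real_of_ereal (\<tau>2 j \<omega>))) * Z2 j \<omega>)"
  unfolding lam_left_def using left_lim_eqI[OF lam_left_tendsto[OF assms(1)] assms(2)] .

lemma intensity_cadlag: "\<omega> \<in> space M \<Longrightarrow> cadlag_on T (\<lambda>t. lam t \<omega>)"
  unfolding cadlag_on_def continuous_within
proof (intro conjI ballI)
  fix t assume \<omega>: "\<omega> \<in> space M"
  show "((\<lambda>t. lam t \<omega>) \<longlongrightarrow> lam t \<omega>) (at_right t)"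
    unfolding intensity_def
    by (intro tendsto_add sum_jumps_right_tendsto[OF jumps1 \<omega>] sum_jumps_right_tendsto[OF jumps2 \<omega>] tendsto_intros)
  show "\<exists>l. ((\<lambda>t. lam t \<omega>) \<longlongrightarrow> l) (at_left t)"
    using lam_left_tendsto[OF \<omega>] by blast
qed

lemma lam_left_measurable:
  "0 \<le> T \<Longrightarrow> (\<lambda>(t, \<omega>). lam_left t \<omega>) \<in> borel_measurable (predictable_sigma {0..T} G)"
  unfolding lam_left_def
  by (rule J1.predictable_left_lim) (auto intro: intensity_adapted intensity_cadlag)

lemma compensator1_formula:
  assumes "subalgebra_family M F" "\<And>t. 0 \<le> t \<Longrightarrow> sets (F t) \<subseteq> sets (G t)" "0 \<le> T"
    "K \<in> borel_measurable (field_sigma {0..T} F)"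
  shows "(\<integral>\<^sup>+\<omega>. (\<Sum>j | \<tau>1 j \<omega> \<le> ereal T. K ((real_of_ereal (\<tau>1 j \<omega>), \<omega>), Z1 j \<omega>)) \<partial>M) =
    (\<integral>\<^sup>+\<omega>. \<integral>\<^sup>+t. \<integral>\<^sup>+z. K ((t, \<omega>), z) * ennreal (lam_left t \<omega>) \<partial>mark_law F1 \<partial>clock T \<partial>M)"
  unfolding lam_left_def
  by (rule compensator_formula[OF J1.adapted_marks_axioms assms(1,2) compensator1 F1.events_eq_borel assms(3,4)])

lemma clock_swap:
  assumes "(\<lambda>(t, \<omega>). f t \<omega>) \<in> borel_measurable (time_scenario T M)"
  shows "(\<integral>\<^sup>+\<omega>. \<integral>\<^sup>+t. f t \<omega> \<partial>clock T \<partial>M) = (\<integral>\<^sup>+t. \<integral>\<^sup>+\<omega>. f t \<omega> \<partial>M \<partial>clock T)"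
proof -
  interpret C: finite_measure "clock T" by (rule finite_measure_clock)
  interpret P: pair_sigma_finite "clock T" M ..
  show ?thesis
    using P.Fubini'[of f] assms unfolding time_scenario_def by simp
qed

text \<open>The intensity feeds on the claims it produces. With \<open>cnt n\<close> the expected
  number of claims up to jump \<open>n\<close>, the compensator identity turns the bound of the
  intensity by past jumps into a linear integral inequality for \<open>cnt n\<close>. Truncation at
  jump \<open>n\<close> makes \<open>cnt n\<close> finite, the Gronwall bound does not depend on
  \<open>n\<close>, and Fatou removes the truncation.\<close>

lemma expected_intensity_finite:
  assumes l: "set_integrable F1 {0<..} l" and z2: "set_integrable F2 {0<..} (\<lambda>z. z)" and T: "0 \<le> T"
  shows "(\<integral>\<^sup>+\<omega>. ennreal (lam T \<omega>) \<partial>M) < \<infinity>"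
proof -
  interpret P1: prob_space "mark_law F1" by (rule prob_space_mark_law)
  interpret P2: prob_space "mark_law F2" by (rule prob_space_mark_law)
  have fin: "(\<integral>\<^sup>+z. ennreal (f z) \<partial>mark_law F) < \<top>"
    if f: "set_integrable F {0<..} f" and F: "sets F = sets borel" for f F
  proof -
    have "integrable (mark_law F) f"
      using f F by (simp add: integrable_restrict_space set_integrable_def)
    then have "(\<integral>\<^sup>+z. ennreal (norm (f z)) \<partial>mark_law F) < \<infinity>" unfolding integrable_iff_bounded by simp
    moreover have "(\<integral>\<^sup>+z. ennreal (f z) \<partial>mark_law F) \<le> (\<integral>\<^sup>+z. ennreal (norm (f z)) \<partial>mark_law F)"
      by (intro nn_integral_mono ennreal_leI) auto
    ultimately show ?thesis by (simp add: order_le_less_trans)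
  qed
  define El where "El = enn2real (\<integral>\<^sup>+z. ennreal (l z) \<partial>mark_law F1)"
  define Ez where "Ez = enn2real (\<integral>\<^sup>+z. ennreal z \<partial>mark_law F2)"
  have El: "(\<integral>\<^sup>+z. ennreal (l z) \<partial>mark_law F1) = ennreal El" "0 \<le> El"
    using fin[OF l] by (simp_all add: El_def)
  have Ez: "(\<integral>\<^sup>+z. ennreal z \<partial>mark_law F2) = ennreal Ez" "0 \<le> Ez"
    using fin[OF z2] by (simp_all add: Ez_def)
  have lm: "l \<in> borel_measurable (mark_law F1)"
    using l_measurable sets_mark_law[of F1] by (simp cong: measurable_cong_sets)
  \<comment> \<open>Indicator of the times up to jump \<open>n\<close>, that jump included; it is
    predictable because \<open>s \<le> \<tau>1 n\<close> can be checked at the rational times before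
    \<open>s\<close>.\<close>
  define k :: "nat \<Rightarrow> real \<Rightarrow> 'a \<Rightarrow> ennreal" where "k n s \<omega> = (if ereal s \<le> \<tau>1 n \<omega> then 1 else 0)" for n s \<omega>
  have k: "(\<lambda>(s, \<omega>). k n s \<omega>) \<in> borel_measurable (predictable_sigma {0..t} G)" if t: "0 \<le> t" for n t
  proof -
    have "{\<omega>\<in>space M. \<not> \<tau>1 n \<omega> \<le> ereal q} \<in> sets (G q)" if "0 \<le> q" for q
    proof -
      have "{\<omega>\<in>space M. \<not> \<tau>1 n \<omega> \<le> ereal q} = space (G q) - {\<omega>\<in>space M. \<tau>1 n \<omega> \<le> ereal q}"
        using J1.space_F[OF that] by auto
      then show ?thesis using J1.tau_adapted[OF that] by auto
    qed
    then have "{x\<in>space (predictable_sigma {0..t} G). \<forall>q\<in>\<rat> \<inter> {0..t}. q < fst x \<longrightarrow> \<not> \<tau>1 n (snd x) \<le> ereal q}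
        \<in> sets (predictable_sigma {0..t} G)"
      by (intro J1.predictable_until t)
    also have "{x\<in>space (predictable_sigma {0..t} G). \<forall>q\<in>\<rat> \<inter> {0..t}. q < fst x \<longrightarrow> \<not> \<tau>1 n (snd x) \<le> ereal q} =
      {x\<in>space (predictable_sigma {0..t} G). ereal (fst x) \<le> \<tau>1 n (snd x)}"
    proof (intro Collect_cong conj_cong refl iffI ballI impI)
      fix x assume x: "x \<in> space (predictable_sigma {0..t} G)"
        and all: "\<forall>q\<in>\<rat> \<inter> {0..t}. q < fst x \<longrightarrow> \<not> \<tau>1 n (snd x) \<le> ereal q"
      have x': "0 \<le> fst x" "fst x \<le> t" "snd x \<in> space M" using x unfolding J1.space_predictable by auto
      show "ereal (fst x) \<le> \<tau>1 n (snd x)"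
      proof (rule ccontr)
        assume *: "\<not> ?thesis"
        then have "\<tau>1 n (snd x) \<le> ereal (fst x)" by simp
        note r = jump_time_real[OF jumps1 x'(3) this]
        have "ereal (real_of_ereal (\<tau>1 n (snd x))) < ereal (fst x)" using * by (simp only: r(1) not_le)
        then have "real_of_ereal (\<tau>1 n (snd x)) < fst x" by simp
        then obtain q where q: "q \<in> \<rat>" "real_of_ereal (\<tau>1 n (snd x)) < q" "q < fst x"
          using Rats_dense_in_real by blast
        then have "ereal (real_of_ereal (\<tau>1 n (snd x))) \<le> ereal q" by simp
        then have "\<tau>1 n (snd x) \<le> ereal q" by (simp only: r(1))
        then show False using all q x' r(2) by auto
      qed
    next
      fix x q assume "ereal (fst x) \<le> \<tau>1 n (snd x)" "q < fst x"
      then show "\<not> \<tau>1 n (snd x) \<le> ereal q" by (metis leD less_ereal.simps(1) order_less_le_trans)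
    qed
    finally show ?thesis unfolding k_def split_beta by (intro measurable_If) auto
  qed
  define cnt where "cnt n t = (\<integral>\<^sup>+\<omega>. (\<Sum>j | \<tau>1 j \<omega> \<le> ereal t. k n (real_of_ereal (\<tau>1 j \<omega>)) \<omega>) \<partial>M)" for n t
  define wl where "wl n t \<omega> = (\<Sum>j | \<tau>1 j \<omega> \<le> ereal t. k n (real_of_ereal (\<tau>1 j \<omega>)) \<omega> * ennreal (l (Z1 j \<omega>)))" for n t \<omega>
  define z where "z t \<omega> = (\<Sum>j | \<tau>2 j \<omega> \<le> ereal t. ennreal (Z2 j \<omega>))" for t \<omega>
  have kf: "(\<lambda>x. k n (fst (fst x)) (snd (fst x))) \<in> borel_measurable (field_sigma {0..t} G)" if "0 \<le> t" for n t
    using J1.measurable_field_fst[OF k[OF that, of n]] by (simp add: split_beta)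
  have klf: "(\<lambda>x. k n (fst (fst x)) (snd (fst x)) * ennreal (l (snd x))) \<in> borel_measurable (field_sigma {0..t} G)" if "0 \<le> t" for n t
    using kf[OF that] measurable_field_mark[OF l_measurable] by measurable
  have zf: "(\<lambda>x. ennreal (snd x)) \<in> borel_measurable (field_sigma {0..t} G)" for t
    using J1.measurable_mark by measurable
  have cnt_eq: "cnt n t = (\<integral>\<^sup>+\<omega>. \<integral>\<^sup>+s. k n s \<omega> * ennreal (lam_left s \<omega>) \<partial>clock t \<partial>M)" if "0 \<le> t" for n t
    using compensator1_formula[OF J1.subalgebra_family_axioms order_refl that kf[OF that, of n]]
    unfolding cnt_def using P1.emeasure_space_1 by (simp add: space_restrict_space)
  \<comment> \<open>The compensator has product form, so the weights \<open>l\<close> integrate out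
    to their mean \<open>El\<close> and leave the compensator of \<open>cnt n\<close>.\<close>
  have wl_eq: "(\<integral>\<^sup>+\<omega>. wl n t \<omega> \<partial>M) = ennreal El * cnt n t" if t: "0 \<le> t" for n t
  proof -
    have m: "(\<lambda>(s, \<omega>). k n s \<omega> * ennreal (lam_left s \<omega>)) \<in> borel_measurable (predictable_sigma {0..t} G)"
      using k[OF t, of n] lam_left_measurable[OF t] unfolding split_beta by measurable
    have ms: "(\<lambda>s. k n s \<omega> * ennreal (lam_left s \<omega>)) \<in> borel_measurable (clock t)" if "\<omega> \<in> space M" for \<omega>
      using J1.predictable_path[OF m t that] by (simp cong: measurable_cong_sets add: sets_restrict_space_cong[of lborel borel])
    have "(\<integral>\<^sup>+\<omega>. wl n t \<omega> \<partial>M) = (\<integral>\<^sup>+\<omega>. \<integral>\<^sup>+s. \<integral>\<^sup>+z. k n s \<omega> * ennreal (l z) * ennreal (lam_left s \<omega>) \<partial>mark_law F1 \<partial>clock t \<partial>M)"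
      using compensator1_formula[OF J1.subalgebra_family_axioms order_refl t klf[OF t, of n]]
      unfolding wl_def by simp
    also have "\<dots> = (\<integral>\<^sup>+\<omega>. \<integral>\<^sup>+s. ennreal El * (k n s \<omega> * ennreal (lam_left s \<omega>)) \<partial>clock t \<partial>M)"
      using lm by (simp add: nn_integral_cmult nn_integral_multc El(1) ac_simps)
    also have "\<dots> = (\<integral>\<^sup>+\<omega>. ennreal El * (\<integral>\<^sup>+s. k n s \<omega> * ennreal (lam_left s \<omega>) \<partial>clock t) \<partial>M)"
      by (intro nn_integral_cong nn_integral_cmult ms)
    also have "\<dots> = ennreal El * cnt n t"
    proof (subst cnt_eq[OF t], rule nn_integral_cmult)
      interpret C: finite_measure "clock t" by (rule finite_measure_clock)
      have "(\<lambda>(s, \<omega>). k n s \<omega> * ennreal (lam_left s \<omega>)) \<in> borel_measurable (clock t \<Otimes>\<^sub>M M)"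
        using J1.measurable_time_scenario[OF m t] by (simp add: time_scenario_def)
      then have "(\<lambda>(\<omega>, s). k n s \<omega> * ennreal (lam_left s \<omega>)) \<in> borel_measurable (M \<Otimes>\<^sub>M clock t)"
        using measurable_compose[OF measurable_pair_swap'] by (simp add: split_beta)
      then show "(\<lambda>\<omega>. \<integral>\<^sup>+s. k n s \<omega> * ennreal (lam_left s \<omega>) \<partial>clock t) \<in> borel_measurable M"
        by (rule C.borel_measurable_nn_integral)
    qed
    finally show ?thesis .
  qed
  have z_eq: "(\<integral>\<^sup>+\<omega>. z t \<omega> \<partial>M) \<le> ennreal (\<rho> * t * Ez)" if t: "0 \<le> t" for t
  proof -
    have "(\<integral>\<^sup>+\<omega>. z t \<omega> \<partial>M) = (\<integral>\<^sup>+\<omega>. \<integral>\<^sup>+s. \<integral>\<^sup>+z. ennreal z * ennreal \<rho> \<partial>mark_law F2 \<partial>clock t \<partial>M)"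
      using compensator_formula[OF J2.adapted_marks_axioms J1.subalgebra_family_axioms order_refl compensator2 F2.events_eq_borel t zf]
      unfolding z_def by simp
    also have "(\<integral>\<^sup>+z. ennreal z * ennreal \<rho> \<partial>mark_law F2) = ennreal Ez * ennreal \<rho>"
    proof -
      have "(\<lambda>z. z) \<in> borel_measurable (mark_law F2)"
        by (intro measurable_restrict_space1) simp
      then show ?thesis by (subst nn_integral_multc) (auto simp: Ez)
    qed
    also have "(\<integral>\<^sup>+\<omega>. \<integral>\<^sup>+s. ennreal Ez * ennreal \<rho> \<partial>clock t \<partial>M) = ennreal Ez * ennreal \<rho> * ennreal t"
      using t by (simp add: emeasure_space_1 emeasure_restrict_space space_restrict_space)
    also have "\<dots> = ennreal (\<rho> * t * Ez)"
      using t pos Ez(2) by (simp add: ennreal_mult[symmetric] ac_simps)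
    finally show ?thesis by simp
  qed
  have lam_le: "ennreal c * ennreal (\<beta> + (lam0 - \<beta>) * exp (- \<alpha> * s)) \<le> ennreal c * ennreal (\<beta> + lam0)" if "0 \<le> s" for s c
  proof (intro mult_left_mono ennreal_leI)
    have e: "exp (- \<alpha> * s) \<le> 1" "0 \<le> exp (- \<alpha> * s)" using pos that by auto
    have "\<beta> + (lam0 - \<beta>) * exp (- \<alpha> * s) = \<beta> * (1 - exp (- \<alpha> * s)) + lam0 * exp (- \<alpha> * s)" by (simp add: algebra_simps)
    also have "\<dots> \<le> \<beta> * 1 + lam0 * 1" using e pos by (intro add_mono mult_left_mono) auto
    finally show "\<beta> + (lam0 - \<beta>) * exp (- \<alpha> * s) \<le> \<beta> + lam0" by simp
  qed simp
  have base: "0 \<le> \<beta> + (lam0 - \<beta>) * exp (- \<alpha> * s)" if "0 \<le> s" for s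
  proof -
    have e: "exp (- \<alpha> * s) \<le> 1" "0 \<le> exp (- \<alpha> * s)" using pos that by auto
    have "\<beta> + (lam0 - \<beta>) * exp (- \<alpha> * s) = \<beta> * (1 - exp (- \<alpha> * s)) + lam0 * exp (- \<alpha> * s)" by (simp add: algebra_simps)
    then show ?thesis using e pos by simp
  qed
  have sum_le: "ennreal (\<Sum>j\<in>J. exp (- \<alpha> * (s - real_of_ereal (\<tau> j \<omega>))) * x j) \<le> (\<Sum>j\<in>J'. ennreal (x j))"
    if "J \<subseteq> J'" "finite J'" "\<And>j. j \<in> J' \<Longrightarrow> 0 \<le> x j" "\<And>j. j \<in> J' \<Longrightarrow> real_of_ereal (\<tau> j \<omega>) \<le> s"
    for J J' :: "nat set" and s \<tau> x and \<omega> :: 'a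
  proof -
    have "exp (- \<alpha> * (s - real_of_ereal (\<tau> j \<omega>))) * x j \<le> 1 * x j" if "j \<in> J'" for j
      using pos that \<open>\<And>j. j \<in> J' \<Longrightarrow> 0 \<le> x j\<close> \<open>\<And>j. j \<in> J' \<Longrightarrow> real_of_ereal (\<tau> j \<omega>) \<le> s\<close>
      by (intro mult_right_mono) auto
    then have "(\<Sum>j\<in>J. exp (- \<alpha> * (s - real_of_ereal (\<tau> j \<omega>))) * x j) \<le> (\<Sum>j\<in>J. x j)"
      using that(1) by (intro sum_mono) auto
    also have "\<dots> \<le> (\<Sum>j\<in>J'. x j)" using that by (intro sum_mono2) auto
    finally have "ennreal (\<Sum>j\<in>J. exp (- \<alpha> * (s - real_of_ereal (\<tau> j \<omega>))) * x j) \<le> ennreal (\<Sum>j\<in>J'. x j)"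
      by (rule ennreal_leI)
    also have "\<dots> = (\<Sum>j\<in>J'. ennreal (x j))" using that by (simp add: sum_ennreal)
    finally show ?thesis .
  qed
  \<comment> \<open>Up to jump \<open>n\<close> none of the earlier jumps is cut off, so
    \<open>wl n\<close> contains every contribution of the claims to the intensity; the exponential
    decay is bounded by one.\<close>
  have step: "k n s \<omega> * ennreal (lam_left s \<omega>) \<le> ennreal (\<beta> + lam0) + wl n s \<omega> + z s \<omega>"
    if \<omega>: "\<omega> \<in> space M" and s: "0 < s" for n s \<omega>
  proof (cases "ereal s \<le> \<tau>1 n \<omega>")
    case True
    have 1: "k n (real_of_ereal (\<tau>1 j \<omega>)) \<omega> = 1" if "\<tau>1 j \<omega> \<le> ereal s" for j
      using jump_time_real(1)[OF jumps1 \<omega> that] that True unfolding k_def by (auto intro: order_trans)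
    have lp: "0 \<le> l (Z1 j \<omega>)" for j using l_nonneg J1.Z_pos[OF \<omega>, of j] by auto
    have n1: "0 \<le> (\<Sum>j | \<tau>1 j \<omega> < ereal s. exp (- \<alpha> * (s - real_of_ereal (\<tau>1 j \<omega>))) * l (Z1 j \<omega>))"
      using lp by (auto intro!: sum_nonneg)
    have n2: "0 \<le> (\<Sum>j | \<tau>2 j \<omega> < ereal s. exp (- \<alpha> * (s - real_of_ereal (\<tau>2 j \<omega>))) * Z2 j \<omega>)"
      using J2.Z_pos[OF \<omega>] by (auto intro!: sum_nonneg simp: less_imp_le)
    have "k n s \<omega> * ennreal (lam_left s \<omega>) = ennreal (lam_left s \<omega>)" using True by (simp add: k_def)
    also have "\<dots> = ennreal (\<beta> + (lam0 - \<beta>) * exp (- \<alpha> * s))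
      + ennreal (\<Sum>j | \<tau>1 j \<omega> < ereal s. exp (- \<alpha> * (s - real_of_ereal (\<tau>1 j \<omega>))) * l (Z1 j \<omega>))
      + ennreal (\<Sum>j | \<tau>2 j \<omega> < ereal s. exp (- \<alpha> * (s - real_of_ereal (\<tau>2 j \<omega>))) * Z2 j \<omega>)"
      unfolding lam_left_eq[OF \<omega> s] using n1 n2 base[of s] s by (simp only: ennreal_plus add_nonneg_nonneg less_imp_le)
    also have "\<dots> \<le> ennreal (\<beta> + lam0) + wl n s \<omega> + z s \<omega>"
    proof (intro add_mono)
      show "ennreal (\<beta> + (lam0 - \<beta>) * exp (- \<alpha> * s)) \<le> ennreal (\<beta> + lam0)"
        using lam_le[of s 1] s by simp
      have "ennreal (\<Sum>j | \<tau>1 j \<omega> < ereal s. exp (- \<alpha> * (s - real_of_ereal (\<tau>1 j \<omega>))) * l (Z1 j \<omega>))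
        \<le> (\<Sum>j | \<tau>1 j \<omega> \<le> ereal s. ennreal (l (Z1 j \<omega>)))"
        using jump_time_real(3)[OF jumps1 \<omega>] by (intro sum_le jump_timesD(4)[OF jumps1 \<omega>] lp) auto
      also have "\<dots> = wl n s \<omega>" unfolding wl_def using 1 by (intro sum.cong) auto
      finally show "ennreal (\<Sum>j | \<tau>1 j \<omega> < ereal s. exp (- \<alpha> * (s - real_of_ereal (\<tau>1 j \<omega>))) * l (Z1 j \<omega>)) \<le> wl n s \<omega>" .
      show "ennreal (\<Sum>j | \<tau>2 j \<omega> < ereal s. exp (- \<alpha> * (s - real_of_ereal (\<tau>2 j \<omega>))) * Z2 j \<omega>) \<le> z s \<omega>"
        unfolding z_def using jump_time_real(3)[OF jumps2 \<omega>] J2.Z_pos[OF \<omega>]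
        by (intro sum_le jump_timesD(4)[OF jumps2 \<omega>]) (auto simp: less_imp_le)
    qed
    finally show ?thesis .
  qed (simp add: k_def)
  have wlm: "wl n t \<in> borel_measurable M" and zm: "z t \<in> borel_measurable M" if t: "0 \<le> t" for n t
    using J1.measurable_F'[OF t J1.sum_jumps_adapted_ennreal[OF t order_refl klf[OF t, of n]]]
      J1.measurable_F'[OF t J2.sum_jumps_adapted_ennreal[OF t order_refl zf]]
    unfolding wl_def[abs_def] z_def[abs_def] by simp_all
  \<comment> \<open>External contribution to the mean intensity: a bound for the deterministic part
    and for the expected jumps of the second process up to \<open>T\<close>.\<close>
  define A where "A = \<beta> + lam0 + \<rho> * T * Ez"
  have A: "0 \<le> A" using pos T Ez(2) by (simp add: A_def)
  \<comment> \<open>Jumps are numbered from \<open>0\<close>, so at most \<open>n + 1\<close> of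
    them occur up to jump \<open>n\<close>.\<close>
  have cnt_le: "cnt n t \<le> ennreal (real (Suc n))" for n t
  proof -
    have "(\<Sum>j | \<tau>1 j \<omega> \<le> ereal t. k n (real_of_ereal (\<tau>1 j \<omega>)) \<omega>) \<le> ennreal (real (Suc n))" if \<omega>: "\<omega> \<in> space M" for \<omega>
    proof -
      have "(\<Sum>j | \<tau>1 j \<omega> \<le> ereal t. k n (real_of_ereal (\<tau>1 j \<omega>)) \<omega>) = (\<Sum>j\<in>{j. \<tau>1 j \<omega> \<le> ereal t} \<inter> {..n}. k n (real_of_ereal (\<tau>1 j \<omega>)) \<omega>)"
      proof (rule sum.mono_neutral_right[OF jump_timesD(4)[OF jumps1 \<omega>]])
        show "\<forall>j\<in>{j. \<tau>1 j \<omega> \<le> ereal t} - {j. \<tau>1 j \<omega> \<le> ereal t} \<inter> {..n}. k n (real_of_ereal (\<tau>1 j \<omega>)) \<omega> = 0"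
        proof
          fix j assume j: "j \<in> {j. \<tau>1 j \<omega> \<le> ereal t} - {j. \<tau>1 j \<omega> \<le> ereal t} \<inter> {..n}"
          then have nj: "n < j" "\<tau>1 j \<omega> \<le> ereal t" by auto
          then have "\<tau>1 n \<omega> \<le> \<tau>1 j \<omega>" using incseqD[OF jump_timesD(2)[OF jumps1 \<omega>], of n j] by auto
          then have "\<tau>1 n \<omega> < \<infinity>" using nj(2) by (auto simp: less_top[symmetric] top_unique)
          then have "\<tau>1 n \<omega> < \<tau>1 j \<omega>" by (rule jump_timesD(3)[OF jumps1 \<omega> _ nj(1)])
          then show "k n (real_of_ereal (\<tau>1 j \<omega>)) \<omega> = 0"
            using jump_time_real(1)[OF jumps1 \<omega> nj(2)] unfolding k_def by auto
        qed
      qed auto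
      also have "\<dots> \<le> (\<Sum>j\<in>{j. \<tau>1 j \<omega> \<le> ereal t} \<inter> {..n}. 1)" by (intro sum_mono) (auto simp: k_def)
      also have "\<dots> \<le> (\<Sum>j\<in>{..n}. 1)" by (intro sum_mono2) auto
      also have "\<dots> = ennreal (real (Suc n))" by (simp add: ennreal_of_nat_eq_real_of_nat)
      finally show ?thesis .
    qed
    then have "cnt n t \<le> (\<integral>\<^sup>+\<omega>. ennreal (real (Suc n)) \<partial>M)"
      unfolding cnt_def by (intro nn_integral_mono) auto
    then show ?thesis by (simp add: emeasure_space_1)
  qed
  have cnt_step: "cnt n t \<le> (\<integral>\<^sup>+s. ennreal A + ennreal El * cnt n s \<partial>clock t)" if t: "t \<in> {0..T}" for n t
  proof -
    have t0: "0 \<le> t" using t by simp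
    have m: "(\<lambda>(s, \<omega>). k n s \<omega> * ennreal (lam_left s \<omega>)) \<in> borel_measurable (predictable_sigma {0..t} G)"
      using k[OF t0, of n] lam_left_measurable[OF t0] unfolding split_beta by measurable
    have "cnt n t = (\<integral>\<^sup>+s. \<integral>\<^sup>+\<omega>. k n s \<omega> * ennreal (lam_left s \<omega>) \<partial>M \<partial>clock t)"
      unfolding cnt_eq[OF t0] by (rule clock_swap[OF J1.measurable_time_scenario[OF m t0]])
    also have "\<dots> \<le> (\<integral>\<^sup>+s. ennreal A + ennreal El * cnt n s \<partial>clock t)"
    proof (rule nn_integral_mono_AE)
      have "AE s in clock t. s \<noteq> 0 \<and> s \<in> {0..t}"
        unfolding AE_clock using AE_lborel_singleton[of 0] by eventually_elim auto
      then show "AE s in clock t. (\<integral>\<^sup>+\<omega>. k n s \<omega> * ennreal (lam_left s \<omega>) \<partial>M) \<le> ennreal A + ennreal El * cnt n s"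
      proof eventually_elim
        case (elim s)
        then have s: "0 < s" "s \<le> T" using t by auto
        have "(\<integral>\<^sup>+\<omega>. k n s \<omega> * ennreal (lam_left s \<omega>) \<partial>M) \<le> (\<integral>\<^sup>+\<omega>. ennreal (\<beta> + lam0) + wl n s \<omega> + z s \<omega> \<partial>M)"
          using s by (intro nn_integral_mono step)
        also have "\<dots> = ennreal (\<beta> + lam0) + ennreal El * cnt n s + (\<integral>\<^sup>+\<omega>. z s \<omega> \<partial>M)"
          using wlm[of s n] zm[of s] s wl_eq[of s n]
          by (simp add: nn_integral_add emeasure_space_1)
        also have "\<dots> \<le> ennreal (\<beta> + lam0) + ennreal El * cnt n s + ennreal (\<rho> * T * Ez)"
          using z_eq[of s] s pos Ez(2)
          by (intro add_left_mono) (auto intro!: order_trans[OF z_eq[of s]] ennreal_leI mult_right_mono mult_left_mono)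
        also have "\<dots> = ennreal A + ennreal El * cnt n s"
          unfolding A_def using pos T Ez(2) by (simp add: ennreal_plus ac_simps)
        finally show ?case .
      qed
    qed
    finally show ?thesis .
  qed
  define B where "B = 2 * A * T * exp (2 * (El + 1) * T)"
  have cnt_B: "cnt n T \<le> ennreal B" for n
    unfolding B_def using T
    by (intro gronwall_bounded[OF T A El(2), of "cnt n" "real (Suc n)"] cnt_le cnt_step) auto
  let ?wl = "\<lambda>\<omega>. \<Sum>j | \<tau>1 j \<omega> \<le> ereal T. ennreal (l (Z1 j \<omega>))"
  \<comment> \<open>On each path the truncation has no effect once \<open>n\<close> reaches the
    index of the last jump up to \<open>T\<close>.\<close>
  have lim: "(\<lambda>n. wl n T \<omega>) \<longlonglongrightarrow> ?wl \<omega>" if \<omega>: "\<omega> \<in> space M" for \<omega>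
  proof (rule tendsto_eventually)
    obtain N where N: "\<And>j. \<tau>1 j \<omega> \<le> ereal T \<Longrightarrow> j \<le> N"
      using finite_nat_set_iff_bounded_le[THEN iffD1, OF jump_timesD(4)[OF jumps1 \<omega>, of T]] by auto
    have "wl n T \<omega> = ?wl \<omega>" if "N \<le> n" for n
      unfolding wl_def
    proof (intro sum.cong refl)
      fix j assume "j \<in> {j. \<tau>1 j \<omega> \<le> ereal T}"
      then have j: "\<tau>1 j \<omega> \<le> ereal T" by simp
      then have "\<tau>1 j \<omega> \<le> \<tau>1 n \<omega>" using N[OF j] that incseqD[OF jump_timesD(2)[OF jumps1 \<omega>], of j n] by auto
      then show "k n (real_of_ereal (\<tau>1 j \<omega>)) \<omega> * ennreal (l (Z1 j \<omega>)) = ennreal (l (Z1 j \<omega>))"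
        unfolding k_def jump_time_real(1)[OF jumps1 \<omega> j] by simp
    qed
    then show "eventually (\<lambda>n. wl n T \<omega> = ?wl \<omega>) sequentially" unfolding eventually_sequentially by blast
  qed
  have "(\<integral>\<^sup>+\<omega>. ?wl \<omega> \<partial>M) = (\<integral>\<^sup>+\<omega>. liminf (\<lambda>n. wl n T \<omega>) \<partial>M)"
    by (intro nn_integral_cong lim_imp_Liminf[symmetric] lim) auto
  also have "\<dots> \<le> liminf (\<lambda>n. \<integral>\<^sup>+\<omega>. wl n T \<omega> \<partial>M)"
    by (rule nn_integral_liminf) (rule wlm[OF T])
  also have "\<dots> \<le> ennreal El * ennreal B"
    unfolding wl_eq[OF T] by (rule Liminf_le) (auto intro!: always_eventually mult_left_mono cnt_B)
  finally have wl_fin: "(\<integral>\<^sup>+\<omega>. ?wl \<omega> \<partial>M) \<le> ennreal El * ennreal B" .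
  have "ennreal (lam T \<omega>) \<le> ennreal (\<beta> + lam0) + ?wl \<omega> + z T \<omega>" if \<omega>: "\<omega> \<in> space M" for \<omega>
  proof -
    have lp: "0 \<le> l (Z1 j \<omega>)" for j using l_nonneg J1.Z_pos[OF \<omega>, of j] by auto
    have n1: "0 \<le> (\<Sum>j | \<tau>1 j \<omega> \<le> ereal T. exp (- \<alpha> * (T - real_of_ereal (\<tau>1 j \<omega>))) * l (Z1 j \<omega>))"
      using lp by (auto intro!: sum_nonneg)
    have n2: "0 \<le> (\<Sum>j | \<tau>2 j \<omega> \<le> ereal T. exp (- \<alpha> * (T - real_of_ereal (\<tau>2 j \<omega>))) * Z2 j \<omega>)"
      using J2.Z_pos[OF \<omega>] by (auto intro!: sum_nonneg simp: less_imp_le)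
    have "ennreal (lam T \<omega>) = ennreal (\<beta> + (lam0 - \<beta>) * exp (- \<alpha> * T))
      + ennreal (\<Sum>j | \<tau>1 j \<omega> \<le> ereal T. exp (- \<alpha> * (T - real_of_ereal (\<tau>1 j \<omega>))) * l (Z1 j \<omega>))
      + ennreal (\<Sum>j | \<tau>2 j \<omega> \<le> ereal T. exp (- \<alpha> * (T - real_of_ereal (\<tau>2 j \<omega>))) * Z2 j \<omega>)"
      unfolding intensity_def using n1 n2 base[OF T] by (simp only: ennreal_plus add_nonneg_nonneg)
    also have "\<dots> \<le> ennreal (\<beta> + lam0) + ?wl \<omega> + z T \<omega>"
    proof (intro add_mono)
      show "ennreal (\<beta> + (lam0 - \<beta>) * exp (- \<alpha> * T)) \<le> ennreal (\<beta> + lam0)"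
        using lam_le[OF T, of 1] by simp
      show "ennreal (\<Sum>j | \<tau>1 j \<omega> \<le> ereal T. exp (- \<alpha> * (T - real_of_ereal (\<tau>1 j \<omega>))) * l (Z1 j \<omega>)) \<le> ?wl \<omega>"
        using jump_time_real(3)[OF jumps1 \<omega>] by (intro sum_le jump_timesD(4)[OF jumps1 \<omega>] lp) auto
      show "ennreal (\<Sum>j | \<tau>2 j \<omega> \<le> ereal T. exp (- \<alpha> * (T - real_of_ereal (\<tau>2 j \<omega>))) * Z2 j \<omega>) \<le> z T \<omega>"
        unfolding z_def using jump_time_real(3)[OF jumps2 \<omega>] J2.Z_pos[OF \<omega>]
        by (intro sum_le jump_timesD(4)[OF jumps2 \<omega>]) (auto simp: less_imp_le)
    qed
    finally show ?thesis .
  qed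
  then have "(\<integral>\<^sup>+\<omega>. ennreal (lam T \<omega>) \<partial>M) \<le> (\<integral>\<^sup>+\<omega>. ennreal (\<beta> + lam0) + ?wl \<omega> + z T \<omega> \<partial>M)"
    by (intro nn_integral_mono)
  also have "\<dots> = ennreal (\<beta> + lam0) + (\<integral>\<^sup>+\<omega>. ?wl \<omega> \<partial>M) + (\<integral>\<^sup>+\<omega>. z T \<omega> \<partial>M)"
  proof -
    have "(\<lambda>x. ennreal (l (snd x))) \<in> borel_measurable (field_sigma {0..T} G)"
      using measurable_field_mark[OF l_measurable] by measurable
    then have "?wl \<in> borel_measurable M"
      using J1.measurable_F'[OF T J1.sum_jumps_adapted_ennreal[OF T order_refl]] by fastforce
    then show ?thesis using zm[OF T] by (simp add: nn_integral_add emeasure_space_1)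
  qed
  also have "\<dots> \<le> ennreal (\<beta> + lam0) + ennreal El * ennreal B + ennreal (\<rho> * T * Ez)"
    by (intro add_mono order_refl wl_fin z_eq T)
  also have "\<dots> < \<infinity>" by (simp add: ennreal_mult_eq_top_iff less_top[symmetric])
  finally show ?thesis .
qed

end

section \<open>The filtered intensity\<close>

text \<open>By right-continuity a value below \<open>a\<close> would persist at slightly later
  rational times. The endpoint \<open>T\<close> is left out since it need not be rational.\<close>

lemma cadlag_on_ge_rational:
  assumes f: "cadlag_on T f" and ge: "\<And>q. q \<in> \<rat> \<Longrightarrow> 0 \<le> q \<Longrightarrow> q \<le> T \<Longrightarrow> a \<le> f q" and t: "0 \<le> t" "t < T"
  shows "a \<le> f t"
proof (rule ccontr)
  assume "\<not> a \<le> f t"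
  then have "eventually (\<lambda>s. f s < a) (at_right t)"
    using cadlag_on_right[OF f t] by (intro order_tendstoD) auto
  then obtain b where b: "t < b" "\<And>s. t < s \<Longrightarrow> s < b \<Longrightarrow> f s < a"
    by (auto simp: eventually_at_right_field)
  then obtain q where "q \<in> \<rat>" "t < q" "q < min b T" using Rats_dense_in_real[of t "min b T"] t by auto
  then show False using b(2)[of q] ge[of q] t by auto
qed

text \<open>The samples are taken at the next grid point strictly after \<open>t\<close>, capped at
  \<open>T\<close>. At each level the sampling time takes countably many values, which is what makes
  a right-continuous process jointly measurable.\<close>

lemma cadlag_on_right_seq:
  assumes f: "cadlag_on T f" and t: "0 \<le> t" "t \<le> T"
  shows "(\<lambda>n. f (min T ((of_int \<lfloor>t * 2 ^ n\<rfloor> + 1) / 2 ^ n))) \<longlonglongrightarrow> f t"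
proof (cases "t < T")
  case True
  let ?s = "\<lambda>n. min T ((of_int \<lfloor>t * 2 ^ n\<rfloor> + 1) / 2 ^ n) :: real"
  have lower: "t < ?s n" for n
  proof -
    have "t * 2 ^ n < of_int \<lfloor>t * 2 ^ n\<rfloor> + 1" by linarith
    then show ?thesis using True by (simp add: field_simps)
  qed
  have upper: "?s n \<le> t + (1/2) ^ n" for n
    by (simp add: field_simps power_divide min_def) linarith
  have "(\<lambda>n. t + (1/2) ^ n) \<longlonglongrightarrow> t + 0"
    by (intro tendsto_intros LIMSEQ_power_zero) simp
  then have lim: "(\<lambda>n. t + (1/2) ^ n) \<longlonglongrightarrow> t" by simp
  have "?s \<longlonglongrightarrow> t"
    by (rule tendsto_sandwich[OF always_eventually always_eventually tendsto_const lim])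
       (use lower upper in \<open>auto intro: less_imp_le\<close>)
  then have "filterlim ?s (at_right t) sequentially"
    using lower by (auto simp: filterlim_at less_imp_neq[symmetric] intro!: always_eventually)
  from filterlim_compose[OF cadlag_on_right[OF f t(1) True] this] show ?thesis .
next
  case False
  then have tT: "t = T" using t by simp
  have "T \<le> (of_int \<lfloor>T * 2 ^ n\<rfloor> + 1) / 2 ^ n" for n
    by (simp add: field_simps) linarith
  then have "min T ((of_int \<lfloor>t * 2 ^ n\<rfloor> + 1) / 2 ^ n) = T" for n
    unfolding tT by (rule min_absorb1)
  then show ?thesis using tT by simp
qed

lemma set_integrable_le_exp:
  fixes f g :: "real \<Rightarrow> real"
  assumes g: "set_integrable F {0<..} (\<lambda>z. exp (g z))" and F: "sets F = sets borel"
    and f: "f \<in> borel_measurable (restrict_space borel {0<..})"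
    and le: "\<And>z. 0 < z \<Longrightarrow> \<bar>f z\<bar> \<le> C * exp (g z)"
  shows "set_integrable F {0<..} f"
proof -
  have 1: "integrable F (\<lambda>z. C * (indicator {0<..} z *\<^sub>R exp (g z)))"
    using g unfolding set_integrable_def by simp
  have "(\<lambda>z. indicator {0<..} z *\<^sub>R f z) \<in> borel_measurable borel"
    using f by (subst (asm) borel_measurable_restrict_space_iff) auto
  then have 2: "(\<lambda>z. indicator {0<..} z *\<^sub>R f z) \<in> borel_measurable F"
    using F by (simp cong: measurable_cong_sets)
  have "norm (indicator {0<..} z *\<^sub>R f z) \<le> norm (C * (indicator {0<..} z *\<^sub>R exp (g z)))" for z
    using le[of z] by (auto simp: indicator_def abs_mult intro: order_trans[OF _ mult_right_mono[OF abs_ge_self]])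
  then show ?thesis
    unfolding set_integrable_def by (intro Bochner_Integration.integrable_bound[OF 1 2]) auto
qed

lemma abs_le_exp: "0 < z \<Longrightarrow> \<bar>z\<bar> \<le> 1 * exp (1 * z)" for z :: real
  using exp_ge_add_one_self[of z] by (simp add: order_trans[of z "1 + z"])

lemma (in risk_model) intensity_nonneg: "0 \<le> t \<Longrightarrow> \<omega> \<in> space M \<Longrightarrow> 0 \<le> lam t \<omega>"
  using intensity_ge[of t \<omega>] intensity_floor_pos by linarith

text \<open>The setting of the theorem, with the essential supremum that is existentially quantified
  in \<open>bsde_solution\<close> made a parameter \<open>g\<close>.\<close>

locale reinsurance = risk_model M G \<alpha> \<beta> lam0 \<rho> l F1 F2 \<tau>1 Z1 \<tau>2 Z2
  for M :: "'a measure" and G :: "real \<Rightarrow> 'a measure" and \<alpha> \<beta> lam0 \<rho> :: real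
    and l :: "real \<Rightarrow> real" and F1 F2 :: "real measure"
    and \<tau>1 :: "nat \<Rightarrow> 'a \<Rightarrow> ereal" and Z1 :: "nat \<Rightarrow> 'a \<Rightarrow> real"
    and \<tau>2 :: "nat \<Rightarrow> 'a \<Rightarrow> ereal" and Z2 :: "nat \<Rightarrow> 'a \<Rightarrow> real" +
  fixes T r \<eta> R0 \<theta>R :: real and p c W g :: "real \<Rightarrow> 'a \<Rightarrow> real" and \<Theta> :: "real \<Rightarrow> 'a \<Rightarrow> real \<Rightarrow> real"
  assumes T_pos: "0 < T" and r_pos: "0 < r" and \<eta>_pos: "0 < \<eta>" and \<theta>R_pos: "0 < \<theta>R"
    and filter_p: "is_filter_of M (natural_filtration M (claims \<tau>1 Z1)) T (intensity \<alpha> \<beta> lam0 l \<tau>1 Z1 \<tau>2 Z2) p"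
    and c_predictable: "predictable_process {0..T} (natural_filtration M (claims \<tau>1 Z1)) c"
    and c_integrable: "integrable (time_scenario T M) (\<lambda>(t, \<omega>). c t \<omega>)"
    and exp_l: "\<And>a. 0 < a \<Longrightarrow> set_integrable F1 {0<..} (\<lambda>z. exp (a * l z))"
    and exp_Z1: "\<And>a. 0 < a \<Longrightarrow> set_integrable F1 {0<..} (\<lambda>z. exp (a * z))"
    and exp_Z2: "\<And>a. 0 < a \<Longrightarrow> set_integrable F2 {0<..} (\<lambda>z. exp (a * z))"
    and value_W: "is_value_process M (natural_filtration M (claims \<tau>1 Z1)) T {0..1} \<eta>
      (wealth r R0 c \<tau>1 Z1 proportional (expected_value_premium \<theta>R F1 p)) 1 W"
    and W_L2: "in_L2 M (natural_filtration M (claims \<tau>1 Z1)) T W"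
    and \<Theta>_L2: "in_L2hat M (natural_filtration M (claims \<tau>1 Z1)) T p F1 \<Theta>"
    and g_sup: "is_ess_sup (time_scenario T M)
      {\<lambda>(t, \<omega>). driver T r \<eta> proportional (expected_value_premium \<theta>R F1 p) p F1 t \<omega>
          (left_lim (\<lambda>s. W s \<omega>) t) (\<Theta> t \<omega>) (u t \<omega>) |u.
        u \<in> admissible M (natural_filtration M (claims \<tau>1 Z1)) T {0..1} \<eta>
          (wealth r R0 c \<tau>1 Z1 proportional (expected_value_premium \<theta>R F1 p))}
      (\<lambda>(t, \<omega>). g t \<omega>)"
    and g_int: "AE \<omega> in M. set_integrable lborel {0..T} (\<lambda>t. g t \<omega>)"
    and W_eq: "AE \<omega> in M. \<forall>t\<in>{0..T}. W t \<omega> =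
      exp (- \<eta> * wealth r R0 c \<tau>1 Z1 proportional (expected_value_premium \<theta>R F1 p) (\<lambda>_ _. 1) T \<omega>)
      - compensated_integral \<tau>1 Z1 p F1 \<Theta> t T \<omega> - (LINT s:{t..T}|lborel. g s \<omega>)"
begin

abbreviation q :: "real \<Rightarrow> 'a \<Rightarrow> real \<Rightarrow> real" where
  "q \<equiv> expected_value_premium \<theta>R F1 p"

abbreviation X :: "(real \<Rightarrow> 'a \<Rightarrow> real) \<Rightarrow> real \<Rightarrow> 'a \<Rightarrow> real" where
  "X \<equiv> wealth r R0 c \<tau>1 Z1 proportional q"

abbreviation admis :: "(real \<Rightarrow> 'a \<Rightarrow> real) set" where
  "admis \<equiv> admissible M H T {0..1} \<eta> X"

definition p_left :: "real \<Rightarrow> 'a \<Rightarrow> real" where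
  "p_left t \<omega> = left_lim (\<lambda>s. p s \<omega>) t"

sublocale mark: prob_space "mark_law F1" by (rule prob_space_mark_law)

sublocale clock: finite_measure "clock T" by (rule finite_measure_clock)

sublocale ts: pair_sigma_finite "clock T" M ..

lemma T_nonneg: "0 \<le> T" using T_pos by simp

lemma l_integrable: "set_integrable F1 {0<..} l"
proof (rule set_integrable_le_exp[OF exp_l[of 1] F1.events_eq_borel l_measurable, where C=1])
  show "\<bar>l z\<bar> \<le> 1 * exp (1 * l z)" if "0 < z" for z
    using l_nonneg[of z] exp_ge_add_one_self[of "l z"] that by (simp add: order_trans[of "l z" "1 + l z"])
qed simp

lemma z2_integrable: "set_integrable F2 {0<..} (\<lambda>z. z)"
proof (rule set_integrable_le_exp[OF exp_Z2[of 1] F2.events_eq_borel, where C=1])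
  show "\<bar>z\<bar> \<le> 1 * exp (1 * z)" if "0 < z" for z :: real
    using abs_le_exp[OF that] .
qed (auto intro!: measurable_restrict_space1)

lemma z1_integrable: "integrable (mark_law F1) (\<lambda>z. z)"
proof -
  have "set_integrable F1 {0<..} (\<lambda>z. z)"
  proof (rule set_integrable_le_exp[OF exp_Z1[of 1] F1.events_eq_borel, where C=1])
    show "\<bar>z\<bar> \<le> 1 * exp (1 * z)" if "0 < z" for z :: real
      using abs_le_exp[OF that] .
  qed (auto intro!: measurable_restrict_space1)
  then show ?thesis by (simp add: integrable_restrict_space set_integrable_def)
qed

text \<open>The constant \<open>2\<close> comes from \<open>z^2 / 2 \<le> exp z\<close>. The second
  moment is paired with the square-integrable \<open>\<Theta>\<close> to integrate their
  product.\<close>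

lemma z1_sq_integrable: "integrable (mark_law F1) (\<lambda>z. z\<^sup>2)"
proof -
  have "set_integrable F1 {0<..} (\<lambda>z. z\<^sup>2)"
  proof (rule set_integrable_le_exp[OF exp_Z1[of 1] F1.events_eq_borel, where C=2])
    show "\<bar>z\<^sup>2\<bar> \<le> 2 * exp (1 * z)" if "0 < z" for z :: real
      using exp_lower_Taylor_quadratic[of z] that by simp
  qed (auto intro!: measurable_restrict_space1)
  then show ?thesis by (simp add: integrable_restrict_space set_integrable_def)
qed

lemma set_integral_mark: "(LINT z:{0<..}|F1. f z) = (\<integral>z. f z \<partial>mark_law F1)" for f :: "real \<Rightarrow> real"
  by (simp add: integral_restrict_space set_lebesgue_integral_def)

lemma intensity_measurable: "0 \<le> t \<Longrightarrow> lam t \<in> borel_measurable M"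
  by (rule J1.measurable_F'[OF _ intensity_adapted])

lemma intensity_integrable: "0 \<le> t \<Longrightarrow> integrable M (lam t)"
proof (rule integrableI_nonneg)
  assume t: "0 \<le> t"
  show "AE \<omega> in M. 0 \<le> lam t \<omega>"
    by (intro AE_I2 intensity_nonneg t)
  show "(\<integral>\<^sup>+\<omega>. ennreal (lam t \<omega>) \<partial>M) < \<infinity>"
    by (rule expected_intensity_finite[OF l_integrable z2_integrable t])
qed (rule intensity_measurable)

lemma cond_H: "0 \<le> t \<Longrightarrow> sigma_finite_subalgebra M (H t)"
  using H.subalg by (intro finite_measure_subalgebra_is_sigma_finite)
    (auto intro!: finite_measure_subalgebra.intro finite_measure_subalgebra_axioms.intro finite_measure_axioms)

lemma p_adapted: "t \<in> {0..T} \<Longrightarrow> p t \<in> borel_measurable (H t)"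
  using filter_p unfolding is_filter_of_def by auto

lemma p_cadlag: "\<omega> \<in> space M \<Longrightarrow> cadlag_on T (\<lambda>t. p t \<omega>)"
  using filter_p unfolding is_filter_of_def by auto

lemma p_cond_exp: "t \<in> {0..T} \<Longrightarrow> AE \<omega> in M. p t \<omega> = real_cond_exp M (H t) (lam t) \<omega>"
  using filter_p unfolding is_filter_of_def by auto

lemma p_measurable: "t \<in> {0..T} \<Longrightarrow> p t \<in> borel_measurable M"
  using H.measurable_F'[OF _ p_adapted] by auto

text \<open>The real conditional expectation is a difference of two extended ones; the negative part
  vanishes, and the positive part is finite almost surely because the intensity has finite
  mean.\<close>

lemma p_nn_cond_exp:
  assumes t: "t \<in> {0..T}"
  shows "AE \<omega> in M. ennreal (p t \<omega>) = nn_cond_exp M (H t) (\<lambda>\<omega>. ennreal (lam t \<omega>)) \<omega>"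
proof -
  have t0: "0 \<le> t" using t by simp
  interpret S: sigma_finite_subalgebra M "H t" by (rule cond_H[OF t0])
  have lm[measurable]: "lam t \<in> borel_measurable M" by (rule intensity_measurable[OF t0])
  have "AE \<omega> in M. 0 = nn_cond_exp M (H t) (\<lambda>\<omega>. ennreal (- lam t \<omega>)) \<omega>"
  proof (rule S.nn_cond_exp_charact)
    fix A assume "A \<in> sets (H t)"
    show "(\<integral>\<^sup>+\<omega>\<in>A. ennreal (- lam t \<omega>) \<partial>M) = (\<integral>\<^sup>+\<omega>\<in>A. 0 \<partial>M)"
      using intensity_nonneg[OF t0] by (intro nn_integral_cong) (auto simp: ennreal_neg)
  qed auto
  moreover have "AE \<omega> in M. nn_cond_exp M (H t) (\<lambda>\<omega>. ennreal (lam t \<omega>)) \<omega> \<noteq> \<infinity>"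
  proof (rule nn_integral_PInf_AE)
    have "(\<integral>\<^sup>+\<omega>. nn_cond_exp M (H t) (\<lambda>\<omega>. ennreal (lam t \<omega>)) \<omega> \<partial>M) = (\<integral>\<^sup>+\<omega>. ennreal (lam t \<omega>) \<partial>M)"
      using S.nn_cond_exp_intg[of "\<lambda>_. 1" "\<lambda>\<omega>. ennreal (lam t \<omega>)"] by simp
    then show "(\<integral>\<^sup>+\<omega>. nn_cond_exp M (H t) (\<lambda>\<omega>. ennreal (lam t \<omega>)) \<omega> \<partial>M) \<noteq> \<infinity>"
      using expected_intensity_finite[OF l_integrable z2_integrable t0] by simp
  qed simp
  ultimately show ?thesis using p_cond_exp[OF t]
    by eventually_elim (auto simp: real_cond_exp_def less_top)
qed

text \<open>The floor holds at each rational time almost surely, hence at all of them at once, and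
  right-continuity extends it to all times before \<open>T\<close> outside a single null
  set.\<close>

lemma p_ge: "AE \<omega> in M. \<forall>t\<in>{0..<T}. min \<beta> lam0 \<le> p t \<omega>"
proof -
  have "AE \<omega> in M. \<forall>q\<in>\<rat> \<inter> {0..T}. min \<beta> lam0 \<le> p q \<omega>"
  proof (subst AE_ball_countable)
    show "countable (\<rat> \<inter> {0..T})" using countable_rat by (rule countable_subset[rotated]) auto
    show "\<forall>q\<in>\<rat> \<inter> {0..T}. AE \<omega> in M. min \<beta> lam0 \<le> p q \<omega>"
    proof
      fix q assume "q \<in> \<rat> \<inter> {0..T}"
      then have q: "q \<in> {0..T}" by auto
      then interpret S: sigma_finite_subalgebra M "H q" by (intro cond_H) auto
      have "AE \<omega> in M. min \<beta> lam0 \<le> real_cond_exp M (H q) (lam q) \<omega>"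
        using q by (intro S.real_cond_exp_ge_c intensity_integrable AE_I2 intensity_ge) auto
      with p_cond_exp[OF q] show "AE \<omega> in M. min \<beta> lam0 \<le> p q \<omega>" by eventually_elim simp
    qed
  qed
  then show ?thesis
  proof (rule AE_mp, intro AE_I2 impI ballI)
    fix \<omega> t assume \<omega>: "\<omega> \<in> space M" and ge: "\<forall>q\<in>\<rat> \<inter> {0..T}. min \<beta> lam0 \<le> p q \<omega>" and t: "t \<in> {0..<T}"
    show "min \<beta> lam0 \<le> p t \<omega>"
      by (rule cadlag_on_ge_rational[OF p_cadlag[OF \<omega>]]) (use ge t in \<open>auto simp del: min_le_iff_disj\<close>)
  qed
qed

lemma p_left_ge: "AE \<omega> in M. \<forall>t\<in>{0<..T}. min \<beta> lam0 \<le> p_left t \<omega>"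
  using p_ge
proof (rule AE_mp, intro AE_I2 impI ballI)
  fix \<omega> t assume "\<omega> \<in> space M" "\<forall>t\<in>{0..<T}. min \<beta> lam0 \<le> p t \<omega>" "t \<in> {0<..T}"
  then show "min \<beta> lam0 \<le> p_left t \<omega>"
    unfolding p_left_def by (intro left_lim_between[OF p_cadlag]) (auto simp del: min_le_iff_disj)
qed

lemma p_left_predictable: "(\<lambda>(t, \<omega>). p_left t \<omega>) \<in> borel_measurable (predictable_sigma {0..T} H)"
  unfolding p_left_def by (rule H.predictable_left_lim[OF T_nonneg p_adapted p_cadlag])

lemma p_jointly_measurable: "(\<lambda>(t, \<omega>). p t \<omega>) \<in> borel_measurable (time_scenario T M)"
proof (rule borel_measurable_LIMSEQ_real)
  fix x assume "x \<in> space (time_scenario T M)"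
  then show "(\<lambda>n. case x of (t, \<omega>) \<Rightarrow> p (min T (max 0 ((of_int \<lfloor>t * 2 ^ n\<rfloor> + 1) / 2 ^ n))) \<omega>)
     \<longlonglongrightarrow> (case x of (t, \<omega>) \<Rightarrow> p t \<omega>)"
    using cadlag_on_right_seq[OF p_cadlag[of "snd x"], of "fst x"]
    by (auto simp: time_scenario_def space_pair_measure space_restrict_space)
next
  fix n
  have fl: "(\<lambda>x. \<lfloor>fst x * 2 ^ n\<rfloor>) \<in> measurable (time_scenario T M) (count_space UNIV)"
    unfolding time_scenario_def
    by (intro measurable_compose[OF _ measurable_real_floor] borel_measurable_times measurable_compose[OF measurable_fst]
        measurable_restrict_space1) auto
  have "(\<lambda>x. p (min T (max 0 ((of_int i + 1) / 2 ^ n))) (snd x)) \<in> borel_measurable (time_scenario T M)" for i :: int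
    unfolding time_scenario_def using T_pos
    by (intro measurable_compose[OF measurable_snd p_measurable]) auto
  from measurable_compose_countable[OF this fl]
  show "(\<lambda>(t, \<omega>). p (min T (max 0 ((of_int \<lfloor>t * 2 ^ n\<rfloor> + 1) / 2 ^ n))) \<omega>) \<in> borel_measurable (time_scenario T M)"
    by (simp add: split_beta)
qed

section \<open>Left limits at almost every time, and the compensator for the filtration of the
  claims\<close>

lemma AE_time_scenarioI:
  assumes "{x\<in>space (time_scenario T M). P (fst x) (snd x)} \<in> sets (time_scenario T M)"
    and "AE \<omega> in M. AE t in clock T. P t \<omega>"
  shows "AE (t, \<omega>) in time_scenario T M. P t \<omega>"
    and "AE t in clock T. AE \<omega> in M. P t \<omega>"
proof -
  show 1: "AE t in clock T. AE \<omega> in M. P t \<omega>"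
    using ts.AE_commute[of P] assms unfolding time_scenario_def by simp
  then show "AE (t, \<omega>) in time_scenario T M. P t \<omega>"
    using ts.AE_pair_iff[of P] assms(1) unfolding time_scenario_def by (simp add: split_beta)
qed

lemma AE_p_left: "\<omega> \<in> space M \<Longrightarrow> AE t in clock T. p_left t \<omega> = p t \<omega>"
proof (rule AE_clock_countable)
  assume "\<omega> \<in> space M"
  from countable_left_jumps[OF p_cadlag[OF this]]
  show "countable {t\<in>{0..T}. p_left t \<omega> \<noteq> p t \<omega>}"
    by (rule countable_subset[rotated]) (auto simp: p_left_def left_lim_def split: if_splits)
qed

text \<open>A path has countably many jump times, a null set of times; Fubini exchanges the
  quantifiers, so that at almost every fixed time a jump has probability zero.\<close>

lemma no_jump_AE:
  assumes "adapted_marks M G \<tau> Z"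
  shows "AE t in clock T. AE \<omega> in M. \<forall>j. \<tau> j \<omega> \<noteq> ereal t"
proof (rule AE_time_scenarioI)
  interpret J: adapted_marks M G \<tau> Z by fact
  define R where "R j \<omega> = (if \<tau> j \<omega> \<le> ereal T then real_of_ereal (\<tau> j \<omega>) else - 1)" for j \<omega>
  have "R j \<in> borel_measurable M" for j
    using J1.measurable_F'[OF T_nonneg J.measurable_at_jump_if[OF T_nonneg order_refl J1.measurable_field_time[OF T_nonneg], of "- 1" j]] space_borel
    unfolding R_def[abs_def] fst_conv by simp
  then have m: "(\<lambda>x. R j (snd x)) \<in> borel_measurable (time_scenario T M)" "(\<lambda>x. fst x) \<in> borel_measurable (time_scenario T M)" for j
    unfolding time_scenario_def by (auto intro!: measurable_compose[OF measurable_snd] measurable_compose[OF measurable_fst] measurable_restrict_space1)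
  have "{x \<in> space (time_scenario T M). \<forall>j. \<tau> j (snd x) \<noteq> ereal (fst x)} = {x \<in> space (time_scenario T M). \<forall>j. R j (snd x) \<noteq> fst x}"
  proof (intro Collect_cong conj_cong refl all_cong1)
    fix x j assume "x \<in> space (time_scenario T M)"
    then have x: "fst x \<in> {0..T}" "snd x \<in> space M" by (auto simp: time_scenario_def space_pair_measure space_restrict_space)
    show "\<tau> j (snd x) \<noteq> ereal (fst x) \<longleftrightarrow> R j (snd x) \<noteq> fst x"
    proof (cases "\<tau> j (snd x) \<le> ereal T")
      case True
      note jump_time_real(1)[OF J.jumps x(2) this]
      then show ?thesis using True unfolding R_def by (metis real_of_ereal.simps(1))
    qed (use x in \<open>auto simp: R_def\<close>)
  qed
  also have "\<dots> \<in> sets (time_scenario T M)"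
    using m by measurable
  finally show "{x \<in> space (time_scenario T M). \<forall>j. \<tau> j (snd x) \<noteq> ereal (fst x)} \<in> sets (time_scenario T M)" .
  show "AE \<omega> in M. AE t in clock T. \<forall>j. \<tau> j \<omega> \<noteq> ereal t"
  proof (rule AE_I2, rule AE_clock_countable)
    fix \<omega>
    have "countable (range (\<lambda>j. real_of_ereal (\<tau> j \<omega>)))" by auto
    then show "countable {t\<in>{0..T}. \<not> (\<forall>j. \<tau> j \<omega> \<noteq> ereal t)}"
      by (rule countable_subset[rotated]) (auto simp: image_iff, metis real_of_ereal.simps(1))
  qed
qed

lemma AE_lam_left: "AE t in clock T. AE \<omega> in M. lam_left t \<omega> = lam t \<omega>"
proof -
  have "AE t in clock T. t \<noteq> 0 \<and> t \<in> {0..T}"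
    unfolding AE_clock using AE_lborel_singleton[of 0] by eventually_elim auto
  then show ?thesis
    using no_jump_AE[OF J1.adapted_marks_axioms] no_jump_AE[OF J2.adapted_marks_axioms]
  proof eventually_elim
    case (elim t)
    show ?case using elim(2,3)
    proof (rule AE_mp[OF _ AE_mp], intro AE_I2 impI)
      fix \<omega> assume \<omega>: "\<omega> \<in> space M" and "\<forall>j. \<tau>1 j \<omega> \<noteq> ereal t" "\<forall>j. \<tau>2 j \<omega> \<noteq> ereal t"
      then have "{j. \<tau>1 j \<omega> < ereal t} = {j. \<tau>1 j \<omega> \<le> ereal t}" "{j. \<tau>2 j \<omega> < ereal t} = {j. \<tau>2 j \<omega> \<le> ereal t}"
        by (auto simp: less_le)
      then show "lam_left t \<omega> = lam t \<omega>"
        using lam_left_eq[OF \<omega>, of t] elim(1) by (simp add: intensity_def)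
    qed
  qed
qed

lemma field_mark_section:
  assumes "f \<in> measurable (field_sigma {0..T} H) N" "t \<in> {0..T}" "\<omega> \<in> space M"
  shows "(\<lambda>z. f ((t, \<omega>), z)) \<in> measurable (mark_law F1) N"
proof -
  have "(\<lambda>z. f ((t, \<omega>), z)) \<in> measurable (restrict_space borel {0<..}) N"
    using measurable_compose[OF measurable_Pair1' assms(1)[unfolded field_sigma_def], of "(t, \<omega>)"] assms(2,3)
    by (simp add: H.space_predictable)
  then show ?thesis using sets_mark_law[OF F1.events_eq_borel] by (simp cong: measurable_cong_sets)
qed

lemma measurable_field_mark_law:
  "measurable (field_sigma {0..T} H) N = measurable (predictable_sigma {0..T} H \<Otimes>\<^sub>M mark_law F1) N"
  unfolding field_sigma_def
  by (rule measurable_cong_sets[OF sets_pair_measure_cong[OF refl sets_mark_law[OF F1.events_eq_borel, symmetric]] refl])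

lemma predictable_nn_integral_mark:
  assumes "f \<in> borel_measurable (field_sigma {0..T} H)"
  shows "(\<lambda>x. \<integral>\<^sup>+z. f (x, z) \<partial>mark_law F1) \<in> borel_measurable (predictable_sigma {0..T} H)"
  using assms unfolding measurable_field_mark_law
  by (intro mark.borel_measurable_nn_integral) (simp add: split_beta)

lemma predictable_integral_mark:
  fixes f :: "(real \<times> 'a) \<times> real \<Rightarrow> real"
  assumes "f \<in> borel_measurable (field_sigma {0..T} H)"
  shows "(\<lambda>x. \<integral>z. f (x, z) \<partial>mark_law F1) \<in> borel_measurable (predictable_sigma {0..T} H)"
  using assms unfolding measurable_field_mark_law
  by (intro mark.borel_measurable_lebesgue_integral) (simp add: split_beta)

text \<open>With respect to the smaller filtration the intensity is replaced by its filter: at almost every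
  time both agree with their left limits, and there the integrand is measurable at that time.\<close>

lemma compensator_H:
  assumes K: "K \<in> borel_measurable (field_sigma {0..T} H)"
  shows "(\<integral>\<^sup>+\<omega>. (\<Sum>j | \<tau>1 j \<omega> \<le> ereal T. K ((real_of_ereal (\<tau>1 j \<omega>), \<omega>), Z1 j \<omega>)) \<partial>M) =
    (\<integral>\<^sup>+\<omega>. \<integral>\<^sup>+t. (\<integral>\<^sup>+z. K ((t, \<omega>), z) \<partial>mark_law F1) * ennreal (p_left t \<omega>) \<partial>clock T \<partial>M)"
proof -
  define k where "k t \<omega> = (\<integral>\<^sup>+z. K ((t, \<omega>), z) \<partial>mark_law F1)" for t \<omega>
  have Kz: "(\<lambda>z. K ((t, \<omega>), z)) \<in> borel_measurable (mark_law F1)" if "t \<in> {0..T}" "\<omega> \<in> space M" for t \<omega>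
    by (rule field_mark_section[OF K that])
  have km: "(\<lambda>(t, \<omega>). k t \<omega>) \<in> borel_measurable (predictable_sigma {0..T} H)"
    using predictable_nn_integral_mark[OF K] unfolding k_def split_beta by simp
  have kG: "(\<lambda>(t, \<omega>). k t \<omega>) \<in> borel_measurable (time_scenario T M)"
    by (rule H.measurable_time_scenario[OF km T_nonneg])
  have lG: "(\<lambda>(t, \<omega>). lam_left t \<omega>) \<in> borel_measurable (time_scenario T M)"
    by (rule J1.measurable_time_scenario[OF lam_left_measurable[OF T_nonneg] T_nonneg])
  have pG: "(\<lambda>(t, \<omega>). p_left t \<omega>) \<in> borel_measurable (time_scenario T M)"
    by (rule H.measurable_time_scenario[OF p_left_predictable T_nonneg])
  have [measurable]: "(\<lambda>x. k (fst x) (snd x)) \<in> borel_measurable (time_scenario T M)"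
    "(\<lambda>x. lam_left (fst x) (snd x)) \<in> borel_measurable (time_scenario T M)"
    "(\<lambda>x. p_left (fst x) (snd x)) \<in> borel_measurable (time_scenario T M)"
    using kG lG pG unfolding split_beta .
  have "(\<integral>\<^sup>+\<omega>. (\<Sum>j | \<tau>1 j \<omega> \<le> ereal T. K ((real_of_ereal (\<tau>1 j \<omega>), \<omega>), Z1 j \<omega>)) \<partial>M) =
    (\<integral>\<^sup>+\<omega>. \<integral>\<^sup>+t. \<integral>\<^sup>+z. K ((t, \<omega>), z) * ennreal (lam_left t \<omega>) \<partial>mark_law F1 \<partial>clock T \<partial>M)"
    by (rule compensator1_formula[OF H.subalgebra_family_axioms H_subset_G T_nonneg K])
  also have "\<dots> = (\<integral>\<^sup>+\<omega>. \<integral>\<^sup>+t. k t \<omega> * ennreal (lam_left t \<omega>) \<partial>clock T \<partial>M)"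
    unfolding k_def by (intro nn_integral_cong nn_integral_multc Kz) (auto simp: space_restrict_space)
  also have "\<dots> = (\<integral>\<^sup>+t. \<integral>\<^sup>+\<omega>. k t \<omega> * ennreal (lam_left t \<omega>) \<partial>M \<partial>clock T)"
    by (intro clock_swap) (unfold split_beta, measurable)
  also have "\<dots> = (\<integral>\<^sup>+t. \<integral>\<^sup>+\<omega>. k t \<omega> * ennreal (p_left t \<omega>) \<partial>M \<partial>clock T)"
  proof (rule nn_integral_cong_AE)
    have "AE t in clock T. AE \<omega> in M. p_left t \<omega> = p t \<omega>"
    proof (rule AE_time_scenarioI)
      show "{x \<in> space (time_scenario T M). p_left (fst x) (snd x) = p (fst x) (snd x)} \<in> sets (time_scenario T M)"
        using pG p_jointly_measurable unfolding split_beta by measurable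
    qed (auto intro: AE_p_left)
    moreover have "AE t in clock T. t \<in> {0..T}" unfolding AE_clock by simp
    ultimately show "AE t in clock T. (\<integral>\<^sup>+\<omega>. k t \<omega> * ennreal (lam_left t \<omega>) \<partial>M) = (\<integral>\<^sup>+\<omega>. k t \<omega> * ennreal (p_left t \<omega>) \<partial>M)"
      using AE_lam_left
    proof eventually_elim
      case (elim t)
      then have t0: "0 \<le> t" by simp
      interpret S: sigma_finite_subalgebra M "H t" by (rule cond_H[OF t0])
      have kt: "k t \<in> borel_measurable (H t)"
        using H.predictable_section[OF km, of t] elim(2) by simp
      have "(\<integral>\<^sup>+\<omega>. k t \<omega> * ennreal (lam_left t \<omega>) \<partial>M) = (\<integral>\<^sup>+\<omega>. k t \<omega> * ennreal (lam t \<omega>) \<partial>M)"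
        by (rule nn_integral_cong_AE) (use elim(3) in eventually_elim, simp)
      also have "\<dots> = (\<integral>\<^sup>+\<omega>. k t \<omega> * nn_cond_exp M (H t) (\<lambda>\<omega>. ennreal (lam t \<omega>)) \<omega> \<partial>M)"
        using kt intensity_measurable[OF t0] by (intro S.nn_cond_exp_intg[symmetric]) auto
      also have "\<dots> = (\<integral>\<^sup>+\<omega>. k t \<omega> * ennreal (p_left t \<omega>) \<partial>M)"
        by (rule nn_integral_cong_AE) (use p_nn_cond_exp[OF elim(2)] elim(1) in eventually_elim, simp)
      finally show ?case .
    qed
  qed
  also have "\<dots> = (\<integral>\<^sup>+\<omega>. \<integral>\<^sup>+t. k t \<omega> * ennreal (p_left t \<omega>) \<partial>clock T \<partial>M)"
    by (intro clock_swap[symmetric]) (unfold split_beta, measurable)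
  finally show ?thesis unfolding k_def .
qed

end

section \<open>Wealth and the value process\<close>

lemma integral_clock: "(LINT t:{0..T}|lborel. f t) = (\<integral>t. f t \<partial>clock T)" for f :: "real \<Rightarrow> real"
  by (simp add: integral_restrict_space set_lebesgue_integral_def)

lemma integrable_clock_iff: "integrable (clock T) f \<longleftrightarrow> set_integrable lborel {0..T} f" for f :: "real \<Rightarrow> real"
  by (simp add: integrable_restrict_space set_integrable_def)

lemma sets_clock: "sets (clock T) = sets (restrict_space borel {0..T})"
  by (rule sets_restrict_space_cong) simp

lemma integrable_clock_bounded:
  fixes f :: "real \<Rightarrow> real"
  assumes "f \<in> borel_measurable (restrict_space borel {0..T})" "\<And>t. t \<in> {0..T} \<Longrightarrow> \<bar>f t\<bar> \<le> B"
  shows "integrable (clock T) f"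
proof -
  interpret finite_measure "clock T" by (rule finite_measure_clock)
  have "f \<in> borel_measurable (clock T)" using assms(1) by (simp cong: measurable_cong_sets add: sets_clock)
  then show ?thesis using assms(2) by (intro integrable_const_bound[of _ B] AE_I2) (auto simp: space_restrict_space)
qed

context reinsurance
begin

text \<open>Admissibility without integrability of the terminal disutility: the candidate has to be
  handled before it is known to be admissible.\<close>

definition control :: "(real \<Rightarrow> 'a \<Rightarrow> real) \<Rightarrow> bool" where
  "control u \<longleftrightarrow> predictable_process {0..T} H u \<and> (\<forall>t\<in>{0..T}. \<forall>\<omega>\<in>space M. u t \<omega> \<in> {0..1})"

lemma admis_iff: "u \<in> admis \<longleftrightarrow> control u \<and> integrable M (\<lambda>\<omega>. exp (- \<eta> * X u T \<omega>))"
  unfolding admissible_def control_def by auto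

definition \<mu> :: real where "\<mu> = mean F1"

lemma \<mu>_eq: "\<mu> = (\<integral>z. z \<partial>mark_law F1)"
  unfolding \<mu>_def mean_def by (rule set_integral_mark)

lemma mark_law_pos: "AE z in mark_law F1. 0 < z"
  by (rule AE_I2) (simp add: space_restrict_space)

lemma \<mu>_pos: "0 < \<mu>"
proof -
  have "(\<integral>z. (0::real) \<partial>mark_law F1) < (\<integral>z. z \<partial>mark_law F1)"
    using mark.integral_less_AE_space[of "\<lambda>_. 0" "\<lambda>z. z"] z1_integrable mark_law_pos
      mark.emeasure_space_1 by (simp add: space_restrict_space)
  then show ?thesis by (simp add: \<mu>_eq)
qed

lemma p_left_bounded:
  assumes "\<omega> \<in> space M" obtains B where "\<And>t. t \<in> {0..T} \<Longrightarrow> \<bar>p_left t \<omega>\<bar> \<le> B"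
proof -
  obtain B where B: "\<And>t. t \<in> {0..T} \<Longrightarrow> \<bar>p t \<omega>\<bar> \<le> B" using cadlag_on_bounded[OF p_cadlag[OF assms]] by blast
  have "\<bar>p_left t \<omega>\<bar> \<le> B" if t: "t \<in> {0..T}" for t
  proof (cases "t = 0")
    case True
    then show ?thesis using B[of 0] T_pos by (simp add: p_left_def left_lim_def)
  next
    case False
    have t': "0 < t" "t \<le> T" using t False by auto
    have "- B \<le> p s \<omega>" "p s \<omega> \<le> B" if "s \<in> {0<..<t}" for s
      using B[of s] that t' by (auto simp: abs_le_iff)
    then have "- B \<le> p_left t \<omega>" "p_left t \<omega> \<le> B"
      unfolding p_left_def by (intro left_lim_between[OF p_cadlag[OF assms] t'] left_lim_between'[OF p_cadlag[OF assms] t']; simp)+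
    then show ?thesis by simp
  qed
  then show thesis by (rule that)
qed

lemma exp_discount: "t \<in> {0..T} \<Longrightarrow> exp (r * (T - t)) \<in> {1..exp (r * T)}"
  using r_pos by (simp add: mult_left_mono)

definition prem :: "(real \<Rightarrow> 'a \<Rightarrow> real) \<Rightarrow> real \<Rightarrow> 'a \<Rightarrow> real" where
  "prem u t \<omega> = exp (r * (T - t)) * q t \<omega> (u t \<omega>)"

lemma q_eq: "q t \<omega> v = (1 + \<theta>R) * \<mu> * p_left t \<omega> * (1 - v)"
  unfolding expected_value_premium_def \<mu>_def p_left_def ..

lemma prem_predictable:
  assumes "control u"
  shows "(\<lambda>x. prem u (fst x) (snd x)) \<in> borel_measurable (predictable_sigma {0..T} H)"
proof -
  have [measurable]: "(\<lambda>x. u (fst x) (snd x)) \<in> borel_measurable (predictable_sigma {0..T} H)"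
    "(\<lambda>x. p_left (fst x) (snd x)) \<in> borel_measurable (predictable_sigma {0..T} H)"
    using assms p_left_predictable unfolding control_def predictable_process_def split_beta by auto
  have [measurable]: "fst \<in> borel_measurable (predictable_sigma {0..T} H)"
    using H.predictable_time[OF T_nonneg] .
  show ?thesis unfolding prem_def q_eq by measurable
qed

lemma prem_bounded:
  assumes u: "control u" and \<omega>: "\<omega> \<in> space M" obtains B where "\<And>t. t \<in> {0..T} \<Longrightarrow> \<bar>prem u t \<omega>\<bar> \<le> B"
proof -
  obtain B where B: "\<And>t. t \<in> {0..T} \<Longrightarrow> \<bar>p_left t \<omega>\<bar> \<le> B" using p_left_bounded[OF \<omega>] by blast
  have "\<bar>prem u t \<omega>\<bar> \<le> exp (r * T) * ((1 + \<theta>R) * \<mu> * B * 1)" if t: "t \<in> {0..T}" for t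
  proof -
    have "u t \<omega> \<in> {0..1}" using u t \<omega> unfolding control_def by auto
    then show ?thesis
      unfolding prem_def q_eq abs_mult using exp_discount[OF t] B[OF t] \<mu>_pos \<theta>R_pos
      by (intro mult_mono) auto
  qed
  then show thesis by (rule that)
qed

lemma prem_integrable:
  assumes u: "control u" and \<omega>: "\<omega> \<in> space M" shows "integrable (clock T) (\<lambda>t. prem u t \<omega>)"
proof -
  obtain B where "\<And>t. t \<in> {0..T} \<Longrightarrow> \<bar>prem u t \<omega>\<bar> \<le> B" using prem_bounded[OF u \<omega>] by blast
  moreover have "(\<lambda>t. prem u t \<omega>) \<in> borel_measurable (restrict_space borel {0..T})"
    using H.predictable_path[OF prem_predictable[OF u] T_nonneg \<omega>] by simp
  ultimately show ?thesis by (intro integrable_clock_bounded)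
qed

lemma c_path_integrable: "AE \<omega> in M. integrable (clock T) (\<lambda>t. c t \<omega>)"
  using ts.AE_integrable_snd[of c] c_integrable unfolding time_scenario_def by simp

lemma discounted_c_integrable: "AE \<omega> in M. integrable (clock T) (\<lambda>t. exp (r * (T - t)) * c t \<omega>)"
  using c_path_integrable
proof eventually_elim
  case (elim \<omega>)
  show ?case
  proof (rule Bochner_Integration.integrable_bound[OF integrable_mult_right[OF elim, of "exp (r * T)"]])
    have "(\<lambda>t. exp (r * (T - t))) \<in> borel_measurable (clock T)" by (intro measurable_restrict_space1) simp
    then show "(\<lambda>t. exp (r * (T - t)) * c t \<omega>) \<in> borel_measurable (clock T)"
      using elim by (intro borel_measurable_times) auto
    have "norm (exp (r * (T - t)) * c t \<omega>) \<le> norm (exp (r * T) * c t \<omega>)" if "t \<in> {0..T}" for t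
      using exp_discount[OF that] by (auto simp: abs_mult intro: mult_right_mono)
    then show "AE t in clock T. norm (exp (r * (T - t)) * c t \<omega>) \<le> norm (exp (r * T) * c t \<omega>)"
      by (intro AE_I2) (auto simp: space_restrict_space)
  qed
qed

definition retained :: "(real \<Rightarrow> 'a \<Rightarrow> real) \<Rightarrow> 'a \<Rightarrow> real" where
  "retained u \<omega> = (\<Sum>j | \<tau>1 j \<omega> \<le> ereal T. exp (r * (T - real_of_ereal (\<tau>1 j \<omega>))) * (Z1 j \<omega> * u (real_of_ereal (\<tau>1 j \<omega>)) \<omega>))"

lemma control_field:
  assumes "control u"
  shows "(\<lambda>x. u (fst (fst x)) (snd (fst x))) \<in> borel_measurable (field_sigma {0..T} H)"
  using H.measurable_field_fst[of "\<lambda>(t, \<omega>). u t \<omega>"] assms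
  unfolding control_def predictable_process_def split_beta by auto

lemma discount_field: "(\<lambda>x. exp (r * (T - fst (fst x)))) \<in> borel_measurable (field_sigma {0..T} H)"
  using H.measurable_field_time[OF T_nonneg] by measurable

text \<open>The two parts of the time integral are kept together, because the path of
  \<open>c\<close> is integrable only almost surely while this form holds in every scenario and so
  gives measurability. Where \<open>c\<close> is integrable, \<open>wealth_eq'\<close> splits
  it.\<close>

lemma wealth_eq:
  assumes u: "control u" and \<omega>: "\<omega> \<in> space M"
  shows "X u T \<omega> = R0 * exp (r * T) + (\<integral>t. exp (r * (T - t)) * c t \<omega> - prem u t \<omega> \<partial>clock T) - retained u \<omega>"
proof -
  have f: "(\<lambda>x. exp (r * (T - fst (fst x))) * (snd x * u (fst (fst x)) (snd (fst x)))) \<in> borel_measurable (field_sigma {0..T} H)"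
    using discount_field control_field[OF u] H.measurable_mark by measurable
  have ivl: "{0<..T} \<subseteq> {0..T}" by auto
  have "(\<lambda>x. indicator ({0<..T} \<times> {0<..}) x *\<^sub>R (exp (r * (T - fst x)) * (snd x * u (fst x) \<omega>))) \<in> borel_measurable borel"
    using measurable_pair_restrict_indicator[OF H.predictable_field_path[OF f T_nonneg \<omega>] _ ivl] by auto
  from integral_jump_measure[where f="\<lambda>t z. exp (r * (T - t)) * (z * u t \<omega>)" and Z=Z1 and \<tau>=\<tau>1 and a=0 and b=T, OF jumps1 \<omega> J1.Z_pos[OF \<omega>] this]
  have "(LINT x:{0<..T} \<times> {0<..}|jump_measure \<tau>1 Z1 \<omega>. exp (r * (T - fst x)) * (snd x * u (fst x) \<omega>)) = retained u \<omega>"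
    unfolding retained_def using jump_timesD(1)[OF jumps1 \<omega>] by (simp add: zero_ereal_def)
  then show ?thesis
    unfolding wealth_def proportional_def integral_clock prem_def by (simp add: right_diff_distrib)
qed

lemma wealth_eq':
  assumes u: "control u" and \<omega>: "\<omega> \<in> space M" and c: "integrable (clock T) (\<lambda>t. exp (r * (T - t)) * c t \<omega>)"
  shows "X u T \<omega> = R0 * exp (r * T) + (\<integral>t. exp (r * (T - t)) * c t \<omega> \<partial>clock T) - (\<integral>t. prem u t \<omega> \<partial>clock T) - retained u \<omega>"
  unfolding wealth_eq[OF u \<omega>] using c prem_integrable[OF u \<omega>] by simp

lemma c_joint: "(\<lambda>(t, \<omega>). exp (r * (T - t)) * c t \<omega>) \<in> borel_measurable (time_scenario T M)"
proof -
  have [measurable]: "(\<lambda>x. c (fst x) (snd x)) \<in> borel_measurable (predictable_sigma {0..T} H)"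
    using c_predictable unfolding predictable_process_def split_beta .
  have [measurable]: "fst \<in> borel_measurable (predictable_sigma {0..T} H)"
    using H.predictable_time[OF T_nonneg] .
  have "(\<lambda>(t, \<omega>). exp (r * (T - t)) * c t \<omega>) \<in> borel_measurable (predictable_sigma {0..T} H)"
    unfolding split_beta by measurable
  then show ?thesis by (rule H.measurable_time_scenario[OF _ T_nonneg])
qed

lemma clock_integral_measurable:
  fixes f :: "real \<Rightarrow> 'a \<Rightarrow> real"
  assumes "(\<lambda>(t, \<omega>). f t \<omega>) \<in> borel_measurable (time_scenario T M)"
  shows "(\<lambda>\<omega>. \<integral>t. f t \<omega> \<partial>clock T) \<in> borel_measurable M"
proof (rule clock.borel_measurable_lebesgue_integral)
  show "(\<lambda>(\<omega>, t). f t \<omega>) \<in> borel_measurable (M \<Otimes>\<^sub>M clock T)"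
    using measurable_compose[OF measurable_pair_swap' assms[unfolded time_scenario_def]] by (simp add: split_beta)
qed

lemma wealth_measurable:
  assumes u: "control u" shows "X u T \<in> borel_measurable M"
proof -
  have "(\<lambda>\<omega>. \<integral>t. exp (r * (T - t)) * c t \<omega> - prem u t \<omega> \<partial>clock T) \<in> borel_measurable M"
  proof (rule clock_integral_measurable)
    have [measurable]: "(\<lambda>x. exp (r * (T - fst x)) * c (fst x) (snd x)) \<in> borel_measurable (time_scenario T M)"
      using c_joint unfolding split_beta .
    have [measurable]: "(\<lambda>x. prem u (fst x) (snd x)) \<in> borel_measurable (time_scenario T M)"
      by (rule H.measurable_time_scenario[OF prem_predictable[OF u] T_nonneg])
    show "(\<lambda>(t, \<omega>). exp (r * (T - t)) * c t \<omega> - prem u t \<omega>) \<in> borel_measurable (time_scenario T M)"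
      unfolding split_beta by measurable
  qed
  moreover have "retained u \<in> borel_measurable M"
  proof -
    have "(\<lambda>x. exp (r * (T - fst (fst x))) * (snd x * u (fst (fst x)) (snd (fst x)))) \<in> borel_measurable (field_sigma {0..T} H)"
      using discount_field control_field[OF u] H.measurable_mark by measurable
    from H.measurable_F'[OF T_nonneg H.sum_jumps_adapted[OF T_nonneg order_refl this]]
    show ?thesis unfolding retained_def[abs_def] by simp
  qed
  ultimately have "(\<lambda>\<omega>. R0 * exp (r * T) + (\<integral>t. exp (r * (T - t)) * c t \<omega> - prem u t \<omega> \<partial>clock T) - retained u \<omega>) \<in> borel_measurable M"
    by measurable
  then show ?thesis using wealth_eq[OF u] by (simp cong: measurable_cong)
qed

text \<open>A positive lower bound, common to all controls, for the terminal disutility.\<close>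

definition Y :: "'a \<Rightarrow> real" where
  "Y \<omega> = min 1 (exp (- \<eta> * (R0 * exp (r * T) + (\<integral>t. exp (r * (T - t)) * c t \<omega> \<partial>clock T))))"

lemma Y_measurable: "Y \<in> borel_measurable M"
  using clock_integral_measurable[OF c_joint] unfolding Y_def[abs_def] by measurable

lemma Y_bounds: "0 < Y \<omega>" "Y \<omega> \<le> 1"
  unfolding Y_def by auto

lemma Y_integrable: "integrable M Y"
  using Y_measurable Y_bounds by (intro integrable_const_bound[of _ 1] AE_I2) (auto simp: less_imp_le)

text \<open>Reinsurance premiums and retained claims can only lower the wealth, so initial capital
  and insurance premiums alone bound it from above. The cap at one in \<open>Y\<close> is for
  integrability.\<close>

lemma Y_le:
  assumes u: "control u"
  shows "AE \<omega> in M. Y \<omega> \<le> exp (- \<eta> * X u T \<omega>)"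
  using discounted_c_integrable p_left_ge
proof (rule AE_mp[OF _ AE_mp], intro AE_I2 impI)
  fix \<omega> assume \<omega>: "\<omega> \<in> space M" and c: "integrable (clock T) (\<lambda>t. exp (r * (T - t)) * c t \<omega>)"
    and pl: "\<forall>t\<in>{0<..T}. min \<beta> lam0 \<le> p_left t \<omega>"
  have u01: "u t \<omega> \<in> {0..1}" if "t \<in> {0..T}" for t using u \<omega> that unfolding control_def by auto
  have "AE t in clock T. 0 \<le> prem u t \<omega>"
  proof -
    have "AE t in clock T. t \<noteq> 0 \<and> t \<in> {0..T}"
      unfolding AE_clock using AE_lborel_singleton[of 0] by eventually_elim auto
    then show ?thesis
    proof eventually_elim
      case (elim t)
      then have "0 < p_left t \<omega>" using pl intensity_floor_pos by (metis atLeastAtMost_iff greaterThanAtMost_iff less_le order.strict_trans2)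
      then show ?case unfolding prem_def q_eq using u01[of t] elim \<mu>_pos \<theta>R_pos by auto
    qed
  qed
  then have "0 \<le> (\<integral>t. prem u t \<omega> \<partial>clock T)" by (rule integral_nonneg_AE)
  moreover have "0 \<le> retained u \<omega>"
    unfolding retained_def
    using jump_time_real(2,3)[OF jumps1 \<omega>] J1.Z_pos[OF \<omega>] u01
    by (intro sum_nonneg mult_nonneg_nonneg) (auto simp: less_imp_le)
  ultimately have "X u T \<omega> \<le> R0 * exp (r * T) + (\<integral>t. exp (r * (T - t)) * c t \<omega> \<partial>clock T)"
    unfolding wealth_eq'[OF u \<omega> c] by simp
  then have "exp (- \<eta> * (R0 * exp (r * T) + (\<integral>t. exp (r * (T - t)) * c t \<omega> \<partial>clock T))) \<le> exp (- \<eta> * X u T \<omega>)"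
    using \<eta>_pos by simp
  then show "Y \<omega> \<le> exp (- \<eta> * X u T \<omega>)" unfolding Y_def by (rule min.coboundedI2)
qed

section \<open>Strict positivity of the value process\<close>

lemma W_adapted: "t \<in> {0..T} \<Longrightarrow> W t \<in> borel_measurable (H t)"
  using W_L2 unfolding in_L2_def by auto

lemma W_cadlag: "\<omega> \<in> space M \<Longrightarrow> cadlag_on T (\<lambda>t. W t \<omega>)"
  using W_L2 unfolding in_L2_def by auto

text \<open>The conditional expectation of \<open>Y\<close> is below every member of the family, and
  the essential infimum is the largest such bound.\<close>

lemma W_ge:
  assumes t: "t \<in> {0..T}" shows "AE \<omega> in M. real_cond_exp M (H t) Y \<omega> \<le> W t \<omega>"
proof -
  interpret S: sigma_finite_subalgebra M "H t" using t by (intro cond_H) auto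
  have "is_ess_inf M
        {real_cond_exp M (H t) (\<lambda>\<omega>. exp (- \<eta> * X u T \<omega>)) |u. u \<in> admis \<and> (\<forall>s\<in>{0..t}. AE \<omega> in M. u s \<omega> = 1)} (W t)"
    using value_W t unfolding is_value_process_def by blast
  then have "(\<forall>R\<in>{real_cond_exp M (H t) (\<lambda>\<omega>. exp (- \<eta> * X u T \<omega>)) |u. u \<in> admis \<and> (\<forall>s\<in>{0..t}. AE \<omega> in M. u s \<omega> = 1)}.
      AE \<omega> in M. real_cond_exp M (H t) Y \<omega> \<le> R \<omega>) \<longrightarrow> ?thesis"
    unfolding is_ess_inf_def using borel_measurable_cond_exp2 by blast
  moreover have "AE \<omega> in M. real_cond_exp M (H t) Y \<omega> \<le> real_cond_exp M (H t) (\<lambda>\<omega>. exp (- \<eta> * X u T \<omega>)) \<omega>" if "u \<in> admis" for u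
    using that unfolding admis_iff by (intro S.real_cond_exp_mono Y_le Y_integrable) auto
  ultimately show ?thesis by blast
qed

text \<open>A maximal inequality for the density \<open>Y\<close>: split by the first time
  \<open>s\<close> in \<open>A\<close> at which \<open>W\<close> is below \<open>\<epsilon>\<close>.
  That event belongs to \<open>H s\<close>, so on it \<open>Y\<close> may be replaced by its
  conditional expectation, which is at most \<open>W s < \<epsilon>\<close>.\<close>

lemma W_first_passage:
  assumes A: "finite A" "A \<subseteq> {0..T}" and \<epsilon>: "0 < \<epsilon>"
  shows "emeasure (density M Y) {\<omega>\<in>space M. \<exists>s\<in>A. W s \<omega> < \<epsilon>} \<le> ennreal \<epsilon>"
proof -
  define B where "B s = {\<omega>\<in>space M. W s \<omega> < \<epsilon> \<and> (\<forall>s'\<in>A. s' < s \<longrightarrow> \<not> W s' \<omega> < \<epsilon>)}" for s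
  have BH: "B s \<in> sets (H s)" if s: "s \<in> A" for s
  proof -
    have s0: "0 \<le> s" using s A by auto
    have [measurable]: "W s' \<in> borel_measurable (H s)" if "s' \<in> A" "s' \<le> s" for s'
      using H.measurable_F[OF _ that(2) W_adapted[of s']] that A by auto
    have "B s = {\<omega>\<in>space (H s). W s \<omega> < \<epsilon>} \<inter> (space (H s) - (\<Union>s'\<in>{s'\<in>A. s' < s}. {\<omega>\<in>space (H s). W s' \<omega> < \<epsilon>}))"
      unfolding B_def H.space_F[OF s0] by auto
    also have "\<dots> \<in> sets (H s)"
    proof (intro sets.Int sets.Diff sets.top sets.finite_UN)
      show "{\<omega>\<in>space (H s). W s \<omega> < \<epsilon>} \<in> sets (H s)" using s by measurable
      show "finite {s'\<in>A. s' < s}" using A by auto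
      fix s' assume "s' \<in> {s'\<in>A. s' < s}"
      then have [measurable]: "W s' \<in> borel_measurable (H s)" by simp
      show "{\<omega>\<in>space (H s). W s' \<omega> < \<epsilon>} \<in> sets (H s)" by measurable
    qed
    finally show ?thesis .
  qed
  have BM: "B s \<in> sets M" if "s \<in> A" for s using BH[OF that] H.sets_F[of s "B s"] A that by auto
  have disj: "disjoint_family_on B A"
    unfolding disjoint_family_on_def
  proof (intro ballI impI)
    fix s s' assume "s \<in> A" "s' \<in> A" "s \<noteq> s'"
    then show "B s \<inter> B s' = {}" unfolding B_def by (cases "s < s'") auto
  qed
  have un: "{\<omega>\<in>space M. \<exists>s\<in>A. W s \<omega> < \<epsilon>} = (\<Union>s\<in>A. B s)"
  proof (intro equalityI subsetI)
    fix \<omega> assume "\<omega> \<in> {\<omega>\<in>space M. \<exists>s\<in>A. W s \<omega> < \<epsilon>}"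
    then have \<omega>: "\<omega> \<in> space M" and ne: "{s\<in>A. W s \<omega> < \<epsilon>} \<noteq> {}" by auto
    define s where "s = Min {s\<in>A. W s \<omega> < \<epsilon>}"
    have fin: "finite {s\<in>A. W s \<omega> < \<epsilon>}" using A by auto
    have "s \<in> {s\<in>A. W s \<omega> < \<epsilon>}" unfolding s_def by (rule Min_in[OF fin ne])
    moreover have "\<not> W s' \<omega> < \<epsilon>" if "s' \<in> A" "s' < s" for s'
      using Min_le[OF fin, of s'] that unfolding s_def[symmetric] by auto
    ultimately show "\<omega> \<in> (\<Union>s\<in>A. B s)" using \<omega> unfolding B_def by auto
  qed (auto simp: B_def)
  have le: "emeasure (density M Y) (B s) \<le> ennreal \<epsilon> * emeasure M (B s)" if s: "s \<in> A" for s
  proof -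
    have s': "s \<in> {0..T}" using s A by auto
    then interpret S: sigma_finite_subalgebra M "H s" by (intro cond_H) auto
    have i: "integrable M (\<lambda>\<omega>. indicator (B s) \<omega> *\<^sub>R Y \<omega>)" "integrable M (\<lambda>\<omega>. indicator (B s) \<omega> *\<^sub>R real_cond_exp M (H s) Y \<omega>)"
      by (intro integrable_mult_indicator BM[OF s] Y_integrable S.real_cond_exp_int)+
    have "emeasure (density M Y) (B s) = (\<integral>\<^sup>+\<omega>. ennreal (indicator (B s) \<omega> *\<^sub>R Y \<omega>) \<partial>M)"
      using BM[OF s] Y_measurable Y_bounds
      by (subst emeasure_density) (auto intro!: nn_integral_cong simp: indicator_def)
    also have "\<dots> = ennreal (\<integral>\<omega>. indicator (B s) \<omega> *\<^sub>R Y \<omega> \<partial>M)"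
      using i(1) Y_bounds by (intro nn_integral_eq_integral AE_I2) (auto simp: less_imp_le)
    also have "(\<integral>\<omega>. indicator (B s) \<omega> *\<^sub>R Y \<omega> \<partial>M) = (\<integral>\<omega>. indicator (B s) \<omega> *\<^sub>R real_cond_exp M (H s) Y \<omega> \<partial>M)"
      using S.real_cond_exp_intA[OF Y_integrable BH[OF s]] unfolding set_lebesgue_integral_def .
    also have "\<dots> \<le> (\<integral>\<omega>. \<epsilon> * indicator (B s) \<omega> \<partial>M)"
    proof (rule integral_mono_AE[OF i(2)])
      show "integrable M (\<lambda>\<omega>. \<epsilon> * indicator (B s) \<omega>)"
        using BM[OF s] by (intro integrable_mult_right integrable_real_indicator) (auto simp: less_top[symmetric])
      show "AE \<omega> in M. indicator (B s) \<omega> *\<^sub>R real_cond_exp M (H s) Y \<omega> \<le> \<epsilon> * indicator (B s) \<omega>"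
        using W_ge[OF s'] by eventually_elim (auto simp: B_def indicator_def)
    qed
    also have "\<dots> = \<epsilon> * measure M (B s)" using BM[OF s] by simp
    finally show ?thesis using \<epsilon> by (simp add: emeasure_eq_measure ennreal_mult[symmetric] ennreal_leI)
  qed
  have "emeasure (density M Y) (\<Union>s\<in>A. B s) = (\<Sum>s\<in>A. emeasure (density M Y) (B s))"
    using BM by (intro sum_emeasure[symmetric] disj A) auto
  also have "\<dots> \<le> (\<Sum>s\<in>A. ennreal \<epsilon> * emeasure M (B s))" by (intro sum_mono le)
  also have "\<dots> = ennreal \<epsilon> * emeasure M (\<Union>s\<in>A. B s)"
    unfolding sum_distrib_left[symmetric] using BM by (subst sum_emeasure[OF _ disj A(1)]) auto
  also have "\<dots> \<le> ennreal \<epsilon> * 1" by (intro mult_left_mono measure_le_1) auto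
  finally show ?thesis unfolding un by simp
qed

text \<open>Let the finite set grow to all rational times and \<open>\<epsilon>\<close> go to zero:
  the scenarios without a positive lower bound have mass zero under the density \<open>Y\<close>,
  hence probability zero because \<open>Y > 0\<close>.\<close>

lemma W_rational_pos: "AE \<omega> in M. \<exists>\<epsilon>>0. \<forall>q\<in>\<rat> \<inter> {0..T}. \<epsilon> \<le> W q \<omega>"
proof -
  let ?Q = "\<rat> \<inter> {0..T}"
  have cQ: "countable ?Q" using countable_rat by (rule countable_subset[rotated]) auto
  have neQ: "?Q \<noteq> {}" using T_pos by (auto intro!: exI[of _ 0])
  define R where "R = from_nat_into ?Q"
  have R: "range R = ?Q" unfolding R_def by (rule range_from_nat_into[OF neQ cQ])
  have Wm: "W q \<in> borel_measurable M" if "q \<in> {0..T}" for q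
    using H.measurable_F'[OF _ W_adapted[OF that]] that by auto
  define Bad where "Bad \<epsilon> = {\<omega>\<in>space M. \<exists>q\<in>?Q. W q \<omega> < \<epsilon>}" for \<epsilon>
  have fin: "{\<omega>\<in>space M. \<exists>s\<in>R ` {..n}. W s \<omega> < \<epsilon>} \<in> sets M" for n \<epsilon>
  proof -
    have "{\<omega>\<in>space M. \<exists>s\<in>R ` {..n}. W s \<omega> < \<epsilon>} = (\<Union>i\<le>n. {\<omega>\<in>space M. W (R i) \<omega> < \<epsilon>})" by auto
    moreover have "{\<omega>\<in>space M. W (R i) \<omega> < \<epsilon>} \<in> sets M" for i
    proof -
      have [measurable]: "W (R i) \<in> borel_measurable M" using R by (intro Wm) auto
      show ?thesis by measurable
    qed
    ultimately show ?thesis by auto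
  qed
  have Bad_un: "Bad \<epsilon> = (\<Union>n. {\<omega>\<in>space M. \<exists>s\<in>R ` {..n}. W s \<omega> < \<epsilon>})" for \<epsilon>
    unfolding Bad_def R[symmetric] by auto
  have BadM: "Bad \<epsilon> \<in> sets M" for \<epsilon> unfolding Bad_un using fin by auto
  have Bad_le: "emeasure (density M Y) (Bad \<epsilon>) \<le> ennreal \<epsilon>" if "0 < \<epsilon>" for \<epsilon>
  proof -
    have "emeasure (density M Y) (Bad \<epsilon>) = (SUP n. emeasure (density M Y) {\<omega>\<in>space M. \<exists>s\<in>R ` {..n}. W s \<omega> < \<epsilon>})"
      unfolding Bad_un
    proof (rule SUP_emeasure_incseq[symmetric])
      show "incseq (\<lambda>n. {\<omega>\<in>space M. \<exists>s\<in>R ` {..n}. W s \<omega> < \<epsilon>})"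
        unfolding incseq_def by (auto intro: order_trans)
    qed (use fin in auto)
    also have "\<dots> \<le> ennreal \<epsilon>"
    proof (rule SUP_least)
      fix n show "emeasure (density M Y) {\<omega>\<in>space M. \<exists>s\<in>R ` {..n}. W s \<omega> < \<epsilon>} \<le> ennreal \<epsilon>"
        using R that by (intro W_first_passage) auto
    qed
    finally show ?thesis .
  qed
  define B where "B = (\<Inter>m. Bad (1 / real (Suc m)))"
  have BM: "B \<in> sets M" unfolding B_def using BadM by auto
  have "emeasure (density M Y) B \<le> 0 + ennreal e" if e: "0 < e" for e :: real
  proof -
    obtain m where m: "1 / real (Suc m) < e" using reals_Archimedean[OF e] by (auto simp: inverse_eq_divide)
    have "emeasure (density M Y) B \<le> emeasure (density M Y) (Bad (1 / real (Suc m)))"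
      by (rule emeasure_mono) (use BadM in \<open>auto simp: B_def\<close>)
    also have "\<dots> \<le> ennreal (1 / real (Suc m))" by (rule Bad_le) simp
    also have "\<dots> \<le> ennreal e" using m by (intro ennreal_leI) auto
    finally show ?thesis by simp
  qed
  then have "emeasure (density M Y) B \<le> 0" by (rule ennreal_le_epsilon)
  then have "B \<in> null_sets (density M Y)" using BM by (simp add: null_sets_def)
  then have "AE \<omega> in M. \<omega> \<in> B \<longrightarrow> ennreal (Y \<omega>) = 0"
    using Y_measurable by (subst (asm) null_sets_density_iff) auto
  then show ?thesis
  proof (rule AE_mp, intro AE_I2 impI)
    fix \<omega> assume \<omega>: "\<omega> \<in> space M" and "\<omega> \<in> B \<longrightarrow> ennreal (Y \<omega>) = 0"
    then have "\<omega> \<notin> B" using Y_bounds(1)[of \<omega>] by auto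
    then obtain m where "\<omega> \<notin> Bad (1 / real (Suc m))" unfolding B_def by auto
    then have "\<forall>q\<in>?Q. 1 / real (Suc m) \<le> W q \<omega>" using \<omega> unfolding Bad_def by (auto simp: not_less)
    then show "\<exists>\<epsilon>>0. \<forall>q\<in>?Q. \<epsilon> \<le> W q \<omega>" by (intro exI[of _ "1 / real (Suc m)"]) auto
  qed
qed

definition W_left :: "real \<Rightarrow> 'a \<Rightarrow> real" where
  "W_left t \<omega> = left_lim (\<lambda>s. W s \<omega>) t"

lemma W_terminal: "AE \<omega> in M. W T \<omega> = exp (- \<eta> * X (\<lambda>_ _. 1) T \<omega>)"
proof -
  have "{T<..T} = {}" by simp
  then have ci: "compensated_integral \<tau>1 Z1 p F1 \<Theta> T T \<omega> = 0" for \<omega>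
    unfolding compensated_integral_def by (simp add: set_lebesgue_integral_def)
  have gi: "(LINT s:{T..T}|lborel. g s \<omega>) = 0" for \<omega>
    unfolding set_lebesgue_integral_def
    by (rule integral_eq_zero_AE) (use AE_lborel_singleton[of T] in eventually_elim, auto)
  show ?thesis
    using W_eq
  proof eventually_elim
    case (elim \<omega>)
    then show ?case using ci[of \<omega>] gi[of \<omega>] T_pos by simp
  qed
qed

end

section \<open>Positivity of the value after a jump\<close>

lemma tilted_integral_integrable:
  fixes w :: "real \<Rightarrow> real"
  assumes w: "integrable N w" and z: "(\<lambda>z. z) \<in> borel_measurable N" "AE z in N. 0 < z" and \<kappa>: "0 < \<kappa>" and v: "v \<le> 1"
  shows "integrable N (\<lambda>z. w z * exp (- \<kappa> * z * (1 - v)))"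
proof (rule Bochner_Integration.integrable_bound[OF w])
  show "(\<lambda>z. w z * exp (- \<kappa> * z * (1 - v))) \<in> borel_measurable N" using w z(1) by measurable
  show "AE z in N. norm (w z * exp (- \<kappa> * z * (1 - v))) \<le> norm (w z)"
    using z(2) by eventually_elim (use \<kappa> v in \<open>auto simp: abs_mult intro!: mult_left_le\<close>)
qed

text \<open>The exponential factor increases strictly with the level at every positive mark, and
  integration against a probability measure keeps a strict inequality.\<close>

lemma tilted_integral_strict_mono:
  fixes w :: "real \<Rightarrow> real"
  assumes w: "integrable N w" "AE z in N. 0 < w z" and z: "(\<lambda>z. z) \<in> borel_measurable N" "AE z in N. 0 < z"
    and \<kappa>: "0 < \<kappa>" and v: "u < v" "v \<le> 1" and N: "prob_space N"
  shows "(\<integral>z. w z * exp (- \<kappa> * z * (1 - u)) \<partial>N) < (\<integral>z. w z * exp (- \<kappa> * z * (1 - v)) \<partial>N)"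
proof -
  interpret N: prob_space N by fact
  have "AE z in N. w z * exp (- \<kappa> * z * (1 - u)) < w z * exp (- \<kappa> * z * (1 - v))"
    using w(2) z(2) by eventually_elim (use \<kappa> v in \<open>auto intro!: mult_strict_left_mono\<close>)
  then show ?thesis
    using tilted_integral_integrable[OF w(1) z \<kappa>] v
    by (intro N.integral_less_AE_space) (auto simp: N.emeasure_space_1)
qed

lemma tilted_integral_continuous:
  fixes w :: "real \<Rightarrow> real"
  assumes w: "integrable N w" and z: "(\<lambda>z. z) \<in> borel_measurable N" "AE z in N. 0 < z" and \<kappa>: "0 < \<kappa>"
  shows "continuous_on {0..1} (\<lambda>v. \<integral>z. w z * exp (- \<kappa> * z * (1 - v)) \<partial>N)"
  unfolding continuous_on_sequentially comp_def
proof (intro allI ballI impI)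
  fix x and v :: real assume x: "v \<in> {0..1}" "(\<forall>n. x n \<in> {0..1}) \<and> x \<longlonglongrightarrow> v"
  show "(\<lambda>n. \<integral>z. w z * exp (- \<kappa> * z * (1 - x n)) \<partial>N) \<longlonglongrightarrow> (\<integral>z. w z * exp (- \<kappa> * z * (1 - v)) \<partial>N)"
  proof (rule integral_dominated_convergence[where w="\<lambda>z. \<bar>w z\<bar>"])
    show "AE z in N. (\<lambda>n. w z * exp (- \<kappa> * z * (1 - x n))) \<longlonglongrightarrow> w z * exp (- \<kappa> * z * (1 - v))"
      using x by (intro AE_I2 tendsto_intros) auto
    show "AE z in N. norm (w z * exp (- \<kappa> * z * (1 - x n))) \<le> \<bar>w z\<bar>" for n
      using z(2) by eventually_elim (use \<kappa> x in \<open>auto simp: abs_mult intro!: mult_left_le\<close>)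
    show "integrable N (\<lambda>z. \<bar>w z\<bar>)" using w by simp
    have [measurable]: "w \<in> borel_measurable N" "(\<lambda>z. z) \<in> borel_measurable N" using w z(1) by auto
    show "(\<lambda>z. w z * exp (- \<kappa> * z * (1 - v))) \<in> borel_measurable N"
      "(\<lambda>z. w z * exp (- \<kappa> * z * (1 - x n))) \<in> borel_measurable N" for n by measurable
  qed
qed

text \<open>In the third case monotonicity and continuity give a unique crossing point
  \<open>v0\<close>, and the rationals below \<open>v0\<close> are dense there, so the countable
  supremum still equals \<open>v0\<close>. Inserting \<open>0\<close> fixes the value when the
  sublevel set is empty.\<close>

lemma Sup_rational_sublevel:
  fixes h :: "real \<Rightarrow> real" and C :: real
  assumes mono: "\<And>u v. 0 \<le> u \<Longrightarrow> u < v \<Longrightarrow> v \<le> 1 \<Longrightarrow> h u < h v" and cont: "continuous_on {0..1} h"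
  defines "s \<equiv> Sup (insert 0 {v\<in>\<rat> \<inter> {0..1}. h v \<le> C})"
  shows "C < h 0 \<Longrightarrow> s = 0" "h 1 < C \<Longrightarrow> s = 1" "h 0 \<le> C \<Longrightarrow> C \<le> h 1 \<Longrightarrow> h s = C"
proof -
  have le: "h u \<le> h v" if "0 \<le> u" "u \<le> v" "v \<le> 1" for u v using mono[of u v] that by (cases "u = v") auto
  show "s = 0" if "C < h 0"
  proof -
    have "{v\<in>\<rat> \<inter> {0..1}. h v \<le> C} = {}" using le[of 0] that by fastforce
    then show ?thesis unfolding s_def by (simp only:) simp
  qed
  show "s = 1" if "h 1 < C"
  proof -
    have "h v \<le> C" if "v \<in> {0..1}" for v using le[of v 1] that \<open>h 1 < C\<close> by auto
    then have "1 \<in> {v\<in>\<rat> \<inter> {0..1}. h v \<le> C}" by auto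
    then show ?thesis unfolding s_def by (intro cSup_eq_maximum) auto
  qed
  show "h s = C" if h: "h 0 \<le> C" "C \<le> h 1"
  proof -
    obtain v0 where v0: "0 \<le> v0" "v0 \<le> 1" "h v0 = C" using IVT'[of h 0 C 1] h cont by auto
    have "s = v0"
      unfolding s_def
    proof (rule cSup_eq)
      fix x assume "x \<in> insert 0 {v\<in>\<rat> \<inter> {0..1}. h v \<le> C}"
      then show "x \<le> v0" using mono[of v0 x] v0 by force
    next
      fix y assume y: "\<And>x. x \<in> insert 0 {v\<in>\<rat> \<inter> {0..1}. h v \<le> C} \<Longrightarrow> x \<le> y"
      show "v0 \<le> y"
      proof (rule ccontr)
        assume "\<not> v0 \<le> y"
        then obtain a where a: "a \<in> \<rat>" "y < a" "a < v0" using Rats_dense_in_real[of y v0] by auto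
        moreover have "0 \<le> y" using y by auto
        ultimately have "a \<le> y" using le[of a v0] v0 by (intro y) auto
        with a show False by simp
      qed
    qed
    then show ?thesis using v0 by simp
  qed
qed

lemma abs_le_sq: "\<bar>x\<bar> \<le> x\<^sup>2 + 1" for x :: real
proof -
  have "0 \<le> (\<bar>x\<bar> - 1)\<^sup>2" by simp
  then have "2 * \<bar>x\<bar> \<le> x\<^sup>2 + 1" by (simp add: power2_diff)
  then show ?thesis by linarith
qed

lemma abs_mult_le_sq: "\<bar>x * y\<bar> \<le> x\<^sup>2 + y\<^sup>2" for x y :: real
proof -
  have "0 \<le> (\<bar>x\<bar> - \<bar>y\<bar>)\<^sup>2" by simp
  then have "2 * (\<bar>x\<bar> * \<bar>y\<bar>) \<le> x\<^sup>2 + y\<^sup>2" by (simp add: power2_diff)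
  moreover have "0 \<le> \<bar>x\<bar> * \<bar>y\<bar>" by simp
  ultimately show ?thesis unfolding abs_mult by linarith
qed

context reinsurance
begin

lemma \<Theta>_field: "(\<lambda>x. \<Theta> (fst (fst x)) (snd (fst x)) (snd x)) \<in> borel_measurable (field_sigma {0..T} H)"
  using \<Theta>_L2 unfolding in_L2hat_def predictable_field_def split_beta by auto

lemma p_left_field: "(\<lambda>x. p_left (fst (fst x)) (snd (fst x))) \<in> borel_measurable (field_sigma {0..T} H)"
  using H.measurable_field_fst[OF p_left_predictable] by (simp add: split_beta)

lemma W_left_predictable: "(\<lambda>(t, \<omega>). W_left t \<omega>) \<in> borel_measurable (predictable_sigma {0..T} H)"
  unfolding W_left_def by (rule H.predictable_left_lim[OF T_nonneg W_adapted W_cadlag])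

lemma W_left_field: "(\<lambda>x. W_left (fst (fst x)) (snd (fst x))) \<in> borel_measurable (field_sigma {0..T} H)"
  using H.measurable_field_fst[OF W_left_predictable] by (simp add: split_beta)

lemma AE_clock_pos: "AE t in clock T. t \<in> {0<..T}"
proof -
  have "AE t in clock T. t \<noteq> 0 \<and> t \<in> {0..T}"
    unfolding AE_clock using AE_lborel_singleton[of 0] by eventually_elim auto
  then show ?thesis by eventually_elim auto
qed

lemma mark_section: "f \<in> borel_measurable (field_sigma {0..T} H) \<Longrightarrow> t \<in> {0..T} \<Longrightarrow> \<omega> \<in> space M \<Longrightarrow>
    (\<lambda>z. f ((t, \<omega>), z)) \<in> borel_measurable (mark_law F1)"
  by (rule field_mark_section)

lemma \<Theta>_section: "t \<in> {0..T} \<Longrightarrow> \<omega> \<in> space M \<Longrightarrow> \<Theta> t \<omega> \<in> borel_measurable (mark_law F1)"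
  using mark_section[OF \<Theta>_field] by simp

lemma z_measurable: "(\<lambda>z. z) \<in> borel_measurable (mark_law F1)"
  by (rule borel_measurable_integrable[OF z1_integrable])

lemma clock_path: "f \<in> borel_measurable (predictable_sigma {0..T} H) \<Longrightarrow> \<omega> \<in> space M \<Longrightarrow>
    (\<lambda>t. f (t, \<omega>)) \<in> borel_measurable (clock T)"
  using H.predictable_path[OF _ T_nonneg, of f borel \<omega>] by (simp cong: measurable_cong_sets add: sets_clock)

section \<open>The backward equation read forward along a path\<close>

lemma \<Theta>_sq_mean_finite: 
  "(\<integral>\<^sup>+\<omega>. \<integral>\<^sup>+t. \<integral>\<^sup>+z. ennreal ((\<Theta> t \<omega> z)\<^sup>2 * p_left t \<omega>) \<partial>mark_law F1 \<partial>clock T \<partial>M) < \<infinity>"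
proof -
  have "(\<integral>\<^sup>+z\<in>{0<..}. ennreal ((\<Theta> t \<omega> z)\<^sup>2 * p_left t \<omega>) \<partial>F1) = (\<integral>\<^sup>+z. ennreal ((\<Theta> t \<omega> z)\<^sup>2 * p_left t \<omega>) \<partial>mark_law F1)" for t \<omega>
    by (subst nn_integral_restrict_space) auto
  then show ?thesis
    using \<Theta>_L2 unfolding in_L2hat_def sq_norm_L2hat_def p_left_def[symmetric] nn_integral_clock by simp
qed

lemma \<Theta>_sq_finite: "AE \<omega> in M. (\<integral>\<^sup>+t. \<integral>\<^sup>+z. ennreal ((\<Theta> t \<omega> z)\<^sup>2 * p_left t \<omega>) \<partial>mark_law F1 \<partial>clock T) \<noteq> \<infinity>"
proof (rule nn_integral_PInf_AE)
  show "(\<integral>\<^sup>+\<omega>. \<integral>\<^sup>+t. \<integral>\<^sup>+z. ennreal ((\<Theta> t \<omega> z)\<^sup>2 * p_left t \<omega>) \<partial>mark_law F1 \<partial>clock T \<partial>M) \<noteq> \<infinity>"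
    using \<Theta>_sq_mean_finite by simp
  have "(\<lambda>x. ennreal ((\<Theta> (fst (fst x)) (snd (fst x)) (snd x))\<^sup>2 * p_left (fst (fst x)) (snd (fst x)))) \<in> borel_measurable (field_sigma {0..T} H)"
    using \<Theta>_field p_left_field by measurable
  from H.measurable_time_scenario[OF predictable_nn_integral_mark[OF this] T_nonneg]
  have "(\<lambda>x. \<integral>\<^sup>+z. ennreal ((\<Theta> (fst x) (snd x) z)\<^sup>2 * p_left (fst x) (snd x)) \<partial>mark_law F1) \<in> borel_measurable (clock T \<Otimes>\<^sub>M M)"
    unfolding time_scenario_def by simp
  from measurable_compose[OF measurable_pair_swap' this]
  show "(\<lambda>\<omega>. \<integral>\<^sup>+t. \<integral>\<^sup>+z. ennreal ((\<Theta> t \<omega> z)\<^sup>2 * p_left t \<omega>) \<partial>mark_law F1 \<partial>clock T) \<in> borel_measurable M"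
    by (intro clock.borel_measurable_nn_integral) (simp add: split_beta)
qed

text \<open>The rate at which the jumps \<open>\<Theta>\<close> are compensated; subtracted from
  \<open>g\<close> it gives the drift of \<open>W\<close> between claims.\<close>

definition \<theta>b :: "real \<Rightarrow> 'a \<Rightarrow> real" where
  "\<theta>b t \<omega> = (\<integral>z. \<Theta> t \<omega> z * p_left t \<omega> \<partial>mark_law F1)"

lemma \<theta>b_predictable: "(\<lambda>(t, \<omega>). \<theta>b t \<omega>) \<in> borel_measurable (predictable_sigma {0..T} H)"
proof -
  have "(\<lambda>x. \<Theta> (fst (fst x)) (snd (fst x)) (snd x) * p_left (fst (fst x)) (snd (fst x))) \<in> borel_measurable (field_sigma {0..T} H)"
    using \<Theta>_field p_left_field by measurable
  from predictable_integral_mark[OF this] show ?thesis unfolding \<theta>b_def split_beta by simp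
qed

text \<open>Since \<open>|x| \<le> x^2 + 1\<close> and the filter is bounded on each path, the
  square norm of \<open>\<Theta>\<close> dominates.\<close>

lemma \<theta>b_integrable: "AE \<omega> in M. set_integrable lborel {0..T} (\<lambda>t. \<theta>b t \<omega>)"
  using \<Theta>_sq_finite p_left_ge
proof (rule AE_mp[OF _ AE_mp], intro AE_I2 impI)
  fix \<omega> assume \<omega>: "\<omega> \<in> space M" and pl: "\<forall>t\<in>{0<..T}. min \<beta> lam0 \<le> p_left t \<omega>"
    and fin: "(\<integral>\<^sup>+t. \<integral>\<^sup>+z. ennreal ((\<Theta> t \<omega> z)\<^sup>2 * p_left t \<omega>) \<partial>mark_law F1 \<partial>clock T) \<noteq> \<infinity>"
  obtain B where B: "\<And>t. t \<in> {0..T} \<Longrightarrow> \<bar>p_left t \<omega>\<bar> \<le> B" using p_left_bounded[OF \<omega>] by blast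
  have Bn: "0 \<le> B" using B[of 0] T_pos by auto
  have bnd: "ennreal (norm (\<theta>b t \<omega>)) \<le> (\<integral>\<^sup>+z. ennreal ((\<Theta> t \<omega> z)\<^sup>2 * p_left t \<omega>) \<partial>mark_law F1) + ennreal B"
    if t: "t \<in> {0<..T}" for t
  \<comment> \<open>Where the mark integral does not exist, \<open>\<theta>b\<close> is
    \<open>0\<close> by convention and the bound is trivial.\<close>
  proof (cases "integrable (mark_law F1) (\<lambda>z. \<Theta> t \<omega> z * p_left t \<omega>)")
    case True
    have pl0: "0 \<le> p_left t \<omega>" using pl t intensity_floor_pos by (meson order.trans less_imp_le)
    have t': "t \<in> {0..T}" using t by auto
    have m: "(\<lambda>z. ennreal ((\<Theta> t \<omega> z)\<^sup>2 * p_left t \<omega>)) \<in> borel_measurable (mark_law F1)"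
      using \<Theta>_section[OF t' \<omega>] by measurable
    have "ennreal (norm (\<theta>b t \<omega>)) \<le> (\<integral>\<^sup>+z. ennreal (norm (\<Theta> t \<omega> z * p_left t \<omega>)) \<partial>mark_law F1)"
      unfolding \<theta>b_def by (rule integral_norm_bound_ennreal[OF True])
    also have "\<dots> \<le> (\<integral>\<^sup>+z. ennreal ((\<Theta> t \<omega> z)\<^sup>2 * p_left t \<omega>) + ennreal B \<partial>mark_law F1)"
    proof (rule nn_integral_mono)
      fix z
      have "norm (\<Theta> t \<omega> z * p_left t \<omega>) \<le> ((\<Theta> t \<omega> z)\<^sup>2 + 1) * p_left t \<omega>"
        using mult_right_mono[OF abs_le_sq pl0, of "\<Theta> t \<omega> z"] pl0 by (simp add: abs_mult)
      also have "\<dots> \<le> (\<Theta> t \<omega> z)\<^sup>2 * p_left t \<omega> + B" using B[OF t'] by (simp add: distrib_right)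
      finally have "ennreal (norm (\<Theta> t \<omega> z * p_left t \<omega>)) \<le> ennreal ((\<Theta> t \<omega> z)\<^sup>2 * p_left t \<omega> + B)" by (rule ennreal_leI)
      then show "ennreal (norm (\<Theta> t \<omega> z * p_left t \<omega>)) \<le> ennreal ((\<Theta> t \<omega> z)\<^sup>2 * p_left t \<omega>) + ennreal B"
        using pl0 Bn by (simp add: ennreal_plus)
    qed
    also have "\<dots> = (\<integral>\<^sup>+z. ennreal ((\<Theta> t \<omega> z)\<^sup>2 * p_left t \<omega>) \<partial>mark_law F1) + ennreal B"
      using mark.emeasure_space_1 m by (subst nn_integral_add) (auto)
    finally show ?thesis .
  qed (simp add: \<theta>b_def not_integrable_integral_eq)
  have "integrable (clock T) (\<lambda>t. \<theta>b t \<omega>)"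
    unfolding integrable_iff_bounded
  proof
    show "(\<lambda>t. \<theta>b t \<omega>) \<in> borel_measurable (clock T)" using clock_path[OF \<theta>b_predictable \<omega>] by simp
    have m: "(\<lambda>t. \<integral>\<^sup>+z. ennreal ((\<Theta> t \<omega> z)\<^sup>2 * p_left t \<omega>) \<partial>mark_law F1) \<in> borel_measurable (clock T)"
    proof -
      have "(\<lambda>x. ennreal ((\<Theta> (fst (fst x)) (snd (fst x)) (snd x))\<^sup>2 * p_left (fst (fst x)) (snd (fst x)))) \<in> borel_measurable (field_sigma {0..T} H)"
        using \<Theta>_field p_left_field by measurable
      from clock_path[OF predictable_nn_integral_mark[OF this] \<omega>] show ?thesis by simp
    qed
    have "(\<integral>\<^sup>+t. ennreal (norm (\<theta>b t \<omega>)) \<partial>clock T) \<le>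
      (\<integral>\<^sup>+t. (\<integral>\<^sup>+z. ennreal ((\<Theta> t \<omega> z)\<^sup>2 * p_left t \<omega>) \<partial>mark_law F1) + ennreal B \<partial>clock T)"
      by (rule nn_integral_mono_AE) (use AE_clock_pos in eventually_elim, rule bnd)
    also have "\<dots> = (\<integral>\<^sup>+t. \<integral>\<^sup>+z. ennreal ((\<Theta> t \<omega> z)\<^sup>2 * p_left t \<omega>) \<partial>mark_law F1 \<partial>clock T) + ennreal B * emeasure (clock T) (space (clock T))"
      using m by (simp add: nn_integral_add)
    also have "\<dots> < \<infinity>"
    proof -
      have "emeasure (clock T) (space (clock T)) < \<top>"
        by (simp add: emeasure_restrict_space space_restrict_space T_nonneg)
      then have "ennreal B * emeasure (clock T) (space (clock T)) < \<top>" by (simp only: ennreal_mult_less_top) simp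
      then show ?thesis using fin by (simp add: less_top)
    qed
    finally show "(\<integral>\<^sup>+t. ennreal (norm (\<theta>b t \<omega>)) \<partial>clock T) < \<infinity>" .
  qed
  then show "set_integrable lborel {0..T} (\<lambda>t. \<theta>b t \<omega>)" by (simp add: integrable_clock_iff)
qed

definition \<Theta>j :: "nat \<Rightarrow> 'a \<Rightarrow> real" where
  "\<Theta>j j \<omega> = \<Theta> (real_of_ereal (\<tau>1 j \<omega>)) \<omega> (Z1 j \<omega>)"

text \<open>Comparing the equation at \<open>t\<close> with the one at \<open>0\<close> removes the
  terminal value and everything after \<open>t\<close>. What remains is a finite sum of jumps and an
  absolutely continuous part, the form to which the product formula applies.\<close>

lemma W_path: "AE \<omega> in M. set_integrable lborel {0..T} (\<lambda>s. g s \<omega> - \<theta>b s \<omega>) \<and>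
    (\<forall>t\<in>{0..T}. W t \<omega> = W 0 \<omega> + (\<Sum>j | \<tau>1 j \<omega> \<le> ereal t. \<Theta>j j \<omega>) + integral {0..t} (\<lambda>s. g s \<omega> - \<theta>b s \<omega>))"
  using W_eq g_int \<theta>b_integrable
proof (rule AE_mp[OF _ AE_mp[OF _ AE_mp]], intro AE_I2 impI)
  fix \<omega> assume \<omega>: "\<omega> \<in> space M" and gi: "set_integrable lborel {0..T} (\<lambda>t. g t \<omega>)" and ti: "set_integrable lborel {0..T} (\<lambda>t. \<theta>b t \<omega>)"
    and W: "\<forall>t\<in>{0..T}. W t \<omega> = exp (- \<eta> * X (\<lambda>_ _. 1) T \<omega>) - compensated_integral \<tau>1 Z1 p F1 \<Theta> t T \<omega> - (LINT s:{t..T}|lborel. g s \<omega>)"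
  have gs: "(\<lambda>t. g t \<omega>) integrable_on {0..T}" "(\<lambda>t. \<theta>b t \<omega>) integrable_on {0..T}"
    using gi ti by (auto intro: set_borel_integral_eq_integral)
  have gsub: "(\<lambda>t. g t \<omega>) integrable_on {0..t}" "(\<lambda>t. \<theta>b t \<omega>) integrable_on {0..t}" if "t \<in> {0..T}" for t
    using gs that by (auto intro: integrable_subinterval_real)
  have ci: "compensated_integral \<tau>1 Z1 p F1 \<Theta> t T \<omega> = (\<Sum>j | \<tau>1 j \<omega> \<le> ereal T. \<Theta>j j \<omega>) - (\<Sum>j | \<tau>1 j \<omega> \<le> ereal t. \<Theta>j j \<omega>)
      - integral {0..T} (\<lambda>s. \<theta>b s \<omega>) + integral {0..t} (\<lambda>s. \<theta>b s \<omega>)" if t: "t \<in> {0..T}" for t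
  proof -
    have ivl: "{t<..T} \<subseteq> {0..T}" using t by auto
    have "(\<lambda>x. indicator ({t<..T} \<times> {0<..}) x *\<^sub>R \<Theta> (fst x) \<omega> (snd x)) \<in> borel_measurable borel"
      using measurable_pair_restrict_indicator[OF H.predictable_field_path[OF \<Theta>_field T_nonneg \<omega>] _ ivl] by auto
    then have 1: "(LINT x:{t<..T} \<times> {0<..}|jump_measure \<tau>1 Z1 \<omega>. \<Theta> (fst x) \<omega> (snd x)) =
      (\<Sum>j | ereal t < \<tau>1 j \<omega> \<and> \<tau>1 j \<omega> \<le> ereal T. \<Theta>j j \<omega>)"
      unfolding \<Theta>j_def by (intro integral_jump_measure[OF jumps1 \<omega>] J1.Z_pos[OF \<omega>])
    have 2: "(\<Sum>j | ereal t < \<tau>1 j \<omega> \<and> \<tau>1 j \<omega> \<le> ereal T. \<Theta>j j \<omega>) =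
      (\<Sum>j | \<tau>1 j \<omega> \<le> ereal T. \<Theta>j j \<omega>) - (\<Sum>j | \<tau>1 j \<omega> \<le> ereal t. \<Theta>j j \<omega>)"
    proof -
      have sub: "{j. \<tau>1 j \<omega> \<le> ereal t} \<subseteq> {j. \<tau>1 j \<omega> \<le> ereal T}" using t by (auto intro: order_trans)
      have "{j. ereal t < \<tau>1 j \<omega> \<and> \<tau>1 j \<omega> \<le> ereal T} = {j. \<tau>1 j \<omega> \<le> ereal T} - {j. \<tau>1 j \<omega> \<le> ereal t}" by auto
      then show ?thesis using sum_diff[OF jump_timesD(4)[OF jumps1 \<omega>] sub, of "\<lambda>j. \<Theta>j j \<omega>"] by simp
    qed
    have 3: "(LINT s:{t<..T}|lborel. (LINT z:{0<..}|F1. \<Theta> s \<omega> z * left_lim (\<lambda>t. p t \<omega>) s)) = (LINT s:{t<..T}|lborel. \<theta>b s \<omega>)"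
      unfolding \<theta>b_def p_left_def set_integral_mark ..
    have 4: "(LINT s:{t<..T}|lborel. \<theta>b s \<omega>) = integral {0..T} (\<lambda>s. \<theta>b s \<omega>) - integral {0..t} (\<lambda>s. \<theta>b s \<omega>)"
    proof -
      have s1: "set_integrable lborel {0..t} (\<lambda>s. \<theta>b s \<omega>)" "set_integrable lborel {t<..T} (\<lambda>s. \<theta>b s \<omega>)"
        using t by (auto intro!: set_integrable_subset[OF ti])
      have "{0..T} = {0..t} \<union> {t<..T}" "{0..t} \<inter> {t<..T} = {}" using t by auto
      then have "(LINT s:{0..T}|lborel. \<theta>b s \<omega>) = (LINT s:{0..t}|lborel. \<theta>b s \<omega>) + (LINT s:{t<..T}|lborel. \<theta>b s \<omega>)"
        using set_integral_Un[OF _ s1] by simp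
      then show ?thesis using set_borel_integral_eq_integral(2)[OF ti] set_borel_integral_eq_integral(2)[OF s1(1)] by simp
    qed
    show ?thesis unfolding compensated_integral_def 1 2 3 4 by simp
  qed
  have Wt: "W t \<omega> = exp (- \<eta> * X (\<lambda>_ _. 1) T \<omega>) - (\<Sum>j | \<tau>1 j \<omega> \<le> ereal T. \<Theta>j j \<omega>) + integral {0..T} (\<lambda>s. \<theta>b s \<omega>)
      - integral {0..T} (\<lambda>s. g s \<omega>)
      + ((\<Sum>j | \<tau>1 j \<omega> \<le> ereal t. \<Theta>j j \<omega>) + integral {0..t} (\<lambda>s. g s \<omega> - \<theta>b s \<omega>))" if t: "t \<in> {0..T}" for t
  proof -
    have st: "set_integrable lborel {t..T} (\<lambda>s. g s \<omega>)" using t by (auto intro!: set_integrable_subset[OF gi])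
    have "(LINT s:{t..T}|lborel. g s \<omega>) = integral {0..T} (\<lambda>s. g s \<omega>) - integral {0..t} (\<lambda>s. g s \<omega>)"
      using set_borel_integral_eq_integral(2)[OF st] Henstock_Kurzweil_Integration.integral_combine[of 0 t T "\<lambda>s. g s \<omega>"] gs t by simp
    moreover have "integral {0..t} (\<lambda>s. g s \<omega> - \<theta>b s \<omega>) = integral {0..t} (\<lambda>s. g s \<omega>) - integral {0..t} (\<lambda>s. \<theta>b s \<omega>)"
      by (rule integral_diff[OF gsub[OF t]])
    ultimately show ?thesis using W ci[OF t] t by simp
  qed
  have "{j. \<tau>1 j \<omega> \<le> ereal 0} = {}" using jump_timesD(1)[OF jumps1 \<omega>] by (simp add: zero_ereal_def[symmetric] not_le)
  then have W0: "W 0 \<omega> = exp (- \<eta> * X (\<lambda>_ _. 1) T \<omega>) - (\<Sum>j | \<tau>1 j \<omega> \<le> ereal T. \<Theta>j j \<omega>) + integral {0..T} (\<lambda>s. \<theta>b s \<omega>)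
      - integral {0..T} (\<lambda>s. g s \<omega>)" using Wt[of 0] T_pos by simp
  show "set_integrable lborel {0..T} (\<lambda>s. g s \<omega> - \<theta>b s \<omega>) \<and>
    (\<forall>t\<in>{0..T}. W t \<omega> = W 0 \<omega> + (\<Sum>j | \<tau>1 j \<omega> \<le> ereal t. \<Theta>j j \<omega>) + integral {0..t} (\<lambda>s. g s \<omega> - \<theta>b s \<omega>))"
    using W0 Wt set_integral_diff(1)[OF gi ti] by auto
qed

text \<open>The integral term is continuous and distinct jumps occur at distinct times, so the left
  limit at jump \<open>j\<close> misses exactly the summand \<open>x j\<close>.\<close>

lemma W_path_jump:
  assumes \<omega>: "\<omega> \<in> space M" and b: "set_integrable lborel {0..T} b"
    and W: "\<And>t. t \<in> {0..T} \<Longrightarrow> W t \<omega> = W 0 \<omega> + (\<Sum>j | \<tau>1 j \<omega> \<le> ereal t. x j) + integral {0..t} b"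
    and j: "\<tau>1 j \<omega> \<le> ereal T"
  shows "W (real_of_ereal (\<tau>1 j \<omega>)) \<omega> = W_left (real_of_ereal (\<tau>1 j \<omega>)) \<omega> + x j"
proof -
  define t where "t = real_of_ereal (\<tau>1 j \<omega>)"
  have t: "0 < t" "t \<le> T" "ereal t = \<tau>1 j \<omega>" using jump_time_real[OF jumps1 \<omega> j] by (auto simp: t_def)
  have bi: "b integrable_on {0..T}" using b by (rule set_borel_integral_eq_integral)
  have c: "continuous_on {0..T} (\<lambda>t. integral {0..t} b)" by (rule indefinite_integral_continuous_1[OF bi])
  have "((\<lambda>s. integral {0..s} b) \<longlongrightarrow> integral {0..t} b) (at t within {0..T})"
    using c t by (auto simp: continuous_on_def)
  then have lim: "((\<lambda>s. integral {0..s} b) \<longlongrightarrow> integral {0..t} b) (at_left t)"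
    by (rule filterlim_mono[OF _ order_refl]) (use t in \<open>auto simp: at_within_Icc_at_left[symmetric] intro!: at_le\<close>)
  have "((\<lambda>s. W 0 \<omega> + (\<Sum>j | \<tau>1 j \<omega> \<le> ereal s. x j) + integral {0..s} b)
      \<longlongrightarrow> W 0 \<omega> + (\<Sum>j | \<tau>1 j \<omega> < ereal t. x j) + integral {0..t} b) (at_left t)"
    by (intro tendsto_add tendsto_const lim sum_jumps_left_tendsto[OF jumps1 \<omega>])
  moreover have "eventually (\<lambda>s. W 0 \<omega> + (\<Sum>j | \<tau>1 j \<omega> \<le> ereal s. x j) + integral {0..s} b = W s \<omega>) (at_left t)"
    unfolding eventually_at_left_field using t by (intro exI[of _ 0]) (auto intro!: W[symmetric])
  ultimately have "((\<lambda>s. W s \<omega>) \<longlongrightarrow> W 0 \<omega> + (\<Sum>j | \<tau>1 j \<omega> < ereal t. x j) + integral {0..t} b) (at_left t)"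
    by (rule Lim_transform_eventually)
  then have WL: "W_left t \<omega> = W 0 \<omega> + (\<Sum>j | \<tau>1 j \<omega> < ereal t. x j) + integral {0..t} b"
    unfolding W_left_def by (rule left_lim_eqI[OF _ t(1)])
  have "{i. \<tau>1 i \<omega> \<le> ereal t} = insert j {i. \<tau>1 i \<omega> < ereal t}"
  proof -
    have "i = j" if "\<tau>1 i \<omega> = \<tau>1 j \<omega>" for i
      using inj_onD[OF jump_times_inj[OF jumps1 \<omega>, of T], of i j] that j by auto
    then show ?thesis using t(3) by (auto simp: less_le)
  qed
  moreover have "j \<notin> {i. \<tau>1 i \<omega> < ereal t}" using t(3) by simp
  moreover have "finite {i. \<tau>1 i \<omega> < ereal t}"
    by (rule finite_subset[OF _ jump_timesD(4)[OF jumps1 \<omega>, of t]]) auto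
  ultimately have "(\<Sum>i | \<tau>1 i \<omega> \<le> ereal t. x i) = x j + (\<Sum>i | \<tau>1 i \<omega> < ereal t. x i)" by simp
  then show ?thesis using W[of t] WL t unfolding t_def[symmetric] by simp
qed

text \<open>Right-continuity carries the rational bound to all times before \<open>T\<close>; at
  \<open>T\<close> itself the value is an exponential by the terminal condition. Left limits inherit
  the bound.\<close>

lemma W_lower: "AE \<omega> in M. \<exists>\<epsilon>>0. (\<forall>t\<in>{0..T}. \<epsilon> \<le> W t \<omega>) \<and> (\<forall>t\<in>{0..T}. \<epsilon> \<le> W_left t \<omega>)"
  using W_rational_pos W_terminal
proof (rule AE_mp[OF _ AE_mp], intro AE_I2 impI)
  fix \<omega> assume \<omega>: "\<omega> \<in> space M" and "\<exists>\<epsilon>>0. \<forall>q\<in>\<rat> \<inter> {0..T}. \<epsilon> \<le> W q \<omega>" and WT: "W T \<omega> = exp (- \<eta> * X (\<lambda>_ _. 1) T \<omega>)"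
  then obtain e where e: "0 < e" "\<And>q. q \<in> \<rat> \<Longrightarrow> 0 \<le> q \<Longrightarrow> q \<le> T \<Longrightarrow> e \<le> W q \<omega>" by auto
  define \<epsilon> where "\<epsilon> = min e (W T \<omega>)"
  have ge: "\<epsilon> \<le> W t \<omega>" if "t \<in> {0..T}" for t
  proof (cases "t = T")
    case False
    then have "e \<le> W t \<omega>" using that by (intro cadlag_on_ge_rational[OF W_cadlag[OF \<omega>] e(2)]) auto
    then show ?thesis by (simp add: \<epsilon>_def)
  qed (simp add: \<epsilon>_def)
  have "\<epsilon> \<le> W_left t \<omega>" if t: "t \<in> {0..T}" for t
  proof (cases "t = 0")
    case True
    then show ?thesis using ge[of 0] T_pos by (simp add: W_left_def left_lim_def)
  next
    case False
    then show ?thesis unfolding W_left_def using t ge by (intro left_lim_between[OF W_cadlag[OF \<omega>]]) auto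
  qed
  moreover have "0 < \<epsilon>" using e(1) WT by (simp add: \<epsilon>_def)
  ultimately show "\<exists>\<epsilon>>0. (\<forall>t\<in>{0..T}. \<epsilon> \<le> W t \<omega>) \<and> (\<forall>t\<in>{0..T}. \<epsilon> \<le> W_left t \<omega>)" using ge by blast
qed

text \<open>Indicator of a nonpositive value after a jump, with extended nonnegative values so that
  the compensator identity applies to it.\<close>

definition bad :: "(real \<times> 'a) \<times> real \<Rightarrow> ennreal" where
  "bad x = (if 0 < W_left (fst (fst x)) (snd (fst x)) + \<Theta> (fst (fst x)) (snd (fst x)) (snd x) then 0 else 1)"

lemma bad_measurable: "bad \<in> borel_measurable (field_sigma {0..T} H)"
  using W_left_field \<Theta>_field unfolding bad_def[abs_def] by measurable

text \<open>\<open>W\<^sub>t\<^sub>- + \<Theta>\<^sub>t(z)\<close> is the value of the positive process \<open>W\<close> after a jump with mark \<open>z\<close>, so it is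
  positive wherever the compensator charges.\<close>

lemma W_left_plus_\<Theta>_pos: "AE \<omega> in M. AE t in clock T. (\<integral>\<^sup>+z. bad ((t, \<omega>), z) \<partial>mark_law F1) = 0"
proof -
  have "(\<integral>\<^sup>+\<omega>. (\<Sum>j | \<tau>1 j \<omega> \<le> ereal T. bad ((real_of_ereal (\<tau>1 j \<omega>), \<omega>), Z1 j \<omega>)) \<partial>M) = (\<integral>\<^sup>+\<omega>. 0 \<partial>M)"
  proof (rule nn_integral_cong_AE)
    show "AE \<omega> in M. (\<Sum>j | \<tau>1 j \<omega> \<le> ereal T. bad ((real_of_ereal (\<tau>1 j \<omega>), \<omega>), Z1 j \<omega>)) = 0"
      using W_path W_lower
    proof (rule AE_mp[OF _ AE_mp], intro AE_I2 impI sum.neutral ballI)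
      fix \<omega> j assume \<omega>: "\<omega> \<in> space M" and W: "set_integrable lborel {0..T} (\<lambda>s. g s \<omega> - \<theta>b s \<omega>) \<and>
        (\<forall>t\<in>{0..T}. W t \<omega> = W 0 \<omega> + (\<Sum>j | \<tau>1 j \<omega> \<le> ereal t. \<Theta>j j \<omega>) + integral {0..t} (\<lambda>s. g s \<omega> - \<theta>b s \<omega>))"
        and low: "\<exists>\<epsilon>>0. (\<forall>t\<in>{0..T}. \<epsilon> \<le> W t \<omega>) \<and> (\<forall>t\<in>{0..T}. \<epsilon> \<le> W_left t \<omega>)" and j': "j \<in> {j. \<tau>1 j \<omega> \<le> ereal T}"
      from j' have j: "\<tau>1 j \<omega> \<le> ereal T" by simp
      have "W (real_of_ereal (\<tau>1 j \<omega>)) \<omega> = W_left (real_of_ereal (\<tau>1 j \<omega>)) \<omega> + \<Theta>j j \<omega>"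
        by (rule W_path_jump[OF \<omega> conjunct1[OF W] _ j]) (use W in blast)
      moreover have "0 < W (real_of_ereal (\<tau>1 j \<omega>)) \<omega>"
        using low jump_time_real[OF jumps1 \<omega> j] by (meson atLeastAtMost_iff less_le_trans less_imp_le)
      ultimately show "bad ((real_of_ereal (\<tau>1 j \<omega>), \<omega>), Z1 j \<omega>) = 0" by (simp add: bad_def \<Theta>j_def)
    qed
  qed
  then have "(\<integral>\<^sup>+\<omega>. \<integral>\<^sup>+t. (\<integral>\<^sup>+z. bad ((t, \<omega>), z) \<partial>mark_law F1) * ennreal (p_left t \<omega>) \<partial>clock T \<partial>M) = 0"
    unfolding compensator_H[OF bad_measurable] by simp
  moreover have m: "(\<lambda>x. (\<integral>\<^sup>+z. bad (x, z) \<partial>mark_law F1) * ennreal (p_left (fst x) (snd x))) \<in> borel_measurable (predictable_sigma {0..T} H)"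
    using predictable_nn_integral_mark[OF bad_measurable] p_left_predictable unfolding split_beta by measurable
  have "(\<lambda>\<omega>. \<integral>\<^sup>+t. (\<integral>\<^sup>+z. bad ((t, \<omega>), z) \<partial>mark_law F1) * ennreal (p_left t \<omega>) \<partial>clock T) \<in> borel_measurable M"
    using measurable_compose[OF measurable_pair_swap' H.measurable_time_scenario[OF m T_nonneg, unfolded time_scenario_def]]
    by (intro clock.borel_measurable_nn_integral) (simp add: split_beta)
  ultimately have "AE \<omega> in M. (\<integral>\<^sup>+t. (\<integral>\<^sup>+z. bad ((t, \<omega>), z) \<partial>mark_law F1) * ennreal (p_left t \<omega>) \<partial>clock T) = 0"
    by (simp add: nn_integral_0_iff_AE)
  then show ?thesis
    using p_left_ge
  proof (rule AE_mp[OF _ AE_mp], intro AE_I2[where M=M] impI)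
    fix \<omega> assume \<omega>: "\<omega> \<in> space M" and pl: "\<forall>t\<in>{0<..T}. min \<beta> lam0 \<le> p_left t \<omega>"
      and "(\<integral>\<^sup>+t. (\<integral>\<^sup>+z. bad ((t, \<omega>), z) \<partial>mark_law F1) * ennreal (p_left t \<omega>) \<partial>clock T) = 0"
    then have "AE t in clock T. (\<integral>\<^sup>+z. bad ((t, \<omega>), z) \<partial>mark_law F1) * ennreal (p_left t \<omega>) = 0"
      using clock_path[OF m \<omega>] by (simp add: nn_integral_0_iff_AE)
    then show "AE t in clock T. (\<integral>\<^sup>+z. bad ((t, \<omega>), z) \<partial>mark_law F1) = 0"
      using AE_clock_pos
    proof eventually_elim
      case (elim t)
      \<comment> \<open>The positive floor of the filter allows it to be cancelled from the
        compensator.\<close>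
      have "0 < p_left t \<omega>" using pl elim(2) intensity_floor_pos by (meson less_le_trans)
      then show ?case using elim(1) by simp
    qed
  qed
qed

text \<open>Collects what the maximisation needs at a fixed time and scenario, so that the argument
  there is deterministic. The conditions hold jointly almost everywhere.\<close>

definition good :: "real \<Rightarrow> 'a \<Rightarrow> bool" where
  "good t \<omega> \<longleftrightarrow> 0 < W_left t \<omega> \<and> 0 < p_left t \<omega> \<and> (\<integral>\<^sup>+z. bad ((t, \<omega>), z) \<partial>mark_law F1) = 0 \<and>
    (\<integral>\<^sup>+z. ennreal ((\<Theta> t \<omega> z)\<^sup>2) \<partial>mark_law F1) < \<infinity>"

lemma good_path: "AE \<omega> in M. AE t in clock T. good t \<omega>"
  using W_left_plus_\<Theta>_pos p_left_ge W_lower \<Theta>_sq_finite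
proof (rule AE_mp[OF _ AE_mp[OF _ AE_mp[OF _ AE_mp]]], intro AE_I2[where M=M] impI)
  fix \<omega> assume \<omega>: "\<omega> \<in> space M" and b: "AE t in clock T. (\<integral>\<^sup>+z. bad ((t, \<omega>), z) \<partial>mark_law F1) = 0"
    and pl: "\<forall>t\<in>{0<..T}. min \<beta> lam0 \<le> p_left t \<omega>" and low: "\<exists>\<epsilon>>0. (\<forall>t\<in>{0..T}. \<epsilon> \<le> W t \<omega>) \<and> (\<forall>t\<in>{0..T}. \<epsilon> \<le> W_left t \<omega>)"
    and fin: "(\<integral>\<^sup>+t. \<integral>\<^sup>+z. ennreal ((\<Theta> t \<omega> z)\<^sup>2 * p_left t \<omega>) \<partial>mark_law F1 \<partial>clock T) \<noteq> \<infinity>"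
  have m: "(\<lambda>t. \<integral>\<^sup>+z. ennreal ((\<Theta> t \<omega> z)\<^sup>2 * p_left t \<omega>) \<partial>mark_law F1) \<in> borel_measurable (clock T)"
  proof -
    have "(\<lambda>x. ennreal ((\<Theta> (fst (fst x)) (snd (fst x)) (snd x))\<^sup>2 * p_left (fst (fst x)) (snd (fst x)))) \<in> borel_measurable (field_sigma {0..T} H)"
      using \<Theta>_field p_left_field by measurable
    from clock_path[OF predictable_nn_integral_mark[OF this] \<omega>] show ?thesis by simp
  qed
  have "AE t in clock T. (\<integral>\<^sup>+z. ennreal ((\<Theta> t \<omega> z)\<^sup>2 * p_left t \<omega>) \<partial>mark_law F1) \<noteq> \<infinity>"
    by (rule nn_integral_PInf_AE[OF m fin])
  with b AE_clock_pos show "AE t in clock T. good t \<omega>"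
  proof eventually_elim
    case (elim t)
    have pp: "0 < p_left t \<omega>" using pl elim(2) intensity_floor_pos by (meson less_le_trans)
    have wp: "0 < W_left t \<omega>" using low elim(2) by (meson atLeastAtMost_iff greaterThanAtMost_iff less_imp_le less_le_trans)
    have t': "t \<in> {0..T}" using elim(2) by auto
    have "(\<integral>\<^sup>+z. ennreal ((\<Theta> t \<omega> z)\<^sup>2 * p_left t \<omega>) \<partial>mark_law F1) = (\<integral>\<^sup>+z. ennreal ((\<Theta> t \<omega> z)\<^sup>2) * ennreal (p_left t \<omega>) \<partial>mark_law F1)"
      using pp by (simp add: ennreal_mult)
    also have "\<dots> = (\<integral>\<^sup>+z. ennreal ((\<Theta> t \<omega> z)\<^sup>2) \<partial>mark_law F1) * ennreal (p_left t \<omega>)"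
    proof (rule nn_integral_multc)
      show "(\<lambda>z. ennreal ((\<Theta> t \<omega> z)\<^sup>2)) \<in> borel_measurable (mark_law F1)"
        using \<Theta>_section[OF t' \<omega>] by measurable
    qed
    finally have "(\<integral>\<^sup>+z. ennreal ((\<Theta> t \<omega> z)\<^sup>2) \<partial>mark_law F1) * ennreal (p_left t \<omega>) \<noteq> \<infinity>" using elim(3) by simp
    then have "(\<integral>\<^sup>+z. ennreal ((\<Theta> t \<omega> z)\<^sup>2) \<partial>mark_law F1) < \<infinity>"
      using pp by (auto simp: ennreal_mult_eq_top_iff less_top)
    then show ?case unfolding good_def using pp wp elim(1) by simp
  qed
qed

lemma good_AE: "AE (t, \<omega>) in time_scenario T M. good t \<omega>"
proof (rule AE_time_scenarioI(1)[OF _ good_path])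
  have m2: "(\<lambda>x. ennreal ((\<Theta> (fst (fst x)) (snd (fst x)) (snd x))\<^sup>2)) \<in> borel_measurable (field_sigma {0..T} H)"
    using \<Theta>_field by measurable
  have [measurable]: "(\<lambda>x. W_left (fst x) (snd x)) \<in> borel_measurable (time_scenario T M)"
    "(\<lambda>x. p_left (fst x) (snd x)) \<in> borel_measurable (time_scenario T M)"
    using H.measurable_time_scenario[OF W_left_predictable T_nonneg] H.measurable_time_scenario[OF p_left_predictable T_nonneg]
    unfolding split_beta .
  have [measurable]: "(\<lambda>x. \<integral>\<^sup>+z. bad (x, z) \<partial>mark_law F1) \<in> borel_measurable (time_scenario T M)"
    by (rule H.measurable_time_scenario[OF predictable_nn_integral_mark[OF bad_measurable] T_nonneg])
  have [measurable]: "(\<lambda>x. \<integral>\<^sup>+z. ennreal ((\<Theta> (fst x) (snd x) z)\<^sup>2) \<partial>mark_law F1) \<in> borel_measurable (time_scenario T M)"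
    using H.measurable_time_scenario[OF predictable_nn_integral_mark[OF m2] T_nonneg] by simp
  show "{x \<in> space (time_scenario T M). good (fst x) (snd x)} \<in> sets (time_scenario T M)"
    unfolding good_def prod.collapse by measurable
qed

end

section \<open>The maximiser of the driver\<close>

context reinsurance
begin

definition \<kappa> :: "real \<Rightarrow> real" where "\<kappa> t = \<eta> * exp (r * (T - t))"

lemma \<kappa>_pos: "0 < \<kappa> t" using \<eta>_pos by (simp add: \<kappa>_def)

definition C :: real where "C = (1 + \<theta>R) * \<mu>"

definition hh :: "real \<Rightarrow> 'a \<Rightarrow> real \<Rightarrow> real" where
  "hh t \<omega> v = (\<integral>z. (W_left t \<omega> + \<Theta> t \<omega> z) / W_left t \<omega> * z * exp (- \<kappa> t * z * (1 - v)) \<partial>mark_law F1)"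

text \<open>The level at which \<open>hh\<close> crosses \<open>C\<close>, truncated to the unit interval; taking the supremum over
  rational levels makes it measurable.\<close>

definition ustar :: "real \<Rightarrow> 'a \<Rightarrow> real" where
  "ustar t \<omega> = Sup (insert 0 {v\<in>\<rat> \<inter> {0..1}. hh t \<omega> v \<le> C})"

lemma ustar_range: "ustar t \<omega> \<in> {0..1}"
proof -
  have "bdd_above (insert 0 {v\<in>\<rat> \<inter> {0..1}. hh t \<omega> v \<le> C})" by (auto intro!: bdd_aboveI[of _ 1])
  then have "0 \<le> ustar t \<omega>" unfolding ustar_def by (intro cSup_upper) auto
  moreover have "ustar t \<omega> \<le> 1" unfolding ustar_def by (intro cSup_least) auto
  ultimately show ?thesis by simp
qed

lemma hh_predictable: "(\<lambda>x. hh (fst x) (snd x) v) \<in> borel_measurable (predictable_sigma {0..T} H)"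
proof -
  have "(\<lambda>x. (W_left (fst (fst x)) (snd (fst x)) + \<Theta> (fst (fst x)) (snd (fst x)) (snd x)) / W_left (fst (fst x)) (snd (fst x))
      * snd x * exp (- \<kappa> (fst (fst x)) * snd x * (1 - v))) \<in> borel_measurable (field_sigma {0..T} H)"
    using W_left_field \<Theta>_field H.measurable_mark H.measurable_field_time[OF T_nonneg] unfolding \<kappa>_def by measurable
  from predictable_integral_mark[OF this] show ?thesis unfolding hh_def by simp
qed

text \<open>For \<open>a \<ge> 0\<close> the level exceeds \<open>a\<close> iff some rational
  \<open>v > a\<close> has \<open>hh t \<omega> v \<le> C\<close>, which is a countable union of
  predictable sets.\<close>

lemma ustar_control: "control ustar"
  unfolding control_def predictable_process_def
proof (intro conjI ballI ustar_range)
  let ?S = "predictable_sigma {0..T} H"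
  have cQ: "countable (\<rat> \<inter> {0..1::real})" using countable_rat by (rule countable_subset[rotated]) auto
  show "(\<lambda>(t, \<omega>). ustar t \<omega>) \<in> borel_measurable ?S"
  proof (rule borel_measurable_iff_greater[THEN iffD2], rule allI)
    fix a :: real
    have iff: "a < ustar t \<omega> \<longleftrightarrow> a < 0 \<or> (\<exists>v\<in>\<rat> \<inter> {0..1}. a < v \<and> hh t \<omega> v \<le> C)" for t \<omega>
    proof -
      have "bdd_above (insert 0 {v\<in>\<rat> \<inter> {0..1}. hh t \<omega> v \<le> C})" by (auto intro!: bdd_aboveI[of _ 1])
      from less_cSup_iff[OF _ this, of a] show ?thesis unfolding ustar_def by auto
    qed
    have "{x \<in> space ?S. a < (case x of (t, \<omega>) \<Rightarrow> ustar t \<omega>)} =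
       (if a < 0 then space ?S else (\<Union>v\<in>{v\<in>\<rat> \<inter> {0..1}. a < v}. {x \<in> space ?S. hh (fst x) (snd x) v \<le> C}))"
      unfolding split_beta iff by auto
    also have "\<dots> \<in> sets ?S"
    proof -
      have "(\<Union>v\<in>{v\<in>\<rat> \<inter> {0..1}. a < v}. {x \<in> space ?S. hh (fst x) (snd x) v \<le> C}) \<in> sets ?S"
      proof (rule sets.countable_UN'')
        show "countable {v\<in>\<rat> \<inter> {0..1}. a < v}" using cQ by (rule countable_subset[rotated]) auto
        fix v have [measurable]: "(\<lambda>x. hh (fst x) (snd x) v) \<in> borel_measurable ?S" by (rule hh_predictable)
        show "{x \<in> space ?S. hh (fst x) (snd x) v \<le> C} \<in> sets ?S" by measurable
      qed
      then show ?thesis by simp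
    qed
    finally show "{x \<in> space ?S. a < (case x of (t, \<omega>) \<Rightarrow> ustar t \<omega>)} \<in> sets ?S" .
  qed
qed

section \<open>Maximisation at a fixed good time and scenario\<close>

context
  fixes t \<omega> assumes t: "t \<in> {0..T}" and \<omega>: "\<omega> \<in> space M" and good: "good t \<omega>"
begin

lemma good_W_left: "0 < W_left t \<omega>" and good_p_left: "0 < p_left t \<omega>"
  using good unfolding good_def by auto

lemma good_AE_pos: "AE z in mark_law F1. 0 < W_left t \<omega> + \<Theta> t \<omega> z"
proof -
  have "(\<integral>\<^sup>+z. bad ((t, \<omega>), z) \<partial>mark_law F1) = 0" using good unfolding good_def by auto
  then have "AE z in mark_law F1. bad ((t, \<omega>), z) = 0"
    using field_mark_section[OF bad_measurable t \<omega>] by (simp add: nn_integral_0_iff_AE)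
  then show ?thesis by eventually_elim (simp add: bad_def split: if_splits)
qed

lemma good_\<Theta>_sq: "integrable (mark_law F1) (\<lambda>z. (\<Theta> t \<omega> z)\<^sup>2)"
  unfolding integrable_iff_bounded
proof
  show "(\<lambda>z. (\<Theta> t \<omega> z)\<^sup>2) \<in> borel_measurable (mark_law F1)" using \<Theta>_section[OF t \<omega>] by measurable
qed (use good in \<open>simp add: good_def\<close>)

lemma good_\<Theta>: "integrable (mark_law F1) (\<Theta> t \<omega>)"
  by (rule Bochner_Integration.integrable_bound[OF Bochner_Integration.integrable_add[OF good_\<Theta>_sq mark.integrable_const[of 1]] \<Theta>_section[OF t \<omega>]])
     (auto intro!: AE_I2 order_trans[OF abs_le_sq])

lemma good_\<Theta>_z: "integrable (mark_law F1) (\<lambda>z. \<Theta> t \<omega> z * z)"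
proof (rule Bochner_Integration.integrable_bound[OF Bochner_Integration.integrable_add[OF good_\<Theta>_sq z1_sq_integrable]])
  show "(\<lambda>z. \<Theta> t \<omega> z * z) \<in> borel_measurable (mark_law F1)"
    using \<Theta>_section[OF t \<omega>] z_measurable by (rule borel_measurable_times)
qed (auto intro!: AE_I2 order_trans[OF abs_mult_le_sq])

lemma good_weight: "integrable (mark_law F1) (\<lambda>z. (W_left t \<omega> + \<Theta> t \<omega> z) / W_left t \<omega> * z)"
  "AE z in mark_law F1. 0 < (W_left t \<omega> + \<Theta> t \<omega> z) / W_left t \<omega> * z"
proof -
  have "integrable (mark_law F1) (\<lambda>z. z + \<Theta> t \<omega> z * z / W_left t \<omega>)"
    using good_\<Theta>_z z1_integrable by auto
  also have "(\<lambda>z. z + \<Theta> t \<omega> z * z / W_left t \<omega>) = (\<lambda>z. (W_left t \<omega> + \<Theta> t \<omega> z) / W_left t \<omega> * z)"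
    using good_W_left by (auto simp: field_simps)
  finally show "integrable (mark_law F1) (\<lambda>z. (W_left t \<omega> + \<Theta> t \<omega> z) / W_left t \<omega> * z)" .
  show "AE z in mark_law F1. 0 < (W_left t \<omega> + \<Theta> t \<omega> z) / W_left t \<omega> * z"
    using good_AE_pos mark_law_pos by eventually_elim (use good_W_left in auto)
qed

lemma hh_strict_mono: "u < v \<Longrightarrow> v \<le> 1 \<Longrightarrow> hh t \<omega> u < hh t \<omega> v"
  unfolding hh_def
  by (rule tilted_integral_strict_mono[OF good_weight z_measurable mark_law_pos \<kappa>_pos _ _ mark.prob_space_axioms])

lemma hh_continuous: "continuous_on {0..1} (hh t \<omega>)"
  unfolding hh_def by (rule tilted_integral_continuous[OF good_weight(1) z_measurable mark_law_pos \<kappa>_pos])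

lemma ustar_cases:
  shows "C < hh t \<omega> 0 \<Longrightarrow> ustar t \<omega> = 0" "hh t \<omega> 1 < C \<Longrightarrow> ustar t \<omega> = 1"
    "hh t \<omega> 0 \<le> C \<Longrightarrow> C \<le> hh t \<omega> 1 \<Longrightarrow> hh t \<omega> (ustar t \<omega>) = C"
  unfolding ustar_def by (rule Sup_rational_sublevel[OF hh_strict_mono hh_continuous]; assumption)+

lemma good_exp_integrable:
  assumes v: "v \<le> 1"
  shows "integrable (mark_law F1) (\<lambda>z. (W_left t \<omega> + \<Theta> t \<omega> z) * exp (- \<kappa> t * z * (1 - v)))"
  by (rule tilted_integral_integrable[OF _ z_measurable mark_law_pos \<kappa>_pos v]) (use good_\<Theta> in simp)

lemma driver_eq:
  "driver T r \<eta> proportional q p F1 t \<omega> (W_left t \<omega>) (\<Theta> t \<omega>) v =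
    - (W_left t \<omega> * \<kappa> t * (C * p_left t \<omega> * (1 - v)))
    - p_left t \<omega> * (\<integral>z. (W_left t \<omega> + \<Theta> t \<omega> z) * (exp (- \<kappa> t * z * (1 - v)) - 1) \<partial>mark_law F1)"
proof -
  have e: "exp (- \<eta> * exp (r * (T - t)) * (z - proportional z v)) = exp (- \<kappa> t * z * (1 - v))" for z
    unfolding \<kappa>_def proportional_def by (simp add: algebra_simps)
  then show ?thesis
    unfolding driver_def q_eq set_integral_mark p_left_def[symmetric] e by (simp add: \<kappa>_def C_def ac_simps)
qed

text \<open>The convex function \<open>exp\<close> lies above its tangent at the exponent of
  \<open>ustar\<close>. Integrated with the positive weight \<open>W_left + \<Theta>\<close>, this
  bounds the integral term at \<open>v\<close> from below by its linearisation at
  \<open>ustar\<close>, whose slope is a multiple of \<open>hh\<close>. No derivative is taken under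
  the integral, and maximality reduces to the sign of \<open>v - ustar\<close> times
  \<open>C - hh\<close>.\<close>

lemma driver_le_ustar:
  assumes v: "v \<in> {0..1}"
  shows "driver T r \<eta> proportional q p F1 t \<omega> (W_left t \<omega>) (\<Theta> t \<omega>) v \<le>
    driver T r \<eta> proportional q p F1 t \<omega> (W_left t \<omega>) (\<Theta> t \<omega>) (ustar t \<omega>)"
proof -
  let ?w = "W_left t \<omega>" and ?pl = "p_left t \<omega>" and ?u = "ustar t \<omega>" and ?k = "\<kappa> t"
  let ?I = "\<lambda>v. \<integral>z. (?w + \<Theta> t \<omega> z) * (exp (- ?k * z * (1 - v)) - 1) \<partial>mark_law F1"
  have u: "?u \<in> {0..1}" by (rule ustar_range)
  have int: "integrable (mark_law F1) (\<lambda>z. (?w + \<Theta> t \<omega> z) * (exp (- ?k * z * (1 - v)) - 1))" if "v \<le> 1" for v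
    using Bochner_Integration.integrable_diff[OF good_exp_integrable[OF that] Bochner_Integration.integrable_add[OF mark.integrable_const[of ?w] good_\<Theta>]]
    by (simp add: right_diff_distrib)
  have inth: "integrable (mark_law F1) (\<lambda>z. (?w + \<Theta> t \<omega> z) / ?w * z * exp (- ?k * z * (1 - ?u)))"
    by (rule tilted_integral_integrable[OF good_weight(1) z_measurable mark_law_pos \<kappa>_pos]) (use u in auto)
  have "?I ?u + ?k * (v - ?u) * (?w * hh t \<omega> ?u) =
    (\<integral>z. (?w + \<Theta> t \<omega> z) * (exp (- ?k * z * (1 - ?u)) - 1) +
      ?k * (v - ?u) * (?w * ((?w + \<Theta> t \<omega> z) / ?w * z * exp (- ?k * z * (1 - ?u)))) \<partial>mark_law F1)"
  proof (subst Bochner_Integration.integral_add)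
    show "?I ?u + ?k * (v - ?u) * (?w * hh t \<omega> ?u) = ?I ?u +
      (\<integral>z. ?k * (v - ?u) * (?w * ((?w + \<Theta> t \<omega> z) / ?w * z * exp (- ?k * z * (1 - ?u)))) \<partial>mark_law F1)"
      unfolding hh_def by (simp only: integral_mult_right_zero)
  qed (use int[of ?u] inth u in \<open>auto intro!: integrable_mult_right simp del: times_divide_eq_left times_divide_eq_right\<close>)
  also have "\<dots> \<le> ?I v"
  proof (rule integral_mono_AE)
    show "integrable (mark_law F1) (\<lambda>z. (?w + \<Theta> t \<omega> z) * (exp (- ?k * z * (1 - ?u)) - 1) +
      ?k * (v - ?u) * (?w * ((?w + \<Theta> t \<omega> z) / ?w * z * exp (- ?k * z * (1 - ?u)))))"
      using int[of ?u] inth u by (intro Bochner_Integration.integrable_add integrable_mult_right) auto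
    show "integrable (mark_law F1) (\<lambda>z. (?w + \<Theta> t \<omega> z) * (exp (- ?k * z * (1 - v)) - 1))" using int v by auto
    show "AE z in mark_law F1. (?w + \<Theta> t \<omega> z) * (exp (- ?k * z * (1 - ?u)) - 1) +
      ?k * (v - ?u) * (?w * ((?w + \<Theta> t \<omega> z) / ?w * z * exp (- ?k * z * (1 - ?u))))
      \<le> (?w + \<Theta> t \<omega> z) * (exp (- ?k * z * (1 - v)) - 1)"
      using good_AE_pos
    proof eventually_elim
      case (elim z)
      let ?a = "- ?k * z * (1 - ?u)" and ?b = "- ?k * z * (1 - v)"
      have "1 + (?b - ?a) \<le> exp (?b - ?a)" by (rule exp_ge_add_one_self)
      then have "exp ?a * (1 + (?b - ?a)) \<le> exp ?a * exp (?b - ?a)" by (intro mult_left_mono) auto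
      also have "exp ?a * exp (?b - ?a) = exp ?b" by (simp add: exp_add[symmetric])
      finally have "exp ?a - 1 + ?k * (v - ?u) * (z * exp ?a) \<le> exp ?b - 1" by (simp add: algebra_simps)
      then have "(?w + \<Theta> t \<omega> z) * (exp ?a - 1 + ?k * (v - ?u) * (z * exp ?a)) \<le> (?w + \<Theta> t \<omega> z) * (exp ?b - 1)"
        using elim by (intro mult_left_mono) auto
      moreover have "?w * ((?w + \<Theta> t \<omega> z) / ?w * z * exp ?a) = (?w + \<Theta> t \<omega> z) * (z * exp ?a)"
        using good_W_left by simp
      ultimately show ?case by (simp only: distrib_left mult.left_commute)
    qed
  qed
  finally have I: "?I ?u + ?k * (v - ?u) * (?w * hh t \<omega> ?u) \<le> ?I v" .
  \<comment> \<open>At a root of \<open>hh = C\<close> the second factor is zero. If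
    \<open>hh\<close> exceeds \<open>C\<close> throughout, \<open>ustar\<close> is \<open>0\<close>
    and the factors have opposite signs, and likewise with \<open>ustar = 1\<close> if
    \<open>hh\<close> stays below \<open>C\<close>.\<close>
  have sgn: "(v - ?u) * (C - hh t \<omega> ?u) \<le> 0"
  proof -
    consider "C < hh t \<omega> 0" | "hh t \<omega> 1 < C" | "hh t \<omega> 0 \<le> C" "C \<le> hh t \<omega> 1" by linarith
    then show ?thesis
    proof cases
      case 1
      then show ?thesis using ustar_cases(1) v by (auto intro: mult_nonneg_nonpos)
    next
      case 2
      then show ?thesis using ustar_cases(2) v by (auto intro: mult_nonpos_nonneg)
    next
      case 3
      then show ?thesis using ustar_cases(3) by simp
    qed
  qed
  have "driver T r \<eta> proportional q p F1 t \<omega> ?w (\<Theta> t \<omega>) v - driver T r \<eta> proportional q p F1 t \<omega> ?w (\<Theta> t \<omega>) ?u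
     = ?w * ?k * C * ?pl * (v - ?u) - ?pl * (?I v - ?I ?u)"
    unfolding driver_eq by (simp add: algebra_simps)
  also have "\<dots> \<le> ?w * ?k * C * ?pl * (v - ?u) - ?pl * (?k * (v - ?u) * (?w * hh t \<omega> ?u))"
    using I good_p_left by (intro diff_left_mono mult_left_mono) auto
  also have "\<dots> = ?pl * ?k * ?w * ((v - ?u) * (C - hh t \<omega> ?u))" by (simp add: algebra_simps)
  also have "\<dots> \<le> 0" using good_p_left good_W_left \<kappa>_pos[of t] by (intro mult_nonneg_nonpos[OF _ sgn]) simp
  finally show ?thesis by simp
qed

end

definition fstar :: "real \<Rightarrow> 'a \<Rightarrow> real" where
  "fstar t \<omega> = driver T r \<eta> proportional q p F1 t \<omega> (W_left t \<omega>) (\<Theta> t \<omega>) (ustar t \<omega>)"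

lemma fstar_measurable: "(\<lambda>(t, \<omega>). fstar t \<omega>) \<in> borel_measurable (time_scenario T M)"
proof (rule H.measurable_time_scenario[OF _ T_nonneg])
  have [measurable]: "(\<lambda>x. W_left (fst x) (snd x)) \<in> borel_measurable (predictable_sigma {0..T} H)"
    "(\<lambda>x. p_left (fst x) (snd x)) \<in> borel_measurable (predictable_sigma {0..T} H)"
    "(\<lambda>x. ustar (fst x) (snd x)) \<in> borel_measurable (predictable_sigma {0..T} H)"
    "fst \<in> borel_measurable (predictable_sigma {0..T} H)"
    using W_left_predictable p_left_predictable ustar_control H.predictable_time[OF T_nonneg]
    unfolding control_def predictable_process_def split_beta by auto
  have "(\<lambda>x. (W_left (fst (fst x)) (snd (fst x)) + \<Theta> (fst (fst x)) (snd (fst x)) (snd x)) *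
      (exp (- \<eta> * exp (r * (T - fst (fst x))) * (snd x - snd x * ustar (fst (fst x)) (snd (fst x)))) - 1) *
      p_left (fst (fst x)) (snd (fst x))) \<in> borel_measurable (field_sigma {0..T} H)"
    using W_left_field \<Theta>_field p_left_field H.measurable_mark H.measurable_field_time[OF T_nonneg] control_field[OF ustar_control]
    by measurable
  from predictable_integral_mark[OF this]
  have [measurable]: "(\<lambda>x. \<integral>z. (W_left (fst x) (snd x) + \<Theta> (fst x) (snd x) z) *
      (exp (- \<eta> * exp (r * (T - fst x)) * (z - z * ustar (fst x) (snd x))) - 1) *
      p_left (fst x) (snd x) \<partial>mark_law F1) \<in> borel_measurable (predictable_sigma {0..T} H)" by simp
  show "(\<lambda>(t, \<omega>). fstar t \<omega>) \<in> borel_measurable (predictable_sigma {0..T} H)"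
    unfolding fstar_def driver_def proportional_def set_integral_mark p_left_def[symmetric] q_eq split_beta
    by measurable
qed

lemma good_AE_space: "AE x in time_scenario T M. fst x \<in> {0..T} \<and> snd x \<in> space M \<and> good (fst x) (snd x)"
proof -
  have "AE x in time_scenario T M. fst x \<in> {0..T} \<and> snd x \<in> space M"
    by (rule AE_I2) (auto simp: time_scenario_def space_pair_measure space_restrict_space)
  moreover have "AE x in time_scenario T M. good (fst x) (snd x)" using good_AE by (simp add: split_beta)
  ultimately show ?thesis by eventually_elim simp
qed

text \<open>The function \<open>fstar\<close> dominates the driver of every admissible control,
  hence also the least such bound \<open>g\<close>. Only this inequality is available here: the
  converse would require \<open>ustar\<close> to be admissible, which is not yet known.\<close>

lemma g_le_fstar: "AE (t, \<omega>) in time_scenario T M. g t \<omega> \<le> fstar t \<omega>"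
proof -
  let ?S = "{\<lambda>(t, \<omega>). driver T r \<eta> proportional q p F1 t \<omega> (left_lim (\<lambda>s. W s \<omega>) t) (\<Theta> t \<omega>) (u t \<omega>) |u. u \<in> admis}"
  have "AE x in time_scenario T M. h x \<le> (case x of (t, \<omega>) \<Rightarrow> fstar t \<omega>)" if hS: "h \<in> ?S" for h
  proof -
    obtain u where u: "u \<in> admis" and h: "h = (\<lambda>(t, \<omega>). driver T r \<eta> proportional q p F1 t \<omega> (W_left t \<omega>) (\<Theta> t \<omega>) (u t \<omega>))"
      using hS unfolding W_left_def by auto
    have cu: "u t \<omega> \<in> {0..1}" if "t \<in> {0..T}" "\<omega> \<in> space M" for t \<omega>
      using u that unfolding admis_iff control_def by auto
    show ?thesis using good_AE_space
    proof eventually_elim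
      case (elim x)
      then show ?case using driver_le_ustar[of "fst x" "snd x" "u (fst x) (snd x)"] cu
        unfolding h split_beta fstar_def by auto
    qed
  qed
  then have "AE x in time_scenario T M. (case x of (t, \<omega>) \<Rightarrow> g t \<omega>) \<le> (case x of (t, \<omega>) \<Rightarrow> fstar t \<omega>)"
    using g_sup fstar_measurable unfolding is_ess_sup_def by blast
  then show ?thesis by (simp add: split_beta)
qed

text \<open>Over an empty family every measurable function is an upper bound, so
  \<open>g - 1\<close> would be one and \<open>g\<close> could not be the least.\<close>

lemma admis_nonempty: "admis \<noteq> {}"
proof
  assume "admis = {}"
  then have sup: "is_ess_sup (time_scenario T M) {} (\<lambda>(t, \<omega>). g t \<omega>)" using g_sup by simp
  then have m: "(\<lambda>x. (case x of (t, \<omega>) \<Rightarrow> g t \<omega>) - 1) \<in> borel_measurable (time_scenario T M)"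
    unfolding is_ess_sup_def by (intro borel_measurable_diff) auto
  have "AE x in time_scenario T M. (case x of (t, \<omega>) \<Rightarrow> g t \<omega>) \<le> (case x of (t, \<omega>) \<Rightarrow> g t \<omega>) - 1"
    by (rule conjunct2[OF conjunct2[OF sup[unfolded is_ess_sup_def]], rule_format, OF m]) simp
  then have "AE x in time_scenario T M. False" by eventually_elim simp
  then have "emeasure (time_scenario T M) (space (time_scenario T M)) = 0"
    by (simp add: AE_iff_measurable[OF sets.top])
  moreover have "emeasure (time_scenario T M) (space (time_scenario T M)) = ennreal T"
    unfolding time_scenario_def space_pair_measure
    by (subst emeasure_pair_measure_Times[OF sets.top sets.top]) (simp_all add: emeasure_space_1 emeasure_restrict_space space_restrict_space T_nonneg)
  ultimately show False using T_pos by simp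
qed

end

section \<open>Supermartingale inequality and optimality\<close>

text \<open>Right-continuity extends the bound from rational times to all times before
  \<open>t\<close>, and left limits at times up to \<open>t\<close> see only those.\<close>

lemma left_lim_le_rational:
  assumes f: "cadlag_on T f" and le: "\<And>q. q \<in> \<rat> \<Longrightarrow> 0 \<le> q \<Longrightarrow> q < t \<Longrightarrow> f q \<le> a"
    and t: "0 < t" "t \<le> T" and s: "s \<in> {0..t}"
  shows "left_lim f s \<le> a"
proof -
  have f': "cadlag_on t f" using f t unfolding cadlag_on_def by auto
  have less: "f v \<le> a" if v: "0 \<le> v" "v < t" for v
  proof (rule ccontr)
    assume "\<not> f v \<le> a"
    then have "eventually (\<lambda>s. a < f s) (at_right v)"
      using cadlag_on_right[OF f' v] by (intro order_tendstoD) auto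
    then obtain b where b: "v < b" "\<And>s. v < s \<Longrightarrow> s < b \<Longrightarrow> a < f s"
      by (auto simp: eventually_at_right_field)
    then obtain q where "q \<in> \<rat>" "v < q" "q < min b t" using Rats_dense_in_real[of v "min b t"] v by auto
    then show False using b(2)[of q] le[of q] v by auto
  qed
  show ?thesis
  proof (cases "s = 0")
    case True
    then show ?thesis using less[of 0] t by (simp add: left_lim_def)
  next
    case False
    then show ?thesis using s t less by (intro left_lim_between'[OF f]) auto
  qed
qed

context reinsurance
begin

text \<open>Exponent contributed by one claim: minus \<open>\<eta>\<close> times the ceded part of
  the claim, compounded to \<open>T\<close>.\<close>

definition al :: "nat \<Rightarrow> 'a \<Rightarrow> real" where
  "al j \<omega> = - \<kappa> (real_of_ereal (\<tau>1 j \<omega>)) * Z1 j \<omega> * (1 - ustar (real_of_ereal (\<tau>1 j \<omega>)) \<omega>)"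

definition IP :: "real \<Rightarrow> 'a \<Rightarrow> real" where
  "IP t \<omega> = (LINT s:{0..t}|lborel. prem ustar s \<omega>)"

text \<open>The factor by which following \<open>ustar\<close> instead of null reinsurance up to time \<open>t\<close> changes the
  terminal disutility.\<close>

definition E :: "real \<Rightarrow> 'a \<Rightarrow> real" where
  "E t \<omega> = exp (\<eta> * IP t \<omega> + (\<Sum>j | \<tau>1 j \<omega> \<le> ereal t. al j \<omega>))"

definition E_left :: "real \<Rightarrow> 'a \<Rightarrow> real" where
  "E_left t \<omega> = left_lim (\<lambda>s. E s \<omega>) t"

lemma E_adapted: "t \<in> {0..T} \<Longrightarrow> E t \<in> borel_measurable (H t)"
proof -
  assume t: "t \<in> {0..T}"
  then have t': "0 \<le> t" "t \<le> T" by auto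
  have [measurable]: "IP t \<in> borel_measurable (H t)"
    using H.predictable_integral[OF prem_predictable[OF ustar_control] t'] unfolding IP_def[abs_def] by simp
  have "(\<lambda>x. - \<kappa> (fst (fst x)) * snd x * (1 - ustar (fst (fst x)) (snd (fst x)))) \<in> borel_measurable (field_sigma {0..T} H)"
    using control_field[OF ustar_control] H.measurable_mark H.measurable_field_time[OF T_nonneg] unfolding \<kappa>_def by measurable
  from H.sum_jumps_adapted[OF t' this]
  have [measurable]: "(\<lambda>\<omega>. \<Sum>j | \<tau>1 j \<omega> \<le> ereal t. al j \<omega>) \<in> borel_measurable (H t)" unfolding al_def by simp
  show ?thesis unfolding E_def[abs_def] by measurable
qed

context
  fixes \<omega> assumes \<omega>: "\<omega> \<in> space M"
begin

lemma prem_set_integrable: "set_integrable lborel {0..T} (\<lambda>s. prem ustar s \<omega>)"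
  using prem_integrable[OF ustar_control \<omega>] by (simp add: integrable_clock_iff)

lemma IP_eq: "t \<in> {0..T} \<Longrightarrow> IP t \<omega> = integral {0..t} (\<lambda>s. prem ustar s \<omega>)"
  unfolding IP_def using set_integrable_subset[OF prem_set_integrable, of "{0..t}"]
  by (intro set_borel_integral_eq_integral) auto

lemma IP_continuous: "continuous_on {0..T} (\<lambda>t. IP t \<omega>)"
proof -
  have "(\<lambda>s. prem ustar s \<omega>) integrable_on {0..T}"
    using prem_set_integrable by (rule set_borel_integral_eq_integral)
  from indefinite_integral_continuous_1[OF this] show ?thesis
    by (rule continuous_on_cong[THEN iffD1, rotated -1]) (auto simp: IP_eq)
qed

lemma IP_left: "0 < t \<Longrightarrow> t \<le> T \<Longrightarrow> ((\<lambda>s. IP s \<omega>) \<longlongrightarrow> IP t \<omega>) (at_left t)"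
  using continuous_on_subset[OF IP_continuous, of "{0..t}"]
  by (auto simp: continuous_on_def at_within_Icc_at_left[symmetric, of 0 t])

lemma IP_right: "0 \<le> t \<Longrightarrow> t < T \<Longrightarrow> ((\<lambda>s. IP s \<omega>) \<longlongrightarrow> IP t \<omega>) (at_right t)"
  using continuous_on_subset[OF IP_continuous, of "{t..T}"]
  by (auto simp: continuous_on_def at_within_Icc_at_right[symmetric, of t T])

lemma E_left_tendsto:
  assumes "0 < t" "t \<le> T"
  shows "((\<lambda>s. E s \<omega>) \<longlongrightarrow> exp (\<eta> * IP t \<omega> + (\<Sum>j | \<tau>1 j \<omega> < ereal t. al j \<omega>))) (at_left t)"
  unfolding E_def
  by (intro tendsto_intros IP_left assms sum_jumps_left_tendsto[OF jumps1 \<omega>, of "\<lambda>s j. al j \<omega>"])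

lemma E_left_eq: "0 < t \<Longrightarrow> t \<le> T \<Longrightarrow> E_left t \<omega> = exp (\<eta> * IP t \<omega> + (\<Sum>j | \<tau>1 j \<omega> < ereal t. al j \<omega>))"
  unfolding E_left_def by (rule left_lim_eqI[OF E_left_tendsto])

lemma E_cadlag: "cadlag_on T (\<lambda>t. E t \<omega>)"
  unfolding cadlag_on_def continuous_within
proof (intro conjI ballI)
  fix t assume "t \<in> {0..<T}"
  then show "((\<lambda>t. E t \<omega>) \<longlongrightarrow> E t \<omega>) (at_right t)"
    unfolding E_def
    by (intro tendsto_intros IP_right sum_jumps_right_tendsto[OF jumps1 \<omega>, of "\<lambda>s j. al j \<omega>"]) auto
next
  fix t assume "t \<in> {0<..T}"
  then show "\<exists>l. ((\<lambda>t. E t \<omega>) \<longlongrightarrow> l) (at_left t)" using E_left_tendsto[of t] by auto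
qed

lemma al_nonpos:
  assumes "\<tau>1 j \<omega> \<le> ereal T" shows "al j \<omega> \<le> 0"
proof -
  have "real_of_ereal (\<tau>1 j \<omega>) \<in> {0..T}" using jump_time_real[OF jumps1 \<omega> assms] by auto
  then show ?thesis
    unfolding al_def using ustar_range[of "real_of_ereal (\<tau>1 j \<omega>)" \<omega>] \<kappa>_pos[of "real_of_ereal (\<tau>1 j \<omega>)"] J1.Z_pos[OF \<omega>, of j]
    by (auto intro!: mult_nonneg_nonneg simp: less_imp_le)
qed

text \<open>Ceded claims only lower the disutility, so the jump terms are nonpositive and the factor
  is controlled by the premium integral alone, whose rate is at most \<open>exp (r T) C m\<close>
  while the filter stays below \<open>m\<close>.\<close>

lemma E_left_bound:
  assumes t: "0 < t" "t \<le> T" and m: "0 \<le> m" "\<And>s. s \<in> {0..t} \<Longrightarrow> p_left s \<omega> \<le> m"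
  shows "E_left t \<omega> \<le> exp (\<eta> * (exp (r * T) * (C * m) * T))"
proof -
  have C0: "0 \<le> C" using \<mu>_pos \<theta>R_pos by (simp add: C_def)
  have le: "prem ustar s \<omega> \<le> exp (r * T) * (C * m)" if s: "s \<in> {0..t}" for s
  proof -
    have s': "s \<in> {0..T}" using s t by auto
    have "p_left s \<omega> * (1 - ustar s \<omega>) \<le> m"
    \<comment> \<open>In a single scenario the filter may be negative, since its floor holds only
      almost surely; the product is then at most \<open>0\<close>.\<close>
    proof (cases "0 \<le> p_left s \<omega>")
      case True
      then show ?thesis using m(2)[OF s] ustar_range[of s \<omega>] mult_left_le[of "1 - ustar s \<omega>" "p_left s \<omega>"] by auto
    next
      case False
      then have "p_left s \<omega> * (1 - ustar s \<omega>) \<le> 0" using ustar_range[of s \<omega>] by (intro mult_nonpos_nonneg) auto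
      then show ?thesis using m by linarith
    qed
    then have "C * (p_left s \<omega> * (1 - ustar s \<omega>)) \<le> C * m" using C0 by (rule mult_left_mono)
    then have "exp (r * (T - s)) * (C * (p_left s \<omega> * (1 - ustar s \<omega>))) \<le> exp (r * (T - s)) * (C * m)"
      by (rule mult_left_mono) simp
    also have "\<dots> \<le> exp (r * T) * (C * m)" using exp_discount[OF s'] C0 m(1) by (intro mult_right_mono) auto
    finally show ?thesis unfolding prem_def q_eq C_def by (simp add: mult.assoc)
  qed
  have t': "t \<in> {0..T}" using t by auto
  have "IP t \<omega> \<le> integral {0..t} (\<lambda>_. exp (r * T) * (C * m))"
    unfolding IP_eq[OF t']
    using set_borel_integral_eq_integral(1)[OF set_integrable_subset[OF prem_set_integrable, of "{0..t}"]] t le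
    by (intro integral_le) auto
  also have "\<dots> = exp (r * T) * (C * m) * t" using t by simp
  also have "\<dots> \<le> exp (r * T) * (C * m) * T" using t C0 m(1) by (intro mult_left_mono) auto
  finally have "\<eta> * IP t \<omega> \<le> \<eta> * (exp (r * T) * (C * m) * T)" using \<eta>_pos by simp
  moreover have "(\<Sum>j | \<tau>1 j \<omega> < ereal t. al j \<omega>) \<le> 0"
  proof (intro sum_nonpos al_nonpos)
    fix j assume "j \<in> {j. \<tau>1 j \<omega> < ereal t}"
    then have "\<tau>1 j \<omega> \<le> ereal t" by simp
    also have "ereal t \<le> ereal T" using t by simp
    finally show "\<tau>1 j \<omega> \<le> ereal T" .
  qed
  ultimately show ?thesis unfolding E_left_eq[OF t] by simp
qed

end

lemma E_left_predictable: "(\<lambda>(t, \<omega>). E_left t \<omega>) \<in> borel_measurable (predictable_sigma {0..T} H)"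
  unfolding E_left_def by (rule H.predictable_left_lim[OF T_nonneg E_adapted E_cadlag])

section \<open>Localisation, and jumps and drift of the product\<close>

text \<open>Neither \<open>p\<close> nor \<open>W\<close> has exceeded \<open>n\<close> at a
  rational time before \<open>t\<close>. Strictly earlier rational times suffice to bound the left
  limits up to \<open>t\<close>, and they make the condition predictable without a stopping time of
  the raw filtration.\<close>

definition chi :: "nat \<Rightarrow> real \<Rightarrow> 'a \<Rightarrow> bool" where
  "chi n t \<omega> \<longleftrightarrow> (\<forall>q\<in>\<rat> \<inter> {0..T}. q < t \<longrightarrow> p q \<omega> \<le> real n \<and> W q \<omega> \<le> real n)"

lemma chi_predictable: "{x\<in>space (predictable_sigma {0..T} H). chi n (fst x) (snd x)} \<in> sets (predictable_sigma {0..T} H)"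
  unfolding chi_def
proof (rule H.predictable_until[OF T_nonneg])
  fix q assume q: "0 \<le> q" "q \<le> T"
  have [measurable]: "p q \<in> borel_measurable (H q)" "W q \<in> borel_measurable (H q)"
    using p_adapted W_adapted q by auto
  have "{\<omega>\<in>space (H q). p q \<omega> \<le> real n \<and> W q \<omega> \<le> real n} \<in> sets (H q)" by measurable
  then show "{\<omega>\<in>space M. p q \<omega> \<le> real n \<and> W q \<omega> \<le> real n} \<in> sets (H q)" using H.space_F[OF q(1)] by simp
qed

lemma chi_field:
  fixes f :: "(real \<times> 'a) \<times> real \<Rightarrow> real"
  assumes f: "f \<in> borel_measurable (field_sigma {0..T} H)"
  shows "(\<lambda>x. if chi n (fst (fst x)) (snd (fst x)) then f x else 0) \<in> borel_measurable (field_sigma {0..T} H)"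
proof -
  have "(\<lambda>x. (if chi n (fst x) (snd x) then 1 else 0) :: real) \<in> borel_measurable (predictable_sigma {0..T} H)"
    by (intro measurable_If chi_predictable) auto
  from H.measurable_field_fst[OF this]
  have "(\<lambda>x. (if chi n (fst (fst x)) (snd (fst x)) then 1 else 0) * f x) \<in> borel_measurable (field_sigma {0..T} H)"
    using f by measurable
  then show ?thesis by (rule measurable_cong[THEN iffD1, rotated]) auto
qed

lemma chi_left:
  assumes "\<omega> \<in> space M" "chi n t \<omega>" "0 < t" "t \<le> T" "s \<in> {0..t}"
  shows "p_left s \<omega> \<le> real n" "W_left s \<omega> \<le> real n"
  unfolding p_left_def W_left_def
  by (rule left_lim_le_rational[OF p_cadlag[OF assms(1)] _ assms(3-5)]; use assms(2-4) in \<open>force simp: chi_def\<close>)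
     (rule left_lim_le_rational[OF W_cadlag[OF assms(1)] _ assms(3-5)]; use assms(2-4) in \<open>force simp: chi_def\<close>)

text \<open>The jump of the product of \<open>E\<close> and \<open>W\<close> at a claim:
  \<open>E\<close> is multiplied by the exponential while \<open>W\<close> moves from
  \<open>W_left\<close> to \<open>W_left + \<Theta>\<close>.\<close>

definition K :: "(real \<times> 'a) \<times> real \<Rightarrow> real" where
  "K x = E_left (fst (fst x)) (snd (fst x)) *
    ((W_left (fst (fst x)) (snd (fst x)) + \<Theta> (fst (fst x)) (snd (fst x)) (snd x)) *
      exp (- \<kappa> (fst (fst x)) * snd x * (1 - ustar (fst (fst x)) (snd (fst x)))) - W_left (fst (fst x)) (snd (fst x)))"

definition Kn :: "nat \<Rightarrow> (real \<times> 'a) \<times> real \<Rightarrow> real" where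
  "Kn n x = (if chi n (fst (fst x)) (snd (fst x)) then K x else 0)"

lemma K_field: "K \<in> borel_measurable (field_sigma {0..T} H)"
proof -
  have "(\<lambda>x. E_left (fst (fst x)) (snd (fst x))) \<in> borel_measurable (field_sigma {0..T} H)"
    using H.measurable_field_fst[OF E_left_predictable] by (simp add: split_beta)
  then show ?thesis
    using W_left_field \<Theta>_field control_field[OF ustar_control] H.measurable_mark H.measurable_field_time[OF T_nonneg]
    unfolding K_def[abs_def] \<kappa>_def by measurable
qed

lemma Kn_field: "Kn n \<in> borel_measurable (field_sigma {0..T} H)"
  unfolding Kn_def[abs_def] by (rule chi_field[OF K_field])

text \<open>On the localising set \<open>E_left\<close>, \<open>W_left\<close> and the filter are
  bounded, so the field grows at most like \<open>\<Theta>^2 + 1\<close>, which is integrable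
  against the compensator because \<open>\<Theta>\<close> has finite square norm. This finiteness
  permits the cancellation of compensators later.\<close>

lemma Kn_abs_finite:
  "(\<integral>\<^sup>+\<omega>. \<integral>\<^sup>+t. (\<integral>\<^sup>+z. ennreal \<bar>Kn n ((t, \<omega>), z)\<bar> \<partial>mark_law F1) * ennreal (p_left t \<omega>) \<partial>clock T \<partial>M) < \<infinity>"
proof -
  define B where "B = exp (\<eta> * (exp (r * T) * (C * real n) * T))"
  \<comment> \<open>The summand \<open>2 n\<close> bounds two occurrences of \<open>W_left\<close>,
    the summand \<open>1\<close> comes from \<open>|x| \<le> x^2 + 1\<close>, and the last factor
    \<open>n\<close> bounds the filter.\<close>
  define c0 where "c0 = B * (2 * real n + 1) * real n"
  have B0: "0 \<le> B" and c00: "0 \<le> c0" by (auto simp: B_def c0_def)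
  define Q where "Q t \<omega> = (\<integral>\<^sup>+z. ennreal ((\<Theta> t \<omega> z)\<^sup>2 * p_left t \<omega>) \<partial>mark_law F1)" for t \<omega>
  have Qp: "(\<lambda>x. Q (fst x) (snd x)) \<in> borel_measurable (predictable_sigma {0..T} H)"
  proof -
    have "(\<lambda>x. ennreal ((\<Theta> (fst (fst x)) (snd (fst x)) (snd x))\<^sup>2 * p_left (fst (fst x)) (snd (fst x)))) \<in> borel_measurable (field_sigma {0..T} H)"
      using \<Theta>_field p_left_field by measurable
    from predictable_nn_integral_mark[OF this] show ?thesis unfolding Q_def by simp
  qed
  have le: "AE \<omega> in M. (\<integral>\<^sup>+t. (\<integral>\<^sup>+z. ennreal \<bar>Kn n ((t, \<omega>), z)\<bar> \<partial>mark_law F1) * ennreal (p_left t \<omega>) \<partial>clock T)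
      \<le> ennreal (c0 * T) + ennreal B * (\<integral>\<^sup>+t. Q t \<omega> \<partial>clock T)"
    using p_left_ge W_lower
  proof (rule AE_mp[OF _ AE_mp], intro AE_I2 impI)
    fix \<omega> assume \<omega>: "\<omega> \<in> space M" and pl: "\<forall>t\<in>{0<..T}. min \<beta> lam0 \<le> p_left t \<omega>"
      and low: "\<exists>\<epsilon>>0. (\<forall>t\<in>{0..T}. \<epsilon> \<le> W t \<omega>) \<and> (\<forall>t\<in>{0..T}. \<epsilon> \<le> W_left t \<omega>)"
    have bnd: "(\<integral>\<^sup>+z. ennreal \<bar>Kn n ((t, \<omega>), z)\<bar> \<partial>mark_law F1) * ennreal (p_left t \<omega>) \<le> ennreal c0 + ennreal B * Q t \<omega>"
      if t: "t \<in> {0<..T}" for t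
    proof (cases "chi n t \<omega>")
      case True
      have t': "t \<in> {0..T}" "0 < t" "t \<le> T" using t by auto
      have p0: "0 \<le> p_left t \<omega>" using pl t intensity_floor_pos by (meson order.trans less_imp_le)
      have pn: "p_left t \<omega> \<le> real n" and wn: "W_left t \<omega> \<le> real n" using chi_left[OF \<omega> True t'(2,3), of t] t' by auto
      have w0: "0 \<le> W_left t \<omega>" using low t' by (meson less_imp_le order.trans)
      have E: "0 \<le> E_left t \<omega>" "E_left t \<omega> \<le> B"
        unfolding B_def using E_left_eq[OF \<omega> t'(2,3)] E_left_bound[OF \<omega> t'(2,3), of "real n"] chi_left(1)[OF \<omega> True t'(2,3)] by auto
      have Kb: "ennreal \<bar>Kn n ((t, \<omega>), z)\<bar> * ennreal (p_left t \<omega>) \<le> ennreal c0 + ennreal B * ennreal ((\<Theta> t \<omega> z)\<^sup>2 * p_left t \<omega>)"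
        if z: "0 < z" for z
      proof -
        let ?e = "exp (- \<kappa> t * z * (1 - ustar t \<omega>))"
        have e: "0 \<le> ?e" "?e \<le> 1" using z \<kappa>_pos[of t] ustar_range[of t \<omega>] by auto
        have "\<bar>(W_left t \<omega> + \<Theta> t \<omega> z) * ?e - W_left t \<omega>\<bar> \<le> \<bar>W_left t \<omega> + \<Theta> t \<omega> z\<bar> * 1 + \<bar>W_left t \<omega>\<bar>"
          using e by (intro order_trans[OF abs_triangle_ineq4] add_mono) (auto simp: abs_mult intro!: mult_left_le)
        also have "\<dots> \<le> 2 * real n + (1 + (\<Theta> t \<omega> z)\<^sup>2)"
          using abs_le_sq[of "\<Theta> t \<omega> z"] abs_triangle_ineq[of "W_left t \<omega>" "\<Theta> t \<omega> z"] wn w0 by simp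
        finally have "\<bar>K ((t, \<omega>), z)\<bar> \<le> B * (2 * real n + 1 + (\<Theta> t \<omega> z)\<^sup>2)"
          unfolding K_def abs_mult using E B0 by (simp add: add.assoc) (intro mult_mono, auto)
        then have "\<bar>K ((t, \<omega>), z)\<bar> * p_left t \<omega> \<le> B * (2 * real n + 1 + (\<Theta> t \<omega> z)\<^sup>2) * p_left t \<omega>"
          using p0 by (rule mult_right_mono)
        also have "\<dots> = B * (2 * real n + 1) * p_left t \<omega> + B * ((\<Theta> t \<omega> z)\<^sup>2 * p_left t \<omega>)" by (simp add: algebra_simps)
        also have "B * (2 * real n + 1) * p_left t \<omega> \<le> c0" unfolding c0_def using pn B0 by (intro mult_left_mono) auto
        finally have "ennreal (\<bar>K ((t, \<omega>), z)\<bar> * p_left t \<omega>) \<le> ennreal (c0 + B * ((\<Theta> t \<omega> z)\<^sup>2 * p_left t \<omega>))"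
          by (intro ennreal_leI) simp
        then show ?thesis using True p0 B0 c00 by (simp add: Kn_def ennreal_mult ennreal_plus)
      qed
      have "(\<integral>\<^sup>+z. ennreal \<bar>Kn n ((t, \<omega>), z)\<bar> \<partial>mark_law F1) * ennreal (p_left t \<omega>) =
         (\<integral>\<^sup>+z. ennreal \<bar>Kn n ((t, \<omega>), z)\<bar> * ennreal (p_left t \<omega>) \<partial>mark_law F1)"
      proof (rule nn_integral_multc[symmetric])
        show "(\<lambda>z. ennreal \<bar>Kn n ((t, \<omega>), z)\<bar>) \<in> borel_measurable (mark_law F1)"
          using field_mark_section[OF Kn_field t'(1) \<omega>, of n] by measurable
      qed
      also have "\<dots> \<le> (\<integral>\<^sup>+z. ennreal c0 + ennreal B * ennreal ((\<Theta> t \<omega> z)\<^sup>2 * p_left t \<omega>) \<partial>mark_law F1)"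
        by (intro nn_integral_mono Kb) (auto simp: space_restrict_space)
      also have "\<dots> = ennreal c0 + ennreal B * Q t \<omega>"
      proof -
        have m: "(\<lambda>z. ennreal ((\<Theta> t \<omega> z)\<^sup>2 * p_left t \<omega>)) \<in> borel_measurable (mark_law F1)"
          using \<Theta>_section[OF t'(1) \<omega>] by measurable
        then have "(\<lambda>z. ennreal B * ennreal ((\<Theta> t \<omega> z)\<^sup>2 * p_left t \<omega>)) \<in> borel_measurable (mark_law F1)" by measurable
        then show ?thesis unfolding Q_def
          using mark.emeasure_space_1 by (subst nn_integral_add) (auto simp: nn_integral_cmult[OF m])
      qed
      finally show ?thesis .
    qed (simp add: Kn_def)
    have "(\<integral>\<^sup>+t. (\<integral>\<^sup>+z. ennreal \<bar>Kn n ((t, \<omega>), z)\<bar> \<partial>mark_law F1) * ennreal (p_left t \<omega>) \<partial>clock T) \<le>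
       (\<integral>\<^sup>+t. ennreal c0 + ennreal B * Q t \<omega> \<partial>clock T)"
      by (rule nn_integral_mono_AE) (use AE_clock_pos in eventually_elim, rule bnd)
    also have "\<dots> = ennreal (c0 * T) + ennreal B * (\<integral>\<^sup>+t. Q t \<omega> \<partial>clock T)"
    proof -
      have m: "(\<lambda>t. Q t \<omega>) \<in> borel_measurable (clock T)" using clock_path[OF Qp \<omega>] by simp
      then have "(\<lambda>t. ennreal B * Q t \<omega>) \<in> borel_measurable (clock T)" by measurable
      then show ?thesis
        using c00 T_nonneg by (subst nn_integral_add)
          (auto simp: nn_integral_cmult[OF m] emeasure_restrict_space space_restrict_space ennreal_mult)
    qed
    finally show "(\<integral>\<^sup>+t. (\<integral>\<^sup>+z. ennreal \<bar>Kn n ((t, \<omega>), z)\<bar> \<partial>mark_law F1) * ennreal (p_left t \<omega>) \<partial>clock T)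
      \<le> ennreal (c0 * T) + ennreal B * (\<integral>\<^sup>+t. Q t \<omega> \<partial>clock T)" .
  qed
  have Qm: "(\<lambda>\<omega>. \<integral>\<^sup>+t. Q t \<omega> \<partial>clock T) \<in> borel_measurable M"
    using measurable_compose[OF measurable_pair_swap' H.measurable_time_scenario[OF Qp T_nonneg, unfolded time_scenario_def]]
    by (intro clock.borel_measurable_nn_integral) (simp add: split_beta)
  have "(\<integral>\<^sup>+\<omega>. \<integral>\<^sup>+t. (\<integral>\<^sup>+z. ennreal \<bar>Kn n ((t, \<omega>), z)\<bar> \<partial>mark_law F1) * ennreal (p_left t \<omega>) \<partial>clock T \<partial>M)
      \<le> (\<integral>\<^sup>+\<omega>. ennreal (c0 * T) + ennreal B * (\<integral>\<^sup>+t. Q t \<omega> \<partial>clock T) \<partial>M)"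
    by (rule nn_integral_mono_AE[OF le])
  also have "\<dots> = ennreal (c0 * T) + ennreal B * (\<integral>\<^sup>+\<omega>. \<integral>\<^sup>+t. Q t \<omega> \<partial>clock T \<partial>M)"
    using Qm by (subst nn_integral_add) (auto simp: nn_integral_cmult emeasure_space_1)
  also have "\<dots> < \<infinity>"
    using \<Theta>_sq_mean_finite unfolding Q_def[symmetric] by (simp add: ennreal_mult_less_top ennreal_add_eq_top less_top)
  finally show ?thesis .
qed

lemma AE_path: "{x \<in> space (time_scenario T M). P (fst x) (snd x)} \<in> sets (time_scenario T M) \<Longrightarrow>
    AE (t, \<omega>) in time_scenario T M. P t \<omega> \<Longrightarrow> AE \<omega> in M. AE t in clock T. P t \<omega>"
  using ts.AE_pair[of "\<lambda>x. P (fst x) (snd x)"] ts.AE_commute[of P]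
  unfolding time_scenario_def by (simp add: split_beta)

lemma g_le_fstar_path: "AE \<omega> in M. AE t in clock T. g t \<omega> \<le> fstar t \<omega>"
proof (rule AE_path[OF _ g_le_fstar])
  have [measurable]: "(\<lambda>x. g (fst x) (snd x)) \<in> borel_measurable (time_scenario T M)"
    using conjunct1[OF g_sup[unfolded is_ess_sup_def]] unfolding split_beta .
  have [measurable]: "(\<lambda>x. fstar (fst x) (snd x)) \<in> borel_measurable (time_scenario T M)"
    using fstar_measurable unfolding split_beta .
  show "{x \<in> space (time_scenario T M). g (fst x) (snd x) \<le> fstar (fst x) (snd x)} \<in> sets (time_scenario T M)"
    by measurable
qed

text \<open>Drift of the product of \<open>E\<close> and \<open>W\<close> between claims:
  \<open>\<eta> prem\<close> is the growth rate of \<open>E\<close> and \<open>g - \<theta>b\<close>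
  the drift of \<open>W\<close>. Left limits appear because the driver is expressed in them; they
  agree with the values at almost every time.\<close>

definition fl :: "real \<Rightarrow> 'a \<Rightarrow> real" where
  "fl t \<omega> = E_left t \<omega> * (W_left t \<omega> * (\<eta> * prem ustar t \<omega>) + (g t \<omega> - \<theta>b t \<omega>))"

text \<open>With \<open>fstar\<close> in place of \<open>g\<close> the second claim is an identity:
  the premium term, \<open>\<theta>b\<close> and the integral in the driver combine to the
  compensator of the jumps. Hence drift and compensator together are at most zero.\<close>

lemma drift_le:
  assumes t: "t \<in> {0<..T}" and \<omega>: "\<omega> \<in> space M" and good: "good t \<omega>" and le: "g t \<omega> \<le> fstar t \<omega>"
  shows "integrable (mark_law F1) (\<lambda>z. K ((t, \<omega>), z))"
    and "fl t \<omega> \<le> - (p_left t \<omega> * (\<integral>z. K ((t, \<omega>), z) \<partial>mark_law F1))"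
proof -
  have t': "t \<in> {0..T}" "0 < t" "t \<le> T" using t by auto
  let ?w = "W_left t \<omega>" and ?pl = "p_left t \<omega>"
  let ?e = "\<lambda>z. exp (- \<kappa> t * z * (1 - ustar t \<omega>))"
  have i1: "integrable (mark_law F1) (\<lambda>z. (?w + \<Theta> t \<omega> z) * ?e z)"
    by (rule good_exp_integrable[OF t'(1) \<omega> good]) (use ustar_range[of t \<omega>] in auto)
  have i2: "integrable (mark_law F1) (\<Theta> t \<omega>)" by (rule good_\<Theta>[OF t'(1) \<omega> good])
  show "integrable (mark_law F1) (\<lambda>z. K ((t, \<omega>), z))" unfolding K_def using i1 by simp
  have K: "(\<integral>z. K ((t, \<omega>), z) \<partial>mark_law F1) = E_left t \<omega> * ((\<integral>z. (?w + \<Theta> t \<omega> z) * ?e z \<partial>mark_law F1) - ?w)"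
    unfolding K_def using i1 mark.prob_space by (simp add: space_restrict_space)
  have I: "(\<integral>z. (?w + \<Theta> t \<omega> z) * (?e z - 1) \<partial>mark_law F1) =
      (\<integral>z. (?w + \<Theta> t \<omega> z) * ?e z \<partial>mark_law F1) - (?w + (\<integral>z. \<Theta> t \<omega> z \<partial>mark_law F1))"
    using i1 i2 mark.prob_space by (simp add: right_diff_distrib)
  have fs: "fstar t \<omega> = - (?w * (\<eta> * prem ustar t \<omega>)) - ?pl * (\<integral>z. (?w + \<Theta> t \<omega> z) * (?e z - 1) \<partial>mark_law F1)"
    unfolding fstar_def driver_eq[OF t'(1) \<omega> good] prem_def q_eq \<kappa>_def C_def by (simp add: ac_simps)
  have tb: "\<theta>b t \<omega> = ?pl * (\<integral>z. \<Theta> t \<omega> z \<partial>mark_law F1)" unfolding \<theta>b_def by simp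
  have "fl t \<omega> \<le> E_left t \<omega> * (?w * (\<eta> * prem ustar t \<omega>) + (fstar t \<omega> - \<theta>b t \<omega>))"
    unfolding fl_def using le E_left_eq[OF \<omega> t'(2,3)] by (intro mult_left_mono) auto
  also have "\<dots> = - (?pl * (\<integral>z. K ((t, \<omega>), z) \<partial>mark_law F1))"
    unfolding fs tb I K by (simp add: algebra_simps)
  finally show "fl t \<omega> \<le> - (?pl * (\<integral>z. K ((t, \<omega>), z) \<partial>mark_law F1))" .
qed

text \<open>Left limits of the paths of \<open>E\<close> and \<open>W\<close> are bounded, so only
  products of bounded and integrable functions occur.\<close>

lemma fl_path_integrable:
  assumes \<omega>: "\<omega> \<in> space M" and b: "set_integrable lborel {0..T} (\<lambda>s. g s \<omega> - \<theta>b s \<omega>)"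
  shows "set_integrable lborel {0..T} (\<lambda>t. fl t \<omega>)"
proof -
  have ll: "\<exists>B. \<forall>t\<in>{0..T}. \<bar>left_lim f t\<bar> \<le> B" if f: "cadlag_on T f" for f
  proof -
    obtain B where B: "\<And>t. t \<in> {0..T} \<Longrightarrow> \<bar>f t\<bar> \<le> B" using cadlag_on_bounded[OF f] by blast
    have "\<bar>left_lim f t\<bar> \<le> B" if t: "t \<in> {0..T}" for t
    proof (cases "t = 0")
      case True
      then show ?thesis using B[of 0] T_pos by (simp add: left_lim_def)
    next
      case False
      then have t': "0 < t" "t \<le> T" using t by auto
      have "- B \<le> f s" "f s \<le> B" if "s \<in> {0<..<t}" for s using B[of s] that t' by (auto simp: abs_le_iff)
      then have "- B \<le> left_lim f t" "left_lim f t \<le> B"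
        by (intro left_lim_between[OF f t'] left_lim_between'[OF f t']; simp)+
      then show ?thesis by simp
    qed
    then show ?thesis by blast
  qed
  have meas: "set_borel_measurable lborel {0..T} f" if "f \<in> borel_measurable (clock T)" for f :: "real \<Rightarrow> real"
    using that unfolding set_borel_measurable_def by (subst (asm) borel_measurable_restrict_space_iff) auto
  obtain BE where BE: "\<And>t. t \<in> {0..T} \<Longrightarrow> \<bar>E_left t \<omega>\<bar> \<le> BE" using ll[OF E_cadlag[OF \<omega>]] unfolding E_left_def by metis
  obtain BW where BW: "\<And>t. t \<in> {0..T} \<Longrightarrow> \<bar>W_left t \<omega>\<bar> \<le> BW" using ll[OF W_cadlag[OF \<omega>]] unfolding W_left_def by metis
  have mE: "set_borel_measurable lborel {0..T} (\<lambda>t. E_left t \<omega>)" using clock_path[OF E_left_predictable \<omega>] by (intro meas) simp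
  have mW: "set_borel_measurable lborel {0..T} (\<lambda>t. W_left t \<omega>)" using clock_path[OF W_left_predictable \<omega>] by (intro meas) simp
  have a: "set_integrable lborel {0..T} (\<lambda>t. \<eta> * prem ustar t \<omega>)"
    using prem_set_integrable[OF \<omega>] by (rule set_integrable_mult_right)
  show ?thesis
    unfolding fl_def
    by (rule set_integrable_mult_bounded[OF set_integral_add(1)[OF set_integrable_mult_bounded[OF a mW BW] b] mE BE])
qed

text \<open>Smaller times satisfy fewer conditions, and the strict inequality \<open>q < t\<close>
  keeps the supremum inside the set. So each path is localised on an interval from \<open>0\<close>
  that contains its right end \<open>\<sigma>\<close>.\<close>

lemma chi_interval:
  obtains \<sigma> where "\<sigma> \<in> {0..T}" "\<And>t. t \<in> {0..T} \<Longrightarrow> chi n t \<omega> \<longleftrightarrow> t \<le> \<sigma>"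
proof -
  define \<sigma> where "\<sigma> = Sup {t\<in>{0..T}. chi n t \<omega>}"
  have c0: "chi n 0 \<omega>" unfolding chi_def by auto
  have ne: "{t\<in>{0..T}. chi n t \<omega>} \<noteq> {}" using c0 T_nonneg by (auto intro!: exI[of _ 0])
  have bdd: "bdd_above {t\<in>{0..T}. chi n t \<omega>}" by (auto intro!: bdd_aboveI[of _ T])
  have mono: "chi n s \<omega>" if "chi n t \<omega>" "s \<le> t" for s t using that unfolding chi_def by auto
  have "chi n \<sigma> \<omega>" unfolding chi_def
  proof (intro ballI impI)
    fix q assume q: "q \<in> \<rat> \<inter> {0..T}" "q < \<sigma>"
    then obtain t where "t \<in> {0..T}" "chi n t \<omega>" "q < t" unfolding \<sigma>_def less_cSup_iff[OF ne bdd] by auto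
    then show "p q \<omega> \<le> real n \<and> W q \<omega> \<le> real n" using q(1) unfolding chi_def by auto
  qed
  moreover have "t \<le> \<sigma>" if "t \<in> {0..T}" "chi n t \<omega>" for t
    unfolding \<sigma>_def using that by (intro cSup_upper bdd) auto
  moreover have "\<sigma> \<in> {0..T}"
  proof -
    have "0 \<le> \<sigma>" unfolding \<sigma>_def using c0 T_nonneg by (intro cSup_upper bdd) auto
    moreover have "\<sigma> \<le> T" unfolding \<sigma>_def using ne by (intro cSup_least) auto
    ultimately show ?thesis by simp
  qed
  ultimately show thesis using mono by (intro that[of \<sigma>]) blast+
qed

text \<open>This is the product formula with jumps for the exponent of \<open>E\<close> and for
  \<open>W\<close>, taken at \<open>\<sigma>\<close>. Its jump terms are values of \<open>K\<close>,
  and the localising condition extends the sum and the integral to the whole interval by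
  zero.\<close>

lemma stopped_product:
  assumes \<omega>: "\<omega> \<in> space M" and b: "set_integrable lborel {0..T} (\<lambda>s. g s \<omega> - \<theta>b s \<omega>)"
    and W: "\<And>t. t \<in> {0..T} \<Longrightarrow> W t \<omega> = W 0 \<omega> + (\<Sum>j | \<tau>1 j \<omega> \<le> ereal t. \<Theta>j j \<omega>) + integral {0..t} (\<lambda>s. g s \<omega> - \<theta>b s \<omega>)"
    and \<sigma>: "\<sigma> \<in> {0..T}" "\<And>t. t \<in> {0..T} \<Longrightarrow> chi n t \<omega> \<longleftrightarrow> t \<le> \<sigma>"
  shows "E \<sigma> \<omega> * W \<sigma> \<omega> = W 0 \<omega> + (\<Sum>j | \<tau>1 j \<omega> \<le> ereal T. Kn n ((real_of_ereal (\<tau>1 j \<omega>), \<omega>), Z1 j \<omega>))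
    + (\<integral>t. (if chi n t \<omega> then fl t \<omega> else 0) \<partial>clock T)"
proof -
  define J where "J = {j. \<tau>1 j \<omega> \<le> ereal T}"
  define \<tau>r where "\<tau>r j = real_of_ereal (\<tau>1 j \<omega>)" for j
  have J: "finite J" "inj_on \<tau>r J" "\<And>j. j \<in> J \<Longrightarrow> 0 < \<tau>r j"
    using jump_timesD(4)[OF jumps1 \<omega>, of T] jump_times_inj[OF jumps1 \<omega>, of T] jump_time_real(2)[OF jumps1 \<omega>, of _ T]
    unfolding J_def \<tau>r_def by auto
  have \<tau>rT: "\<tau>r j \<in> {0..T}" "ereal (\<tau>r j) = \<tau>1 j \<omega>" if "j \<in> J" for j
    using jump_time_real[OF jumps1 \<omega>, of j T] that unfolding J_def \<tau>r_def by auto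
  have set: "{j\<in>J. \<tau>r j \<le> x} = {j. \<tau>1 j \<omega> \<le> ereal x}" if x: "x \<in> {0..T}" for x
  proof (intro equalityI subsetI)
    fix j assume "j \<in> {j\<in>J. \<tau>r j \<le> x}"
    then have "j \<in> J" "ereal (\<tau>r j) \<le> ereal x" by auto
    then show "j \<in> {j. \<tau>1 j \<omega> \<le> ereal x}" using \<tau>rT(2) by simp
  next
    fix j assume "j \<in> {j. \<tau>1 j \<omega> \<le> ereal x}"
    then have j: "\<tau>1 j \<omega> \<le> ereal x" by simp
    also have "ereal x \<le> ereal T" using x by simp
    finally have "j \<in> J" unfolding J_def by simp
    then show "j \<in> {j\<in>J. \<tau>r j \<le> x}" using jump_time_real(3)[OF jumps1 \<omega> j] unfolding \<tau>r_def by simp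
  qed
  have a: "set_integrable lborel {0..T} (\<lambda>t. \<eta> * prem ustar t \<omega>)"
    using prem_set_integrable[OF \<omega>] by (rule set_integrable_mult_right)
  have Ex: "exp (integral {0..x} (\<lambda>t. \<eta> * prem ustar t \<omega>) + (\<Sum>j\<in>{j\<in>J. \<tau>r j \<le> x}. al j \<omega>)) = E x \<omega>" if "x \<in> {0..T}" for x
    unfolding E_def IP_eq[OF \<omega> that] set[OF that] by simp
  have Wx: "W 0 \<omega> + integral {0..x} (\<lambda>s. g s \<omega> - \<theta>b s \<omega>) + (\<Sum>j\<in>{j\<in>J. \<tau>r j \<le> x}. \<Theta>j j \<omega>) = W x \<omega>" if "x \<in> {0..T}" for x
    unfolding set[OF that] W[OF that] by simp
  \<comment> \<open>Undoing the jumps turns values at the claim into left limits: \<open>W\<close>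
    loses \<open>\<Theta>j\<close> and \<open>E\<close> loses the factor
    \<open>exp (al j \<omega>)\<close>.\<close>
  have jump: "E (\<tau>r j) \<omega> * (W (\<tau>r j) \<omega> - exp (- al j \<omega>) * (W (\<tau>r j) \<omega> - \<Theta>j j \<omega>)) = K ((\<tau>r j, \<omega>), Z1 j \<omega>)" if j: "j \<in> J" for j
  proof -
    have j': "\<tau>1 j \<omega> \<le> ereal T" using j by (simp add: J_def)
    have Wj: "W (\<tau>r j) \<omega> = W_left (\<tau>r j) \<omega> + \<Theta>j j \<omega>"
      unfolding \<tau>r_def by (rule W_path_jump[OF \<omega> b W j'])
    have "{i. \<tau>1 i \<omega> \<le> ereal (\<tau>r j)} = insert j {i. \<tau>1 i \<omega> < ereal (\<tau>r j)}"
    proof -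
      have "i = j" if "\<tau>1 i \<omega> = \<tau>1 j \<omega>" for i
        using inj_onD[OF jump_times_inj[OF jumps1 \<omega>, of T], of i j] that j' by auto
      then show ?thesis using \<tau>rT(2)[OF j] by (auto simp: less_le)
    qed
    moreover have "j \<notin> {i. \<tau>1 i \<omega> < ereal (\<tau>r j)}" using \<tau>rT(2)[OF j] by simp
    moreover have "finite {i. \<tau>1 i \<omega> < ereal (\<tau>r j)}"
      by (rule finite_subset[OF _ jump_timesD(4)[OF jumps1 \<omega>, of "\<tau>r j"]]) auto
    ultimately have "(\<Sum>i | \<tau>1 i \<omega> \<le> ereal (\<tau>r j). al i \<omega>) = al j \<omega> + (\<Sum>i | \<tau>1 i \<omega> < ereal (\<tau>r j). al i \<omega>)" by simp
    then have Ej: "E (\<tau>r j) \<omega> = E_left (\<tau>r j) \<omega> * exp (al j \<omega>)"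
      unfolding E_def using E_left_eq[OF \<omega>, of "\<tau>r j"] J(3)[OF j] \<tau>rT(1)[OF j] by (simp add: exp_add ac_simps)
    have "K ((\<tau>r j, \<omega>), Z1 j \<omega>) = E_left (\<tau>r j) \<omega> * ((W_left (\<tau>r j) \<omega> + \<Theta>j j \<omega>) * exp (al j \<omega>) - W_left (\<tau>r j) \<omega>)"
      unfolding K_def al_def \<Theta>j_def \<tau>r_def by simp
    moreover have "exp (al j \<omega>) * exp (- al j \<omega>) = 1" by (simp add: exp_minus)
    ultimately show ?thesis unfolding Wj Ej by algebra
  qed
  have "E \<sigma> \<omega> * W \<sigma> \<omega> = W 0 \<omega>
    + (\<Sum>j\<in>{j\<in>J. \<tau>r j \<le> \<sigma>}. E (\<tau>r j) \<omega> * (W (\<tau>r j) \<omega> - exp (- al j \<omega>) * (W (\<tau>r j) \<omega> - \<Theta>j j \<omega>)))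
    + integral {0..\<sigma>} (\<lambda>v. E v \<omega> * (W v \<omega> * (\<eta> * prem ustar v \<omega>) + (g v \<omega> - \<theta>b v \<omega>)))"
  proof -
    note pf = exp_product_formula_jumps[OF a b J \<sigma>(1), of "\<lambda>j. al j \<omega>" "W 0 \<omega>" "\<lambda>j. \<Theta>j j \<omega>"]
    have s1: "(\<Sum>j\<in>{j\<in>J. \<tau>r j \<le> \<sigma>}. exp (integral {0..\<tau>r j} (\<lambda>t. \<eta> * prem ustar t \<omega>) + (\<Sum>i\<in>{i\<in>J. \<tau>r i \<le> \<tau>r j}. al i \<omega>)) *
        (W 0 \<omega> + integral {0..\<tau>r j} (\<lambda>s. g s \<omega> - \<theta>b s \<omega>) + (\<Sum>i\<in>{i\<in>J. \<tau>r i \<le> \<tau>r j}. \<Theta>j i \<omega>) -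
         exp (- al j \<omega>) * (W 0 \<omega> + integral {0..\<tau>r j} (\<lambda>s. g s \<omega> - \<theta>b s \<omega>) + (\<Sum>i\<in>{i\<in>J. \<tau>r i \<le> \<tau>r j}. \<Theta>j i \<omega>) - \<Theta>j j \<omega>))) =
      (\<Sum>j\<in>{j\<in>J. \<tau>r j \<le> \<sigma>}. E (\<tau>r j) \<omega> * (W (\<tau>r j) \<omega> - exp (- al j \<omega>) * (W (\<tau>r j) \<omega> - \<Theta>j j \<omega>)))"
    proof (intro sum.cong refl)
      fix j assume "j \<in> {j\<in>J. \<tau>r j \<le> \<sigma>}"
      then have "\<tau>r j \<in> {0..T}" using \<tau>rT(1) by simp
      note Ex[OF this] Wx[OF this]
      then show "exp (integral {0..\<tau>r j} (\<lambda>t. \<eta> * prem ustar t \<omega>) + (\<Sum>i\<in>{i\<in>J. \<tau>r i \<le> \<tau>r j}. al i \<omega>)) *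
        (W 0 \<omega> + integral {0..\<tau>r j} (\<lambda>s. g s \<omega> - \<theta>b s \<omega>) + (\<Sum>i\<in>{i\<in>J. \<tau>r i \<le> \<tau>r j}. \<Theta>j i \<omega>) -
         exp (- al j \<omega>) * (W 0 \<omega> + integral {0..\<tau>r j} (\<lambda>s. g s \<omega> - \<theta>b s \<omega>) + (\<Sum>i\<in>{i\<in>J. \<tau>r i \<le> \<tau>r j}. \<Theta>j i \<omega>) - \<Theta>j j \<omega>)) =
        E (\<tau>r j) \<omega> * (W (\<tau>r j) \<omega> - exp (- al j \<omega>) * (W (\<tau>r j) \<omega> - \<Theta>j j \<omega>))" by (simp only:)
    qed
    have s2: "integral {0..\<sigma>} (\<lambda>v. exp (integral {0..v} (\<lambda>t. \<eta> * prem ustar t \<omega>) + (\<Sum>j\<in>{j\<in>J. \<tau>r j \<le> v}. al j \<omega>)) *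
        ((W 0 \<omega> + integral {0..v} (\<lambda>s. g s \<omega> - \<theta>b s \<omega>) + (\<Sum>j\<in>{j\<in>J. \<tau>r j \<le> v}. \<Theta>j j \<omega>)) * (\<eta> * prem ustar v \<omega>) + (g v \<omega> - \<theta>b v \<omega>)))
      = integral {0..\<sigma>} (\<lambda>v. E v \<omega> * (W v \<omega> * (\<eta> * prem ustar v \<omega>) + (g v \<omega> - \<theta>b v \<omega>)))"
    proof (rule integral_cong)
      fix v assume "v \<in> {0..\<sigma>}"
      then have "v \<in> {0..T}" using \<sigma>(1) by auto
      note Ex[OF this] Wx[OF this]
      then show "exp (integral {0..v} (\<lambda>t. \<eta> * prem ustar t \<omega>) + (\<Sum>j\<in>{j\<in>J. \<tau>r j \<le> v}. al j \<omega>)) *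
        ((W 0 \<omega> + integral {0..v} (\<lambda>s. g s \<omega> - \<theta>b s \<omega>) + (\<Sum>j\<in>{j\<in>J. \<tau>r j \<le> v}. \<Theta>j j \<omega>)) * (\<eta> * prem ustar v \<omega>) + (g v \<omega> - \<theta>b v \<omega>))
        = E v \<omega> * (W v \<omega> * (\<eta> * prem ustar v \<omega>) + (g v \<omega> - \<theta>b v \<omega>))" by (simp only:)
    qed
    show ?thesis using pf unfolding s1 s2 Ex[OF \<sigma>(1)] Wx[OF \<sigma>(1)] .
  qed
  also have "(\<Sum>j\<in>{j\<in>J. \<tau>r j \<le> \<sigma>}. E (\<tau>r j) \<omega> * (W (\<tau>r j) \<omega> - exp (- al j \<omega>) * (W (\<tau>r j) \<omega> - \<Theta>j j \<omega>)))
    = (\<Sum>j\<in>J. Kn n ((\<tau>r j, \<omega>), Z1 j \<omega>))"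
  proof -
    have "(\<Sum>j\<in>{j\<in>J. \<tau>r j \<le> \<sigma>}. E (\<tau>r j) \<omega> * (W (\<tau>r j) \<omega> - exp (- al j \<omega>) * (W (\<tau>r j) \<omega> - \<Theta>j j \<omega>)))
      = (\<Sum>j\<in>{j\<in>J. \<tau>r j \<le> \<sigma>}. K ((\<tau>r j, \<omega>), Z1 j \<omega>))"
      by (intro sum.cong refl jump) simp
    also have "\<dots> = (\<Sum>j\<in>J. if \<tau>r j \<le> \<sigma> then K ((\<tau>r j, \<omega>), Z1 j \<omega>) else 0)" by (rule sum.inter_filter[OF J(1)])
    also have "\<dots> = (\<Sum>j\<in>J. Kn n ((\<tau>r j, \<omega>), Z1 j \<omega>))"
      using \<sigma>(2)[OF \<tau>rT(1)] by (intro sum.cong) (auto simp: Kn_def)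
    finally show ?thesis .
  qed
  \<comment> \<open>The paths differ from their left limits at countably many times only, a null set
    for the integral.\<close>
  also have "integral {0..\<sigma>} (\<lambda>v. E v \<omega> * (W v \<omega> * (\<eta> * prem ustar v \<omega>) + (g v \<omega> - \<theta>b v \<omega>))) = integral {0..\<sigma>} (\<lambda>t. fl t \<omega>)"
  proof (rule integral_spike)
    show "negligible (insert 0 ({t\<in>{0<..T}. left_lim (\<lambda>s. E s \<omega>) t \<noteq> E t \<omega>} \<union> {t\<in>{0<..T}. left_lim (\<lambda>s. W s \<omega>) t \<noteq> W t \<omega>}))"
      using countable_left_jumps[OF E_cadlag[OF \<omega>]] countable_left_jumps[OF W_cadlag[OF \<omega>]]
      unfolding negligible_iff_null_sets
      by (intro null_sets_completionI countable_imp_null_set_lborel) auto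
    fix t assume t: "t \<in> {0..\<sigma>} - insert 0 ({t\<in>{0<..T}. left_lim (\<lambda>s. E s \<omega>) t \<noteq> E t \<omega>} \<union> {t\<in>{0<..T}. left_lim (\<lambda>s. W s \<omega>) t \<noteq> W t \<omega>})"
    then have "E_left t \<omega> = E t \<omega>" "W_left t \<omega> = W t \<omega>" using \<sigma>(1) unfolding E_left_def W_left_def by auto
    then show "fl t \<omega> = E t \<omega> * (W t \<omega> * (\<eta> * prem ustar t \<omega>) + (g t \<omega> - \<theta>b t \<omega>))"
      unfolding fl_def by (simp only:)
  qed
  also have "integral {0..\<sigma>} (\<lambda>t. fl t \<omega>) = (LINT t:{0..\<sigma>}|lborel. fl t \<omega>)"
    using \<sigma>(1) set_integrable_subset[OF fl_path_integrable[OF \<omega> b], of "{0..\<sigma>}"]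
    by (intro set_borel_integral_eq_integral(2)[symmetric]) auto
  also have "\<dots> = (\<integral>t. (if chi n t \<omega> then fl t \<omega> else 0) \<partial>clock T)"
    unfolding integral_clock[symmetric] set_lebesgue_integral_def
    using \<sigma> by (intro Bochner_Integration.integral_cong) (auto simp: indicator_def)
  finally show ?thesis unfolding J_def \<tau>r_def .
qed

text \<open>Null reinsurance pays no premium and cedes nothing, so the terminal wealths under
  \<open>ustar\<close> and under null reinsurance differ by premiums paid and claims ceded; this
  difference times \<open>- \<eta>\<close> is the exponent of \<open>E T\<close>.\<close>

lemma terminal_product:
  assumes \<omega>: "\<omega> \<in> space M" and c: "integrable (clock T) (\<lambda>t. exp (r * (T - t)) * c t \<omega>)"
    and WT: "W T \<omega> = exp (- \<eta> * X (\<lambda>_ _. 1) T \<omega>)"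
  shows "E T \<omega> * W T \<omega> = exp (- \<eta> * X ustar T \<omega>)"
proof -
  have c1: "control (\<lambda>_ _. 1)" unfolding control_def predictable_process_def by simp
  have ret: "\<eta> * (retained (\<lambda>_ _. 1) \<omega> - retained ustar \<omega>) = - (\<Sum>j | \<tau>1 j \<omega> \<le> ereal T. al j \<omega>)"
    unfolding retained_def sum_subtractf[symmetric] sum_distrib_left sum_negf[symmetric]
    by (intro sum.cong) (auto simp: al_def \<kappa>_def algebra_simps)
  have "prem (\<lambda>_ _. 1) t \<omega> = 0" for t unfolding prem_def q_eq by simp
  then have "X ustar T \<omega> - X (\<lambda>_ _. 1) T \<omega> = - IP T \<omega> + (retained (\<lambda>_ _. 1) \<omega> - retained ustar \<omega>)"
    unfolding wealth_eq'[OF ustar_control \<omega> c] wealth_eq'[OF c1 \<omega> c] IP_def integral_clock by simp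
  then have "\<eta> * (X ustar T \<omega> - X (\<lambda>_ _. 1) T \<omega>) = - (\<eta> * IP T \<omega>) + \<eta> * (retained (\<lambda>_ _. 1) \<omega> - retained ustar \<omega>)"
    by (simp add: right_diff_distrib)
  then have "- \<eta> * X ustar T \<omega> = \<eta> * IP T \<omega> + (\<Sum>j | \<tau>1 j \<omega> \<le> ereal T. al j \<omega>) + - \<eta> * X (\<lambda>_ _. 1) T \<omega>"
    unfolding ret by (simp add: right_diff_distrib)
  then show ?thesis unfolding WT E_def exp_add[symmetric] by (simp only:)
qed

text \<open>Conversion to extended nonnegative reals truncates at zero: the identity as
  \<open>f\<close> gives the positive part of the jumps and \<open>uminus\<close> the negative part,
  and the compensator identity holds for each of them separately.\<close>

definition jump_part :: "(real \<Rightarrow> real) \<Rightarrow> nat \<Rightarrow> 'a \<Rightarrow> ennreal" where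
  "jump_part f n \<omega> = (\<Sum>j | \<tau>1 j \<omega> \<le> ereal T. ennreal (f (Kn n ((real_of_ereal (\<tau>1 j \<omega>), \<omega>), Z1 j \<omega>))))"

definition drift_part :: "(real \<Rightarrow> real) \<Rightarrow> nat \<Rightarrow> 'a \<Rightarrow> ennreal" where
  "drift_part f n \<omega> = (\<integral>\<^sup>+t. (\<integral>\<^sup>+z. ennreal (f (Kn n ((t, \<omega>), z))) \<partial>mark_law F1) * ennreal (p_left t \<omega>) \<partial>clock T)"

lemma part_field: "f \<in> borel_measurable borel \<Longrightarrow> (\<lambda>x. ennreal (f (Kn n x))) \<in> borel_measurable (field_sigma {0..T} H)"
  by (rule measurable_compose[OF measurable_compose[OF Kn_field] measurable_ennreal])

lemma drift_part_measurable:
  assumes [measurable]: "f \<in> borel_measurable borel" shows "drift_part f n \<in> borel_measurable M"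
proof -
  have [measurable]: "(\<lambda>x. p_left (fst x) (snd x)) \<in> borel_measurable (predictable_sigma {0..T} H)"
    using p_left_predictable unfolding split_beta .
  have [measurable]: "(\<lambda>x. \<integral>\<^sup>+z. ennreal (f (Kn n (x, z))) \<partial>mark_law F1) \<in> borel_measurable (predictable_sigma {0..T} H)"
    by (rule predictable_nn_integral_mark[OF part_field[OF assms]])
  have "(\<lambda>x. (\<integral>\<^sup>+z. ennreal (f (Kn n (x, z))) \<partial>mark_law F1) * ennreal (p_left (fst x) (snd x))) \<in> borel_measurable (predictable_sigma {0..T} H)"
    by measurable
  from measurable_compose[OF measurable_pair_swap' H.measurable_time_scenario[OF this T_nonneg, unfolded time_scenario_def]]
  show ?thesis unfolding drift_part_def[abs_def]
    by (intro clock.borel_measurable_nn_integral) (simp add: split_beta)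
qed

lemma jump_part_measurable: "f \<in> borel_measurable borel \<Longrightarrow> jump_part f n \<in> borel_measurable M"
  using H.measurable_F'[OF T_nonneg H.sum_jumps_adapted_ennreal[OF T_nonneg order_refl part_field]]
  unfolding jump_part_def[abs_def] by simp

lemma part_eq: "f \<in> borel_measurable borel \<Longrightarrow> (\<integral>\<^sup>+\<omega>. jump_part f n \<omega> \<partial>M) = (\<integral>\<^sup>+\<omega>. drift_part f n \<omega> \<partial>M)"
  unfolding jump_part_def drift_part_def by (rule compensator_H[OF part_field])

lemma part_finite:
  assumes "\<And>x. f x \<le> \<bar>x\<bar>" shows "(\<integral>\<^sup>+\<omega>. drift_part f n \<omega> \<partial>M) < \<infinity>"
proof -
  have "(\<integral>\<^sup>+\<omega>. drift_part f n \<omega> \<partial>M) \<le> (\<integral>\<^sup>+\<omega>. drift_part abs n \<omega> \<partial>M)"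
    unfolding drift_part_def using assms by (intro nn_integral_mono mult_right_mono ennreal_leI) auto
  also have "\<dots> < \<infinity>" unfolding drift_part_def by (rule Kn_abs_finite)
  finally show ?thesis .
qed

text \<open>At almost every time the mark integral is finite, because \<open>K\<close> is integrable
  there on the localising set, and elsewhere \<open>Kn\<close> is zero and
  \<open>f 0 \<le> 0\<close> is truncated. So the extended integral is the real one.\<close>

lemma drift_part_integral:
  assumes f[measurable]: "f \<in> borel_measurable borel" and f0: "f 0 \<le> 0" and fl: "\<And>x. f x \<le> \<bar>x\<bar>"
    and \<omega>: "\<omega> \<in> space M" and fin: "drift_part f n \<omega> < \<infinity>"
    and good: "AE t in clock T. good t \<omega>" and le: "AE t in clock T. g t \<omega> \<le> fstar t \<omega>"
  defines "k \<equiv> \<lambda>t. enn2real (\<integral>\<^sup>+z. ennreal (f (Kn n ((t, \<omega>), z))) \<partial>mark_law F1) * p_left t \<omega>"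
  shows "integrable (clock T) k" "(\<integral>t. k t \<partial>clock T) = enn2real (drift_part f n \<omega>)"
proof -
  have [measurable]: "(\<lambda>t. p_left t \<omega>) \<in> borel_measurable (clock T)" using clock_path[OF p_left_predictable \<omega>] by simp
  have [measurable]: "(\<lambda>t. \<integral>\<^sup>+z. ennreal (f (Kn n ((t, \<omega>), z))) \<partial>mark_law F1) \<in> borel_measurable (clock T)"
    using clock_path[OF predictable_nn_integral_mark[OF part_field[OF f]] \<omega>] by simp
  have km: "k \<in> borel_measurable (clock T)" unfolding k_def by measurable
  have k0: "AE t in clock T. 0 \<le> k t"
    using good by eventually_elim (simp add: k_def good_def)
  have eq: "AE t in clock T. ennreal (k t) = (\<integral>\<^sup>+z. ennreal (f (Kn n ((t, \<omega>), z))) \<partial>mark_law F1) * ennreal (p_left t \<omega>)"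
    using good le AE_clock_pos
  proof eventually_elim
    case (elim t)
    have "(\<integral>\<^sup>+z. ennreal (f (Kn n ((t, \<omega>), z))) \<partial>mark_law F1) < \<infinity>"
    proof (cases "chi n t \<omega>")
      case True
      have "(\<integral>\<^sup>+z. ennreal (f (Kn n ((t, \<omega>), z))) \<partial>mark_law F1) \<le> (\<integral>\<^sup>+z. ennreal (norm (K ((t, \<omega>), z))) \<partial>mark_law F1)"
        using True fl by (intro nn_integral_mono ennreal_leI) (simp add: Kn_def)
      also have "\<dots> < \<infinity>" using drift_le(1)[OF elim(3) \<omega> elim(1,2)] unfolding integrable_iff_bounded by simp
      finally show ?thesis .
    next
      case False
      then show ?thesis using f0 by (simp add: Kn_def ennreal_neg)
    qed
    then show ?case using elim(1) unfolding k_def good_def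
      by (simp add: ennreal_mult less_top[symmetric])
  qed
  have nn: "(\<integral>\<^sup>+t. ennreal (k t) \<partial>clock T) = drift_part f n \<omega>"
    unfolding drift_part_def by (rule nn_integral_cong_AE[OF eq])
  show "integrable (clock T) k"
    using fin nn by (intro integrableI_nonneg km k0) simp
  show "(\<integral>t. k t \<partial>clock T) = enn2real (drift_part f n \<omega>)"
    unfolding nn[symmetric] by (rule integral_eq_nn_integral[OF km k0])
qed

text \<open>The stopped product identity with the drift \<open>fl\<close> replaced by its bound,
  minus the compensator of \<open>K\<close>. Every term is moved to the side where it is
  nonnegative, so that both sides can be integrated as extended reals.\<close>

lemma stopped_inequality:
  "AE \<omega> in M. (if chi n T \<omega> then ennreal (exp (- \<eta> * X ustar T \<omega>)) else 0) + jump_part uminus n \<omega> + drift_part (\<lambda>x. x) n \<omega>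
    \<le> ennreal (W 0 \<omega>) + jump_part (\<lambda>x. x) n \<omega> + drift_part uminus n \<omega>"
proof -
  have fin: "AE \<omega> in M. drift_part f n \<omega> \<noteq> \<infinity>" if "f \<in> borel_measurable borel" "\<And>x. f x \<le> \<bar>x\<bar>" for f
    using part_finite[of f n, OF that(2)] by (intro nn_integral_PInf_AE drift_part_measurable that(1)) auto
  have "AE \<omega> in M. drift_part (\<lambda>x. x) n \<omega> \<noteq> \<infinity>" "AE \<omega> in M. drift_part uminus n \<omega> \<noteq> \<infinity>"
    by (intro fin; simp add: abs_ge_minus_self)+
  with W_path W_lower W_terminal discounted_c_integrable good_path g_le_fstar_path AE_space
  show ?thesis
  proof eventually_elim
    case (elim \<omega>)
    note \<omega> = elim(7)
    have fP: "drift_part (\<lambda>x. x) n \<omega> < \<infinity>" and fM: "drift_part uminus n \<omega> < \<infinity>"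
      using elim(8,9) by (simp_all add: less_top)
    obtain \<sigma> where \<sigma>: "\<sigma> \<in> {0..T}" "\<And>t. t \<in> {0..T} \<Longrightarrow> chi n t \<omega> \<longleftrightarrow> t \<le> \<sigma>" using chi_interval by blast
    have b: "set_integrable lborel {0..T} (\<lambda>s. g s \<omega> - \<theta>b s \<omega>)" using elim(1) by blast
    define S where "S = (\<Sum>j | \<tau>1 j \<omega> \<le> ereal T. Kn n ((real_of_ereal (\<tau>1 j \<omega>), \<omega>), Z1 j \<omega>))"
    define \<phi> where "\<phi> t = (if chi n t \<omega> then fl t \<omega> else 0)" for t
    have prod: "E \<sigma> \<omega> * W \<sigma> \<omega> = W 0 \<omega> + S + (\<integral>t. \<phi> t \<partial>clock T)"
      unfolding S_def \<phi>_def by (rule stopped_product[OF \<omega> b _ \<sigma>]) (use elim(1) in blast)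
    define kP where "kP t = enn2real (\<integral>\<^sup>+z. ennreal (Kn n ((t, \<omega>), z)) \<partial>mark_law F1) * p_left t \<omega>" for t
    define kM where "kM t = enn2real (\<integral>\<^sup>+z. ennreal (- Kn n ((t, \<omega>), z)) \<partial>mark_law F1) * p_left t \<omega>" for t
    have P: "integrable (clock T) kP" "(\<integral>t. kP t \<partial>clock T) = enn2real (drift_part (\<lambda>x. x) n \<omega>)"
      using drift_part_integral[of "\<lambda>x. x", OF _ _ _ \<omega> fP elim(5,6)] unfolding kP_def by auto
    have Mi: "integrable (clock T) kM" "(\<integral>t. kM t \<partial>clock T) = enn2real (drift_part uminus n \<omega>)"
      using drift_part_integral[of uminus, OF _ _ _ \<omega> fM elim(5,6)] unfolding kM_def by (auto simp: abs_ge_minus_self)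
    have \<phi>i: "integrable (clock T) \<phi>"
    proof -
      have "set_integrable lborel {0..\<sigma>} (\<lambda>t. fl t \<omega>)"
        using set_integrable_subset[OF fl_path_integrable[OF \<omega> b], of "{0..\<sigma>}"] \<sigma>(1) by auto
      also have "set_integrable lborel {0..\<sigma>} (\<lambda>t. fl t \<omega>) \<longleftrightarrow> set_integrable lborel {0..T} \<phi>"
        unfolding set_integrable_def \<phi>_def using \<sigma> by (intro Bochner_Integration.integrable_cong) (auto simp: indicator_def)
      finally show ?thesis by (simp add: integrable_clock_iff)
    qed
    have "(\<integral>t. \<phi> t \<partial>clock T) \<le> (\<integral>t. kM t - kP t \<partial>clock T)"
    proof (rule integral_mono_AE[OF \<phi>i Bochner_Integration.integrable_diff[OF Mi(1) P(1)]])
      show "AE t in clock T. \<phi> t \<le> kM t - kP t"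
        using elim(5,6) AE_clock_pos
      proof eventually_elim
        case (elim t)
        show ?case
        proof (cases "chi n t \<omega>")
          case True
          note d = drift_le[OF elim(3) \<omega> elim(1,2)]
          have "Kn n ((t, \<omega>), z) = K ((t, \<omega>), z)" for z using True by (simp add: Kn_def)
          then show ?thesis
            using d(2) True unfolding \<phi>_def kP_def kM_def real_lebesgue_integral_def[OF d(1)] by (simp add: algebra_simps)
        qed (simp add: \<phi>_def kP_def kM_def Kn_def)
      qed
    qed
    also have "\<dots> = enn2real (drift_part uminus n \<omega>) - enn2real (drift_part (\<lambda>x. x) n \<omega>)"
      using P Mi by simp
    finally have I: "(\<integral>t. \<phi> t \<partial>clock T) \<le> enn2real (drift_part uminus n \<omega>) - enn2real (drift_part (\<lambda>x. x) n \<omega>)" .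
    \<comment> \<open>If the localisation lasts until \<open>T\<close>, the product at
      \<open>\<sigma> = T\<close> is the terminal disutility of \<open>ustar\<close>; otherwise it
      is positive and is bounded below by \<open>0\<close>.\<close>
    define v where "v = (if chi n T \<omega> then exp (- \<eta> * X ustar T \<omega>) else 0)"
    have v: "v \<le> E \<sigma> \<omega> * W \<sigma> \<omega>"
    proof (cases "chi n T \<omega>")
      case True
      then have "\<sigma> = T" using \<sigma>(2)[of T] \<sigma>(1) T_nonneg by auto
      then show ?thesis using True terminal_product[OF \<omega> elim(4,3)] unfolding v_def by simp
    next
      case False
      have "0 < W \<sigma> \<omega>" using elim(2) \<sigma>(1) by (meson less_le_trans)
      then show ?thesis using False unfolding v_def E_def by simp
    qed
    define sP where "sP = (\<Sum>j | \<tau>1 j \<omega> \<le> ereal T. max 0 (Kn n ((real_of_ereal (\<tau>1 j \<omega>), \<omega>), Z1 j \<omega>)))"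
    define sM where "sM = (\<Sum>j | \<tau>1 j \<omega> \<le> ereal T. max 0 (- Kn n ((real_of_ereal (\<tau>1 j \<omega>), \<omega>), Z1 j \<omega>)))"
    have S: "S = sP - sM" unfolding S_def sP_def sM_def sum_subtractf[symmetric] by (intro sum.cong) auto
    have s0: "0 \<le> sP" "0 \<le> sM" unfolding sP_def sM_def by (auto intro!: sum_nonneg)
    have pos_part: "(\<Sum>j\<in>A. ennreal (h j)) = ennreal (\<Sum>j\<in>A. max 0 (h j))" for A :: "nat set" and h
    proof -
      have "(\<Sum>j\<in>A. ennreal (h j)) = (\<Sum>j\<in>A. ennreal (max 0 (h j)))" by (simp only: ennreal_max_0)
      also have "\<dots> = ennreal (\<Sum>j\<in>A. max 0 (h j))" by (rule sum_ennreal) simp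
      finally show ?thesis .
    qed
    have sP: "jump_part (\<lambda>x. x) n \<omega> = ennreal sP" and sM: "jump_part uminus n \<omega> = ennreal sM"
      unfolding jump_part_def sP_def sM_def by (rule pos_part)+
    have "v + sM + enn2real (drift_part (\<lambda>x. x) n \<omega>) \<le> W 0 \<omega> + sP + enn2real (drift_part uminus n \<omega>)"
      using v prod I S by linarith
    then have "ennreal (v + sM + enn2real (drift_part (\<lambda>x. x) n \<omega>)) \<le> ennreal (W 0 \<omega> + sP + enn2real (drift_part uminus n \<omega>))"
      by (rule ennreal_leI)
    moreover have "0 \<le> v" by (simp add: v_def)
    moreover have "0 \<le> W 0 \<omega>" using elim(2) T_nonneg by (meson atLeastAtMost_iff less_le_trans less_imp_le order_refl)
    ultimately have "ennreal v + ennreal sM + ennreal (enn2real (drift_part (\<lambda>x. x) n \<omega>)) \<le>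
       ennreal (W 0 \<omega>) + ennreal sP + ennreal (enn2real (drift_part uminus n \<omega>))"
      using s0 by (simp add: ennreal_plus)
    moreover have "ennreal v = (if chi n T \<omega> then ennreal (exp (- \<eta> * X ustar T \<omega>)) else 0)" by (simp add: v_def)
    ultimately show ?case unfolding sP sM using fP fM by simp
  qed
qed

section \<open>Removal of the localisation and comparison with admissible controls\<close>

lemma W_measurable: "t \<in> {0..T} \<Longrightarrow> W t \<in> borel_measurable M"
  using H.measurable_F'[OF _ W_adapted] by auto

lemma chi_T_measurable: "{\<omega>\<in>space M. chi n T \<omega>} \<in> sets M"
proof -
  have "(\<lambda>x. (if chi n (fst x) (snd x) then 1 else 0) :: real) \<in> borel_measurable (predictable_sigma {0..T} H)"
    by (intro measurable_If chi_predictable) auto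
  from H.measurable_F'[OF T_nonneg H.predictable_section[OF this T_nonneg order_refl]]
  have [measurable]: "(\<lambda>\<omega>. (if chi n T \<omega> then 1 else 0) :: real) \<in> borel_measurable M" by simp
  have "{\<omega>\<in>space M. (if chi n T \<omega> then 1 else 0 :: real) = 1} \<in> sets M" by measurable
  also have "{\<omega>\<in>space M. (if chi n T \<omega> then 1 else 0 :: real) = 1} = {\<omega>\<in>space M. chi n T \<omega>}" by auto
  finally show ?thesis .
qed

text \<open>After integration the jump parts equal the corresponding drift parts, so both sides
  contain the same finite sum, which cancels. The paths of \<open>p\<close> and \<open>W\<close> are
  bounded, so on each path the localisation is inactive for large \<open>n\<close>, and Fatou gives
  the limit.\<close>

lemma ustar_disutility_le: "(\<integral>\<^sup>+\<omega>. ennreal (exp (- \<eta> * X ustar T \<omega>)) \<partial>M) \<le> (\<integral>\<^sup>+\<omega>. ennreal (W 0 \<omega>) \<partial>M)"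
proof -
  have Xm[measurable]: "X ustar T \<in> borel_measurable M" by (rule wealth_measurable[OF ustar_control])
  have W0[measurable]: "W 0 \<in> borel_measurable M" using T_nonneg by (intro W_measurable) simp
  define v where "v n \<omega> = (if chi n T \<omega> then ennreal (exp (- \<eta> * X ustar T \<omega>)) else 0)" for n \<omega>
  have vm[measurable]: "v n \<in> borel_measurable M" for n
    unfolding v_def[abs_def] by (intro measurable_If chi_T_measurable) auto
  have le: "(\<integral>\<^sup>+\<omega>. v n \<omega> \<partial>M) \<le> (\<integral>\<^sup>+\<omega>. ennreal (W 0 \<omega>) \<partial>M)" for n
  proof -
    have m: "jump_part f n \<in> borel_measurable M" "drift_part f n \<in> borel_measurable M" if "f \<in> borel_measurable borel" for f
      using jump_part_measurable[OF that] drift_part_measurable[OF that] by auto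
    note [measurable] = m[of "\<lambda>x. x"] m[of uminus]
    let ?p = "\<integral>\<^sup>+\<omega>. drift_part (\<lambda>x. x) n \<omega> \<partial>M" and ?m = "\<integral>\<^sup>+\<omega>. drift_part uminus n \<omega> \<partial>M"
    have "(\<integral>\<^sup>+\<omega>. v n \<omega> + jump_part uminus n \<omega> + drift_part (\<lambda>x. x) n \<omega> \<partial>M)
      \<le> (\<integral>\<^sup>+\<omega>. ennreal (W 0 \<omega>) + jump_part (\<lambda>x. x) n \<omega> + drift_part uminus n \<omega> \<partial>M)"
      unfolding v_def by (rule nn_integral_mono_AE[OF stopped_inequality])
    then have "(\<integral>\<^sup>+\<omega>. v n \<omega> \<partial>M) + ?m + ?p \<le> (\<integral>\<^sup>+\<omega>. ennreal (W 0 \<omega>) \<partial>M) + ?p + ?m"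
      using m[of "\<lambda>x. x"] m[of uminus] by (simp add: nn_integral_add part_eq)
    then have "(?p + ?m) + (\<integral>\<^sup>+\<omega>. v n \<omega> \<partial>M) \<le> (?p + ?m) + (\<integral>\<^sup>+\<omega>. ennreal (W 0 \<omega>) \<partial>M)"
      by (simp add: ac_simps)
    moreover have "?p + ?m \<noteq> \<top>"
      using part_finite[of "\<lambda>x. x" n, OF abs_ge_self] part_finite[of uminus n, OF abs_ge_minus_self]
      by (simp add: less_top)
    ultimately show ?thesis by (simp add: ennreal_add_left_cancel_le)
  qed
  have "(\<integral>\<^sup>+\<omega>. ennreal (exp (- \<eta> * X ustar T \<omega>)) \<partial>M) = (\<integral>\<^sup>+\<omega>. liminf (\<lambda>n. v n \<omega>) \<partial>M)"
  proof (rule nn_integral_cong)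
    fix \<omega> assume \<omega>: "\<omega> \<in> space M"
    obtain B1 where B1: "\<And>t. t \<in> {0..T} \<Longrightarrow> \<bar>p t \<omega>\<bar> \<le> B1" using cadlag_on_bounded[OF p_cadlag[OF \<omega>]] by blast
    obtain B2 where B2: "\<And>t. t \<in> {0..T} \<Longrightarrow> \<bar>W t \<omega>\<bar> \<le> B2" using cadlag_on_bounded[OF W_cadlag[OF \<omega>]] by blast
    obtain N where N: "max B1 B2 \<le> real N" using real_arch_simple by blast
    have "v n \<omega> = ennreal (exp (- \<eta> * X ustar T \<omega>))" if "N \<le> n" for n
    proof -
      have "max B1 B2 \<le> real n" using N that by (meson of_nat_le_iff order_trans)
      then have "p q \<omega> \<le> real n \<and> W q \<omega> \<le> real n" if "q \<in> {0..T}" for q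
        using B1[OF that] B2[OF that] by (auto simp: abs_le_iff)
      then have "chi n T \<omega>" unfolding chi_def by blast
      then show ?thesis by (simp add: v_def)
    qed
    then have "(\<lambda>n. v n \<omega>) \<longlonglongrightarrow> ennreal (exp (- \<eta> * X ustar T \<omega>))"
      by (intro tendsto_eventually) (auto simp: eventually_sequentially)
    then show "ennreal (exp (- \<eta> * X ustar T \<omega>)) = liminf (\<lambda>n. v n \<omega>)"
      by (intro lim_imp_Liminf[symmetric]) auto
  qed
  also have "\<dots> \<le> liminf (\<lambda>n. \<integral>\<^sup>+\<omega>. v n \<omega> \<partial>M)" by (rule nn_integral_liminf) (rule vm)
  also have "\<dots> \<le> (\<integral>\<^sup>+\<omega>. ennreal (W 0 \<omega>) \<partial>M)"
    by (rule Liminf_le) (auto intro: le always_eventually)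
  finally show ?thesis .
qed

text \<open>The value at time \<open>0\<close> compares only with controls that equal null
  reinsurance at time \<open>0\<close> itself. Changing \<open>v\<close> at that single time affects
  neither the premium integral nor the retained claims, since jump times are positive.\<close>

lemma value_le:
  assumes v: "v \<in> admis"
  shows "(\<integral>\<^sup>+\<omega>. ennreal (W 0 \<omega>) \<partial>M) \<le> ennreal (\<integral>\<omega>. exp (- \<eta> * X v T \<omega>) \<partial>M)"
proof -
  define v' where "v' t \<omega> = (if t \<le> 0 then 1 else v t \<omega>)" for t and \<omega> :: 'a
  have cv: "control v" using v by (simp add: admis_iff)
  have cv': "control v'"
    unfolding control_def predictable_process_def
  proof (intro conjI ballI)
    have "{x \<in> space (predictable_sigma {0..T} H). fst x \<le> 0} \<in> sets (predictable_sigma {0..T} H)"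
      using H.predictable_time[OF T_nonneg] by measurable
    then show "(\<lambda>(t, \<omega>). v' t \<omega>) \<in> borel_measurable (predictable_sigma {0..T} H)"
      using cv unfolding v'_def split_beta control_def predictable_process_def by (intro measurable_If) auto
    show "v' t \<omega> \<in> {0..1}" if "t \<in> {0..T}" "\<omega> \<in> space M" for t \<omega>
      using cv that unfolding control_def v'_def by auto
  qed
  have Xv': "X v' T \<omega> = X v T \<omega>" if \<omega>: "\<omega> \<in> space M" for \<omega>
  proof -
    have "(\<integral>t. exp (r * (T - t)) * c t \<omega> - prem v' t \<omega> \<partial>clock T) = (\<integral>t. exp (r * (T - t)) * c t \<omega> - prem v t \<omega> \<partial>clock T)"
    proof (rule integral_cong_AE)
      have [measurable]: "(\<lambda>t. exp (r * (T - t)) * c t \<omega>) \<in> borel_measurable (clock T)"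
      proof -
        have [measurable]: "(\<lambda>t. c t \<omega>) \<in> borel_measurable (clock T)"
          using clock_path[OF c_predictable[unfolded predictable_process_def] \<omega>] by simp
        have [measurable]: "(\<lambda>t. t) \<in> borel_measurable (clock T)" by (intro measurable_restrict_space1) simp
        show ?thesis by measurable
      qed
      have [measurable]: "(\<lambda>t. prem u t \<omega>) \<in> borel_measurable (clock T)" if "control u" for u
        using clock_path[OF prem_predictable[OF that] \<omega>] by simp
      show "(\<lambda>t. exp (r * (T - t)) * c t \<omega> - prem v' t \<omega>) \<in> borel_measurable (clock T)"
        "(\<lambda>t. exp (r * (T - t)) * c t \<omega> - prem v t \<omega>) \<in> borel_measurable (clock T)"
        using cv cv' by measurable
      show "AE t in clock T. exp (r * (T - t)) * c t \<omega> - prem v' t \<omega> = exp (r * (T - t)) * c t \<omega> - prem v t \<omega>"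
        using AE_clock_pos by eventually_elim (simp add: prem_def v'_def)
    qed
    moreover have "retained v' \<omega> = retained v \<omega>"
      unfolding retained_def using jump_time_real(2)[OF jumps1 \<omega>] by (intro sum.cong) (auto simp: v'_def not_le[symmetric])
    ultimately show ?thesis unfolding wealth_eq[OF cv \<omega>] wealth_eq[OF cv' \<omega>] by simp
  qed
  have int: "integrable M (\<lambda>\<omega>. exp (- \<eta> * X v T \<omega>))" using v by (simp add: admis_iff)
  have int': "integrable M (\<lambda>\<omega>. exp (- \<eta> * X v' T \<omega>))"
    using int by (rule Bochner_Integration.integrable_cong[THEN iffD1, rotated -1]) (simp_all add: Xv')
  have v'a: "v' \<in> admis" using cv' int' by (simp add: admis_iff)
  interpret S: sigma_finite_subalgebra M "H 0" by (rule cond_H) simp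
  have "is_ess_inf M {real_cond_exp M (H 0) (\<lambda>\<omega>. exp (- \<eta> * X u T \<omega>)) |u. u \<in> admis \<and> (\<forall>s\<in>{0..0}. AE \<omega> in M. u s \<omega> = 1)} (W 0)"
    using value_W T_nonneg unfolding is_value_process_def by force
  moreover have "\<forall>s\<in>{0..0}. AE \<omega> in M. v' s \<omega> = 1" by (simp add: v'_def)
  ultimately have "AE \<omega> in M. W 0 \<omega> \<le> real_cond_exp M (H 0) (\<lambda>\<omega>. exp (- \<eta> * X v' T \<omega>)) \<omega>"
    using v'a unfolding is_ess_inf_def by blast
  then have "(\<integral>\<^sup>+\<omega>. ennreal (W 0 \<omega>) \<partial>M) \<le> (\<integral>\<^sup>+\<omega>. ennreal (real_cond_exp M (H 0) (\<lambda>\<omega>. exp (- \<eta> * X v' T \<omega>)) \<omega>) \<partial>M)"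
    by (intro nn_integral_mono_AE) (auto elim: eventually_mono intro: ennreal_leI)
  also have "\<dots> = ennreal (\<integral>\<omega>. real_cond_exp M (H 0) (\<lambda>\<omega>. exp (- \<eta> * X v' T \<omega>)) \<omega> \<partial>M)"
    using int' by (intro nn_integral_eq_integral S.real_cond_exp_int(1) S.real_cond_exp_pos) auto
  also have "(\<integral>\<omega>. real_cond_exp M (H 0) (\<lambda>\<omega>. exp (- \<eta> * X v' T \<omega>)) \<omega> \<partial>M) = (\<integral>\<omega>. exp (- \<eta> * X v' T \<omega>) \<partial>M)"
    by (rule S.real_cond_exp_int(2)[OF int'])
  also have "\<dots> = (\<integral>\<omega>. exp (- \<eta> * X v T \<omega>) \<partial>M)"
    by (rule Bochner_Integration.integral_cong) (simp_all add: Xv')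
  finally show ?thesis .
qed

text \<open>The mean of \<open>W 0\<close> separates the disutility of \<open>ustar\<close> from
  that of any admissible control. Compared with one admissible control, whose existence is
  \<open>admis_nonempty\<close>, this gives integrability and hence admissibility of
  \<open>ustar\<close>; compared with all of them it gives optimality.\<close>

lemma ustar_optimal: "optimal M H T {0..1} \<eta> X ustar"
proof -
  have [measurable]: "X ustar T \<in> borel_measurable M" by (rule wealth_measurable[OF ustar_control])
  have le: "(\<integral>\<^sup>+\<omega>. ennreal (exp (- \<eta> * X ustar T \<omega>)) \<partial>M) \<le> ennreal (\<integral>\<omega>. exp (- \<eta> * X v T \<omega>) \<partial>M)" if "v \<in> admis" for v
    by (rule order_trans[OF ustar_disutility_le value_le[OF that]])
  obtain v0 where v0: "v0 \<in> admis" using admis_nonempty by auto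
  have int: "integrable M (\<lambda>\<omega>. exp (- \<eta> * X ustar T \<omega>))"
  proof (rule integrableI_nonneg)
    show "(\<integral>\<^sup>+\<omega>. ennreal (exp (- \<eta> * X ustar T \<omega>)) \<partial>M) < \<infinity>"
      using le[OF v0] by (auto intro: le_less_trans)
  qed auto
  have ua: "ustar \<in> admis" using int ustar_control by (simp add: admis_iff)
  have le': "(\<integral>\<omega>. exp (- \<eta> * X ustar T \<omega>) \<partial>M) \<le> (\<integral>\<omega>. exp (- \<eta> * X v T \<omega>) \<partial>M)" if "v \<in> admis" for v
    using le[OF that] nn_integral_eq_integral[OF int] by simp
  have "(\<integral>\<omega>. exp (- \<eta> * X ustar T \<omega>) \<partial>M) = (INF v\<in>admis. \<integral>\<omega>. exp (- \<eta> * X v T \<omega>) \<partial>M)"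
    by (rule cInf_eq_minimum[symmetric]) (use ua le' in auto)
  then show ?thesis using ua unfolding optimal_def by simp
qed

section \<open>Thresholds and the interior retention level\<close>

lemma retention_equation_iff:
  "retention_equation T r \<eta> \<theta>R F1 t (W_left t \<omega>) (\<Theta> t \<omega>) v \<longleftrightarrow> hh t \<omega> v = C"
  unfolding retention_equation_def hh_def C_def \<mu>_def \<kappa>_def set_integral_mark by auto

definition thF :: "real \<Rightarrow> 'a \<Rightarrow> real" where
  "thF t \<omega> = 1 / mean F1 * (LINT z:{0<..}|F1. (W_left t \<omega> + \<Theta> t \<omega> z) / W_left t \<omega> * z
     * exp (- \<eta> * exp (r * (T - t)) * z)) - 1"

definition thN :: "real \<Rightarrow> 'a \<Rightarrow> real" where
  "thN t \<omega> = 1 / mean F1 * (LINT z:{0<..}|F1. (W_left t \<omega> + \<Theta> t \<omega> z) / W_left t \<omega> * z) - 1"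

text \<open>A chosen root, so that it depends on the scenario only through \<open>w\<close> and
  \<open>\<theta>\<close>. The interval is closed because the root is an endpoint when
  \<open>\<theta>R\<close> equals a threshold.\<close>

definition ubar :: "real \<Rightarrow> real \<Rightarrow> (real \<Rightarrow> real) \<Rightarrow> real" where
  "ubar t w \<theta> = (SOME v. v \<in> {0..1} \<and> retention_equation T r \<eta> \<theta>R F1 t w \<theta> v)"

lemma thF_eq: "thF t \<omega> = hh t \<omega> 0 / \<mu> - 1"
  unfolding thF_def hh_def \<mu>_def \<kappa>_def set_integral_mark by simp

lemma thN_eq: "thN t \<omega> = hh t \<omega> 1 / \<mu> - 1"
  unfolding thN_def hh_def \<mu>_def \<kappa>_def set_integral_mark by simp

lemma threshold_less: "t \<in> {0..T} \<Longrightarrow> \<omega> \<in> space M \<Longrightarrow> good t \<omega> \<Longrightarrow> thF t \<omega> < thN t \<omega>"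
  unfolding thF_eq thN_eq using hh_strict_mono[of t \<omega> 0 1] \<mu>_pos by (simp add: divide_strict_right_mono)

lemma below_thF_iff: "\<theta>R < thF t \<omega> \<longleftrightarrow> C < hh t \<omega> 0"
  unfolding thF_eq C_def using \<mu>_pos by (auto simp: field_simps)

lemma above_thN_iff: "thN t \<omega> < \<theta>R \<longleftrightarrow> hh t \<omega> 1 < C"
  unfolding thN_eq C_def using \<mu>_pos by (auto simp: field_simps)

lemma thF_less_iff: "thF t \<omega> < \<theta>R \<longleftrightarrow> hh t \<omega> 0 < C"
  unfolding thF_eq C_def using \<mu>_pos by (auto simp: field_simps)

lemma less_thN_iff: "\<theta>R < thN t \<omega> \<longleftrightarrow> C < hh t \<omega> 1"
  unfolding thN_eq C_def using \<mu>_pos by (auto simp: field_simps)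

text \<open>Between the thresholds \<open>ustar\<close> is a root, so the choice succeeds, and
  strict monotonicity of \<open>hh\<close> makes the root unique.\<close>

lemma ubar_between:
  assumes t: "t \<in> {0..T}" and \<omega>: "\<omega> \<in> space M" and good: "good t \<omega>"
    and between: "thF t \<omega> \<le> \<theta>R" "\<theta>R \<le> thN t \<omega>"
  shows "hh t \<omega> (ubar t (W_left t \<omega>) (\<Theta> t \<omega>)) = C" "ubar t (W_left t \<omega>) (\<Theta> t \<omega>) \<in> {0..1}"
    "ubar t (W_left t \<omega>) (\<Theta> t \<omega>) = ustar t \<omega>"
proof -
  let ?u = "ubar t (W_left t \<omega>) (\<Theta> t \<omega>)"
  have h: "hh t \<omega> (ustar t \<omega>) = C"
    using ustar_cases(3)[OF t \<omega> good] between below_thF_iff[of t \<omega>] above_thN_iff[of t \<omega>] by auto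
  have "?u \<in> {0..1} \<and> hh t \<omega> ?u = C"
    unfolding ubar_def retention_equation_iff by (rule someI[of _ "ustar t \<omega>"]) (use h ustar_range in blast)
  then show u: "hh t \<omega> ?u = C" "?u \<in> {0..1}" by auto
  show "?u = ustar t \<omega>"
    using hh_strict_mono[OF t \<omega> good, of ?u "ustar t \<omega>"] hh_strict_mono[OF t \<omega> good, of "ustar t \<omega>" ?u]
      u h ustar_range[of t \<omega>] by (cases ?u "ustar t \<omega>" rule: linorder_cases) auto
qed

lemma optimal_retention:
  "\<exists>\<theta>F \<theta>N u_bar u.
    (\<forall>t\<in>{0..T}. \<forall>\<omega>\<in>space M. \<theta>F t \<omega> = 1 / mean F1 *
       (LINT z:{0<..}|F1. (W_left t \<omega> + \<Theta> t \<omega> z) / W_left t \<omega> * z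
          * exp (- \<eta> * exp (r * (T - t)) * z)) - 1) \<and>
    (\<forall>t\<in>{0..T}. \<forall>\<omega>\<in>space M. \<theta>N t \<omega> = 1 / mean F1 *
       (LINT z:{0<..}|F1. (W_left t \<omega> + \<Theta> t \<omega> z) / W_left t \<omega> * z) - 1) \<and>
    (AE (t, \<omega>) in time_scenario T M. \<theta>F t \<omega> < \<theta>N t \<omega>) \<and>
    (AE (t, \<omega>) in time_scenario T M. \<theta>F t \<omega> \<le> \<theta>R \<and> \<theta>R \<le> \<theta>N t \<omega> \<longrightarrow>
       retention_equation T r \<eta> \<theta>R F1 t (W_left t \<omega>) (\<Theta> t \<omega>) (u_bar t (W_left t \<omega>) (\<Theta> t \<omega>)) \<and>
       u_bar t (W_left t \<omega>) (\<Theta> t \<omega>) \<in> {0..1} \<and>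
       (\<theta>F t \<omega> < \<theta>R \<and> \<theta>R < \<theta>N t \<omega> \<longrightarrow> u_bar t (W_left t \<omega>) (\<Theta> t \<omega>) \<in> {0<..<1})) \<and>
    optimal M H T {0..1} \<eta> X u \<and>
    (AE (t, \<omega>) in time_scenario T M. u t \<omega> =
       (if \<theta>R < \<theta>F t \<omega> then 0
        else if \<theta>R > \<theta>N t \<omega> then 1
        else u_bar t (W_left t \<omega>) (\<Theta> t \<omega>)))"
proof (rule exI[of _ thF], rule exI[of _ thN], rule exI[of _ ubar], rule exI[of _ ustar], intro conjI ballI)
  show "AE (t, \<omega>) in time_scenario T M. thF t \<omega> < thN t \<omega>"
    using good_AE_space by eventually_elim (auto simp: split_beta intro: threshold_less)
  show "AE (t, \<omega>) in time_scenario T M. thF t \<omega> \<le> \<theta>R \<and> \<theta>R \<le> thN t \<omega> \<longrightarrow>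
       retention_equation T r \<eta> \<theta>R F1 t (W_left t \<omega>) (\<Theta> t \<omega>) (ubar t (W_left t \<omega>) (\<Theta> t \<omega>)) \<and>
       ubar t (W_left t \<omega>) (\<Theta> t \<omega>) \<in> {0..1} \<and>
       (thF t \<omega> < \<theta>R \<and> \<theta>R < thN t \<omega> \<longrightarrow> ubar t (W_left t \<omega>) (\<Theta> t \<omega>) \<in> {0<..<1})"
    using good_AE_space
  proof eventually_elim
    case (elim x)
    obtain t \<omega> where x: "x = (t, \<omega>)" by (cases x)
    then have g: "t \<in> {0..T}" "\<omega> \<in> space M" "good t \<omega>" using elim by auto
    let ?u = "ubar t (W_left t \<omega>) (\<Theta> t \<omega>)"
    have "retention_equation T r \<eta> \<theta>R F1 t (W_left t \<omega>) (\<Theta> t \<omega>) ?u \<and> ?u \<in> {0..1} \<and>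
       (thF t \<omega> < \<theta>R \<and> \<theta>R < thN t \<omega> \<longrightarrow> ?u \<in> {0<..<1})" if b: "thF t \<omega> \<le> \<theta>R" "\<theta>R \<le> thN t \<omega>"
    proof -
      note u = ubar_between(1,2)[OF g b]
      \<comment> \<open>Strict inequalities exclude the endpoints, where \<open>hh\<close> takes the
        values that define the thresholds.\<close>
      have "?u \<noteq> 0" if "thF t \<omega> < \<theta>R" using that u(1) unfolding thF_less_iff by auto
      moreover have "?u \<noteq> 1" if "\<theta>R < thN t \<omega>" using that u(1) unfolding less_thN_iff by auto
      ultimately show ?thesis using u unfolding retention_equation_iff by force
    qed
    then show ?case unfolding x by simp
  qed
  show "optimal M H T {0..1} \<eta> X ustar" by (rule ustar_optimal)
  show "AE (t, \<omega>) in time_scenario T M. ustar t \<omega> =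
       (if \<theta>R < thF t \<omega> then 0 else if \<theta>R > thN t \<omega> then 1 else ubar t (W_left t \<omega>) (\<Theta> t \<omega>))"
    using good_AE_space
  proof eventually_elim
    case (elim x)
    obtain t \<omega> where x: "x = (t, \<omega>)" by (cases x)
    then have g: "t \<in> {0..T}" "\<omega> \<in> space M" "good t \<omega>" using elim by auto
    have "ustar t \<omega> = (if \<theta>R < thF t \<omega> then 0 else if \<theta>R > thN t \<omega> then 1 else ubar t (W_left t \<omega>) (\<Theta> t \<omega>))"
      using ustar_cases(1,2)[OF g] ubar_between(3)[OF g] below_thF_iff[of t \<omega>] above_thN_iff[of t \<omega>] by auto
    then show ?case unfolding x by simp
  qed
qed (simp_all add: thF_def thN_def)

end

text \<open>The order of the thresholds and the form of the strategy hold almost everywhere in time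
  and scenario, because \<open>\<Theta>\<close> itself is determined only up to null elements. The
  interior level lies in the open interval when both inequalities are strict; at equality with a
  threshold the root is the corresponding endpoint.\<close>

theorem proposition6p3:
  fixes M :: "'a measure" and G :: "real \<Rightarrow> 'a measure"
    and T \<alpha> \<beta> lam0 \<rho> r \<eta> R0 \<theta>R :: real
    and l :: "real \<Rightarrow> real" and F1 F2 :: "real measure"
    and \<tau>1 \<tau>2 :: "nat \<Rightarrow> 'a \<Rightarrow> ereal" and Z1 Z2 :: "nat \<Rightarrow> 'a \<Rightarrow> real"
    and p c W :: "real \<Rightarrow> 'a \<Rightarrow> real" and \<Theta> :: "real \<Rightarrow> 'a \<Rightarrow> real \<Rightarrow> real"
  defines "H \<equiv> natural_filtration M (claims \<tau>1 Z1)"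
    and "q \<equiv> expected_value_premium \<theta>R F1 p"
  defines "X \<equiv> wealth r R0 c \<tau>1 Z1 proportional q"
  defines "W_left \<equiv> (\<lambda>t \<omega>. left_lim (\<lambda>s. W s \<omega>) t)"
  assumes "risk_model M G \<alpha> \<beta> lam0 \<rho> l F1 F2 \<tau>1 Z1 \<tau>2 Z2"
    and "0 < T" "0 < r" "0 < \<eta>" "0 \<le> R0" "0 < \<theta>R"
    and "is_filter_of M H T (intensity \<alpha> \<beta> lam0 l \<tau>1 Z1 \<tau>2 Z2) p"
    and "predictable_process {0..T} H c"
    and "integrable (time_scenario T M) (\<lambda>(t, \<omega>). c t \<omega>)"
    and "\<And>a. 0 < a \<Longrightarrow> set_integrable F1 {0<..} (\<lambda>z. exp (a * l z))"
    and "\<And>a. 0 < a \<Longrightarrow> set_integrable F1 {0<..} (\<lambda>z. exp (a * z))"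
    and "\<And>a. 0 < a \<Longrightarrow> set_integrable F2 {0<..} (\<lambda>z. exp (a * z))"
    and "is_value_process M H T {0..1} \<eta> X 1 W"
    and "unique_bsde_solution M H T \<tau>1 Z1 p F1 (\<lambda>\<omega>. exp (- \<eta> * X (\<lambda>_ _. 1) T \<omega>))
           (driver T r \<eta> proportional q p F1) (admissible M H T {0..1} \<eta> X) W \<Theta>"
  shows "\<exists>\<theta>F \<theta>N u_bar u.
    (\<forall>t\<in>{0..T}. \<forall>\<omega>\<in>space M. \<theta>F t \<omega> = 1 / mean F1 *
       (LINT z:{0<..}|F1. (W_left t \<omega> + \<Theta> t \<omega> z) / W_left t \<omega> * z
          * exp (- \<eta> * exp (r * (T - t)) * z)) - 1) \<and>
    (\<forall>t\<in>{0..T}. \<forall>\<omega>\<in>space M. \<theta>N t \<omega> = 1 / mean F1 *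
       (LINT z:{0<..}|F1. (W_left t \<omega> + \<Theta> t \<omega> z) / W_left t \<omega> * z) - 1) \<and>
    (AE (t, \<omega>) in time_scenario T M. \<theta>F t \<omega> < \<theta>N t \<omega>) \<and>
    (AE (t, \<omega>) in time_scenario T M. \<theta>F t \<omega> \<le> \<theta>R \<and> \<theta>R \<le> \<theta>N t \<omega> \<longrightarrow>
       retention_equation T r \<eta> \<theta>R F1 t (W_left t \<omega>) (\<Theta> t \<omega>) (u_bar t (W_left t \<omega>) (\<Theta> t \<omega>)) \<and>
       u_bar t (W_left t \<omega>) (\<Theta> t \<omega>) \<in> {0..1} \<and>
       (\<theta>F t \<omega> < \<theta>R \<and> \<theta>R < \<theta>N t \<omega> \<longrightarrow> u_bar t (W_left t \<omega>) (\<Theta> t \<omega>) \<in> {0<..<1})) \<and>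
    optimal M H T {0..1} \<eta> X u \<and>
    (AE (t, \<omega>) in time_scenario T M. u t \<omega> =
       (if \<theta>R < \<theta>F t \<omega> then 0
        else if \<theta>R > \<theta>N t \<omega> then 1
        else u_bar t (W_left t \<omega>) (\<Theta> t \<omega>)))"
proof -
  obtain g where g: "is_ess_sup (time_scenario T M)
      {\<lambda>(t, \<omega>). driver T r \<eta> proportional q p F1 t \<omega> (left_lim (\<lambda>s. W s \<omega>) t) (\<Theta> t \<omega>) (u t \<omega>) |u.
        u \<in> admissible M H T {0..1} \<eta> X} (\<lambda>(t, \<omega>). g t \<omega>)"
    "AE \<omega> in M. set_integrable lborel {0..T} (\<lambda>t. g t \<omega>)"
    "AE \<omega> in M. \<forall>t\<in>{0..T}. W t \<omega> = exp (- \<eta> * X (\<lambda>_ _. 1) T \<omega>)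
      - compensated_integral \<tau>1 Z1 p F1 \<Theta> t T \<omega> - (LINT s:{t..T}|lborel. g s \<omega>)"
    and L2: "in_L2 M H T W" "in_L2hat M H T p F1 \<Theta>"
    using assms(18) unfolding unique_bsde_solution_def bsde_solution_def by blast
  interpret R: reinsurance M G \<alpha> \<beta> lam0 \<rho> l F1 F2 \<tau>1 Z1 \<tau>2 Z2 T r \<eta> R0 \<theta>R p c W g \<Theta>
    using assms(5-8,10-17) g L2 unfolding H_def q_def X_def
    by (intro reinsurance.intro reinsurance_axioms.intro)
  have "W_left = R.W_left" unfolding W_left_def by (auto simp: R.W_left_def fun_eq_iff)
  then show ?thesis using R.optimal_retention unfolding H_def q_def X_def by (simp only:)
qed

end
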